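(* Let $T>0$, let $\mu_0\in\mathcal P_c(\mathbb R^{2d})$ with $\operatorname{supp}(\mu_0)\subset B(R)$, let $\mathcal F:[0,T]\times\mathbb R^d\times\mathbb R^m\to\mathbb R^d$ satisfy Assumptions (A1) and (A2) of the context, let $\ell\in C^2(\mathbb R^d\times\mathbb R^d)$, and let $\psi_T\in C_c^2(\mathbb R^{2d})$ be a terminal condition satisfying $$\operatorname{supp}(\psi_T)=B(R_T)\qquad\text{and}\qquad\psi_T(x,y)=\ell(x,y)\ \text{ for all }(x,y)\in B(R_T),$$ where $R_T$ is as in the context. Let $C_\Gamma>0$ and $$\Gamma_C:=\{\theta\in L^2([0,T];\mathbb R^m):\ \|\theta\|_2\le C_\Gamma T^{1/2}\}.$$ Suppose that $\lambda>0$ is large enough. Then there exists a triple $(\mu^*,\theta^*,\psi^* )\in C([0,T];\mathcal P_c(\mathbb R^{2d}))\times\operatorname{Lip}([0,T];\mathbb R^m)\times C^1([0,T];C_c^2(\mathbb R^{2d}))$ solving $$\begin{cases}\partial_t\mu^*_t+\nabla_x\cdot(\mathcal F(t,x,\theta^*_t)\mu^*_t)=0,\quad\mu^*_t|_{t=0}=\mu_0,\\ \partial_t\psi^*+\nabla_x\psi^*\cdot\mathcal F(t,x,\theta^*_t)=0,\quad\psi^*_t|_{t=T}=\psi_T,\\ \theta_t^{*\top}=-\dfrac1{2\lambda}\displaystyle\int_{\mathbb R^{2d}}\nabla_x\psi^*\cdot\nabla_\theta\mathcal F(t,x,\theta^*_t)\,d\mu^*_t(x,y).\end{cases}$$ Moreover,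 the control solution $\theta^*$ is unique in $\Gamma_C\subset L^2([0,T];\mathbb R^m)$, and $\psi^*\in C^1([0,T];C^2_c(\mathbb R^{2d}))$ is in characteristic form.
   Context: Notation: $B(R)$ is the ball of radius $R$ centred at the origin; $\mathcal P_c(\mathbb R^{2d})$ is the set of compactly supported Borel probability measures; points of $\mathbb R^{2d}$ are $(x,y)\in\mathbb R^d\times\mathbb R^d$. Assumption (A1). (i) For each $\theta\in\mathbb R^m$, $(t,x)\mapsto\mathcal F(t,x,\theta)$ is continuous. (ii) There is $C_{\mathcal F}>0$ (possibly depending on $d,m$) with $|\mathcal F(t,x,\theta)|\le C_{\mathcal F}(1+|x|)$ for all $\theta$, a.e. $t\in[0,T]$ and all $x$. (iii) There is $L_{\mathcal F}>0$ independent of $d,m$ with $|\mathcal F(t,x_1,\theta)-\mathcal F(t,x_2,\theta)|\le L_{\mathcal F}(1+|\theta|)|x_1-x_2|$ for all $\theta$, a.e. $t$ and all $x_1,x_2$. (iv) For all $(t,x)$, $\theta\mapsto\mathcal F(t,x,\theta)$ is twice differentiable, and for each $R>0$ there is $C(d,m,R)>0$ bounding $\|\nabla_\theta\mathcal F\|_{C([0,T]\times B(R)\times\mathbb R^m)}+\|\nabla^2_\theta\mathcal F\|_{C([0,T]\times B(R)\times\mathbb R^m)}$. Assumption (A2). For each $R>0$: (i) $x\mapsto\mathcal F(t,x,\theta)$ is $C^2$ for all $t,\theta$, and for $x\in B(R)$, $|\nabla_x\cdot\nabla_\theta\mathcal F(t,x,\theta)|+|\nabla_x\mathcal F(t,x,\theta)|+|\nabla_x^2\mathcal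 F(t,x,\theta)|\le C(d,m,R,|\theta|)$. (ii) $|\mathcal F(t,x,\theta^1)-\mathcal F(s,x,\theta^2)|\le C(d,m,R)(|t-s|+|\theta^1-\theta^2|)$ for all $\theta^1,\theta^2\in\mathbb R^m$, $s,t\in[0,T]$, $x\in B(R)$. (iii) For all fixed $\theta$, $t$: $|\nabla_\theta\mathcal F(t,x,\theta)-\nabla_\theta\mathcal F(t,y,\theta)|\le C(d,m,R,|\theta|)|x-y|$ for $x,y\in B(R)$. For $\theta\in L^2([0,T];\mathbb R^m)$ the continuity equation with datum $\mu_0$ has a unique distributional solution $\mu^\theta\in C([0,T];\mathcal P_c(\mathbb R^{2d}))$ (test functions in $C^1_c((0,T)\times\mathbb R^{2d})$), and $R_T>0$, depending only on $R,T,C_{\mathcal F}$, is a radius with $\operatorname{supp}(\mu^\theta_t)\subset B(R_T)$ for all $t\in[0,T]$ and all $\theta$. Let $\Phi^\theta_{(\tau,t)}$ be the flow on $\mathbb R^d$ of $\dot X_t=\mathcal F(t,X_t,\theta_t)$ from time $\tau$ to time $t$. A solution of the backward equation is in characteristic form if $\psi(t,x,y)=\psi_T(\Phi^{\theta}_{(t,T)}(x),y)$; only such solutions are considered. "$\lambda$ large enough" means above a threshold depending only on $T,R,\mathcal F,\psi_T,C_\Gamma$ and an (arbitrarily fixed) bound for the Lipschitz constant of $\theta^*$. "Unique in $\Gamma_C$" means that any control in $\Gamma_C$ solving the system (with its associated $\mu$ and characteristic $\psi$) equals $\theta^*$. $\nabla_x\psi\cdot\nabla_\theta\mathcal F$ is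 the row vector with $j$-th entry $\sum_k\partial_{x_k}\psi\,\partial_{\theta_j}\mathcal F_k$.
   Formalization: θ* is proved continuous, and Lipschitz only if ∇_θF is also locally Lipschitz in t (false otherwise); ψ* in C¹([0,T];C_c²) is replaced by C([0,T];C_c²)∩C¹([0,T];C_c¹), as ∂_tψ* need not be C²; the constants C(d,m,R,|θ|) are taken nondecreasing in |θ|. *)

theory Defs
  imports "HOL-Probability.Probability"
begin

section \<open>Derivatives and function classes\<close>

text \<open>The derivative as an element of the normed space of bounded linear maps. It is meaningful
  where \<open>f\<close> is differentiable, which is always required separately.\<close>

definition Dif :: "('a::real_normed_vector \<Rightarrow> 'b::real_normed_vector) \<Rightarrow> 'a \<Rightarrow> ('a \<Rightarrow>\<^sub>L 'b)" where
  "Dif f x = Blinfun (frechet_derivative f (at x))"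

definition C1 :: "('a::real_normed_vector \<Rightarrow> 'b::real_normed_vector) \<Rightarrow> bool" where
  "C1 f \<longleftrightarrow> (\<forall>x. f differentiable (at x)) \<and> continuous_on UNIV (Dif f)"

definition C2 :: "('a::real_normed_vector \<Rightarrow> 'b::real_normed_vector) \<Rightarrow> bool" where
  "C2 f \<longleftrightarrow> C1 f \<and> C1 (Dif f)"

definition fsupport :: "('a::topological_space \<Rightarrow> real) \<Rightarrow> 'a set" where
  "fsupport f = closure {z. f z \<noteq> 0}"

definition C1c :: "('a::real_normed_vector \<Rightarrow> real) \<Rightarrow> bool" where
  "C1c f \<longleftrightarrow> C1 f \<and> compact (fsupport f)"

definition C2c :: "('a::real_normed_vector \<Rightarrow> real) \<Rightarrow> bool" where
  "C2c f \<longleftrightarrow> C2 f \<and> compact (fsupport f)"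

text \<open>\<open>C\<^sup>1\<close> in time with values in \<open>C\<^sup>2\<^sub>c\<close>, read as regularity of a solution of a transport equation
  with \<open>C\<^sup>2\<close> data: all \<open>\<psi> t\<close> are in \<open>C\<^sup>2\<^sub>c\<close> with a common compact support, \<open>\<psi>\<close> is a continuous curve
  in \<open>C\<^sup>2\<close> and a \<open>C\<^sup>1\<close> curve in \<open>C\<^sup>1\<close>. The time derivative cannot be required to be \<open>C\<^sup>2\<close> in space:
  for the field \<open>(1, 0, \<dots>, 0)\<close> the solution is \<open>\<psi>\<^sub>T (x + (T - t) e\<^sub>1, y)\<close>, whose time derivative is
  \<open>- \<partial>\<^sub>1 \<psi>\<^sub>T (x + (T - t) e\<^sub>1, y)\<close>. At the end points of the time interval, derivatives are one-sided.\<close>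

definition C1_in_time_C2c :: "real \<Rightarrow> (real \<Rightarrow> 'a::real_normed_vector \<Rightarrow> real) \<Rightarrow> bool" where
  "C1_in_time_C2c T \<psi> \<longleftrightarrow>
     (\<exists>K. compact K \<and> (\<forall>t\<in>{0..T}. fsupport (\<psi> t) \<subseteq> K)) \<and>
     (\<forall>t\<in>{0..T}. C2c (\<psi> t)) \<and>
     continuous_on ({0..T} \<times> UNIV) (\<lambda>(t, z). \<psi> t z) \<and>
     continuous_on ({0..T} \<times> UNIV) (\<lambda>(t, z). Dif (\<psi> t) z) \<and>
     continuous_on ({0..T} \<times> UNIV) (\<lambda>(t, z). Dif (Dif (\<psi> t)) z) \<and>
     (\<exists>\<psi>'. (\<forall>t\<in>{0..T}. \<forall>z. ((\<lambda>s. \<psi> s z) has_real_derivative \<psi>' t z) (at t within {0..T})) \<and>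
           (\<forall>t\<in>{0..T}. C1 (\<psi>' t)) \<and>
           continuous_on ({0..T} \<times> UNIV) (\<lambda>(t, z). \<psi>' t z) \<and>
           continuous_on ({0..T} \<times> UNIV) (\<lambda>(t, z). Dif (\<psi>' t) z))"

section \<open>Assumptions on the vector field\<close>

text \<open>A finite norm in \<open>C([0,T] \<times> B(R) \<times> \<real>\<^sup>m)\<close> means: continuous, with a finite supremum.
  \<open>B(R)\<close> is the closed ball throughout.\<close>

definition A1 :: "real \<Rightarrow> (real \<Rightarrow> real^'d \<Rightarrow> real^'m \<Rightarrow> real^'d) \<Rightarrow> bool" where
  "A1 T F \<longleftrightarrow>
     (\<forall>\<theta>. continuous_on ({0..T} \<times> UNIV) (\<lambda>(t, x). F t x \<theta>)) \<and>
     (\<exists>C>0. \<forall>\<theta>. AE t in lebesgue_on {0..T}. \<forall>x. norm (F t x \<theta>) \<le> C * (1 + norm x)) \<and>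
     (\<exists>L>0. \<forall>\<theta>. AE t in lebesgue_on {0..T}. \<forall>x\<^sub>1 x\<^sub>2.
        norm (F t x\<^sub>1 \<theta> - F t x\<^sub>2 \<theta>) \<le> L * (1 + norm \<theta>) * norm (x\<^sub>1 - x\<^sub>2)) \<and>
     (\<forall>t\<in>{0..T}. \<forall>x \<theta>. F t x differentiable (at \<theta>) \<and> Dif (F t x) differentiable (at \<theta>)) \<and>
     (\<forall>R>0.
        continuous_on ({0..T} \<times> cball 0 R \<times> UNIV) (\<lambda>(t, x, \<theta>). Dif (F t x) \<theta>) \<and>
        continuous_on ({0..T} \<times> cball 0 R \<times> UNIV) (\<lambda>(t, x, \<theta>). Dif (Dif (F t x)) \<theta>) \<and>
        (\<exists>C>0. \<forall>t\<in>{0..T}. \<forall>x\<in>cball 0 R. \<forall>\<theta>.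
           norm (Dif (F t x) \<theta>) + norm (Dif (Dif (F t x)) \<theta>) \<le> C))"

text \<open>The entry \<open>(k, j)\<close> of \<open>\<nabla>\<^sub>\<theta> F\<close> is \<open>\<partial>F\<^sub>k / \<partial>\<theta>\<^sub>j\<close>. The divergence \<open>\<nabla>\<^sub>x \<cdot> \<nabla>\<^sub>\<theta> F\<close> contracts over \<open>k\<close>,
  as in the product \<open>\<nabla>\<^sub>x \<psi> \<cdot> \<nabla>\<^sub>\<theta> F\<close> below; it is the row vector with entries
  \<open>\<Sum>k. \<partial>\<^sup>2 F\<^sub>k / \<partial>x\<^sub>k \<partial>\<theta>\<^sub>j\<close>.\<close>

definition row_divergence :: "(real^'d \<Rightarrow> (real^'m) \<Rightarrow>\<^sub>L (real^'d)) \<Rightarrow> real^'d \<Rightarrow> real^'m" where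
  "row_divergence M x =
     (\<chi> j. \<Sum>k\<in>UNIV. deriv (\<lambda>s. blinfun_apply (M (x + s *\<^sub>R axis k 1)) (axis j 1) $ k) 0)"

definition row_divergence_exists :: "(real^'d \<Rightarrow> (real^'m) \<Rightarrow>\<^sub>L (real^'d)) \<Rightarrow> real^'d \<Rightarrow> bool" where
  "row_divergence_exists M x \<longleftrightarrow>
     (\<forall>j k. (\<lambda>s::real. blinfun_apply (M (x + s *\<^sub>R axis k 1)) (axis j 1) $ k) differentiable (at 0))"

text \<open>A constant depending on \<open>\<bar>\<theta>\<bar>\<close> is a nondecreasing function of \<open>\<bar>\<theta>\<bar>\<close>, i.e. it is uniform for
  \<open>\<theta>\<close> in bounded sets.\<close>

definition A2 :: "real \<Rightarrow> (real \<Rightarrow> real^'d \<Rightarrow> real^'m \<Rightarrow> real^'d) \<Rightarrow> bool" where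
  "A2 T F \<longleftrightarrow>
     (\<forall>t\<in>{0..T}. \<forall>\<theta>. C2 (\<lambda>x. F t x \<theta>)) \<and>
     (\<forall>t\<in>{0..T}. \<forall>x \<theta>. row_divergence_exists (\<lambda>x. Dif (F t x) \<theta>) x) \<and>
     (\<forall>R>0. \<exists>C. mono C \<and> (\<forall>t\<in>{0..T}. \<forall>x\<in>cball 0 R. \<forall>\<theta>.
        norm (row_divergence (\<lambda>x. Dif (F t x) \<theta>) x) + norm (Dif (\<lambda>x. F t x \<theta>) x)
          + norm (Dif (Dif (\<lambda>x. F t x \<theta>)) x) \<le> C (norm \<theta>))) \<and>
     (\<forall>R>0. \<exists>C. \<forall>\<theta>\<^sub>1 \<theta>\<^sub>2. \<forall>s\<in>{0..T}. \<forall>t\<in>{0..T}. \<forall>x\<in>cball 0 R.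
        norm (F t x \<theta>\<^sub>1 - F s x \<theta>\<^sub>2) \<le> C * (\<bar>t - s\<bar> + norm (\<theta>\<^sub>1 - \<theta>\<^sub>2))) \<and>
     (\<forall>R>0. \<exists>C. mono C \<and> (\<forall>\<theta>. \<forall>t\<in>{0..T}. \<forall>x\<in>cball 0 R. \<forall>y\<in>cball 0 R.
        norm (Dif (F t x) \<theta> - Dif (F t y) \<theta>) \<le> C (norm \<theta>) * norm (x - y)))"

text \<open>Time regularity of \<open>\<nabla>\<^sub>\<theta> F\<close>, which neither \<^const>\<open>A1\<close> nor \<^const>\<open>A2\<close> contains and without which
  the optimal control need not be Lipschitz. For \<open>d = m = 1\<close> and
  \<open>F t x \<theta> = sin \<theta> + (\<Sum>n\<ge>1. r\<^sub>n\<^sup>2 / n\<^sup>2 * sin (t / r\<^sub>n\<^sup>2) * sin (\<theta> / r\<^sub>n))\<close> with \<open>r\<^sub>n = 4 powr (-n)\<close>, both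
  assumptions hold, and the control equation reads \<open>\<theta> t = - c / (2 \<lambda>) * \<partial>\<^sub>\<theta> F t x (\<theta> t)\<close> with \<open>c\<close>
  constant in time; for \<open>c \<noteq> 0\<close> its solution is not Lipschitz, because
  \<open>t \<mapsto> \<Sum>n. r\<^sub>n / n\<^sup>2 * cos (\<theta> / r\<^sub>n) * sin (t / r\<^sub>n\<^sup>2)\<close> is a lacunary series that is not Lipschitz.\<close>

definition gradient_time_lipschitz ::
    "real \<Rightarrow> (real \<Rightarrow> real^'d \<Rightarrow> real^'m \<Rightarrow> real^'d) \<Rightarrow> bool" where
  "gradient_time_lipschitz T F \<longleftrightarrow>
     (\<forall>R>0. \<exists>C. mono C \<and> (\<forall>\<theta>. \<forall>s\<in>{0..T}. \<forall>t\<in>{0..T}. \<forall>x\<in>cball 0 R.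
        norm (Dif (F t x) \<theta> - Dif (F s x) \<theta>) \<le> C (norm \<theta>) * \<bar>t - s\<bar>))"

section \<open>Controls\<close>

text \<open>Controls are functions, to be identified when they agree almost everywhere on \<open>[0,T]\<close>.\<close>

definition L2 :: "real \<Rightarrow> (real \<Rightarrow> real^'m) set" where
  "L2 T = {\<theta>. \<theta> \<in> borel_measurable (lebesgue_on {0..T}) \<and>
               integrable (lebesgue_on {0..T}) (\<lambda>t. (norm (\<theta> t))\<^sup>2)}"

definition L2_norm :: "real \<Rightarrow> (real \<Rightarrow> real^'m) \<Rightarrow> real" where
  "L2_norm T \<theta> = sqrt (LINT t|lebesgue_on {0..T}. (norm (\<theta> t))\<^sup>2)"

definition Gamma_C :: "real \<Rightarrow> real \<Rightarrow> (real \<Rightarrow> real^'m) set" where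
  "Gamma_C T C\<^sub>\<Gamma> = {\<theta> \<in> L2 T. L2_norm T \<theta> \<le> C\<^sub>\<Gamma> * sqrt T}"

section \<open>Compactly supported probability measures and the continuity equation\<close>

definition msupport :: "'a::topological_space measure \<Rightarrow> 'a set" where
  "msupport M = {z. \<forall>U. open U \<and> z \<in> U \<longrightarrow> emeasure M U > 0}"

definition Pc :: "'a::topological_space measure set" where
  "Pc = {M. prob_space M \<and> sets M = sets borel \<and> compact (msupport M)}"

text \<open>Continuity of curves of measures is narrow continuity; for curves supported in a common
  compact set this is continuity in any Wasserstein distance.\<close>

definition continuous_curve_Pc :: "real \<Rightarrow> (real \<Rightarrow> 'a::real_normed_vector measure) \<Rightarrow> bool" where
  "continuous_curve_Pc T \<mu> \<longleftrightarrow>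
     (\<forall>t\<in>{0..T}. \<mu> t \<in> Pc) \<and>
     (\<forall>f :: 'a \<Rightarrow> real. continuous_on UNIV f \<and> bounded (range f) \<longrightarrow>
        continuous_on {0..T} (\<lambda>t. LINT z|\<mu> t. f z))"

text \<open>Distributional solutions of \<open>\<partial>\<^sub>t \<mu>\<^sub>t + \<nabla>\<^sub>x \<cdot> (F(t, x, \<theta>\<^sub>t) \<mu>\<^sub>t) = 0\<close>: for a test function \<open>\<phi>\<close>, the
  function \<open>\<partial>\<^sub>t \<phi> + \<nabla>\<^sub>x \<phi> \<cdot> F\<close> is the derivative of \<open>\<phi>\<close> in the direction \<open>(1, (F, 0))\<close>.\<close>

definition continuity_equation ::
    "real \<Rightarrow> (real \<Rightarrow> real^'d \<Rightarrow> real^'m \<Rightarrow> real^'d) \<Rightarrow> ((real^'d) \<times> (real^'d)) measure \<Rightarrow>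
     (real \<Rightarrow> real^'m) \<Rightarrow> (real \<Rightarrow> ((real^'d) \<times> (real^'d)) measure) \<Rightarrow> bool" where
  "continuity_equation T F \<mu>\<^sub>0 \<theta> \<mu> \<longleftrightarrow>
     continuous_curve_Pc T \<mu> \<and> \<mu> 0 = \<mu>\<^sub>0 \<and>
     (\<forall>\<phi> :: real \<times> ((real^'d) \<times> (real^'d)) \<Rightarrow> real. C1c \<phi> \<and> fsupport \<phi> \<subseteq> {0<..<T} \<times> UNIV \<longrightarrow>
        (let I = (\<lambda>t. LINT (x, y)|\<mu> t.
                    blinfun_apply (Dif \<phi> (t, (x, y))) (1, (F t x (\<theta> t), 0)))
         in integrable (lebesgue_on {0..T}) I \<and> (LINT t|lebesgue_on {0..T}. I t) = 0))"

definition support_radius ::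
    "real \<Rightarrow> real \<Rightarrow> (real \<Rightarrow> real^'d \<Rightarrow> real^'m \<Rightarrow> real^'d) \<Rightarrow> real \<Rightarrow> bool" where
  "support_radius T R F R\<^sub>T \<longleftrightarrow> R\<^sub>T > 0 \<and>
     (\<forall>\<mu>\<^sub>0\<in>Pc. msupport \<mu>\<^sub>0 \<subseteq> cball 0 R \<longrightarrow>
        (\<forall>\<theta>\<in>L2 T. \<forall>\<mu>. continuity_equation T F \<mu>\<^sub>0 \<theta> \<mu> \<longrightarrow>
           (\<forall>t\<in>{0..T}. msupport (\<mu> t) \<subseteq> cball 0 R\<^sub>T)))"

section \<open>The flow and the backward equation\<close>

text \<open>\<open>\<Phi> \<tau> t x\<close> is the position at time \<open>t\<close> of the (Caratheodory) solution passing through \<open>x\<close> at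
  time \<open>\<tau>\<close>; both \<open>\<tau> \<le> t\<close> and \<open>t \<le> \<tau>\<close> are covered, the interval integral being oriented.\<close>

definition flow ::
    "real \<Rightarrow> (real \<Rightarrow> real^'d \<Rightarrow> real^'m \<Rightarrow> real^'d) \<Rightarrow> (real \<Rightarrow> real^'m) \<Rightarrow>
     (real \<Rightarrow> real \<Rightarrow> real^'d \<Rightarrow> real^'d) \<Rightarrow> bool" where
  "flow T F \<theta> \<Phi> \<longleftrightarrow>
     (\<forall>\<tau>\<in>{0..T}. \<forall>x. continuous_on {0..T} (\<lambda>t. \<Phi> \<tau> t x) \<and>
        (\<forall>t\<in>{0..T}.
           interval_lebesgue_integrable lebesgue (ereal \<tau>) (ereal t) (\<lambda>s. F s (\<Phi> \<tau> s x) (\<theta> s)) \<and>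
           \<Phi> \<tau> t x = x + (LINT s=ereal \<tau>..ereal t|lebesgue. F s (\<Phi> \<tau> s x) (\<theta> s))))"

definition characteristic_form ::
    "real \<Rightarrow> (real \<Rightarrow> real^'d \<Rightarrow> real^'m \<Rightarrow> real^'d) \<Rightarrow> ((real^'d) \<times> (real^'d) \<Rightarrow> real) \<Rightarrow>
     (real \<Rightarrow> real^'m) \<Rightarrow> (real \<Rightarrow> (real^'d) \<times> (real^'d) \<Rightarrow> real) \<Rightarrow> bool" where
  "characteristic_form T F \<psi>\<^sub>T \<theta> \<psi> \<longleftrightarrow>
     (\<exists>\<Phi>. flow T F \<theta> \<Phi> \<and> (\<forall>t\<in>{0..T}. \<forall>x y. \<psi> t (x, y) = \<psi>\<^sub>T (\<Phi> t T x, y)))"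

definition Dx :: "((real^'d) \<times> (real^'d) \<Rightarrow> real) \<Rightarrow> real^'d \<Rightarrow> real^'d \<Rightarrow> ((real^'d) \<Rightarrow>\<^sub>L real)" where
  "Dx f x y = Dif (\<lambda>x'. f (x', y)) x"

definition backward_equation ::
    "real \<Rightarrow> (real \<Rightarrow> real^'d \<Rightarrow> real^'m \<Rightarrow> real^'d) \<Rightarrow> ((real^'d) \<times> (real^'d) \<Rightarrow> real) \<Rightarrow>
     (real \<Rightarrow> real^'m) \<Rightarrow> (real \<Rightarrow> (real^'d) \<times> (real^'d) \<Rightarrow> real) \<Rightarrow> bool" where
  "backward_equation T F \<psi>\<^sub>T \<theta> \<psi> \<longleftrightarrow> \<psi> T = \<psi>\<^sub>T \<and>
     (\<forall>t\<in>{0..T}. \<forall>x y. \<exists>D. ((\<lambda>s. \<psi> s (x, y)) has_real_derivative D) (at t within {0..T}) \<and>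
        D + blinfun_apply (Dx (\<psi> t) x y) (F t x (\<theta> t)) = 0)"

section \<open>The control equation\<close>

text \<open>\<open>\<nabla>\<^sub>x \<psi> \<cdot> \<nabla>\<^sub>\<theta> F\<close>, with \<open>j\<close>-th entry \<open>\<Sum>k. \<partial>\<psi>/\<partial>x\<^sub>k * \<partial>F\<^sub>k/\<partial>\<theta>\<^sub>j\<close>.\<close>

definition grad_prod :: "((real^'d) \<Rightarrow>\<^sub>L real) \<Rightarrow> ((real^'m) \<Rightarrow>\<^sub>L (real^'d)) \<Rightarrow> real^'m" where
  "grad_prod p A =
     (\<chi> j. \<Sum>k\<in>UNIV. blinfun_apply p (axis k 1) * (blinfun_apply A (axis j 1) $ k))"

definition control_equation_at ::
    "(real \<Rightarrow> real^'d \<Rightarrow> real^'m \<Rightarrow> real^'d) \<Rightarrow> real \<Rightarrow> (real \<Rightarrow> ((real^'d) \<times> (real^'d)) measure) \<Rightarrow>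
     (real \<Rightarrow> real^'m) \<Rightarrow> (real \<Rightarrow> (real^'d) \<times> (real^'d) \<Rightarrow> real) \<Rightarrow> real \<Rightarrow> bool" where
  "control_equation_at F lam \<mu> \<theta> \<psi> t \<longleftrightarrow>
     (let g = (\<lambda>(x, y). grad_prod (Dx (\<psi> t) x y) (Dif (F t x) (\<theta> t)))
      in integrable (\<mu> t) g \<and> \<theta> t = - (1 / (2 * lam)) *\<^sub>R (LINT z|\<mu> t. g z))"

end

theory Submission
  imports Defs
begin

text \<open>Adding the passive variable \<open>y\<close> to the state turns the problem into one for a vector field on
  pairs, with flow \<open>\<Phi>\<close>, \<open>\<mu>\<^sub>t\<close> the push-forward of \<open>\<mu>\<^sub>0\<close> and \<open>\<psi>\<^sub>t = \<psi>\<^sub>T \<circ> \<Phi>\<^bsub>(t,T)\<^esub>\<close>. The right-hand side of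
  the control equation is then a function of the control alone. Since \<open>\<Phi>\<close> and its derivative depend
  Lipschitz continuously on the control in \<open>L\<^sup>1\<close>, for large \<open>\<lambda>\<close> it is a contraction of a small ball of
  continuous controls, and its fixed point is the solution.

  For uniqueness, let \<open>\<theta>'\<close> be another square integrable solution, with measures \<open>\<mu>'\<close>. Testing the
  continuity equation of \<open>\<mu>'\<close> with functions constant along the flow of the continuous control \<open>\<theta>\<close>
  shows that the Wasserstein distance of \<open>\<mu>\<^sub>t\<close> and \<open>\<mu>'\<^sub>t\<close> is at most a multiple of the \<open>L\<^sup>1\<close> distance of
  \<open>\<theta>\<close> and \<open>\<theta>'\<close>. The control equations then give \<open>\<parallel>\<theta> - \<theta>'\<parallel> \<le> c / \<lambda> * \<parallel>\<theta> - \<theta>'\<parallel>\<close> in \<open>L\<^sup>1\<close>.\<close>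

section \<open>Gronwall estimates with square integrable weights\<close>

text \<open>Competing controls are merely square integrable, so composing with their own flows gives
  no \<open>C1\<close> test functions of time and space. The duality argument therefore transports
  test functions by the continuous control only. The transport equation cancels everything in the
  weak equation of the other measure except the term with the difference of the two fields, and that
  term is Lipschitz in the difference of the controls.

  Every constant has to be fixed before \<lambda>. The estimates see a control only through one
  number \<open>N\<close>, a bound for the integral of the squared Lipschitz weight
  \<open>C + L * (1 + norm (\<theta> t))\<close>, and this bound is uniform on
  \<open>Gamma_C\<close>. The constants of (A2) grow with the size of the control, but the control
  equation forces that size below a constant divided by \<lambda>, so their values on the unit ball
  suffice.

  Existence is a contraction in the supremum norm, which keeps the control continuous. Uniqueness
  uses the distance in the mean, because a control enters a flow through a time integral and the
  competing equation holds only almost everywhere.\<close>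

definition J :: "real \<Rightarrow> real \<Rightarrow> (real \<Rightarrow> 'b::euclidean_space) \<Rightarrow> 'b" where
  "J \<tau> t f = integral {0..t} f - integral {0..\<tau>} f"

text \<open>The unoriented interval between two times. Together with the oriented integral
  \<open>J\<close> it lets flows run forwards and backwards in time under the same
  estimates.\<close>

definition seg :: "real \<Rightarrow> real \<Rightarrow> real set" where
  "seg \<tau> t = {min \<tau> t..max \<tau> t}"

lemma seg_subset: "\<tau> \<in> {0..T} \<Longrightarrow> t \<in> {0..T} \<Longrightarrow> seg \<tau> t \<subseteq> {0..T}"
  by (auto simp: seg_def)

lemma J_le:
  assumes "0 \<le> \<tau>" "\<tau> \<le> t" "f integrable_on {0..t}"
  shows "J \<tau> t f = integral {\<tau>..t} f"
  using Henstock_Kurzweil_Integration.integral_combine[OF assms] unfolding J_def by (metis add_diff_cancel_left')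

lemma J_swap: "J t \<tau> f = - J \<tau> t f"
  by (simp add: J_def)

lemma J_add_interval: "J \<tau> s f + J s t f = J \<tau> t f"
  by (simp add: J_def)

lemma integrable_sub:
  fixes f :: "real \<Rightarrow> 'b::euclidean_space"
  assumes "f integrable_on {0..T}" "\<tau> \<in> {0..T}" "t \<in> {0..T}"
  shows "f integrable_on {\<tau>..t}" "f integrable_on seg \<tau> t"
  using assms by (auto intro!: integrable_subinterval_real[OF assms(1)] simp: seg_def min_def max_def)

lemma J_diff:
  assumes "f integrable_on {0..T}" "g integrable_on {0..T}" "\<tau> \<in> {0..T}" "t \<in> {0..T}"
  shows "J \<tau> t (\<lambda>s. f s - g s) = J \<tau> t f - J \<tau> t g"
  using assms integrable_sub(1)[OF assms(1), of 0] integrable_sub(1)[OF assms(2), of 0]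
  by (simp add: J_def Henstock_Kurzweil_Integration.integral_diff)

lemma J_add:
  assumes "f integrable_on {0..T}" "g integrable_on {0..T}" "\<tau> \<in> {0..T}" "t \<in> {0..T}"
  shows "J \<tau> t (\<lambda>s. f s + g s) = J \<tau> t f + J \<tau> t g"
  using assms integrable_sub(1)[OF assms(1), of 0] integrable_sub(1)[OF assms(2), of 0]
  by (simp add: J_def Henstock_Kurzweil_Integration.integral_add)

lemma J_linear:
  assumes "f integrable_on {0..T}" "\<tau> \<in> {0..T}" "t \<in> {0..T}" "bounded_linear h"
  shows "J \<tau> t (\<lambda>s. h (f s)) = h (J \<tau> t f)"
proof -
  interpret h: bounded_linear h by fact
  have "integral {0..r} (\<lambda>s. h (f s)) = h (integral {0..r} f)" if "r \<in> {0..T}" for r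
    using integral_linear[OF integrable_sub(1)[OF assms(1), of 0 r] assms(4)] that assms(2)
    by (simp add: o_def)
  then show ?thesis using assms by (simp add: J_def h.diff)
qed

lemma J_cong:
  assumes "\<tau> \<in> {0..T}" "t \<in> {0..T}" "\<And>s. s \<in> {0..T} \<Longrightarrow> f s = g s"
  shows "J \<tau> t f = J \<tau> t g"
  unfolding J_def using assms
  by (intro arg_cong2[where f = "(-)"] Henstock_Kurzweil_Integration.integral_cong) auto

lemma J_norm_bound:
  fixes f :: "real \<Rightarrow> 'b::euclidean_space"
  assumes "f integrable_on {0..T}" "g integrable_on {0..T}" "\<tau> \<in> {0..T}" "t \<in> {0..T}"
    and "\<And>s. s \<in> seg \<tau> t \<Longrightarrow> norm (f s) \<le> g s"
  shows "norm (J \<tau> t f) \<le> integral (seg \<tau> t) g"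
proof -
  have *: "norm (J a b f) \<le> integral {a..b} g"
    if "a \<le> b" "a \<in> {0..T}" "b \<in> {0..T}" "\<And>s. s \<in> {a..b} \<Longrightarrow> norm (f s) \<le> g s" for a b
  proof -
    have "J a b f = integral {a..b} f"
      using that integrable_sub(1)[OF assms(1), of 0 b] by (intro J_le) auto
    also have "norm \<dots> \<le> integral {a..b} g"
      by (rule integral_norm_bound_integral)
        (use that integrable_sub(1)[OF assms(1), of a b] integrable_sub(1)[OF assms(2), of a b] in auto)
    finally show ?thesis .
  qed
  show ?thesis
  proof (cases "\<tau> \<le> t")
    case True then show ?thesis using *[of \<tau> t] assms by (auto simp: seg_def)
  next
    case False then show ?thesis using *[of t \<tau>] assms by (subst J_swap) (auto simp: seg_def)
  qed
qed

lemma continuous_on_J: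
  assumes "f integrable_on {0..T}"
  shows "continuous_on {0..T} (\<lambda>t. J \<tau> t f)"
  unfolding J_def by (intro continuous_intros indefinite_integral_continuous_1 assms)

lemma integral_seg_le:
  fixes g :: "real \<Rightarrow> real"
  assumes "g integrable_on {0..T}" "\<tau> \<in> {0..T}" "t \<in> {0..T}" "\<And>s. s \<in> {0..T} \<Longrightarrow> 0 \<le> g s"
  shows "integral (seg \<tau> t) g \<le> integral {0..T} g"
  using assms integrable_sub(2)[OF assms(1-3)] seg_subset[OF assms(2,3)]
  by (intro integral_subset_le) auto

text \<open>Here \<open>k\<close> stands for a Lipschitz constant of the field at time
  \<open>s\<close>; it depends on the control and so is only square integrable. Later bounds involve
  \<open>k\<close> through \<open>N\<close> alone, which makes them uniform in the control.\<close>

definition weight :: "real \<Rightarrow> (real \<Rightarrow> real) \<Rightarrow> real \<Rightarrow> bool" where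
  "weight T k N \<longleftrightarrow> k \<in> borel_measurable (lebesgue_on {0..T}) \<and> (\<forall>s\<in>{0..T}. 0 \<le> k s) \<and>
     (\<lambda>s. (k s)\<^sup>2) integrable_on {0..T} \<and> integral {0..T} (\<lambda>s. (k s)\<^sup>2) \<le> N"

lemma weight_nonneg: "weight T k N \<Longrightarrow> 0 \<le> N"
  unfolding weight_def
  by (metis (no_types, lifting) Henstock_Kurzweil_Integration.integral_nonneg order_trans zero_le_power2)

lemma weight_integrable:
  assumes "weight T k N"
  shows "k absolutely_integrable_on {0..T}"
proof (rule measurable_bounded_by_integrable_imp_absolutely_integrable)
  show "(\<lambda>s. 1 + (k s)\<^sup>2) integrable_on {0..T}"
    using assms by (auto simp: weight_def intro!: integrable_add)
  have "x \<le> 1 + x\<^sup>2" if "0 \<le> x" for x :: real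
    using that by (smt (verit, best) self_le_power zero_le_power2 zero_less_numeral)
  then show "\<And>x. x \<in> {0..T} \<Longrightarrow> norm (k x) \<le> 1 + (k x)\<^sup>2"
    using assms by (auto simp: weight_def)
qed (use assms in \<open>auto simp: weight_def\<close>)

lemma absint_mult_bounded:
  fixes f g :: "real \<Rightarrow> real"
  assumes "f absolutely_integrable_on {0..T}" "continuous_on {0..T} g"
  shows "(\<lambda>s. f s * g s) absolutely_integrable_on {0..T}"
proof -
  obtain B where B: "\<And>s. s \<in> {0..T} \<Longrightarrow> norm (g s) \<le> B"
    using compact_continuous_image[OF assms(2) compact_Icc] compact_imp_bounded[of "g ` {0..T}"]
    unfolding bounded_iff by (meson imageI)
  show ?thesis
  proof (rule measurable_bounded_by_integrable_imp_absolutely_integrable)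
    show "(\<lambda>s. f s * g s) \<in> borel_measurable (lebesgue_on {0..T})"
      using absolutely_integrable_imp_borel_measurable[OF assms(1)]
        continuous_imp_measurable_on_sets_lebesgue[OF assms(2)] by auto
    show "(\<lambda>s. norm (f s) * B) integrable_on {0..T}"
      using assms(1) by (auto simp: absolutely_integrable_on_def intro: integrable_on_mult_left)
    show "norm (f x * g x) \<le> norm (f x) * B" if "x \<in> {0..T}" for x
      using B[OF that] by (simp add: abs_mult mult_left_mono)
  qed auto
qed

lemma integral_exp_decay:
  fixes \<alpha> a b :: real
  assumes "\<alpha> > 0" "a \<le> b"
  shows "integral {a..b} (\<lambda>s. exp (- \<alpha> * (b - s))) \<le> 1 / \<alpha>"
    and "integral {a..b} (\<lambda>s. exp (- \<alpha> * (s - a))) \<le> 1 / \<alpha>"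
proof -
  have 1: "((\<lambda>s. exp (- \<alpha> * (b - s))) has_integral exp (- \<alpha> * (b - b)) / \<alpha> - exp (- \<alpha> * (b - a)) / \<alpha>) {a..b}"
    using assms by (intro fundamental_theorem_of_calculus[where f = "\<lambda>s. exp (- \<alpha> * (b - s)) / \<alpha>"])
      (auto intro!: derivative_eq_intros simp flip: has_real_derivative_iff_has_vector_derivative)
  have 2: "((\<lambda>s. exp (- \<alpha> * (s - a))) has_integral - exp (- \<alpha> * (b - a)) / \<alpha> - - exp (- \<alpha> * (a - a)) / \<alpha>) {a..b}"
    using assms by (intro fundamental_theorem_of_calculus[where f = "\<lambda>s. - exp (- \<alpha> * (s - a)) / \<alpha>"])
      (auto intro!: derivative_eq_intros simp flip: has_real_derivative_iff_has_vector_derivative)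
  show "integral {a..b} (\<lambda>s. exp (- \<alpha> * (b - s))) \<le> 1 / \<alpha>"
    using integral_unique[OF 1] assms by simp
  show "integral {a..b} (\<lambda>s. exp (- \<alpha> * (s - a))) \<le> 1 / \<alpha>"
    using integral_unique[OF 2] assms by simp
qed

text \<open>The exponential weight replaces Gronwall's lemma: by Young's inequality the weighted
  integral operator with an \<open>L\<^sup>2\<close> kernel is a contraction with factor \<open>1/2\<close>.\<close>

lemma weighted_integral_le:
  assumes k: "weight T k N" and "\<tau> \<in> {0..T}" "t \<in> {0..T}" and \<alpha>: "\<alpha> = 2 * (N + 1)"
  shows "integral (seg \<tau> t) (\<lambda>s. k s * exp (\<alpha> * \<bar>s - \<tau>\<bar>)) \<le> exp (\<alpha> * \<bar>t - \<tau>\<bar>) / 2"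
proof -
  have N: "0 \<le> N" using weight_nonneg[OF k] .
  have k0: "s \<in> {0..T} \<Longrightarrow> 0 \<le> k s" for s using k by (auto simp: weight_def)
  have kint: "k absolutely_integrable_on {0..T}" by (rule weight_integrable[OF k])
  have k2: "(\<lambda>s. (k s)\<^sup>2) integrable_on {0..T}" using k by (auto simp: weight_def)
  have sub: "seg \<tau> t \<subseteq> {0..T}" using assms by (intro seg_subset)
  \<comment> \<open>On \<open>seg \<tau> t\<close> the distances satisfy \<open>\<bar>s -
    \<tau>\<bar> = \<bar>t - \<tau>\<bar> - \<bar>t - s\<bar>\<close>, so the weight at
    \<open>t\<close> can be pulled out. Young's inequality with parameter \<open>N + 1\<close> then
    splits the rest into two terms; \<alpha> is chosen so that each of them integrates to at most
    1/4.\<close>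
  have young: "k s * exp (\<alpha> * \<bar>s - \<tau>\<bar>)
      \<le> exp (\<alpha> * \<bar>t - \<tau>\<bar>) * ((k s)\<^sup>2 / (4 * (N + 1)) + (N + 1) * exp (- (2 * \<alpha>) * \<bar>t - s\<bar>))"
    if "s \<in> seg \<tau> t" for s
  proof -
    have e: "exp (\<alpha> * \<bar>s - \<tau>\<bar>) = exp (\<alpha> * \<bar>t - \<tau>\<bar>) * exp (- \<alpha> * \<bar>t - s\<bar>)"
      using that by (auto simp: seg_def abs_if algebra_simps simp flip: exp_add)
    have "0 \<le> (k s / (2 * (N + 1)) - exp (- \<alpha> * \<bar>t - s\<bar>))\<^sup>2 * (N + 1)" using N by simp
    also have "\<dots> = (k s)\<^sup>2 / (4 * (N + 1)) - k s * exp (- \<alpha> * \<bar>t - s\<bar>) + (N + 1) * (exp (- \<alpha> * \<bar>t - s\<bar>))\<^sup>2"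
    proof -
      have "(x / (2 * M) - E)\<^sup>2 * M = x\<^sup>2 / (4 * M) - x * E + M * E\<^sup>2" if "M > 0" for x E M :: real
        using that by (simp add: power2_eq_square field_simps)
      then show ?thesis by this (use N in simp)
    qed
    also have "(exp (- \<alpha> * \<bar>t - s\<bar>))\<^sup>2 = exp (- (2 * \<alpha>) * \<bar>t - s\<bar>)"
      by (simp add: power2_eq_square flip: exp_add)
    finally have "k s * exp (- \<alpha> * \<bar>t - s\<bar>)
      \<le> (k s)\<^sup>2 / (4 * (N + 1)) + (N + 1) * exp (- (2 * \<alpha>) * \<bar>t - s\<bar>)" by simp
    then have "exp (\<alpha> * \<bar>t - \<tau>\<bar>) * (k s * exp (- \<alpha> * \<bar>t - s\<bar>))
      \<le> exp (\<alpha> * \<bar>t - \<tau>\<bar>) * ((k s)\<^sup>2 / (4 * (N + 1)) + (N + 1) * exp (- (2 * \<alpha>) * \<bar>t - s\<bar>))"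
      by (intro mult_left_mono) auto
    then show ?thesis unfolding e by (simp add: mult_ac)
  qed
  have i1: "(\<lambda>s. k s * exp (\<alpha> * \<bar>s - \<tau>\<bar>)) integrable_on seg \<tau> t"
    by (rule integrable_sub(2)[OF _ assms(2,3)])
      (auto intro!: set_lebesgue_integral_eq_integral(1) absint_mult_bounded kint continuous_intros)
  have i2: "(\<lambda>s. (k s)\<^sup>2) integrable_on seg \<tau> t"
    by (rule integrable_sub(2)[OF k2 assms(2,3)])
  have i3: "(\<lambda>s. exp (- (2 * \<alpha>) * \<bar>t - s\<bar>)) integrable_on seg \<tau> t"
    unfolding seg_def by (intro integrable_continuous_real continuous_intros)
  have "integral (seg \<tau> t) (\<lambda>s. k s * exp (\<alpha> * \<bar>s - \<tau>\<bar>))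
    \<le> integral (seg \<tau> t) (\<lambda>s. exp (\<alpha> * \<bar>t - \<tau>\<bar>) * ((k s)\<^sup>2 / (4 * (N + 1)) + (N + 1) * exp (- (2 * \<alpha>) * \<bar>t - s\<bar>)))"
    by (intro integral_le i1 young integrable_on_mult_right integrable_add i2 i3 integrable_on_divide)
  also have "\<dots> = exp (\<alpha> * \<bar>t - \<tau>\<bar>) * (integral (seg \<tau> t) (\<lambda>s. (k s)\<^sup>2) / (4 * (N + 1))
      + (N + 1) * integral (seg \<tau> t) (\<lambda>s. exp (- (2 * \<alpha>) * \<bar>t - s\<bar>)))"
  proof -
    have "integral (seg \<tau> t) (\<lambda>s. (k s)\<^sup>2 / (4 * (N + 1)) + (N + 1) * exp (- (2 * \<alpha>) * \<bar>t - s\<bar>))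
      = integral (seg \<tau> t) (\<lambda>s. (k s)\<^sup>2 / (4 * (N + 1))) + integral (seg \<tau> t) (\<lambda>s. (N + 1) * exp (- (2 * \<alpha>) * \<bar>t - s\<bar>))"
      by (intro Henstock_Kurzweil_Integration.integral_add integrable_on_mult_right i2 i3 integrable_on_divide)
    then show ?thesis
      by (simp del: mult_minus_left)
  qed
  also have "\<dots> \<le> exp (\<alpha> * \<bar>t - \<tau>\<bar>) * (1 / 4 + 1 / 4)"
  proof (intro mult_left_mono add_mono)
    have "integral (seg \<tau> t) (\<lambda>s. (k s)\<^sup>2) \<le> integral {0..T} (\<lambda>s. (k s)\<^sup>2)"
      using assms by (intro integral_seg_le k2) auto
    also have "\<dots> \<le> N + 1" using k by (auto simp: weight_def)
    finally show "integral (seg \<tau> t) (\<lambda>s. (k s)\<^sup>2) / (4 * (N + 1)) \<le> 1 / 4"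
      using N by (simp add: field_simps)
    have "integral (seg \<tau> t) (\<lambda>s. exp (- (2 * \<alpha>) * \<bar>t - s\<bar>)) \<le> 1 / (2 * \<alpha>)"
    proof (cases "\<tau> \<le> t")
      case True
      have "integral (seg \<tau> t) (\<lambda>s. exp (- (2 * \<alpha>) * \<bar>t - s\<bar>)) = integral {\<tau>..t} (\<lambda>s. exp (- (2 * \<alpha>) * (t - s)))"
      proof -
        have "seg \<tau> t = {\<tau>..t}" using True by (simp add: seg_def)
        then show ?thesis using True by (auto intro!: Henstock_Kurzweil_Integration.integral_cong)
      qed
      also have "\<dots> \<le> 1 / (2 * \<alpha>)"
        using N \<alpha> True by (intro integral_exp_decay) auto
      finally show ?thesis .
    next
      case False
      have "integral (seg \<tau> t) (\<lambda>s. exp (- (2 * \<alpha>) * \<bar>t - s\<bar>)) = integral {t..\<tau>} (\<lambda>s. exp (- (2 * \<alpha>) * (s - t)))"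
      proof -
        have "seg \<tau> t = {t..\<tau>}" using False by (simp add: seg_def)
        then show ?thesis using False by (auto intro!: Henstock_Kurzweil_Integration.integral_cong)
      qed
      also have "\<dots> \<le> 1 / (2 * \<alpha>)"
        using N \<alpha> False by (intro integral_exp_decay) auto
      finally show ?thesis .
    qed
    then have "(N + 1) * integral (seg \<tau> t) (\<lambda>s. exp (- (2 * \<alpha>) * \<bar>t - s\<bar>)) \<le> (N + 1) * (1 / (2 * \<alpha>))"
      using N by (intro mult_left_mono) auto
    also have "\<dots> = 1 / 4" using N by (simp add: \<alpha>)
    finally show "(N + 1) * integral (seg \<tau> t) (\<lambda>s. exp (- (2 * \<alpha>) * \<bar>t - s\<bar>)) \<le> 1 / 4" .
  qed auto
  finally show ?thesis by simp
qed

text \<open>The factor 2 comes from absorbing half of the maximum, the exponential is the weight at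
  the largest possible distance \<open>T\<close> from the starting time.\<close>

definition gron :: "real \<Rightarrow> real \<Rightarrow> real" where
  "gron T N = 2 * exp (2 * (N + 1) * T)"

lemma gron_pos: "0 < gron T N"
  by (simp add: gron_def)

text \<open>At a maximum point of \<open>f\<close> times the decaying weight, the integral is at
  most half of \<open>f\<close> there and can be absorbed. Since \<open>f\<close> is never
  differentiated, continuity is enough and both time directions are treated at once.\<close>

lemma gronwall:
  fixes f :: "real \<Rightarrow> real"
  assumes k: "weight T k N" and \<tau>: "\<tau> \<in> {0..T}" and cont: "continuous_on {0..T} f"
    and a: "0 \<le> a" and f0: "\<And>t. t \<in> {0..T} \<Longrightarrow> 0 \<le> f t"
    and le: "\<And>t. t \<in> {0..T} \<Longrightarrow> f t \<le> a + integral (seg \<tau> t) (\<lambda>s. k s * f s)"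
    and t: "t \<in> {0..T}"
  shows "f t \<le> a * gron T N"
proof -
  define \<alpha> where "\<alpha> = 2 * (N + 1)"
  have N: "0 \<le> N" using weight_nonneg[OF k] .
  then have \<alpha>: "0 < \<alpha>" by (simp add: \<alpha>_def)
  define g where "g s = exp (- \<alpha> * \<bar>s - \<tau>\<bar>) * f s" for s
  have "continuous_on {0..T} g" unfolding g_def by (intro continuous_intros cont)
  then obtain t0 where t0: "t0 \<in> {0..T}" "\<And>s. s \<in> {0..T} \<Longrightarrow> g s \<le> g t0"
    using continuous_attains_sup[of "{0..T}" g] t by auto
  have gf: "f s = g s * exp (\<alpha> * \<bar>s - \<tau>\<bar>)" for s
    by (simp add: g_def mult_ac flip: exp_add)
  have kint: "k absolutely_integrable_on {0..T}" by (rule weight_integrable[OF k])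
  have k0: "s \<in> {0..T} \<Longrightarrow> 0 \<le> k s" for s using k by (auto simp: weight_def)
  have sub: "seg \<tau> t0 \<subseteq> {0..T}" using \<tau> t0 by (intro seg_subset)
  have i1: "(\<lambda>s. k s * f s) integrable_on seg \<tau> t0"
    by (rule integrable_sub(2)[OF _ \<tau> t0(1)])
      (auto intro!: set_lebesgue_integral_eq_integral(1) absint_mult_bounded kint cont)
  have i2: "(\<lambda>s. k s * exp (\<alpha> * \<bar>s - \<tau>\<bar>)) integrable_on seg \<tau> t0"
    by (rule integrable_sub(2)[OF _ \<tau> t0(1)])
      (auto intro!: set_lebesgue_integral_eq_integral(1) absint_mult_bounded kint continuous_intros)
  have g0: "0 \<le> g t0" using f0[OF t0(1)] by (simp add: g_def)
  have "f t0 \<le> a + integral (seg \<tau> t0) (\<lambda>s. k s * f s)" by (rule le[OF t0(1)])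
  also have "integral (seg \<tau> t0) (\<lambda>s. k s * f s)
      \<le> integral (seg \<tau> t0) (\<lambda>s. g t0 * (k s * exp (\<alpha> * \<bar>s - \<tau>\<bar>)))"
  proof (intro integral_le i1 integrable_on_mult_right i2)
    fix s assume s: "s \<in> seg \<tau> t0"
    then have "s \<in> {0..T}" using sub by auto
    then show "k s * f s \<le> g t0 * (k s * exp (\<alpha> * \<bar>s - \<tau>\<bar>))"
      using t0(2)[of s] k0[of s] by (subst gf) (simp add: mult_left_mono mult_right_mono mult_ac)
  qed
  also have "\<dots> = g t0 * integral (seg \<tau> t0) (\<lambda>s. k s * exp (\<alpha> * \<bar>s - \<tau>\<bar>))"
    by simp
  also have "\<dots> \<le> g t0 * (exp (\<alpha> * \<bar>t0 - \<tau>\<bar>) / 2)"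
    by (intro mult_left_mono weighted_integral_le[OF k \<tau> t0(1)] g0) (simp add: \<alpha>_def)
  finally have "f t0 \<le> a + f t0 / 2" by (subst (2) gf) simp
  then have "f t0 \<le> 2 * a" by simp
  moreover have "g t0 \<le> f t0" using f0[OF t0(1)] \<alpha> by (auto simp: g_def intro!: mult_left_le_one_le)
  ultimately have "g t \<le> 2 * a" using t0(2)[OF t] by simp
  then have "f t \<le> 2 * a * exp (\<alpha> * \<bar>t - \<tau>\<bar>)" by (subst gf) (intro mult_right_mono, auto)
  also have "\<dots> \<le> 2 * a * exp (\<alpha> * T)"
    using a \<alpha> t \<tau> by (intro mult_left_mono) (auto simp: abs_if)
  finally show ?thesis by (simp add: gron_def \<alpha>_def mult_ac)
qed

section \<open>Caratheodory equations\<close>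

text \<open>Integral form, because the field is only measurable in time; the trajectory is required
  on the whole interval, before and after the starting time \<tau>.\<close>

definition sol :: "real \<Rightarrow> (real \<Rightarrow> 'b \<Rightarrow> 'b::euclidean_space) \<Rightarrow> real \<Rightarrow> 'b \<Rightarrow> (real \<Rightarrow> 'b) \<Rightarrow> bool" where
  "sol T H \<tau> z X \<longleftrightarrow> continuous_on {0..T} X \<and> (\<lambda>s. H s (X s)) integrable_on {0..T} \<and>
     (\<forall>t\<in>{0..T}. X t = z + J \<tau> t (\<lambda>s. H s (X s)))"

lemma J_same [simp]: "J \<tau> \<tau> f = 0"
  by (simp add: J_def)

lemma sol_init: "sol T H \<tau> z X \<Longrightarrow> \<tau> \<in> {0..T} \<Longrightarrow> X \<tau> = z"
  by (simp add: sol_def)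

text \<open>Restarting a trajectory at another time is what allows solutions with different starting
  times to be compared by \<open>sol_stable\<close>.\<close>

lemma sol_shift:
  assumes "sol T H \<tau> z X" "\<tau> \<in> {0..T}" "\<sigma> \<in> {0..T}"
  shows "sol T H \<sigma> (X \<sigma>) X"
  unfolding sol_def
proof (intro conjI ballI)
  fix t assume "t \<in> {0..T}"
  then have "X t = z + J \<tau> t (\<lambda>s. H s (X s))" using assms by (simp add: sol_def)
  moreover have "X \<sigma> = z + J \<tau> \<sigma> (\<lambda>s. H s (X s))" using assms by (simp add: sol_def)
  ultimately show "X t = X \<sigma> + J \<sigma> t (\<lambda>s. H s (X s))"
    using J_add_interval[of \<tau> \<sigma> "\<lambda>s. H s (X s)" t] by (metis add.assoc)
qed (use assms in \<open>auto simp: sol_def\<close>)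

lemma sol_zero: "sol T (\<lambda>s _. 0) \<tau> 0 (\<lambda>_. 0)"
  by (simp add: sol_def J_def integrable_0)

lemma sol_cong:
  assumes "sol T H \<tau> z X" "\<tau> \<in> {0..T}" "\<And>s. s \<in> {0..T} \<Longrightarrow> H s (X s) = H2 s (X s)"
  shows "sol T H2 \<tau> z X"
  unfolding sol_def
proof (intro conjI ballI)
  show "(\<lambda>s. H2 s (X s)) integrable_on {0..T}"
    using assms integrable_eq[of "\<lambda>s. H s (X s)" "{0..T}" "\<lambda>s. H2 s (X s)"] by (auto simp: sol_def)
  fix t assume t: "t \<in> {0..T}"
  then show "X t = z + J \<tau> t (\<lambda>s. H2 s (X s))"
    using assms J_cong[OF assms(2) t assms(3), of "\<lambda>s. s"] by (simp add: sol_def)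
qed (use assms in \<open>auto simp: sol_def\<close>)

text \<open>The comparison estimate behind all others: the fields are compared only along the two
  given solutions, the part proportional to their distance goes into Gronwall and the rest
  \<open>b\<close> acts as data. Dependence on the starting point, the starting time and the
  control, and the remainder of the linearization, are all instances.\<close>

lemma sol_stable:
  assumes 1: "sol T H1 \<tau> z1 X1" and 2: "sol T H2 \<tau> z2 X2" and k: "weight T k N"
    and \<tau>: "\<tau> \<in> {0..T}" and t: "t \<in> {0..T}"
    and b: "b integrable_on {0..T}" "\<And>s. s \<in> {0..T} \<Longrightarrow> 0 \<le> b s"
    and le: "\<And>s. s \<in> {0..T} \<Longrightarrow> norm (H1 s (X1 s) - H2 s (X2 s)) \<le> k s * norm (X1 s - X2 s) + b s"
  shows "norm (X1 t - X2 t) \<le> (norm (z1 - z2) + integral {0..T} b) * gron T N"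
proof (rule gronwall[OF k \<tau>, where f = "\<lambda>t. norm (X1 t - X2 t)"])
  have c: "continuous_on {0..T} X1" "continuous_on {0..T} X2" using 1 2 by (auto simp: sol_def)
  show c': "continuous_on {0..T} (\<lambda>t. norm (X1 t - X2 t))" by (intro continuous_intros c)
  show "0 \<le> norm (z1 - z2) + integral {0..T} b"
    using Henstock_Kurzweil_Integration.integral_nonneg[OF b] by simp
  have kf: "(\<lambda>s. k s * norm (X1 s - X2 s)) integrable_on {0..T}"
    by (intro set_lebesgue_integral_eq_integral(1) absint_mult_bounded weight_integrable[OF k] c')
  fix t assume t: "t \<in> {0..T}"
  have i: "(\<lambda>s. H1 s (X1 s)) integrable_on {0..T}" "(\<lambda>s. H2 s (X2 s)) integrable_on {0..T}"
    using 1 2 by (auto simp: sol_def)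
  have "X1 t - X2 t = (z1 - z2) + J \<tau> t (\<lambda>s. H1 s (X1 s) - H2 s (X2 s))"
    using 1 2 t J_diff[OF i \<tau> t] by (simp add: sol_def)
  then have "norm (X1 t - X2 t) \<le> norm (z1 - z2) + norm (J \<tau> t (\<lambda>s. H1 s (X1 s) - H2 s (X2 s)))"
    by (metis norm_triangle_ineq)
  also have "norm (J \<tau> t (\<lambda>s. H1 s (X1 s) - H2 s (X2 s)))
    \<le> integral (seg \<tau> t) (\<lambda>s. k s * norm (X1 s - X2 s) + b s)"
    by (rule J_norm_bound[OF _ _ \<tau> t])
      (use i kf b seg_subset[OF \<tau> t] in \<open>auto intro!: le integrable_diff integrable_add\<close>)
  also have "\<dots> = integral (seg \<tau> t) (\<lambda>s. k s * norm (X1 s - X2 s)) + integral (seg \<tau> t) b"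
    by (intro Henstock_Kurzweil_Integration.integral_add integrable_sub(2)[OF kf \<tau> t] integrable_sub(2)[OF b(1) \<tau> t])
  also have "integral (seg \<tau> t) b \<le> integral {0..T} b"
    by (intro integral_seg_le b \<tau> t)
  finally show "norm (X1 t - X2 t) \<le> norm (z1 - z2) + integral {0..T} b
      + integral (seg \<tau> t) (\<lambda>s. k s * norm (X1 s - X2 s))" by simp
qed (use t in auto)

text \<open>Stability against the zero solution of the zero field.\<close>

lemma sol_bound:
  assumes 1: "sol T H \<tau> z X" and k: "weight T k N" and \<tau>: "\<tau> \<in> {0..T}" and t: "t \<in> {0..T}"
    and b: "b integrable_on {0..T}" "\<And>s. s \<in> {0..T} \<Longrightarrow> 0 \<le> b s"
    and le: "\<And>s. s \<in> {0..T} \<Longrightarrow> norm (H s (X s)) \<le> k s * norm (X s) + b s"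
  shows "norm (X t) \<le> (norm z + integral {0..T} b) * gron T N"
  using sol_stable[OF 1 sol_zero k \<tau> t b] le by simp

lemma sol_unique:
  assumes 1: "sol T H \<tau> z X1" and 2: "sol T H \<tau> z X2" and k: "weight T k N"
    and \<tau>: "\<tau> \<in> {0..T}" and t: "t \<in> {0..T}"
    and le: "\<And>s. s \<in> {0..T} \<Longrightarrow> norm (H s (X1 s) - H s (X2 s)) \<le> k s * norm (X1 s - X2 s)"
  shows "X1 t = X2 t"
  using sol_stable[OF 1 2 k \<tau> t, of "\<lambda>_. 0"] le by (simp add: integrable_0)

text \<open>Measurability is asked only along continuous curves. This is all that the integral
  equation uses, and it passes to the linearized field, see \<open>meas_field_deriv\<close>.\<close>

definition meas_field :: "real \<Rightarrow> (real \<Rightarrow> 'b::euclidean_space \<Rightarrow> 'c::euclidean_space) \<Rightarrow> bool" where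
  "meas_field T H \<longleftrightarrow>
     (\<forall>c. continuous_on {0..T} c \<longrightarrow> (\<lambda>s. H s (c s)) \<in> borel_measurable (lebesgue_on {0..T}))"

lemma lip_field_integrable:
  assumes meas: "meas_field T H" and k: "weight T k N"
    and lip: "\<And>s v w. s \<in> {0..T} \<Longrightarrow> norm (H s v - H s w) \<le> k s * norm (v - w)"
    and zero: "\<And>s. s \<in> {0..T} \<Longrightarrow> norm (H s 0) \<le> k s"
    and c: "continuous_on {0..T} c"
  shows "(\<lambda>s. H s (c s)) absolutely_integrable_on {0..T}"
proof (rule measurable_bounded_by_integrable_imp_absolutely_integrable)
  show "(\<lambda>s. H s (c s)) \<in> borel_measurable (lebesgue_on {0..T})"
    using meas c by (auto simp: meas_field_def)
  show "(\<lambda>s. k s * (1 + norm (c s))) integrable_on {0..T}"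
    by (intro set_lebesgue_integral_eq_integral(1) absint_mult_bounded weight_integrable[OF k]
        continuous_intros c)
  fix s assume s: "s \<in> {0..T}"
  have "norm (H s (c s)) \<le> norm (H s (c s) - H s 0) + norm (H s 0)"
    by (metis norm_triangle_sub add.commute)
  also have "\<dots> \<le> k s * norm (c s - 0) + k s" using lip[OF s] zero[OF s] by (intro add_mono)
  finally show "norm (H s (c s)) \<le> k s * (1 + norm (c s))" by (simp add: algebra_simps)
qed auto

text \<open>Extends curves from the time interval to the whole line by constants, so that the
  complete space of bounded continuous functions on \<open>real\<close> can host the fixed point
  arguments.\<close>

definition clampT :: "real \<Rightarrow> real \<Rightarrow> real" where
  "clampT T t = max 0 (min T t)"

lemma clampT_in: "0 \<le> T \<Longrightarrow> clampT T t \<in> {0..T}" and clampT_id: "t \<in> {0..T} \<Longrightarrow> clampT T t = t"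
  by (auto simp: clampT_def)

lemma continuous_clampT: "continuous_on S (clampT T)"
  unfolding clampT_def by (intro continuous_intros)

lemma clamp_bcontfun:
  fixes f :: "real \<Rightarrow> 'b::euclidean_space"
  assumes "continuous_on {0..T} f" "0 \<le> T"
  shows "(\<lambda>t. f (clampT T t)) \<in> bcontfun"
  unfolding bcontfun_def
proof (intro CollectI conjI)
  show "continuous_on UNIV (\<lambda>t. f (clampT T t))"
    by (rule continuous_on_compose2[OF assms(1) continuous_clampT]) (use clampT_in assms in auto)
  have "range (\<lambda>t. f (clampT T t)) \<subseteq> f ` {0..T}" using clampT_in[OF assms(2)] by auto
  then show "bounded (range (\<lambda>t. f (clampT T t)))"
    using compact_imp_bounded[OF compact_continuous_image[OF assms(1) compact_Icc]] bounded_subset by blast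
qed

text \<open>Picard iteration on the whole interval at once: in the exponentially weighted supremum
  norm the integral operator has factor 1/2 by \<open>weighted_integral_le\<close>.\<close>

lemma sol_exists:
  fixes H :: "real \<Rightarrow> 'b::euclidean_space \<Rightarrow> 'b"
  assumes T: "0 \<le> T" and meas: "meas_field T H" and k: "weight T k N" and \<tau>: "\<tau> \<in> {0..T}"
    and lip: "\<And>s v w. s \<in> {0..T} \<Longrightarrow> norm (H s v - H s w) \<le> k s * norm (v - w)"
    and zero: "\<And>s. s \<in> {0..T} \<Longrightarrow> norm (H s 0) \<le> k s"
  shows "\<exists>X. sol T H \<tau> z X"
proof -
  define \<alpha> where "\<alpha> = 2 * (N + 1)"
  define e where "e s = exp (\<alpha> * \<bar>s - \<tau>\<bar>)" for s
  have e0: "e s > 0" for s by (simp add: e_def)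
  \<comment> \<open>The unknown is the solution divided by the weight \<open>e\<close>, which turns
    the weighted norm into the plain supremum norm.\<close>
  define P :: "(real \<Rightarrow>\<^sub>C 'b) \<Rightarrow> real \<Rightarrow> 'b"
    where "P Y t = (1 / e t) *\<^sub>R (z + J \<tau> t (\<lambda>s. H s (e s *\<^sub>R Y s)))" for Y t
  have cY: "continuous_on {0..T} (\<lambda>s. e s *\<^sub>R apply_bcontfun Y s)" for Y :: "real \<Rightarrow>\<^sub>C 'b"
    unfolding e_def by (intro continuous_intros continuous_on_apply_bcontfun)
  have iY: "(\<lambda>s. H s (e s *\<^sub>R Y s)) integrable_on {0..T}" for Y :: "real \<Rightarrow>\<^sub>C 'b"
    by (intro set_lebesgue_integral_eq_integral(1) lip_field_integrable[OF meas k lip zero cY])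
  have cP: "continuous_on {0..T} (P Y)" for Y
    unfolding P_def using e0 by (intro continuous_intros continuous_on_J iY) (auto simp: e_def intro!: continuous_intros)
  define Q where "Q Y = Bcontfun (\<lambda>t. P Y (clampT T t))" for Y
  have Q: "apply_bcontfun (Q Y) t = P Y (clampT T t)" for Y t
    unfolding Q_def by (simp add: Bcontfun_inverse clamp_bcontfun[OF cP T])
  have contr: "norm (P Y1 t - P Y2 t) \<le> 1 / 2 * dist Y1 Y2" if t: "t \<in> {0..T}" for Y1 Y2 t
  proof -
    have "P Y1 t - P Y2 t = (1 / e t) *\<^sub>R J \<tau> t (\<lambda>s. H s (e s *\<^sub>R Y1 s) - H s (e s *\<^sub>R Y2 s))"
      unfolding P_def by (simp add: J_diff[OF iY iY \<tau> t] scaleR_diff_right[symmetric])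
    then have "norm (P Y1 t - P Y2 t) = 1 / e t * norm (J \<tau> t (\<lambda>s. H s (e s *\<^sub>R Y1 s) - H s (e s *\<^sub>R Y2 s)))"
      using e0[of t] by simp
    also have "norm (J \<tau> t (\<lambda>s. H s (e s *\<^sub>R Y1 s) - H s (e s *\<^sub>R Y2 s)))
      \<le> integral (seg \<tau> t) (\<lambda>s. dist Y1 Y2 * (k s * e s))"
    proof (rule J_norm_bound[OF _ _ \<tau> t])
      show "(\<lambda>s. dist Y1 Y2 * (k s * e s)) integrable_on {0..T}"
        unfolding e_def by (intro integrable_on_mult_right set_lebesgue_integral_eq_integral(1) absint_mult_bounded weight_integrable[OF k]
        continuous_intros)
      fix s assume "s \<in> seg \<tau> t"
      then have s: "s \<in> {0..T}" using seg_subset[OF \<tau> t] by auto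
      have "norm (H s (e s *\<^sub>R Y1 s) - H s (e s *\<^sub>R Y2 s)) \<le> k s * norm (e s *\<^sub>R Y1 s - e s *\<^sub>R Y2 s)"
        by (rule lip[OF s])
      also have "\<dots> = k s * (e s * dist (apply_bcontfun Y1 s) (apply_bcontfun Y2 s))"
        using e0[of s] by (simp add: scaleR_diff_right[symmetric] dist_norm)
      also have "\<dots> \<le> k s * (e s * dist Y1 Y2)"
        using k s e0[of s] by (intro mult_left_mono dist_bounded) (auto simp: weight_def)
      finally show "norm (H s (e s *\<^sub>R Y1 s) - H s (e s *\<^sub>R Y2 s)) \<le> dist Y1 Y2 * (k s * e s)"
        by (simp add: mult_ac)
    qed (intro integrable_diff iY)
    also have "\<dots> = dist Y1 Y2 * integral (seg \<tau> t) (\<lambda>s. k s * e s)" by simp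
    also have "\<dots> \<le> dist Y1 Y2 * (e t / 2)"
      unfolding e_def by (intro mult_left_mono weighted_integral_le[OF k \<tau> t] \<alpha>_def) auto
    finally show ?thesis using e0[of t] by (simp add: mult_left_mono field_simps)
  qed
  have "\<exists>!Y. Q Y = Y"
  proof (rule banach_fix_type[of "1/2"], safe)
    fix Y1 Y2 show "dist (Q Y1) (Q Y2) \<le> 1 / 2 * dist Y1 Y2"
    proof (rule dist_bound)
      fix t show "dist (apply_bcontfun (Q Y1) t) (apply_bcontfun (Q Y2) t) \<le> 1 / 2 * dist Y1 Y2"
        using contr[OF clampT_in[OF T]] by (simp add: Q dist_norm)
    qed
  qed auto
  then obtain Y where Y: "Q Y = Y" by auto
  define X where "X s = e s *\<^sub>R Y s" for s
  have "X t = z + J \<tau> t (\<lambda>s. H s (X s))" if "t \<in> {0..T}" for t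
  proof -
    have "apply_bcontfun Y t = P Y t" using Q[of Y t] Y clampT_id[OF that] by simp
    then show ?thesis using e0[of t] by (simp add: X_def P_def)
  qed
  then show ?thesis unfolding sol_def X_def using cY iY by blast
qed

section \<open>Differentiability of the flow\<close>

lemma sol_continuous: "sol T H \<tau> z X \<Longrightarrow> continuous_on {0..T} X"
  by (simp add: sol_def)

lemma sol_integrable: "sol T H \<tau> z X \<Longrightarrow> (\<lambda>s. H s (X s)) integrable_on {0..T}"
  by (simp add: sol_def)

lemma meas_field_curve:
  "meas_field T H \<Longrightarrow> continuous_on {0..T} c \<Longrightarrow> (\<lambda>s. H s (c s)) \<in> borel_measurable (lebesgue_on {0..T})"
  by (simp add: meas_field_def)

text \<open>Along a curve, the derivative is a pointwise limit of difference quotients with step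
  \<open>1 / Suc n\<close>, each of which only evaluates \<open>H\<close> on continuous
  curves.\<close>

lemma meas_field_deriv:
  fixes H :: "real \<Rightarrow> 'b::euclidean_space \<Rightarrow> 'c::euclidean_space"
  assumes meas: "meas_field T H" and X: "continuous_on {0..T} X"
    and deriv: "\<And>s z. s \<in> {0..T} \<Longrightarrow> (H s has_derivative H' s z) (at z)"
  shows "meas_field T (\<lambda>s. H' s (X s))"
  unfolding meas_field_def
proof (intro allI impI)
  fix c :: "real \<Rightarrow> 'b" assume c: "continuous_on {0..T} c"
  define D where "D n s = real (Suc n) *\<^sub>R (H s (X s + (1 / real (Suc n)) *\<^sub>R c s) - H s (X s))" for n s
  show "(\<lambda>s. H' s (X s) (c s)) \<in> borel_measurable (lebesgue_on {0..T})"
  proof (rule borel_measurable_LIMSEQ_metric[where f = D])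
    fix n
    have "(\<lambda>s. H s (X s + (1 / real (Suc n)) *\<^sub>R c s)) \<in> borel_measurable (lebesgue_on {0..T})"
      by (intro meas_field_curve[OF meas] continuous_intros X c)
    moreover have "(\<lambda>s. H s (X s)) \<in> borel_measurable (lebesgue_on {0..T})"
      using meas X by (auto simp: meas_field_def)
    ultimately show "D n \<in> borel_measurable (lebesgue_on {0..T})"
      unfolding D_def by measurable
  next
    fix s assume "s \<in> space (lebesgue_on {0..T})"
    then have s: "s \<in> {0..T}" by simp
    let ?v = "H' s (X s) (c s)"
    have "((\<lambda>h. X s + h *\<^sub>R c s) has_derivative (\<lambda>h. h *\<^sub>R c s)) (at 0)"
      by (auto intro!: derivative_eq_intros)
    from diff_chain_at[OF this, of "H s" "H' s (X s)"] deriv[OF s, of "X s"]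
    have "((\<lambda>h. H s (X s + h *\<^sub>R c s)) has_derivative (\<lambda>h. H' s (X s) (h *\<^sub>R c s))) (at 0)"
      by (simp add: o_def)
    then have "(\<lambda>h. norm (H s (X s + h *\<^sub>R c s) - H s (X s) - h *\<^sub>R ?v) / norm h) \<midarrow>0\<rightarrow> 0"
      using has_derivative_bounded_linear[OF deriv[OF s, of "X s"]]
      by (simp add: has_derivative_at linear_simps)
    moreover have "filterlim (\<lambda>n. 1 / real (Suc n)) (at 0) sequentially"
      unfolding filterlim_at using LIMSEQ_Suc[OF lim_1_over_n] by auto
    ultimately have "(\<lambda>n. norm (H s (X s + (1 / real (Suc n)) *\<^sub>R c s) - H s (X s) - (1 / real (Suc n)) *\<^sub>R ?v)
        / norm (1 / real (Suc n))) \<longlonglongrightarrow> 0"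
      by (rule filterlim_compose)
    moreover have "norm (H s (X s + (1 / real (Suc n)) *\<^sub>R c s) - H s (X s) - (1 / real (Suc n)) *\<^sub>R ?v)
        / norm (1 / real (Suc n)) = norm (D n s - ?v)" for n
    proof -
      have "D n s - ?v = real (Suc n) *\<^sub>R (H s (X s + (1 / real (Suc n)) *\<^sub>R c s) - H s (X s) - (1 / real (Suc n)) *\<^sub>R ?v)"
        unfolding D_def scaleR_diff_right by simp
      then show ?thesis by (simp only: norm_scaleR) simp
    qed
    ultimately show "(\<lambda>n. D n s) \<longlonglongrightarrow> ?v"
      by (simp add: tendsto_norm_zero_iff LIM_zero_iff)
  qed
qed

lemma LIMSEQ_common_bound:
  fixes z :: "'b::real_normed_vector"
  assumes "zn \<longlonglongrightarrow> z"
  obtains r where "\<And>n. norm (zn n) \<le> r" "norm z \<le> r"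
proof -
  obtain B where B: "\<And>n. norm (zn n) \<le> B"
    using convergent_imp_bounded[OF assms] unfolding bounded_iff by blast
  show ?thesis
    by (rule that[of "max B (norm z)"]) (auto intro: order_trans[OF B])
qed

text \<open>The bounds on the field and its derivative hold on balls only, with a weight that may
  depend on the ball; \<open>bdd\<close> keeps trajectories in a ball. This local form is what the
  tangent field satisfies, whose derivative grows with the tangent vector.\<close>

locale c1_flow =
  fixes T :: real and H :: "real \<Rightarrow> 'b::euclidean_space \<Rightarrow> 'b" and H' :: "real \<Rightarrow> 'b \<Rightarrow> 'b \<Rightarrow> 'b"
    and \<Phi> :: "real \<Rightarrow> real \<Rightarrow> 'b \<Rightarrow> 'b"
  assumes T: "0 < T"
    and meas: "meas_field T H"
    and deriv: "s \<in> {0..T} \<Longrightarrow> (H s has_derivative H' s z) (at z)"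
    and cont': "s \<in> {0..T} \<Longrightarrow> continuous_on UNIV (\<lambda>z. H' s z q)"
    and bound: "\<exists>k N. weight T k N \<and>
      (\<forall>s\<in>{0..T}. \<forall>z\<in>cball 0 \<rho>. norm (H s z) \<le> k s \<and> (\<forall>q. norm (H' s z q) \<le> k s * norm q))"
    and flow: "\<tau> \<in> {0..T} \<Longrightarrow> sol T H \<tau> z (\<lambda>t. \<Phi> \<tau> t z)"
    and bdd: "\<exists>\<rho>'. \<forall>\<tau>\<in>{0..T}. \<forall>t\<in>{0..T}. \<forall>z\<in>cball 0 \<rho>. norm (\<Phi> \<tau> t z) \<le> \<rho>'"
begin

lemma linear': "s \<in> {0..T} \<Longrightarrow> bounded_linear (H' s z)"
  using has_derivative_bounded_linear[OF deriv] .

lemma diff': "s \<in> {0..T} \<Longrightarrow> H' s z (v - w) = H' s z v - H' s z w"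
  using linear' bounded_linear.linear linear_diff by blast

lemma flow_cont: "\<tau> \<in> {0..T} \<Longrightarrow> continuous_on {0..T} (\<lambda>t. \<Phi> \<tau> t z)"
  using flow by (rule sol_continuous)

lemma flow_init: "\<tau> \<in> {0..T} \<Longrightarrow> \<Phi> \<tau> \<tau> z = z"
  using flow by (rule sol_init)

text \<open>Fixes, for starting points in one ball, a larger ball that traps all trajectories and a
  single weight valid there. The Lipschitz bound follows from the derivative bound because balls are
  convex.\<close>

lemma control:
  obtains k N \<rho>' where "weight T k N" "0 \<le> \<rho>'"
    "\<And>\<tau> t z. \<tau> \<in> {0..T} \<Longrightarrow> t \<in> {0..T} \<Longrightarrow> norm z \<le> \<rho> \<Longrightarrow> norm (\<Phi> \<tau> t z) \<le> \<rho>'"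
    "\<And>s z q. s \<in> {0..T} \<Longrightarrow> norm z \<le> \<rho>' \<Longrightarrow> norm (H' s z q) \<le> k s * norm q"
    "\<And>s z w. s \<in> {0..T} \<Longrightarrow> norm z \<le> \<rho>' \<Longrightarrow> norm w \<le> \<rho>' \<Longrightarrow> norm (H s z - H s w) \<le> k s * norm (z - w)"
    "\<And>s z. s \<in> {0..T} \<Longrightarrow> norm z \<le> \<rho>' \<Longrightarrow> norm (H s z) \<le> k s"
proof -
  obtain \<rho>0 where \<rho>0: "\<forall>\<tau>\<in>{0..T}. \<forall>t\<in>{0..T}. \<forall>z\<in>cball 0 \<rho>. norm (\<Phi> \<tau> t z) \<le> \<rho>0"
    using bdd by blast
  define \<rho>' where "\<rho>' = max 0 \<rho>0"
  obtain k N where k: "weight T k N"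
    "\<forall>s\<in>{0..T}. \<forall>z\<in>cball 0 \<rho>'. norm (H s z) \<le> k s \<and> (\<forall>q. norm (H' s z q) \<le> k s * norm q)"
    using bound by blast
  show ?thesis
  proof (rule that[of k N \<rho>'])
    fix s and z w :: 'b assume s: "s \<in> {0..T}" and z: "norm z \<le> \<rho>'" and w: "norm w \<le> \<rho>'"
    show "norm (H s z - H s w) \<le> k s * norm (z - w)"
    proof (rule differentiable_bound[of "cball 0 \<rho>'"])
      fix x :: 'b assume x: "x \<in> cball 0 \<rho>'"
      show "(H s has_derivative H' s x) (at x within cball 0 \<rho>')"
        using deriv[OF s] by (rule has_derivative_at_withinI)
      show "onorm (H' s x) \<le> k s"
        using k(2) s x k(1) by (intro onorm_bound) (auto simp: weight_def)
    qed (use z w in auto)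
  qed (use k \<rho>0 in \<open>auto simp: \<rho>'_def le_max_iff_disj\<close>)
qed

text \<open>The solution of the variational equation along the trajectory from \<open>z\<close>, the
  candidate for the derivative of the flow in direction \<open>q\<close>. \<open>Y_unique\<close>
  makes the choice immaterial.\<close>

definition Y :: "real \<Rightarrow> 'b \<Rightarrow> 'b \<Rightarrow> real \<Rightarrow> 'b" where
  "Y \<tau> z q = (SOME X. sol T (\<lambda>s. H' s (\<Phi> \<tau> s z)) \<tau> q X)"

lemma Y_sol:
  assumes \<tau>: "\<tau> \<in> {0..T}"
  shows "sol T (\<lambda>s. H' s (\<Phi> \<tau> s z)) \<tau> q (Y \<tau> z q)"
proof -
  obtain k N \<rho>' where k: "weight T k N" "0 \<le> \<rho>'"
    "\<And>\<tau> t x. \<tau> \<in> {0..T} \<Longrightarrow> t \<in> {0..T} \<Longrightarrow> norm x \<le> norm z \<Longrightarrow> norm (\<Phi> \<tau> t x) \<le> \<rho>'"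
    "\<And>s z q. s \<in> {0..T} \<Longrightarrow> norm z \<le> \<rho>' \<Longrightarrow> norm (H' s z q) \<le> k s * norm q"
    using control[of "norm z"] by metis
  have "\<exists>X. sol T (\<lambda>s. H' s (\<Phi> \<tau> s z)) \<tau> q X"
  proof (rule sol_exists[OF _ meas_field_deriv[OF meas flow_cont[OF \<tau>] deriv] k(1) \<tau>])
    fix s v w assume s: "s \<in> {0..T}"
    show "norm (H' s (\<Phi> \<tau> s z) v - H' s (\<Phi> \<tau> s z) w) \<le> k s * norm (v - w)"
      using k(4)[OF s k(3)[OF \<tau> s order_refl], of "v - w"] diff'[OF s] by simp
    show "norm (H' s (\<Phi> \<tau> s z) 0) \<le> k s"
      using k(1) s linear'[OF s] by (simp add: linear_simps weight_def)
  qed (use T in auto)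
  then show ?thesis unfolding Y_def by (rule someI_ex)
qed

lemma Y_unique:
  assumes \<tau>: "\<tau> \<in> {0..T}" and X: "sol T (\<lambda>s. H' s (\<Phi> \<tau> s z)) \<tau> q X" and t: "t \<in> {0..T}"
  shows "X t = Y \<tau> z q t"
proof -
  obtain k N \<rho>' where k: "weight T k N" "0 \<le> \<rho>'"
    "\<And>\<tau> t x. \<tau> \<in> {0..T} \<Longrightarrow> t \<in> {0..T} \<Longrightarrow> norm x \<le> norm z \<Longrightarrow> norm (\<Phi> \<tau> t x) \<le> \<rho>'"
    "\<And>s z q. s \<in> {0..T} \<Longrightarrow> norm z \<le> \<rho>' \<Longrightarrow> norm (H' s z q) \<le> k s * norm q"
    using control[of "norm z"] by metis
  show ?thesis
  proof (rule sol_unique[OF X Y_sol[OF \<tau>] k(1) \<tau> t])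
    fix s assume s: "s \<in> {0..T}"
    show "norm (H' s (\<Phi> \<tau> s z) (X s) - H' s (\<Phi> \<tau> s z) (Y \<tau> z q s)) \<le> k s * norm (X s - Y \<tau> z q s)"
      using k(4)[OF s k(3)[OF \<tau> s order_refl]] diff'[OF s] by metis
  qed
qed

text \<open>Sums and multiples of solutions solve the linear equation again, so uniqueness
  identifies them.\<close>

lemma Y_linear:
  assumes \<tau>: "\<tau> \<in> {0..T}" and t: "t \<in> {0..T}"
  shows "linear (\<lambda>q. Y \<tau> z q t)"
proof (rule linearI)
  have Y: "Y \<tau> z q s = q + J \<tau> s (\<lambda>s. H' s (\<Phi> \<tau> s z) (Y \<tau> z q s))" if "s \<in> {0..T}" for q s
    using Y_sol[OF \<tau>] that by (auto simp: sol_def)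
  have i: "(\<lambda>s. H' s (\<Phi> \<tau> s z) (Y \<tau> z q s)) integrable_on {0..T}" for q
    using sol_integrable[OF Y_sol[OF \<tau>]] .
  have c: "continuous_on {0..T} (Y \<tau> z q)" for q
    using sol_continuous[OF Y_sol[OF \<tau>]] .
  fix p q :: 'b
  have "sol T (\<lambda>s. H' s (\<Phi> \<tau> s z)) \<tau> (p + q) (\<lambda>s. Y \<tau> z p s + Y \<tau> z q s)"
    unfolding sol_def
  proof (intro conjI ballI)
    have e: "H' s (\<Phi> \<tau> s z) (Y \<tau> z p s) + H' s (\<Phi> \<tau> s z) (Y \<tau> z q s) = H' s (\<Phi> \<tau> s z) (Y \<tau> z p s + Y \<tau> z q s)"
      if "s \<in> {0..T}" for s
      using linear'[OF that] by (simp add: linear_simps)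
    show "(\<lambda>s. H' s (\<Phi> \<tau> s z) (Y \<tau> z p s + Y \<tau> z q s)) integrable_on {0..T}"
      by (rule integrable_eq[OF integrable_add[OF i[of p] i[of q]] e])
    fix t assume t: "t \<in> {0..T}"
    have "Y \<tau> z p t + Y \<tau> z q t = p + q + J \<tau> t (\<lambda>s. H' s (\<Phi> \<tau> s z) (Y \<tau> z p s) + H' s (\<Phi> \<tau> s z) (Y \<tau> z q s))"
      using arg_cong2[OF Y[OF t, of p] Y[OF t, of q], of plus] unfolding J_add[OF i i \<tau> t]
      by (simp only: ac_simps)
    also have "J \<tau> t (\<lambda>s. H' s (\<Phi> \<tau> s z) (Y \<tau> z p s) + H' s (\<Phi> \<tau> s z) (Y \<tau> z q s))
      = J \<tau> t (\<lambda>s. H' s (\<Phi> \<tau> s z) (Y \<tau> z p s + Y \<tau> z q s))"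
      by (rule J_cong[OF \<tau> t e])
    finally show "Y \<tau> z p t + Y \<tau> z q t = p + q + J \<tau> t (\<lambda>s. H' s (\<Phi> \<tau> s z) (Y \<tau> z p s + Y \<tau> z q s))" .
  qed (intro continuous_intros c)
  from Y_unique[OF \<tau> this t] show "Y \<tau> z (p + q) t = Y \<tau> z p t + Y \<tau> z q t" by simp
next
  have Y: "Y \<tau> z q s = q + J \<tau> s (\<lambda>s. H' s (\<Phi> \<tau> s z) (Y \<tau> z q s))" if "s \<in> {0..T}" for q s
    using Y_sol[OF \<tau>] that by (auto simp: sol_def)
  have i: "(\<lambda>s. H' s (\<Phi> \<tau> s z) (Y \<tau> z q s)) integrable_on {0..T}" for q
    using sol_integrable[OF Y_sol[OF \<tau>]] .
  have c: "continuous_on {0..T} (Y \<tau> z q)" for q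
    using sol_continuous[OF Y_sol[OF \<tau>]] .
  fix r :: real and q :: 'b
  have "sol T (\<lambda>s. H' s (\<Phi> \<tau> s z)) \<tau> (r *\<^sub>R q) (\<lambda>s. r *\<^sub>R Y \<tau> z q s)"
    unfolding sol_def
  proof (intro conjI ballI)
    have e: "r *\<^sub>R H' s (\<Phi> \<tau> s z) (Y \<tau> z q s) = H' s (\<Phi> \<tau> s z) (r *\<^sub>R Y \<tau> z q s)"
      if "s \<in> {0..T}" for s
      using linear'[OF that] by (simp add: linear_simps)
    show "(\<lambda>s. H' s (\<Phi> \<tau> s z) (r *\<^sub>R Y \<tau> z q s)) integrable_on {0..T}"
      by (rule integrable_eq[OF integrable_cmul[OF i[of q]] e])
    fix t assume t: "t \<in> {0..T}"
    have "r *\<^sub>R Y \<tau> z q t = r *\<^sub>R q + r *\<^sub>R J \<tau> t (\<lambda>s. H' s (\<Phi> \<tau> s z) (Y \<tau> z q s))"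
      using arg_cong[OF Y[OF t, of q], of "scaleR r"] by (simp only: scaleR_add_right)
    also have "r *\<^sub>R J \<tau> t (\<lambda>s. H' s (\<Phi> \<tau> s z) (Y \<tau> z q s)) = J \<tau> t (\<lambda>s. r *\<^sub>R H' s (\<Phi> \<tau> s z) (Y \<tau> z q s))"
      using J_linear[OF i \<tau> t bounded_linear_scaleR_right[of r]] by simp
    also have "J \<tau> t (\<lambda>s. r *\<^sub>R H' s (\<Phi> \<tau> s z) (Y \<tau> z q s)) = J \<tau> t (\<lambda>s. H' s (\<Phi> \<tau> s z) (r *\<^sub>R Y \<tau> z q s))"
      by (rule J_cong[OF \<tau> t e])
    finally show "r *\<^sub>R Y \<tau> z q t = r *\<^sub>R q + J \<tau> t (\<lambda>s. H' s (\<Phi> \<tau> s z) (r *\<^sub>R Y \<tau> z q s))" .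
  qed (intro continuous_intros c)
  from Y_unique[OF \<tau> this t] show "Y \<tau> z (r *\<^sub>R q) t = r *\<^sub>R Y \<tau> z q t" by simp
qed

lemma Y_bdd: "\<exists>C\<ge>0. \<forall>\<tau>\<in>{0..T}. \<forall>t\<in>{0..T}. \<forall>z\<in>cball 0 \<rho>. \<forall>q. norm (Y \<tau> z q t) \<le> C * norm q"
proof -
  obtain k N \<rho>' where k: "weight T k N" "0 \<le> \<rho>'"
    "\<And>\<tau> t x. \<tau> \<in> {0..T} \<Longrightarrow> t \<in> {0..T} \<Longrightarrow> norm x \<le> \<rho> \<Longrightarrow> norm (\<Phi> \<tau> t x) \<le> \<rho>'"
    "\<And>s z q. s \<in> {0..T} \<Longrightarrow> norm z \<le> \<rho>' \<Longrightarrow> norm (H' s z q) \<le> k s * norm q"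
    using control[of \<rho>] by metis
  have "norm (Y \<tau> z q t) \<le> gron T N * norm q" if \<tau>: "\<tau>\<in>{0..T}" and t: "t\<in>{0..T}" and z: "norm z \<le> \<rho>" for \<tau> t z q
    using sol_bound[OF Y_sol[OF \<tau>, of z q] k(1) \<tau> t, of "\<lambda>_. 0"] k(4)[OF _ k(3)[OF \<tau> _ z]]
    by (simp add: integrable_0 mult.commute)
  moreover have "0 \<le> gron T N" using gron_pos[of T N] by simp
  ultimately show ?thesis by auto
qed

lemma flow_lip:
  "\<exists>C\<ge>0. \<forall>\<tau>\<in>{0..T}. \<forall>t\<in>{0..T}. \<forall>z\<in>cball 0 \<rho>. \<forall>w\<in>cball 0 \<rho>. norm (\<Phi> \<tau> t z - \<Phi> \<tau> t w) \<le> C * norm (z - w)"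
proof -
  obtain k N \<rho>' where k: "weight T k N" "0 \<le> \<rho>'"
    "\<And>\<tau> t x. \<tau> \<in> {0..T} \<Longrightarrow> t \<in> {0..T} \<Longrightarrow> norm x \<le> \<rho> \<Longrightarrow> norm (\<Phi> \<tau> t x) \<le> \<rho>'"
    "\<And>s z w. s \<in> {0..T} \<Longrightarrow> norm z \<le> \<rho>' \<Longrightarrow> norm w \<le> \<rho>' \<Longrightarrow> norm (H s z - H s w) \<le> k s * norm (z - w)"
    using control[of \<rho>] by metis
  have "norm (\<Phi> \<tau> t z - \<Phi> \<tau> t w) \<le> gron T N * norm (z - w)"
    if \<tau>: "\<tau>\<in>{0..T}" and t: "t\<in>{0..T}" and z: "norm z \<le> \<rho>" and w: "norm w \<le> \<rho>" for \<tau> t z w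
    using sol_stable[OF flow[OF \<tau>, of z] flow[OF \<tau>, of w] k(1) \<tau> t, of "\<lambda>_. 0"]
      k(4)[OF _ k(3)[OF \<tau> _ z] k(3)[OF \<tau> _ w]]
    by (simp add: integrable_0 mult.commute)
  moreover have "0 \<le> gron T N" using gron_pos[of T N] by simp
  ultimately show ?thesis by auto
qed

text \<open>A change of the starting time is a change of the starting point: at time
  \<open>\<tau>n n\<close> the limit trajectory sits at \<open>\<Phi> \<tau> (\<tau>n n) z\<close>,
  which tends to \<open>z\<close>, and from there the two trajectories are compared as solutions of
  the same equation.\<close>

lemma flow_seq:
  assumes \<tau>: "\<tau> \<in> {0..T}" "\<And>n. \<tau>n n \<in> {0..T}" "\<tau>n \<longlonglongrightarrow> \<tau>" and z: "zn \<longlonglongrightarrow> z" and t: "t \<in> {0..T}"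
  shows "(\<lambda>n. \<Phi> (\<tau>n n) t (zn n)) \<longlonglongrightarrow> \<Phi> \<tau> t z"
proof -
  obtain r where r: "\<And>n. norm (zn n) \<le> r" "norm z \<le> r"
    using LIMSEQ_common_bound[OF z] by blast
  obtain k N \<rho>' where k: "weight T k N" "0 \<le> \<rho>'"
    "\<And>\<tau> t x. \<tau> \<in> {0..T} \<Longrightarrow> t \<in> {0..T} \<Longrightarrow> norm x \<le> r \<Longrightarrow> norm (\<Phi> \<tau> t x) \<le> \<rho>'"
    "\<And>s z w. s \<in> {0..T} \<Longrightarrow> norm z \<le> \<rho>' \<Longrightarrow> norm w \<le> \<rho>' \<Longrightarrow> norm (H s z - H s w) \<le> k s * norm (z - w)"
    using control[of r] by metis
  have le: "norm (\<Phi> (\<tau>n n) t (zn n) - \<Phi> \<tau> t z) \<le> norm (zn n - \<Phi> \<tau> (\<tau>n n) z) * gron T N" for n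
  proof -
    have "norm (\<Phi> (\<tau>n n) t (zn n) - \<Phi> \<tau> t z) \<le> (norm (zn n - \<Phi> \<tau> (\<tau>n n) z) + integral {0..T} (\<lambda>_. 0)) * gron T N"
    proof (rule sol_stable[OF flow[OF \<tau>(2)] sol_shift[OF flow[OF \<tau>(1)] \<tau>(1) \<tau>(2)] k(1) \<tau>(2) t])
      fix s assume s: "s \<in> {0..T}"
      show "norm (H s (\<Phi> (\<tau>n n) s (zn n)) - H s (\<Phi> \<tau> s z)) \<le> k s * norm (\<Phi> (\<tau>n n) s (zn n) - \<Phi> \<tau> s z) + 0"
        using k(4)[OF s k(3)[OF \<tau>(2) s r(1)] k(3)[OF \<tau>(1) s r(2)]] by simp
    qed (auto intro: integrable_0)
    then show ?thesis by simp
  qed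
  have "(\<lambda>n. \<Phi> \<tau> (\<tau>n n) z) \<longlonglongrightarrow> \<Phi> \<tau> \<tau> z"
    by (rule continuous_on_tendsto_compose[OF flow_cont[OF \<tau>(1)] \<tau>(3,1)]) (use \<tau> in auto)
  then have "(\<lambda>n. norm (zn n - \<Phi> \<tau> (\<tau>n n) z) * gron T N) \<longlonglongrightarrow> norm (z - z) * gron T N"
    unfolding flow_init[OF \<tau>(1)] by (intro tendsto_intros z)
  then have "(\<lambda>n. \<Phi> (\<tau>n n) t (zn n) - \<Phi> \<tau> t z) \<longlonglongrightarrow> 0"
    by (intro Lim_null_comparison[OF always_eventually[OF allI[OF le]]]) simp
  then show ?thesis by (rule LIM_zero_cancel)
qed

lemma flow_continuous:
  assumes t: "t \<in> {0..T}"
  shows "continuous_on ({0..T} \<times> UNIV) (\<lambda>(\<tau>, z). \<Phi> \<tau> t z)"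
  unfolding continuous_on_sequentially
proof (intro allI ballI impI, elim conjE)
  fix x and p :: "real \<times> 'b"
  assume p: "p \<in> {0..T} \<times> UNIV" and x: "\<forall>n. x n \<in> {0..T} \<times> (UNIV :: 'b set)" "x \<longlonglongrightarrow> p"
  have "(\<lambda>n. \<Phi> (fst (x n)) t (snd (x n))) \<longlonglongrightarrow> \<Phi> (fst p) t (snd p)"
    by (rule flow_seq) (use p x t in \<open>auto simp: mem_Times_iff intro!: tendsto_intros\<close>)
  then show "((\<lambda>(\<tau>, z). \<Phi> \<tau> t z) \<circ> x) \<longlonglongrightarrow> (\<lambda>(\<tau>, z). \<Phi> \<tau> t z) p"
    by (simp add: o_def case_prod_beta)
qed

text \<open>As for \<open>flow_seq\<close>, but the coefficients of the linear equation move as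
  well. The derivative of the field is only continuous in the state, so the error tends to zero by
  dominated convergence and without a rate.\<close>

lemma Y_seq:
  assumes \<tau>: "\<tau> \<in> {0..T}" "\<And>n. \<tau>n n \<in> {0..T}" "\<tau>n \<longlonglongrightarrow> \<tau>" and z: "zn \<longlonglongrightarrow> z" and t: "t \<in> {0..T}"
  shows "(\<lambda>n. Y (\<tau>n n) (zn n) q t) \<longlonglongrightarrow> Y \<tau> z q t"
proof -
  obtain r where r: "\<And>n. norm (zn n) \<le> r" "norm z \<le> r"
    using LIMSEQ_common_bound[OF z] by blast
  obtain k N \<rho>' where k: "weight T k N" "0 \<le> \<rho>'"
    "\<And>\<tau> t x. \<tau> \<in> {0..T} \<Longrightarrow> t \<in> {0..T} \<Longrightarrow> norm x \<le> r \<Longrightarrow> norm (\<Phi> \<tau> t x) \<le> \<rho>'"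
    "\<And>s z q. s \<in> {0..T} \<Longrightarrow> norm z \<le> \<rho>' \<Longrightarrow> norm (H' s z q) \<le> k s * norm q"
    using control[of r] by metis
  define W where "W = Y \<tau> z q"
  have Wsol: "sol T (\<lambda>s. H' s (\<Phi> \<tau> s z)) \<tau> q W" unfolding W_def by (rule Y_sol[OF \<tau>(1)])
  note Wc = sol_continuous[OF Wsol]
  \<comment> \<open>The change of coefficients is applied to the fixed limit solution
    \<open>W\<close>; the varying solution enters only through the term that Gronwall
    absorbs.\<close>
  define b where "b n s = norm (H' s (\<Phi> (\<tau>n n) s (zn n)) (W s) - H' s (\<Phi> \<tau> s z) (W s))" for n s
  have kW: "(\<lambda>s. k s * (2 * norm (W s))) absolutely_integrable_on {0..T}"
    by (intro absint_mult_bounded weight_integrable[OF k(1)] continuous_intros Wc)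
  note kW' = set_lebesgue_integral_eq_integral(1)[OF kW]
  have bk: "norm (b n s) \<le> k s * (2 * norm (W s))" if s: "s \<in> {0..T}" for n s
  proof -
    have "norm (b n s) \<le> norm (H' s (\<Phi> (\<tau>n n) s (zn n)) (W s)) + norm (H' s (\<Phi> \<tau> s z) (W s))"
      unfolding b_def by (simp add: norm_triangle_ineq4)
    also have "\<dots> \<le> k s * norm (W s) + k s * norm (W s)"
      by (intro add_mono k(4) s k(3) \<tau> r)
    finally show ?thesis by simp
  qed
  have bint: "b n integrable_on {0..T}" for n
  proof (intro set_lebesgue_integral_eq_integral(1) measurable_bounded_by_integrable_imp_absolutely_integrable[OF _ _ _ bk])
    show "b n \<in> borel_measurable (lebesgue_on {0..T})"
    proof -
      have "(\<lambda>s. H' s (\<Phi> (\<tau>n n) s (zn n)) (W s)) \<in> borel_measurable (lebesgue_on {0..T})"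
        by (rule meas_field_curve[OF meas_field_deriv[OF meas flow_cont[OF \<tau>(2)] deriv] Wc])
      moreover have "(\<lambda>s. H' s (\<Phi> \<tau> s z) (W s)) \<in> borel_measurable (lebesgue_on {0..T})"
        by (rule meas_field_curve[OF meas_field_deriv[OF meas flow_cont[OF \<tau>(1)] deriv] Wc])
      ultimately show ?thesis
        unfolding b_def by (rule measurable_compose[OF borel_measurable_diff borel_measurable_norm])
    qed
  qed (use kW kW' in auto)
  have "(\<lambda>n. integral {0..T} (b n)) \<longlonglongrightarrow> integral {0..T} (\<lambda>s. 0)"
  proof (rule dominated_convergence(2)[OF bint _ bk])
    fix s assume s: "s \<in> {0..T}"
    have "(\<lambda>n. \<Phi> (\<tau>n n) s (zn n)) \<longlonglongrightarrow> \<Phi> \<tau> s z" by (rule flow_seq[OF \<tau> z s])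
    then have "(\<lambda>n. H' s (\<Phi> (\<tau>n n) s (zn n)) (W s)) \<longlonglongrightarrow> H' s (\<Phi> \<tau> s z) (W s)"
      by (rule continuous_on_tendsto_compose[OF cont'[OF s]]) auto
    then have "(\<lambda>n. b n s) \<longlonglongrightarrow> norm (H' s (\<Phi> \<tau> s z) (W s) - H' s (\<Phi> \<tau> s z) (W s))"
      unfolding b_def by (intro tendsto_intros)
    then show "(\<lambda>n. b n s) \<longlonglongrightarrow> 0" by simp
  qed (rule kW')
  then have b0: "(\<lambda>n. integral {0..T} (b n)) \<longlonglongrightarrow> 0" by simp
  have le: "norm (Y (\<tau>n n) (zn n) q t - W t) \<le> (norm (q - W (\<tau>n n)) + integral {0..T} (b n)) * gron T N" for n
  proof (rule sol_stable[OF Y_sol[OF \<tau>(2)] sol_shift[OF Wsol \<tau>(1) \<tau>(2)] k(1) \<tau>(2) t bint])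
    fix s assume s: "s \<in> {0..T}"
    let ?A = "H' s (\<Phi> (\<tau>n n) s (zn n))"
    have "?A (Y (\<tau>n n) (zn n) q s) - H' s (\<Phi> \<tau> s z) (W s)
      = ?A (Y (\<tau>n n) (zn n) q s - W s) + (?A (W s) - H' s (\<Phi> \<tau> s z) (W s))"
      by (simp add: diff'[OF s])
    then have "norm (?A (Y (\<tau>n n) (zn n) q s) - H' s (\<Phi> \<tau> s z) (W s))
      \<le> norm (?A (Y (\<tau>n n) (zn n) q s - W s)) + b n s"
      unfolding b_def by (metis norm_triangle_ineq)
    also have "norm (?A (Y (\<tau>n n) (zn n) q s - W s)) \<le> k s * norm (Y (\<tau>n n) (zn n) q s - W s)"
      by (intro k(4) s k(3) \<tau> r)
    finally show "norm (?A (Y (\<tau>n n) (zn n) q s) - H' s (\<Phi> \<tau> s z) (W s))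
      \<le> k s * norm (Y (\<tau>n n) (zn n) q s - W s) + b n s" by simp
  qed (simp add: b_def)
  have "(\<lambda>n. W (\<tau>n n)) \<longlonglongrightarrow> W \<tau>"
    by (rule continuous_on_tendsto_compose[OF Wc \<tau>(3,1)]) (use \<tau> in auto)
  then have "(\<lambda>n. (norm (q - W (\<tau>n n)) + integral {0..T} (b n)) * gron T N) \<longlonglongrightarrow> (norm (q - q) + 0) * gron T N"
    unfolding sol_init[OF Wsol \<tau>(1)] by (intro tendsto_intros b0)
  then have "(\<lambda>n. Y (\<tau>n n) (zn n) q t - W t) \<longlonglongrightarrow> 0"
    by (intro Lim_null_comparison[OF always_eventually[OF allI[OF le]]]) simp
  then show ?thesis unfolding W_def by (rule LIM_zero_cancel)
qed

lemma Y_continuous: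
  assumes t: "t \<in> {0..T}"
  shows "continuous_on ({0..T} \<times> UNIV) (\<lambda>(\<tau>, z). Y \<tau> z q t)"
  unfolding continuous_on_sequentially
proof (intro allI ballI impI, elim conjE)
  fix x and p :: "real \<times> 'b"
  assume p: "p \<in> {0..T} \<times> UNIV" and x: "\<forall>n. x n \<in> {0..T} \<times> (UNIV :: 'b set)" "x \<longlonglongrightarrow> p"
  have "(\<lambda>n. Y (fst (x n)) (snd (x n)) q t) \<longlonglongrightarrow> Y (fst p) (snd p) q t"
    by (rule Y_seq) (use p x t in \<open>auto simp: mem_Times_iff intro!: tendsto_intros\<close>)
  then show "((\<lambda>(\<tau>, z). Y \<tau> z q t) \<circ> x) \<longlonglongrightarrow> (\<lambda>(\<tau>, z). Y \<tau> z q t) p"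
    by (simp add: o_def case_prod_beta)
qed

text \<open>The difference of two trajectories satisfies the variational equation up to the
  linearization remainder of the field. Divided by the length of the increment, this remainder is
  dominated by a multiple of the weight and tends to zero at each time, hence also in the
  mean.\<close>

lemma flow_has_derivative:
  assumes \<tau>: "\<tau> \<in> {0..T}" and t: "t \<in> {0..T}"
  shows "((\<lambda>z. \<Phi> \<tau> t z) has_derivative (\<lambda>q. Y \<tau> z q t)) (at z)"
  unfolding has_derivative_at
proof
  show "bounded_linear (\<lambda>q. Y \<tau> z q t)"
    using Y_linear[OF \<tau> t] by (simp add: linear_conv_bounded_linear)
  show "(\<lambda>h. norm (\<Phi> \<tau> t (z + h) - \<Phi> \<tau> t z - Y \<tau> z h t) / norm h) \<midarrow>0\<rightarrow> 0"
    unfolding tendsto_at_iff_sequentially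
  proof (intro allI impI)
    fix h :: "nat \<Rightarrow> 'b" assume h0: "\<forall>i. h i \<in> UNIV - {0}" and h: "h \<longlonglongrightarrow> 0"
    have hn: "h n \<noteq> 0" for n using h0 by auto
    have zh: "(\<lambda>n. z + h n) \<longlonglongrightarrow> z" using tendsto_add[OF tendsto_const h, of z] by simp
    obtain r where r: "\<And>n. norm (z + h n) \<le> r" "norm z \<le> r"
      using LIMSEQ_common_bound[OF zh] by blast
    obtain k N \<rho>' where k: "weight T k N" "0 \<le> \<rho>'"
      "\<And>\<tau> t x. \<tau> \<in> {0..T} \<Longrightarrow> t \<in> {0..T} \<Longrightarrow> norm x \<le> r \<Longrightarrow> norm (\<Phi> \<tau> t x) \<le> \<rho>'"
      "\<And>s z q. s \<in> {0..T} \<Longrightarrow> norm z \<le> \<rho>' \<Longrightarrow> norm (H' s z q) \<le> k s * norm q"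
      "\<And>s z w. s \<in> {0..T} \<Longrightarrow> norm z \<le> \<rho>' \<Longrightarrow> norm w \<le> \<rho>' \<Longrightarrow> norm (H s z - H s w) \<le> k s * norm (z - w)"
      using control[of r] by metis
    obtain C where C: "0 \<le> C" "\<And>t z w. t \<in> {0..T} \<Longrightarrow> norm z \<le> r \<Longrightarrow> norm w \<le> r \<Longrightarrow> norm (\<Phi> \<tau> t z - \<Phi> \<tau> t w) \<le> C * norm (z - w)"
      using flow_lip[of r] \<tau> by (metis mem_cball_0)
    define X where "X n s = \<Phi> \<tau> s (z + h n) - \<Phi> \<tau> s z" for n s
    define A where "A s = H' s (\<Phi> \<tau> s z)" for s
    \<comment> \<open>The linearization remainder along the trajectory, relative to the initial
      increment \<open>h n\<close>.\<close>
    define \<beta> where "\<beta> n s = (1 / norm (h n)) *\<^sub>R (H s (\<Phi> \<tau> s z + X n s) - H s (\<Phi> \<tau> s z) - A s (X n s))" for n s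
    have XC: "norm (X n s) \<le> C * norm (h n)" if "s \<in> {0..T}" for n s
      using C(2)[OF that r(1)[of n] r(2)] by (simp add: X_def)
    have Xc: "continuous_on {0..T} (X n)" for n
      unfolding X_def by (intro continuous_intros flow_cont \<tau>)
    have Xsol: "sol T (\<lambda>s v. H s (\<Phi> \<tau> s z + v) - H s (\<Phi> \<tau> s z)) \<tau> (h n) (X n)" for n
    proof -
      have i: "(\<lambda>s. H s (\<Phi> \<tau> s w)) integrable_on {0..T}" for w
        using sol_integrable[OF flow[OF \<tau>]] .
      have "X n t = h n + J \<tau> t (\<lambda>s. H s (\<Phi> \<tau> s (z + h n)) - H s (\<Phi> \<tau> s z))" if t: "t \<in> {0..T}" for t
        using flow[OF \<tau>, of "z + h n"] flow[OF \<tau>, of z] t J_diff[OF i i \<tau> t, of "z + h n" z]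
        by (simp add: X_def sol_def)
      then show ?thesis unfolding sol_def
        using Xc integrable_diff[OF i[of "z + h n"] i[of z]] by (auto simp: X_def)
    qed
    have bk: "norm (\<beta> n s) \<le> k s * (2 * C)" if s: "s \<in> {0..T}" for n s
    proof -
      have "norm (H s (\<Phi> \<tau> s z + X n s) - H s (\<Phi> \<tau> s z) - A s (X n s))
        \<le> norm (H s (\<Phi> \<tau> s (z + h n)) - H s (\<Phi> \<tau> s z)) + norm (A s (X n s))"
        by (simp add: X_def norm_triangle_ineq4)
      also have "\<dots> \<le> k s * norm (X n s) + k s * norm (X n s)"
        unfolding X_def A_def by (intro add_mono k s \<tau> r)
      also have "\<dots> \<le> k s * (C * norm (h n)) + k s * (C * norm (h n))"
        using k(1) s by (intro add_mono mult_left_mono XC) (auto simp: weight_def)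
      finally have "norm (H s (\<Phi> \<tau> s z + X n s) - H s (\<Phi> \<tau> s z) - A s (X n s)) \<le> k s * (2 * C) * norm (h n)"
        by (simp add: mult_ac)
      then show ?thesis using hn[of n] unfolding \<beta>_def by (simp only: norm_scaleR) (simp add: divide_simps)
    qed
    have kC: "(\<lambda>s. k s * (2 * C)) absolutely_integrable_on {0..T}"
      by (intro absint_mult_bounded weight_integrable[OF k(1)] continuous_intros)
    note kC' = set_lebesgue_integral_eq_integral(1)[OF kC]
    have bm: "\<beta> n \<in> borel_measurable (lebesgue_on {0..T})" for n
    proof -
      have "(\<lambda>s. H s (\<Phi> \<tau> s z + X n s)) \<in> borel_measurable (lebesgue_on {0..T})"
        by (intro meas_field_curve[OF meas] continuous_intros Xc flow_cont \<tau>)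
      moreover have "(\<lambda>s. H s (\<Phi> \<tau> s z)) \<in> borel_measurable (lebesgue_on {0..T})"
        by (intro meas_field_curve[OF meas] continuous_intros Xc flow_cont \<tau>)
      moreover have "(\<lambda>s. A s (X n s)) \<in> borel_measurable (lebesgue_on {0..T})"
        unfolding A_def by (rule meas_field_curve[OF meas_field_deriv[OF meas flow_cont[OF \<tau>] deriv] Xc])
      ultimately show ?thesis
        unfolding \<beta>_def by (intro borel_measurable_scaleR borel_measurable_diff borel_measurable_const)
    qed
    have bint: "(\<lambda>s. norm (\<beta> n s)) integrable_on {0..T}" for n
    proof -
      have "\<beta> n absolutely_integrable_on {0..T}"
        by (rule measurable_bounded_by_integrable_imp_absolutely_integrable[OF bm _ _ bk])
          (auto intro: kC')
      then show ?thesis by (simp add: absolutely_integrable_on_def)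
    qed
    have "(\<lambda>n. integral {0..T} (\<lambda>s. norm (\<beta> n s))) \<longlonglongrightarrow> integral {0..T} (\<lambda>s. 0)"
    proof (rule dominated_convergence(2)[OF bint, where h = "\<lambda>s. k s * (2 * C)"])
      fix s assume s: "s \<in> {0..T}"
      show "(\<lambda>n. norm (\<beta> n s)) \<longlonglongrightarrow> 0"
      proof (rule LIMSEQ_I)
        fix \<epsilon> :: real assume e: "0 < \<epsilon>"
        define e' where "e' = \<epsilon> / (2 * (C + 1))"
        have e': "0 < e'" using e C by (simp add: e'_def)
        obtain d where d: "d > 0" "\<And>y. norm (y - \<Phi> \<tau> s z) < d \<Longrightarrow>
            norm (H s y - H s (\<Phi> \<tau> s z) - A s (y - \<Phi> \<tau> s z)) \<le> e' * norm (y - \<Phi> \<tau> s z)"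
          using deriv[OF s, of "\<Phi> \<tau> s z"] e' unfolding has_derivative_at_alt A_def by blast
        have "(\<lambda>n. X n s) \<longlonglongrightarrow> 0"
          unfolding X_def by (intro LIM_zero flow_seq \<tau> zh s tendsto_const)
        from LIMSEQ_D[OF this d(1)] obtain n0 where n0: "\<And>n. n \<ge> n0 \<Longrightarrow> norm (X n s) < d"
          by auto
        show "\<exists>n0. \<forall>n\<ge>n0. norm (norm (\<beta> n s) - 0) < \<epsilon>"
        proof (intro exI allI impI)
          fix n assume "n \<ge> n0"
          then have "norm (H s (\<Phi> \<tau> s z + X n s) - H s (\<Phi> \<tau> s z) - A s (X n s)) \<le> e' * norm (X n s)"
            using d(2)[of "\<Phi> \<tau> s z + X n s"] n0 by simp
          also have "\<dots> \<le> e' * (C * norm (h n))" using e' by (intro mult_left_mono XC s) auto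
          finally have "norm (\<beta> n s) \<le> e' * C" using hn[of n] unfolding \<beta>_def by (simp only: norm_scaleR) (simp add: divide_simps)
          also have "\<dots> \<le> e' * (C + 1)" using e' by (intro mult_left_mono) auto
          also have "\<dots> = \<epsilon> / 2" using C(1) unfolding e'_def by (simp add: divide_simps add_nonneg_eq_0_iff algebra_simps)
          finally show "norm (norm (\<beta> n s) - 0) < \<epsilon>" using e by simp
        qed
      qed
    qed (use kC' bk in simp_all)
    then have b0: "(\<lambda>n. integral {0..T} (\<lambda>s. norm (\<beta> n s))) \<longlonglongrightarrow> 0" by simp
    have le: "norm (X n t - Y \<tau> z (h n) t) / norm (h n) \<le> integral {0..T} (\<lambda>s. norm (\<beta> n s)) * gron T N" for n
    proof -
      have "norm (X n t - Y \<tau> z (h n) t) \<le> (norm (h n - h n) + integral {0..T} (\<lambda>s. norm (h n) * norm (\<beta> n s))) * gron T N"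
      proof (rule sol_stable[OF Xsol Y_sol[OF \<tau>] k(1) \<tau> t])
        fix s assume s: "s \<in> {0..T}"
        have "H s (\<Phi> \<tau> s z + X n s) - H s (\<Phi> \<tau> s z) - A s (Y \<tau> z (h n) s)
          = A s (X n s - Y \<tau> z (h n) s) + norm (h n) *\<^sub>R \<beta> n s"
          using hn[of n] by (simp add: \<beta>_def A_def diff'[OF s])
        then have "norm (H s (\<Phi> \<tau> s z + X n s) - H s (\<Phi> \<tau> s z) - A s (Y \<tau> z (h n) s))
          \<le> norm (A s (X n s - Y \<tau> z (h n) s)) + norm (norm (h n) *\<^sub>R \<beta> n s)"
          by (metis norm_triangle_ineq)
        also have "\<dots> \<le> k s * norm (X n s - Y \<tau> z (h n) s) + norm (h n) * norm (\<beta> n s)"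
          unfolding A_def by (intro add_mono k s \<tau> r) auto
        finally show "norm (H s (\<Phi> \<tau> s z + X n s) - H s (\<Phi> \<tau> s z) - H' s (\<Phi> \<tau> s z) (Y \<tau> z (h n) s))
          \<le> k s * norm (X n s - Y \<tau> z (h n) s) + norm (h n) * norm (\<beta> n s)" by (simp add: A_def)
      qed (auto intro!: integrable_on_mult_right bint)
      then show ?thesis using hn[of n] by (simp add: field_simps)
    qed
    then have le': "norm (norm (X n t - Y \<tau> z (h n) t) / norm (h n)) \<le> integral {0..T} (\<lambda>s. norm (\<beta> n s)) * gron T N" for n
      by simp
    have "(\<lambda>n. integral {0..T} (\<lambda>s. norm (\<beta> n s)) * gron T N) \<longlonglongrightarrow> 0"
      using tendsto_mult_right[OF b0, of "gron T N"] by simp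
    then have "(\<lambda>n. norm (X n t - Y \<tau> z (h n) t) / norm (h n)) \<longlonglongrightarrow> 0"
      by (intro Lim_null_comparison[OF always_eventually[OF allI[OF le']]]) simp
    then show "((\<lambda>h. norm (\<Phi> \<tau> t (z + h) - \<Phi> \<tau> t z - Y \<tau> z h t) / norm h) \<circ> h) \<longlonglongrightarrow> 0"
      by (simp add: o_def X_def)
  qed
qed

end

section \<open>Derivatives as bounded linear maps, and maps with values in such operators\<close>

lemma Dif_eqI: "(f has_derivative blinfun_apply A) (at x) \<Longrightarrow> Dif f x = A"
  unfolding Dif_def using frechet_derivative_at[of f "blinfun_apply A" x]
  by (metis blinfun_apply_inverse)

lemma Dif_works: "f differentiable (at x) \<Longrightarrow> (f has_derivative blinfun_apply (Dif f x)) (at x)"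
  unfolding Dif_def
  by (simp add: bounded_linear_Blinfun_apply frechet_derivative_works has_derivative_bounded_linear)

lemma Dif_apply: "(f has_derivative f') (at x) \<Longrightarrow> blinfun_apply (Dif f x) = f'"
  using Dif_works[of f x] has_derivative_unique differentiableI by blast

text \<open>A rank-one operator. Operator-valued maps are differentiated on each basis vector and
  reassembled from these, see \<open>blinfun_has_derivative_componentwise\<close>.\<close>

definition lift_basis :: "'a::euclidean_space \<Rightarrow> 'b::real_normed_vector \<Rightarrow> ('a \<Rightarrow>\<^sub>L 'b)" where
  "lift_basis i w = blinfun_scaleR_left w o\<^sub>L blinfun_inner_left i"

lemma lift_basis_apply [simp]: "blinfun_apply (lift_basis i w) v = (v \<bullet> i) *\<^sub>R w"
  by (simp add: lift_basis_def)

lemma bounded_linear_lift_basis: "bounded_linear (lift_basis i)"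
  unfolding lift_basis_def
  by (intro bounded_linear_intros bounded_linear_blinfun_scaleR_left)

lemma blinfun_basis_expansion: "A = (\<Sum>i\<in>Basis. lift_basis i (blinfun_apply A i))"
proof (rule blinfun_eqI)
  fix v
  have "blinfun_apply A v = blinfun_apply A (\<Sum>i\<in>Basis. (v \<bullet> i) *\<^sub>R i)"
    by (simp add: euclidean_representation)
  also have "\<dots> = blinfun_apply (\<Sum>i\<in>Basis. lift_basis i (blinfun_apply A i)) v"
    by (simp add: blinfun.sum_left blinfun.sum_right blinfun.scaleR_right)
  finally show "blinfun_apply A v = blinfun_apply (\<Sum>i\<in>Basis. lift_basis i (blinfun_apply A i)) v" .
qed

lemma blinfun_has_derivative_componentwise:
  fixes A :: "'c::real_normed_vector \<Rightarrow> 'a::euclidean_space \<Rightarrow>\<^sub>L 'b::real_normed_vector"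
  assumes "\<And>i. i \<in> Basis \<Longrightarrow> ((\<lambda>z. blinfun_apply (A z) i) has_derivative A' i) (at z)"
  shows "(A has_derivative (\<lambda>p. \<Sum>i\<in>Basis. lift_basis i (A' i p))) (at z)"
proof -
  have "((\<lambda>z. \<Sum>i\<in>Basis. lift_basis i (blinfun_apply (A z) i)) has_derivative (\<lambda>p. \<Sum>i\<in>Basis. lift_basis i (A' i p))) (at z)"
    by (intro has_derivative_sum bounded_linear.has_derivative[OF bounded_linear_lift_basis] assms)
  moreover have "(\<lambda>z. \<Sum>i\<in>Basis. lift_basis i (blinfun_apply (A z) i)) = A"
    by (rule ext) (rule blinfun_basis_expansion[symmetric])
  ultimately show ?thesis by simp
qed

context c1_flow
begin

definition D\<Phi> :: "real \<Rightarrow> real \<Rightarrow> 'b \<Rightarrow> 'b \<Rightarrow>\<^sub>L 'b" where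
  "D\<Phi> \<tau> t z = Blinfun (\<lambda>q. Y \<tau> z q t)"

lemma D\<Phi>_apply:
  assumes "\<tau> \<in> {0..T}" "t \<in> {0..T}"
  shows "blinfun_apply (D\<Phi> \<tau> t z) q = Y \<tau> z q t"
  unfolding D\<Phi>_def
  using has_derivative_bounded_linear[OF flow_has_derivative[OF assms]] by (simp add: bounded_linear_Blinfun_apply)

lemma D\<Phi>_has_derivative:
  assumes "\<tau> \<in> {0..T}" "t \<in> {0..T}"
  shows "(\<Phi> \<tau> t has_derivative blinfun_apply (D\<Phi> \<tau> t z)) (at z)"
proof -
  have "blinfun_apply (D\<Phi> \<tau> t z) = (\<lambda>q. Y \<tau> z q t)" by (rule ext) (rule D\<Phi>_apply[OF assms])
  then show ?thesis using flow_has_derivative[OF assms, of z] by simp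
qed

lemma Dif_flow: "\<tau> \<in> {0..T} \<Longrightarrow> t \<in> {0..T} \<Longrightarrow> Dif (\<Phi> \<tau> t) z = D\<Phi> \<tau> t z"
  by (intro Dif_eqI D\<Phi>_has_derivative)

lemma D\<Phi>_continuous:
  assumes t: "t \<in> {0..T}"
  shows "continuous_on ({0..T} \<times> UNIV) (\<lambda>(\<tau>, z). D\<Phi> \<tau> t z)"
proof (rule continuous_on_blinfun_componentwise)
  fix i :: 'b
  show "continuous_on ({0..T} \<times> UNIV) (\<lambda>x. blinfun_apply (case x of (\<tau>, z) \<Rightarrow> D\<Phi> \<tau> t z) i)"
    by (rule continuous_on_eq[OF Y_continuous[OF t, of i]]) (use t in \<open>auto simp: D\<Phi>_apply\<close>)
qed

lemma flow_trans:
  assumes "\<tau> \<in> {0..T}" "\<sigma> \<in> {0..T}" "t \<in> {0..T}"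
  shows "\<Phi> \<sigma> t (\<Phi> \<tau> \<sigma> z) = \<Phi> \<tau> t z"
proof -
  define r where "r = max (norm z) (norm (\<Phi> \<tau> \<sigma> z))"
  obtain k N \<rho>' where k: "weight T k N" "0 \<le> \<rho>'"
    "\<And>\<tau> t z. \<tau> \<in> {0..T} \<Longrightarrow> t \<in> {0..T} \<Longrightarrow> norm z \<le> r \<Longrightarrow> norm (\<Phi> \<tau> t z) \<le> \<rho>'"
    "\<And>s z w. s \<in> {0..T} \<Longrightarrow> norm z \<le> \<rho>' \<Longrightarrow> norm w \<le> \<rho>' \<Longrightarrow> norm (H s z - H s w) \<le> k s * norm (z - w)"
    using control[of r] by metis
  show ?thesis
  proof (rule sol_unique[OF flow[OF assms(2)] sol_shift[OF flow[OF assms(1)] assms(1,2)] k(1) assms(2,3)])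
    fix s assume s: "s \<in> {0..T}"
    show "norm (H s (\<Phi> \<sigma> s (\<Phi> \<tau> \<sigma> z)) - H s (\<Phi> \<tau> s z)) \<le> k s * norm (\<Phi> \<sigma> s (\<Phi> \<tau> \<sigma> z) - \<Phi> \<tau> s z)"
      by (intro k(4)[OF s] k(3) assms s) (auto simp: r_def)
  qed
qed

lemma flow_time_derivative:
  assumes c: "continuous_on {0..T} (\<lambda>s. H s (\<Phi> \<tau> s z))" and \<tau>: "\<tau> \<in> {0..T}" and t: "t \<in> {0..T}"
  shows "((\<lambda>t. \<Phi> \<tau> t z) has_vector_derivative H t (\<Phi> \<tau> t z)) (at t within {0..T})"
proof -
  have "((\<lambda>t. z + (integral {0..t} (\<lambda>s. H s (\<Phi> \<tau> s z)) - integral {0..\<tau>} (\<lambda>s. H s (\<Phi> \<tau> s z))))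
      has_vector_derivative 0 + (H t (\<Phi> \<tau> t z) - 0)) (at t within {0..T})"
    by (intro has_vector_derivative_add has_vector_derivative_diff has_vector_derivative_const integral_has_vector_derivative c t)
  then have "((\<lambda>t. z + J \<tau> t (\<lambda>s. H s (\<Phi> \<tau> s z))) has_vector_derivative H t (\<Phi> \<tau> t z)) (at t within {0..T})"
    by (simp add: J_def)
  from has_vector_derivative_transform[OF t _ this] show ?thesis
    using flow[OF \<tau>, of z] by (simp add: sol_def)
qed

text \<open>The map \<open>\<sigma> \<mapsto> \<Phi> \<sigma> t (\<Phi> \<tau> \<sigma> z)\<close>
  is constant. Moving the starting time from \<tau> to \<sigma> thus has the effect of moving the
  starting point from \<open>\<Phi> \<tau> \<sigma> z\<close> back to \<open>z\<close>, which
  explains the minus sign.\<close>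

lemma flow_start_derivative:
  assumes c: "continuous_on {0..T} (\<lambda>s. H s (\<Phi> \<tau> s z))" and \<tau>: "\<tau> \<in> {0..T}" and t: "t \<in> {0..T}"
  shows "((\<lambda>\<sigma>. \<Phi> \<sigma> t z) has_vector_derivative - D\<Phi> \<tau> t z (H \<tau> z)) (at \<tau> within {0..T})"
  unfolding has_vector_derivative_def has_derivative_within_alt
proof (intro conjI allI impI)
  show "bounded_linear (\<lambda>x. x *\<^sub>R - D\<Phi> \<tau> t z (H \<tau> z))" by (rule bounded_linear_scaleR_left)
  fix \<epsilon> :: real assume e: "0 < \<epsilon>"
  let ?A = "D\<Phi> \<tau> t z" and ?g = "H \<tau> z"
  define e' where "e' = min 1 (\<epsilon> / (norm ?A + norm ?g + 1))"
  have pos: "0 < norm ?A + norm ?g + 1" by (simp add: add_nonneg_pos)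
  have e': "0 < e'" "e' \<le> 1" and e'': "e' * (norm ?A + norm ?g + 1) \<le> \<epsilon>"
  proof -
    show "0 < e'" "e' \<le> 1" using e pos by (auto simp: e'_def)
    have "e' \<le> \<epsilon> / (norm ?A + norm ?g + 1)" by (simp add: e'_def)
    then show "e' * (norm ?A + norm ?g + 1) \<le> \<epsilon>" using pos by (simp add: pos_le_divide_eq)
  qed
  have "((\<lambda>t. \<Phi> \<tau> t z) has_vector_derivative ?g) (at \<tau> within {0..T})"
    using flow_time_derivative[OF c \<tau> \<tau>] by (simp add: flow_init[OF \<tau>])
  then obtain d1 where d1: "d1 > 0" "\<And>\<sigma>. \<sigma> \<in> {0..T} \<Longrightarrow> norm (\<sigma> - \<tau>) < d1 \<Longrightarrow>
      norm (\<Phi> \<tau> \<sigma> z - z - (\<sigma> - \<tau>) *\<^sub>R ?g) \<le> e' * norm (\<sigma> - \<tau>)"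
    unfolding has_vector_derivative_def has_derivative_within_alt flow_init[OF \<tau>] using e'(1) by blast
  obtain d2 where d2: "d2 > 0" "\<And>\<sigma> x. \<sigma> \<in> {0..T} \<Longrightarrow> dist (\<sigma>, x) (\<tau>, z) < d2 \<Longrightarrow> dist (D\<Phi> \<sigma> t x) ?A < e'"
  proof -
    have "\<exists>d>0. \<forall>y\<in>{0..T} \<times> UNIV. dist y (\<tau>, z) < d \<longrightarrow> dist ((\<lambda>(\<tau>, z). D\<Phi> \<tau> t z) y) ((\<lambda>(\<tau>, z). D\<Phi> \<tau> t z) (\<tau>, z)) < e'"
    proof -
      have "(\<tau>, z) \<in> {0..T} \<times> UNIV" using \<tau> by simp
      from D\<Phi>_continuous[OF t, unfolded continuous_on_iff, THEN bspec, OF this, THEN spec, of e'] e'(1)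
      show ?thesis by blast
    qed
    then obtain d where d: "d > 0" and *: "\<forall>y\<in>{0..T} \<times> UNIV. dist y (\<tau>, z) < d \<longrightarrow> dist ((\<lambda>(\<tau>, z). D\<Phi> \<tau> t z) y) ((\<lambda>(\<tau>, z). D\<Phi> \<tau> t z) (\<tau>, z)) < e'"
      by blast
    show ?thesis
    proof (rule that[OF d])
      fix \<sigma> x assume "\<sigma> \<in> {0..T}" "dist (\<sigma>, x) (\<tau>, z) < d"
      then show "dist (D\<Phi> \<sigma> t x) ?A < e'" using *[rule_format, of "(\<sigma>, x)"] by simp
    qed
  qed
  define M where "M = norm ?g + 1"
  have M: "M > 0" by (simp add: M_def add_nonneg_pos)
  \<comment> \<open>Half of \<open>d2\<close> is reserved for the distance in time and half for the
    distance in space; the latter grows at most at rate \<open>M\<close>.\<close>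
  define d where "d = min d1 (min (d2 / 2) (d2 / (2 * M)))"
  have d: "0 < d" "d \<le> d1" "d \<le> d2 / 2" "d * M \<le> d2 / 2"
  proof -
    show "0 < d" "d \<le> d1" "d \<le> d2 / 2" using d1 d2 M by (auto simp: d_def)
    have "d \<le> d2 / (2 * M)" by (simp add: d_def)
    then show "d * M \<le> d2 / 2" using M by (simp add: field_simps)
  qed
  show "\<exists>d>0. \<forall>\<sigma>\<in>{0..T}. norm (\<sigma> - \<tau>) < d \<longrightarrow>
      norm (\<Phi> \<sigma> t z - \<Phi> \<tau> t z - (\<sigma> - \<tau>) *\<^sub>R - ?A ?g) \<le> \<epsilon> * norm (\<sigma> - \<tau>)"
  proof (intro exI conjI ballI impI)
    fix \<sigma> assume \<sigma>: "\<sigma> \<in> {0..T}" and near: "norm (\<sigma> - \<tau>) < d"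
    define w where "w = \<Phi> \<tau> \<sigma> z"
    define r where "r = w - z - (\<sigma> - \<tau>) *\<^sub>R ?g"
    have r: "norm r \<le> e' * norm (\<sigma> - \<tau>)"
      unfolding r_def w_def using near d by (intro d1(2) \<sigma>) auto
    have "norm (w - z) = norm (r + (\<sigma> - \<tau>) *\<^sub>R ?g)" by (simp add: r_def)
    also have "\<dots> \<le> e' * norm (\<sigma> - \<tau>) + norm (\<sigma> - \<tau>) * norm ?g"
      using r norm_triangle_ineq[of r "(\<sigma> - \<tau>) *\<^sub>R ?g"] by simp
    also have "\<dots> \<le> 1 * norm (\<sigma> - \<tau>) + norm (\<sigma> - \<tau>) * norm ?g"
      using e' by (intro add_mono mult_right_mono) auto
    also have "\<dots> = M * norm (\<sigma> - \<tau>)" by (simp add: M_def algebra_simps)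
    finally have wz: "norm (w - z) \<le> M * norm (\<sigma> - \<tau>)" .
    have wz': "norm (w - z) < d2 / 2"
    proof -
      have "M * norm (\<sigma> - \<tau>) < M * d" using near M by (intro mult_strict_left_mono)
      then show ?thesis using wz d(4) by (simp add: mult.commute)
    qed
    \<comment> \<open>Mean value inequality for the flow started at \<sigma> minus the fixed linear
      map \<open>?A\<close>. Continuity of the derivative jointly in starting time and point makes
      the slope at most \<open>e'\<close> on the whole segment.\<close>
    have bnd: "norm ((\<Phi> \<sigma> t z - ?A z) - (\<Phi> \<sigma> t w - ?A w)) \<le> e' * norm (z - w)"
    proof (rule differentiable_bound[of "closed_segment z w"])
      fix x assume x: "x \<in> closed_segment z w"
      show "((\<lambda>x. \<Phi> \<sigma> t x - ?A x) has_derivative blinfun_apply (D\<Phi> \<sigma> t x - ?A)) (at x within closed_segment z w)"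
      proof -
        have "blinfun_apply (D\<Phi> \<sigma> t x - ?A) = (\<lambda>q. D\<Phi> \<sigma> t x q - ?A q)"
          by (rule ext) (rule blinfun.diff_left)
        moreover have "((\<lambda>x. \<Phi> \<sigma> t x - ?A x) has_derivative (\<lambda>q. D\<Phi> \<sigma> t x q - ?A q)) (at x)"
          by (rule has_derivative_diff[OF D\<Phi>_has_derivative[OF \<sigma> t] bounded_linear_imp_has_derivative[OF blinfun.bounded_linear_right]])
        ultimately show ?thesis by (simp only: has_derivative_at_withinI)
      qed
      have "norm (x - z) \<le> norm (w - z)" using segment_bound(1)[OF x] by simp
      then have "dist (\<sigma>, x) (\<tau>, z) \<le> norm (\<sigma> - \<tau>) + norm (w - z)"
        using norm_Pair_le[of "\<sigma> - \<tau>" "x - z"] unfolding dist_norm diff_Pair by linarith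
      also have "\<dots> < d2" using near d(3) wz' by simp
      finally have "dist (D\<Phi> \<sigma> t x) ?A < e'" using \<sigma> by (intro d2)
      then show "onorm (blinfun_apply (D\<Phi> \<sigma> t x - ?A)) \<le> e'"
        by (simp add: norm_blinfun.rep_eq[symmetric] dist_norm)
    qed auto
    have tr: "\<Phi> \<sigma> t w = \<Phi> \<tau> t z" unfolding w_def by (rule flow_trans[OF \<tau> \<sigma> t])
    have "\<Phi> \<sigma> t z - \<Phi> \<tau> t z - ?A (z - w) = (\<Phi> \<sigma> t z - ?A z) - (\<Phi> \<sigma> t w - ?A w)"
      unfolding tr blinfun.diff_right by simp
    then have main: "norm (\<Phi> \<sigma> t z - \<Phi> \<tau> t z - ?A (z - w)) \<le> e' * norm (w - z)"
      using bnd unfolding norm_minus_commute[of z w] by (simp only:)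
    have "\<Phi> \<sigma> t z - \<Phi> \<tau> t z - (\<sigma> - \<tau>) *\<^sub>R - ?A ?g = (\<Phi> \<sigma> t z - \<Phi> \<tau> t z - ?A (z - w)) - ?A r"
      by (simp add: r_def blinfun.diff_right blinfun.scaleR_right)
    also have "norm \<dots> \<le> e' * norm (w - z) + norm ?A * norm r"
      by (intro order_trans[OF norm_triangle_ineq4] add_mono main norm_blinfun)
    also have "\<dots> \<le> e' * (M * norm (\<sigma> - \<tau>)) + norm ?A * (e' * norm (\<sigma> - \<tau>))"
      using e' wz r by (intro add_mono mult_left_mono) auto
    also have "\<dots> = e' * (norm ?A + norm ?g + 1) * norm (\<sigma> - \<tau>)" by (simp add: M_def distrib_right distrib_left mult.commute)
    also have "\<dots> \<le> \<epsilon> * norm (\<sigma> - \<tau>)" by (intro mult_right_mono e'') auto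
    finally show "norm (\<Phi> \<sigma> t z - \<Phi> \<tau> t z - (\<sigma> - \<tau>) *\<^sub>R - ?A ?g) \<le> \<epsilon> * norm (\<sigma> - \<tau>)" .
  qed (use d in auto)
qed

end

section \<open>Second derivatives of the flow\<close>

lemma weight_scale:
  assumes "weight T k N" "0 \<le> c"
  shows "weight T (\<lambda>s. c * k s) (c\<^sup>2 * N)"
proof -
  have k: "k \<in> borel_measurable (lebesgue_on {0..T})" "(\<lambda>s. (k s)\<^sup>2) integrable_on {0..T}"
    "\<forall>s\<in>{0..T}. 0 \<le> k s" "integral {0..T} (\<lambda>s. (k s)\<^sup>2) \<le> N"
    using assms(1) by (auto simp: weight_def)
  show ?thesis
    unfolding weight_def power_mult_distrib
    using k assms(2) by (auto intro!: borel_measurable_times integrable_on_mult_right mult_left_mono)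
qed

locale c2_flow =
  fixes T :: real and G :: "real \<Rightarrow> 'b::euclidean_space \<Rightarrow> 'b" and D :: "real \<Rightarrow> 'b \<Rightarrow> 'b \<Rightarrow>\<^sub>L 'b"
    and D2 :: "real \<Rightarrow> 'b \<Rightarrow> 'b \<Rightarrow>\<^sub>L ('b \<Rightarrow>\<^sub>L 'b)" and \<Phi> :: "real \<Rightarrow> real \<Rightarrow> 'b \<Rightarrow> 'b"
  assumes base: "c1_flow T G (\<lambda>s z. blinfun_apply (D s z)) \<Phi>"
    and deriv2: "s \<in> {0..T} \<Longrightarrow> (D s has_derivative blinfun_apply (D2 s z)) (at z)"
    and cont2: "s \<in> {0..T} \<Longrightarrow> continuous_on UNIV (D2 s)"
    and bound2: "\<exists>k N. weight T k N \<and>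
      (\<forall>s\<in>{0..T}. \<forall>z\<in>cball 0 \<rho>. norm (G s z) \<le> k s \<and> norm (D s z) \<le> k s \<and> norm (D2 s z) \<le> k s)"
begin

sublocale c1_flow T G "\<lambda>s z. blinfun_apply (D s z)" \<Phi> by (rule base)

text \<open>The pair of a trajectory and its linearization is the flow of the tangent field, so the second
  derivative of the flow is a first derivative of the tangent flow.\<close>

definition tangent_field :: "real \<Rightarrow> 'b \<times> 'b \<Rightarrow> 'b \<times> 'b" where
  "tangent_field s x = (G s (fst x), D s (fst x) (snd x))"

definition tangent_field' :: "real \<Rightarrow> 'b \<times> 'b \<Rightarrow> 'b \<times> 'b \<Rightarrow> 'b \<times> 'b" where
  "tangent_field' s x h = (D s (fst x) (fst h), D2 s (fst x) (fst h) (snd x) + D s (fst x) (snd h))"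

definition tangent_flow :: "real \<Rightarrow> real \<Rightarrow> 'b \<times> 'b \<Rightarrow> 'b \<times> 'b" where
  "tangent_flow \<tau> t x = (\<Phi> \<tau> t (fst x), Y \<tau> (fst x) (snd x) t)"

lemma D_continuous: "s \<in> {0..T} \<Longrightarrow> continuous_on UNIV (D s)"
  using deriv2 by (meson has_derivative_continuous continuous_at_imp_continuous_on)

lemma integrable_Pair:
  fixes f :: "real \<Rightarrow> 'c::euclidean_space" and g :: "real \<Rightarrow> 'd::euclidean_space"
  assumes "f integrable_on S" "g integrable_on S"
  shows "(\<lambda>s. (f s, g s)) integrable_on S"
proof -
  have "(\<lambda>s. (f s, 0) + (0, g s)) integrable_on S"
    using integrable_linear[OF assms(1) bounded_linear_Pair[OF bounded_linear_ident bounded_linear_zero]]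
      integrable_linear[OF assms(2) bounded_linear_Pair[OF bounded_linear_zero bounded_linear_ident]]
    by (intro integrable_add) (simp_all add: o_def)
  then show ?thesis by simp
qed

lemma sol_tangent:
  assumes \<tau>: "\<tau> \<in> {0..T}"
  shows "sol T tangent_field \<tau> x (\<lambda>t. tangent_flow \<tau> t x)"
  unfolding sol_def
proof (intro conjI ballI)
  let ?f = "\<lambda>s. G s (\<Phi> \<tau> s (fst x))" and ?g = "\<lambda>s. D s (\<Phi> \<tau> s (fst x)) (Y \<tau> (fst x) (snd x) s)"
  note f = flow[OF \<tau>, of "fst x"] and g = Y_sol[OF \<tau>, of "fst x" "snd x"]
  have i: "(\<lambda>s. (?f s, ?g s)) integrable_on {0..T}"
    by (intro integrable_Pair sol_integrable[OF f] sol_integrable[OF g])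
  then show "(\<lambda>s. tangent_field s (tangent_flow \<tau> s x)) integrable_on {0..T}"
    by (simp add: tangent_field_def tangent_flow_def)
  show "continuous_on {0..T} (\<lambda>t. tangent_flow \<tau> t x)"
    unfolding tangent_flow_def by (intro continuous_on_Pair sol_continuous[OF f] sol_continuous[OF g])
  fix t assume t: "t \<in> {0..T}"
  have "fst (J \<tau> t (\<lambda>s. (?f s, ?g s))) = J \<tau> t ?f" "snd (J \<tau> t (\<lambda>s. (?f s, ?g s))) = J \<tau> t ?g"
    using J_linear[OF i \<tau> t bounded_linear_fst] J_linear[OF i \<tau> t bounded_linear_snd] by simp_all
  then have "J \<tau> t (\<lambda>s. (?f s, ?g s)) = (J \<tau> t ?f, J \<tau> t ?g)" by (simp add: prod_eq_iff)
  moreover have "\<Phi> \<tau> t (fst x) = fst x + J \<tau> t ?f" "Y \<tau> (fst x) (snd x) t = snd x + J \<tau> t ?g"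
    using f g t by (auto simp: sol_def)
  ultimately show "tangent_flow \<tau> t x = x + J \<tau> t (\<lambda>s. tangent_field s (tangent_flow \<tau> s x))"
    by (simp add: tangent_field_def tangent_flow_def prod_eq_iff)
qed

sublocale tangent: c1_flow T tangent_field tangent_field' tangent_flow
proof
  show "meas_field T tangent_field"
    unfolding meas_field_def tangent_field_def
  proof (intro allI impI)
    fix c :: "real \<Rightarrow> 'b \<times> 'b" assume c: "continuous_on {0..T} c"
    then have c': "continuous_on {0..T} (\<lambda>s. fst (c s))" "continuous_on {0..T} (\<lambda>s. snd (c s))"
      by (auto intro: continuous_intros)
    show "(\<lambda>s. (G s (fst (c s)), D s (fst (c s)) (snd (c s)))) \<in> borel_measurable (lebesgue_on {0..T})"
      by (rule borel_measurable_Pair[OF meas_field_curve[OF meas c'(1)]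
          meas_field_curve[OF meas_field_deriv[OF meas c'(1) deriv] c'(2)]])
  qed
next
  fix s and x :: "'b \<times> 'b" assume s: "s \<in> {0..T}"
  have 1: "((\<lambda>x. G s (fst x)) has_derivative (\<lambda>h. D s (fst x) (fst h))) (at x)"
    by (rule has_derivative_compose[OF _ deriv[OF s], of fst]) (auto intro!: derivative_eq_intros)
  have 2: "((\<lambda>x. D s (fst x)) has_derivative (\<lambda>h. D2 s (fst x) (fst h))) (at x)"
    by (rule has_derivative_compose[OF _ deriv2[OF s], of fst]) (auto intro!: derivative_eq_intros)
  have 3: "((\<lambda>x. D s (fst x) (snd x)) has_derivative
      (\<lambda>h. D s (fst x) (snd h) + D2 s (fst x) (fst h) (snd x))) (at x)"
    by (rule blinfun.FDERIV[OF 2]) (auto intro!: derivative_eq_intros)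
  show "(tangent_field s has_derivative tangent_field' s x) (at x)"
    using has_derivative_Pair[OF 1 3] by (simp add: tangent_field_def[abs_def] tangent_field'_def[abs_def] add.commute)
next
  fix s and h :: "'b \<times> 'b" assume s: "s \<in> {0..T}"
  show "continuous_on UNIV (\<lambda>x. tangent_field' s x h)"
    unfolding tangent_field'_def
    by (intro continuous_intros continuous_on_compose2[OF D_continuous[OF s]] continuous_on_compose2[OF cont2[OF s]]) auto
next
  fix \<rho> :: real
  obtain k N where k: "weight T k N"
    "\<forall>s\<in>{0..T}. \<forall>z\<in>cball 0 \<rho>. norm (G s z) \<le> k s \<and> norm (D s z) \<le> k s \<and> norm (D2 s z) \<le> k s"
    using bound2 by blast
  \<comment> \<open>The mixed term of \<open>tangent_field'\<close> is linear in
    \<open>snd x\<close> and contributes \<open>\<bar>\<rho>\<bar>\<close>; its two first order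
    terms contribute 2.\<close>
  define c where "c = 2 + \<bar>\<rho>\<bar>"
  have "norm (tangent_field s x) \<le> c * k s \<and> (\<forall>q. norm (tangent_field' s x q) \<le> c * k s * norm q)"
    if s: "s \<in> {0..T}" and x: "norm x \<le> \<rho>" for s x
  proof -
    have fx: "norm (fst x) \<le> \<rho>" "norm (snd x) \<le> \<bar>\<rho>\<bar>"
      using x norm_fst_le[of "fst x" "snd x"] norm_snd_le[of "snd x" "fst x"] unfolding prod.collapse by linarith+
    then have k': "norm (G s (fst x)) \<le> k s" "norm (D s (fst x)) \<le> k s" "norm (D2 s (fst x)) \<le> k s"
      using k(2) s by auto
    have k0: "0 \<le> k s" using k(1) s by (auto simp: weight_def)
    have D: "norm (D s (fst x) q) \<le> k s * norm q" for q
      using norm_blinfun[of "D s (fst x)" q] k'(2) by (meson mult_right_mono norm_ge_zero order_trans)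
    have D2: "norm (D2 s (fst x) p q) \<le> k s * norm p * norm q" for p q
      by (intro order_trans[OF norm_blinfun] mult_right_mono order_trans[OF norm_blinfun] k') auto
    have "norm (tangent_field s x) \<le> norm (G s (fst x)) + norm (D s (fst x) (snd x))"
      unfolding tangent_field_def by (rule norm_Pair_le)
    also have "\<dots> \<le> k s + k s * \<bar>\<rho>\<bar>"
      by (intro add_mono k' order_trans[OF D] mult_left_mono fx k0)
    also have "\<dots> \<le> c * k s" using k0 by (simp add: c_def algebra_simps)
    finally have 1: "norm (tangent_field s x) \<le> c * k s" .
    have "norm (tangent_field' s x q) \<le> c * k s * norm q" for q
    proof -
      have q: "norm (fst q) \<le> norm q" "norm (snd q) \<le> norm q" using norm_fst_le[of "fst q" "snd q"] norm_snd_le[of "snd q" "fst q"] by simp_all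
      have "norm (tangent_field' s x q) \<le> norm (D s (fst x) (fst q)) + (norm (D2 s (fst x) (fst q) (snd x)) + norm (D s (fst x) (snd q)))"
        unfolding tangent_field'_def by (intro order_trans[OF norm_Pair_le] add_left_mono norm_triangle_ineq)
      also have "\<dots> \<le> k s * norm q + (k s * norm q * \<bar>\<rho>\<bar> + k s * norm q)"
        by (intro add_mono order_trans[OF D] order_trans[OF D2] mult_mono fx q k0 mult_nonneg_nonneg order_refl) auto
      also have "\<dots> = c * k s * norm q" by (simp add: c_def algebra_simps)
      finally show ?thesis .
    qed
    with 1 show ?thesis by blast
  qed
  moreover have "weight T (\<lambda>s. c * k s) (c\<^sup>2 * N)" by (intro weight_scale k) (simp add: c_def)
  ultimately show "\<exists>k N. weight T k N \<and> (\<forall>s\<in>{0..T}. \<forall>z\<in>cball 0 \<rho>.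
      norm (tangent_field s z) \<le> k s \<and> (\<forall>q. norm (tangent_field' s z q) \<le> k s * norm q))"
    by (metis mem_cball_0)
next
  fix \<tau> and x :: "'b \<times> 'b" assume "\<tau> \<in> {0..T}"
  then show "sol T tangent_field \<tau> x (\<lambda>t. tangent_flow \<tau> t x)" by (rule sol_tangent)
next
  fix \<rho> :: real
  obtain \<rho>1 where \<rho>1: "\<forall>\<tau>\<in>{0..T}. \<forall>t\<in>{0..T}. \<forall>z\<in>cball 0 \<rho>. norm (\<Phi> \<tau> t z) \<le> \<rho>1" using bdd by blast
  obtain C where C: "0 \<le> C" "\<forall>\<tau>\<in>{0..T}. \<forall>t\<in>{0..T}. \<forall>z\<in>cball 0 \<rho>. \<forall>q. norm (Y \<tau> z q t) \<le> C * norm q"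
    using Y_bdd by blast
  have "norm (tangent_flow \<tau> t x) \<le> \<rho>1 + C * \<rho>" if \<tau>: "\<tau> \<in> {0..T}" and t: "t \<in> {0..T}" and x: "norm x \<le> \<rho>" for \<tau> t x
  proof -
    have fx: "norm (fst x) \<le> \<rho>" "norm (snd x) \<le> \<rho>"
      using x norm_fst_le[of "fst x" "snd x"] norm_snd_le[of "snd x" "fst x"] unfolding prod.collapse by linarith+
    have "norm (tangent_flow \<tau> t x) \<le> norm (\<Phi> \<tau> t (fst x)) + norm (Y \<tau> (fst x) (snd x) t)"
      unfolding tangent_flow_def by (rule norm_Pair_le)
    also have "\<dots> \<le> \<rho>1 + C * norm (snd x)" using \<rho>1 C \<tau> t fx by (intro add_mono) auto
    also have "\<dots> \<le> \<rho>1 + C * \<rho>" using C fx by (intro add_mono mult_left_mono) auto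
    finally show ?thesis .
  qed
  then show "\<exists>\<rho>'. \<forall>\<tau>\<in>{0..T}. \<forall>t\<in>{0..T}. \<forall>z\<in>cball 0 \<rho>. norm (tangent_flow \<tau> t z) \<le> \<rho>'"
    by (metis mem_cball_0)
qed (use T in auto)

text \<open>Linearizing the tangent flow at \<open>(z, i)\<close> in direction \<open>(p, 0)\<close>
  moves the base point and leaves the initial tangent vector fixed, so its second component is the
  derivative of \<open>z \<mapsto> D\<Phi> \<tau> t z i\<close> in direction
  \<open>p\<close>.\<close>

definition D2\<Phi> :: "real \<Rightarrow> real \<Rightarrow> 'b \<Rightarrow> 'b \<Rightarrow>\<^sub>L ('b \<Rightarrow>\<^sub>L 'b)" where
  "D2\<Phi> \<tau> t z = Blinfun (\<lambda>p. \<Sum>i\<in>Basis. lift_basis i (snd (tangent.Y \<tau> (z, i) (p, 0) t)))"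

lemma D\<Phi>_component_derivative:
  assumes \<tau>: "\<tau> \<in> {0..T}" and t: "t \<in> {0..T}"
  shows "((\<lambda>z. D\<Phi> \<tau> t z i) has_derivative (\<lambda>p. snd (tangent.Y \<tau> (z, i) (p, 0) t))) (at z)"
proof -
  have "((\<lambda>z. (z, i)) has_derivative (\<lambda>p. (p, 0))) (at z)" by (auto intro!: derivative_eq_intros)
  from has_derivative_snd[OF has_derivative_compose[OF this tangent.flow_has_derivative[OF \<tau> t]]]
  show ?thesis by (simp add: tangent_flow_def D\<Phi>_apply[OF \<tau> t])
qed

lemma D2\<Phi>_has_derivative:
  assumes \<tau>: "\<tau> \<in> {0..T}" and t: "t \<in> {0..T}"
  shows "(D\<Phi> \<tau> t has_derivative blinfun_apply (D2\<Phi> \<tau> t z)) (at z)"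
proof -
  have *: "(D\<Phi> \<tau> t has_derivative (\<lambda>p. \<Sum>i\<in>Basis. lift_basis i (snd (tangent.Y \<tau> (z, i) (p, 0) t)))) (at z)"
    by (intro blinfun_has_derivative_componentwise D\<Phi>_component_derivative[OF \<tau> t])
  then show ?thesis unfolding D2\<Phi>_def
    by (simp add: bounded_linear_Blinfun_apply has_derivative_bounded_linear[OF *])
qed

lemma D2\<Phi>_apply:
  assumes \<tau>: "\<tau> \<in> {0..T}" and t: "t \<in> {0..T}"
  shows "blinfun_apply (D2\<Phi> \<tau> t z) p = (\<Sum>i\<in>Basis. lift_basis i (snd (tangent.Y \<tau> (z, i) (p, 0) t)))"
proof -
  have *: "(D\<Phi> \<tau> t has_derivative (\<lambda>p. \<Sum>i\<in>Basis. lift_basis i (snd (tangent.Y \<tau> (z, i) (p, 0) t)))) (at z)"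
    by (intro blinfun_has_derivative_componentwise D\<Phi>_component_derivative[OF \<tau> t])
  then show ?thesis unfolding D2\<Phi>_def
    by (simp add: bounded_linear_Blinfun_apply has_derivative_bounded_linear[OF *])
qed

lemma D2\<Phi>_continuous:
  assumes t: "t \<in> {0..T}"
  shows "continuous_on ({0..T} \<times> UNIV) (\<lambda>(\<tau>, z). D2\<Phi> \<tau> t z)"
proof (rule continuous_on_blinfun_componentwise)
  fix p :: 'b
  have "continuous_on ({0..T} \<times> UNIV) (\<lambda>x. \<Sum>i\<in>Basis. lift_basis i (snd (tangent.Y (fst x) (snd x, i) (p, 0) t)))"
  proof (intro continuous_on_sum bounded_linear.continuous_on[OF bounded_linear_lift_basis] continuous_on_snd)
    fix i :: 'b
    show "continuous_on ({0..T} \<times> UNIV) (\<lambda>x. tangent.Y (fst x) (snd x, i) (p, 0) t)"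
    proof -
      have "continuous_on ({0..T} \<times> UNIV) (\<lambda>x. (\<lambda>(\<tau>, z). tangent.Y \<tau> z (p, 0) t) (fst x, (snd x, i)))"
        by (rule continuous_on_compose2[OF tangent.Y_continuous[OF t, of "(p, 0)"]]) (auto intro!: continuous_intros)
      then show ?thesis by simp
    qed
  qed
  then show "continuous_on ({0..T} \<times> UNIV) (\<lambda>x. blinfun_apply (case x of (\<tau>, z) \<Rightarrow> D2\<Phi> \<tau> t z) p)"
    by (rule continuous_on_eq) (use t in \<open>auto simp: D2\<Phi>_apply\<close>)
qed

end

section \<open>Control systems\<close>

text \<open>A Lipschitz bound near the point bounds all short difference quotients and hence their
  limit. In this way Lipschitz assumptions on the field become bounds on its derivative.\<close>

lemma has_derivative_norm_le:
  assumes f: "(f has_derivative f') (at x)" and r: "0 < r"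
    and lip: "\<And>y. norm (y - x) < r \<Longrightarrow> norm (f y - f x) \<le> B * norm (y - x)"
  shows "norm (f' q) \<le> B * norm q"
proof (rule field_le_epsilon)
  interpret f': bounded_linear f' using f by (rule has_derivative_bounded_linear)
  fix e :: real assume e: "0 < e"
  define e' where "e' = e / (norm q + 1)"
  have q1: "0 < norm q + 1" by (simp add: add_nonneg_pos)
  have e': "0 < e'" "e' * norm q \<le> e"
    using e q1 by (auto simp: e'_def field_simps)
  obtain d where d: "d > 0" "\<And>y. norm (y - x) < d \<Longrightarrow> norm (f y - f x - f' (y - x)) \<le> e' * norm (y - x)"
    using f e'(1) unfolding has_derivative_at_alt by blast
  \<comment> \<open>Short enough for \<open>t *\<^sub>R q\<close> to stay within both radii; adding
    1 in the denominator covers \<open>q = 0\<close>.\<close>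
  define t where "t = min d r / (2 * (norm q + 1))"
  have t: "0 < t" using d r q1 by (simp add: t_def)
  have "t * norm q < min d r"
  proof -
    have "t * norm q \<le> t * (norm q + 1)" using t by (intro mult_left_mono) auto
    also have "\<dots> = min d r / 2" using q1 unfolding t_def by (simp add: divide_simps)
    also have "\<dots> < min d r" using d(1) r by (simp add: min_def)
    finally show ?thesis .
  qed
  then have near: "norm (x + t *\<^sub>R q - x) < d" "norm (x + t *\<^sub>R q - x) < r" using t by simp_all
  have "t * norm (f' q) = norm (f' (t *\<^sub>R q))" using t by (simp add: f'.scaleR)
  also have "\<dots> \<le> norm (f (x + t *\<^sub>R q) - f x) + norm (f (x + t *\<^sub>R q) - f x - f' (x + t *\<^sub>R q - x))"
    using norm_triangle_ineq4[of "f (x + t *\<^sub>R q) - f x" "f (x + t *\<^sub>R q) - f x - f' (x + t *\<^sub>R q - x)"] by simp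
  also have "\<dots> \<le> B * norm (x + t *\<^sub>R q - x) + e' * norm (x + t *\<^sub>R q - x)"
    by (intro add_mono lip d near)
  also have "\<dots> = t * (B * norm q + e' * norm q)" using t by (simp add: algebra_simps)
  finally have "norm (f' q) \<le> B * norm q + e' * norm q" using t by simp
  then show "norm (f' q) \<le> B * norm q + e" using e'(2) by simp
qed

text \<open>The functional \<open>v \<mapsto> p (B v)\<close> represented as a vector: the
  coordinate-free form of \<open>grad_prod\<close>.\<close>

definition gp :: "('z::euclidean_space \<Rightarrow>\<^sub>L real) \<Rightarrow> ('m::euclidean_space \<Rightarrow>\<^sub>L 'z) \<Rightarrow> 'm" where
  "gp p B = (\<Sum>w\<in>Basis. p (B w) *\<^sub>R w)"

lemma gp_inner: "gp p B \<bullet> v = p (B v)"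
proof -
  have "p (B v) = p (B (\<Sum>w\<in>Basis. (v \<bullet> w) *\<^sub>R w))" by (simp add: euclidean_representation)
  also have "\<dots> = (\<Sum>w\<in>Basis. (v \<bullet> w) * p (B w))"
    by (simp add: blinfun.sum_right blinfun.scaleR_right)
  also have "\<dots> = gp p B \<bullet> v" unfolding gp_def inner_sum_left by (simp add: inner_commute mult.commute)
  finally show ?thesis by simp
qed

lemma gp_diff_left: "gp (p - p') B = gp p B - gp p' B"
  by (simp add: gp_def blinfun.diff_left scaleR_diff_left sum_subtractf)

lemma gp_diff_right: "gp p (B - B') = gp p B - gp p B'"
  by (simp add: gp_def blinfun.diff_left blinfun.diff_right scaleR_diff_left sum_subtractf)

lemma norm_gp: "norm (gp p B) \<le> norm p * norm B"
proof (cases "gp p B = 0")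
  case False
  let ?v = "gp p B"
  have "norm ?v * norm ?v = p (B ?v)" by (simp add: gp_inner[symmetric] flip: power2_norm_eq_inner power2_eq_square)
  also have "\<dots> \<le> norm (p (B ?v))" by simp
  also have "\<dots> \<le> norm p * (norm B * norm ?v)"
    by (intro order_trans[OF norm_blinfun] mult_left_mono norm_blinfun) auto
  finally show ?thesis using False by (simp add: mult.assoc[symmetric])
qed simp

lemma continuous_on_gp:
  assumes "continuous_on S p" "continuous_on S B"
  shows "continuous_on S (\<lambda>x. gp (p x) (B x))"
  unfolding gp_def by (intro continuous_intros assms)

lemma C1_works: "C1 f \<Longrightarrow> (f has_derivative blinfun_apply (Dif f x)) (at x)"
  by (simp add: C1_def Dif_works)

lemma continuous_bounded_cball:
  fixes f :: "'a::euclidean_space \<Rightarrow> 'b::real_normed_vector"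
  assumes "continuous_on UNIV f"
  shows "\<exists>B\<ge>0. \<forall>z\<in>cball 0 \<rho>. norm (f z) \<le> B"
proof -
  have "bounded (f ` cball 0 \<rho>)"
    using assms by (intro compact_imp_bounded compact_continuous_image compact_cball) (rule continuous_on_subset, auto)
  then obtain B where "\<forall>z\<in>cball 0 \<rho>. norm (f z) \<le> B" unfolding bounded_iff by blast
  then show ?thesis by (intro exI[of _ "max B 0"]) auto
qed

text \<open>Bounds that may grow with \<open>\<bar>\<theta>\<bar>\<close> are only assumed on the unit ball: for large \<open>\<lambda>\<close>, every control
  solving the control equation is small.\<close>

locale control_system =
  fixes T :: real
    and F :: "real \<Rightarrow> 'z::euclidean_space \<Rightarrow> 'm::euclidean_space \<Rightarrow> 'z"
    and DF :: "real \<Rightarrow> 'm \<Rightarrow> 'z \<Rightarrow> 'z \<Rightarrow>\<^sub>L 'z"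
    and D2F :: "real \<Rightarrow> 'm \<Rightarrow> 'z \<Rightarrow> 'z \<Rightarrow>\<^sub>L ('z \<Rightarrow>\<^sub>L 'z)"
    and A :: "real \<Rightarrow> 'z \<Rightarrow> 'm \<Rightarrow> 'm \<Rightarrow>\<^sub>L 'z"
    and C L :: real
    and g :: "'z \<Rightarrow> real"
  assumes T: "0 < T" and C: "0 < C" and L: "0 < L"
    and F_cont: "continuous_on ({0..T} \<times> UNIV \<times> UNIV) (\<lambda>(t, z, \<theta>). F t z \<theta>)"
    and growth: "t \<in> {0..T} \<Longrightarrow> norm (F t z \<theta>) \<le> C * (1 + norm z)"
    and lip: "t \<in> {0..T} \<Longrightarrow> norm (F t z \<theta> - F t w \<theta>) \<le> L * (1 + norm \<theta>) * norm (z - w)"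
    and DF: "t \<in> {0..T} \<Longrightarrow> ((\<lambda>z. F t z \<theta>) has_derivative blinfun_apply (DF t \<theta> z)) (at z)"
    and D2F: "t \<in> {0..T} \<Longrightarrow> (DF t \<theta> has_derivative blinfun_apply (D2F t \<theta> z)) (at z)"
    and D2F_cont: "t \<in> {0..T} \<Longrightarrow> continuous_on UNIV (D2F t \<theta>)"
    and D2F_bound: "\<exists>M\<ge>0. \<forall>t\<in>{0..T}. \<forall>\<theta>. \<forall>z\<in>cball 0 \<rho>. norm \<theta> \<le> 1 \<longrightarrow> norm (D2F t \<theta> z) \<le> M"
    and A: "t \<in> {0..T} \<Longrightarrow> (F t z has_derivative blinfun_apply (A t z \<theta>)) (at \<theta>)"
    and A_cont: "continuous_on ({0..T} \<times> UNIV \<times> UNIV) (\<lambda>(t, z, \<theta>). A t z \<theta>)"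
    and A_bound: "\<exists>M\<ge>0. \<forall>t\<in>{0..T}. \<forall>\<theta>. \<forall>z\<in>cball 0 \<rho>. norm (A t z \<theta>) \<le> M"
    and A_lip_state: "\<exists>M\<ge>0. \<forall>t\<in>{0..T}. \<forall>\<theta>. \<forall>z\<in>cball 0 \<rho>. \<forall>w\<in>cball 0 \<rho>. norm \<theta> \<le> 1 \<longrightarrow>
        norm (A t z \<theta> - A t w \<theta>) \<le> M * norm (z - w)"
    and A_lip_control: "\<exists>M\<ge>0. \<forall>t\<in>{0..T}. \<forall>\<theta>\<^sub>1 \<theta>\<^sub>2. \<forall>z\<in>cball 0 \<rho>.
        norm (A t z \<theta>\<^sub>1 - A t z \<theta>\<^sub>2) \<le> M * norm (\<theta>\<^sub>1 - \<theta>\<^sub>2)"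
    and g: "C2 g"
begin

text \<open>The global Lipschitz bound of the field in the state limits the growth of its
  derivative; unlike the second order bounds, it holds for controls of any size.\<close>

lemma DF_norm:
  assumes "t \<in> {0..T}"
  shows "norm (DF t \<theta> z q) \<le> L * (1 + norm \<theta>) * norm q"
  by (rule has_derivative_norm_le[OF DF[OF assms] zero_less_one lip[OF assms]])

lemma F_lip_control: "\<exists>M\<ge>0. \<forall>t\<in>{0..T}. \<forall>\<theta>\<^sub>1 \<theta>\<^sub>2. \<forall>z\<in>cball 0 \<rho>.
    norm (F t z \<theta>\<^sub>1 - F t z \<theta>\<^sub>2) \<le> M * norm (\<theta>\<^sub>1 - \<theta>\<^sub>2)"
proof -
  obtain M where M: "M \<ge> 0" "\<forall>t\<in>{0..T}. \<forall>\<theta>. \<forall>z\<in>cball 0 \<rho>. norm (A t z \<theta>) \<le> M" using A_bound by blast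
  have "norm (F t z \<theta>\<^sub>1 - F t z \<theta>\<^sub>2) \<le> M * norm (\<theta>\<^sub>1 - \<theta>\<^sub>2)" if "t \<in> {0..T}" "z \<in> cball 0 \<rho>" for t z \<theta>\<^sub>1 \<theta>\<^sub>2
    by (rule differentiable_bound[of UNIV "F t z" "\<lambda>\<theta>. blinfun_apply (A t z \<theta>)"])
      (use M that in \<open>auto intro!: A simp: norm_blinfun.rep_eq[symmetric]\<close>)
  then show ?thesis using M(1) by blast
qed

lemma DF_lip_state: "\<exists>M\<ge>0. \<forall>t\<in>{0..T}. \<forall>\<theta>. \<forall>z\<in>cball 0 \<rho>. \<forall>w\<in>cball 0 \<rho>. norm \<theta> \<le> 1 \<longrightarrow>
    norm (DF t \<theta> z - DF t \<theta> w) \<le> M * norm (z - w)"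
proof -
  obtain M where M: "M \<ge> 0" "\<forall>t\<in>{0..T}. \<forall>\<theta>. \<forall>z\<in>cball 0 \<rho>. norm \<theta> \<le> 1 \<longrightarrow> norm (D2F t \<theta> z) \<le> M"
    using D2F_bound[of \<rho>] by blast
  have "norm (DF t \<theta> z - DF t \<theta> w) \<le> M * norm (z - w)"
    if t: "t \<in> {0..T}" and z: "z \<in> cball 0 \<rho>" "w \<in> cball 0 \<rho>" and \<theta>: "norm \<theta> \<le> 1" for t z w \<theta>
  proof (rule differentiable_bound[OF convex_cball _ _ z])
    fix x :: 'z assume x: "x \<in> cball 0 \<rho>"
    show "(DF t \<theta> has_derivative blinfun_apply (D2F t \<theta> x)) (at x within cball 0 \<rho>)"
      by (rule has_derivative_at_withinI[OF D2F[OF t]])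
    show "onorm (blinfun_apply (D2F t \<theta> x)) \<le> M"
      using M t \<theta> x by (simp add: norm_blinfun.rep_eq[symmetric])
  qed
  then show ?thesis using M(1) by blast
qed

text \<open>Interchanging the order of the two derivatives: a Lipschitz bound for \<open>A\<close> in the state is a
  Lipschitz bound for \<open>DF\<close> in the control.\<close>

lemma DF_lip_control: "\<exists>M\<ge>0. \<forall>t\<in>{0..T}. \<forall>\<theta>\<^sub>1 \<theta>\<^sub>2. \<forall>z\<in>cball 0 \<rho>. norm \<theta>\<^sub>1 \<le> 1 \<longrightarrow> norm \<theta>\<^sub>2 \<le> 1 \<longrightarrow>
    (\<forall>q. norm (DF t \<theta>\<^sub>1 z q - DF t \<theta>\<^sub>2 z q) \<le> M * norm (\<theta>\<^sub>1 - \<theta>\<^sub>2) * norm q)"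
proof -
  \<comment> \<open>The ball is enlarged by 1 to hold the neighbourhood of \<open>z\<close> on which
    \<open>has_derivative_norm_le\<close> tests increments.\<close>
  obtain M where M: "M \<ge> 0" "\<forall>t\<in>{0..T}. \<forall>\<theta>. \<forall>z\<in>cball 0 (\<rho> + 1). \<forall>w\<in>cball 0 (\<rho> + 1). norm \<theta> \<le> 1 \<longrightarrow>
        norm (A t z \<theta> - A t w \<theta>) \<le> M * norm (z - w)" using A_lip_state[of "\<rho> + 1"] by blast
  have "norm (DF t \<theta>\<^sub>1 z q - DF t \<theta>\<^sub>2 z q) \<le> M * norm (\<theta>\<^sub>1 - \<theta>\<^sub>2) * norm q"
    if t: "t \<in> {0..T}" and z: "z \<in> cball 0 \<rho>" and \<theta>: "norm \<theta>\<^sub>1 \<le> 1" "norm \<theta>\<^sub>2 \<le> 1" for t z \<theta>\<^sub>1 \<theta>\<^sub>2 q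
  proof (rule has_derivative_norm_le[OF has_derivative_diff[OF DF[OF t] DF[OF t]] zero_less_one])
    fix y assume y: "norm (y - z) < 1"
    have y': "norm y \<le> \<rho> + 1" using y z norm_triangle_sub[of y z] by simp
    \<comment> \<open>A mixed second difference: the increment in the state is differentiated in the
      control, with derivative \<open>A t y \<theta> - A t z \<theta>\<close>.\<close>
    have "norm ((F t y \<theta>\<^sub>1 - F t z \<theta>\<^sub>1) - (F t y \<theta>\<^sub>2 - F t z \<theta>\<^sub>2)) \<le> (M * norm (y - z)) * norm (\<theta>\<^sub>1 - \<theta>\<^sub>2)"
    proof (rule differentiable_bound[of "cball 0 1"])
      fix \<theta> :: 'm assume \<theta>: "\<theta> \<in> cball 0 1"
      show "((\<lambda>\<theta>. F t y \<theta> - F t z \<theta>) has_derivative (\<lambda>h. A t y \<theta> h - A t z \<theta> h)) (at \<theta> within cball 0 1)"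
        by (rule has_derivative_at_withinI[OF has_derivative_diff[OF A[OF t] A[OF t]]])
      have "norm (A t y \<theta> - A t z \<theta>) \<le> M * norm (y - z)" using M(2) t y' z \<theta> by simp
      moreover have "blinfun_apply (A t y \<theta> - A t z \<theta>) = (\<lambda>h. A t y \<theta> h - A t z \<theta> h)"
        by (rule ext) (rule blinfun.diff_left)
      ultimately show "onorm (\<lambda>h. A t y \<theta> h - A t z \<theta> h) \<le> M * norm (y - z)"
        by (simp only: norm_blinfun.rep_eq)
    qed (use \<theta> in auto)
    then show "norm (F t y \<theta>\<^sub>1 - F t y \<theta>\<^sub>2 - (F t z \<theta>\<^sub>1 - F t z \<theta>\<^sub>2)) \<le> M * norm (\<theta>\<^sub>1 - \<theta>\<^sub>2) * norm (y - z)"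
      by (simp add: algebra_simps)
  qed
  then show ?thesis using M(1) by blast
qed

text \<open>The summand \<open>C\<close> lets one weight dominate both the Lipschitz constant and
  the size of the field at the origin. All constants below depend on \<open>N\<close> and a radius,
  but on no individual control.\<close>

definition adm :: "real \<Rightarrow> (real \<Rightarrow> 'm) \<Rightarrow> bool" where
  "adm N \<theta> \<longleftrightarrow> \<theta> \<in> borel_measurable (lebesgue_on {0..T}) \<and> weight T (\<lambda>t. C + L * (1 + norm (\<theta> t))) N"

definition is_flow :: "(real \<Rightarrow> 'm) \<Rightarrow> (real \<Rightarrow> real \<Rightarrow> 'z \<Rightarrow> 'z) \<Rightarrow> bool" where
  "is_flow \<theta> \<Phi> \<longleftrightarrow> (\<forall>\<tau>\<in>{0..T}. \<forall>z. sol T (\<lambda>s z. F s z (\<theta> s)) \<tau> z (\<lambda>t. \<Phi> \<tau> t z))"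

lemma F_clamp_cont: "continuous_on UNIV (\<lambda>(t, z, \<theta>). F (clampT T t) z \<theta>)"
proof -
  have "continuous_on UNIV (\<lambda>x. (\<lambda>(t, z, \<theta>). F t z \<theta>) (clampT T (fst x), fst (snd x), snd (snd x)))"
    using clampT_in[of T] T
    by (intro continuous_on_compose2[OF F_cont] continuous_intros continuous_on_compose2[OF continuous_clampT[of UNIV]]) auto
  then show ?thesis by (simp add: case_prod_beta)
qed

text \<open>With time clamped to the interval, the field is continuous on the whole product, hence
  Borel, and can be composed with a control that is only Lebesgue measurable.\<close>

lemma F_measurable:
  assumes \<theta>: "\<theta> \<in> borel_measurable (lebesgue_on {0..T})" and c: "continuous_on {0..T} c"
  shows "(\<lambda>s. F s (c s) (\<theta> s)) \<in> borel_measurable (lebesgue_on {0..T})"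
proof -
  have 1: "(\<lambda>s. (s, (c s, \<theta> s))) \<in> borel_measurable (lebesgue_on {0..T})"
    by (intro borel_measurable_Pair \<theta> continuous_imp_measurable_on_sets_lebesgue c) (auto intro: continuous_intros)
  have 2: "(\<lambda>(t, z, \<theta>). F (clampT T t) z \<theta>) \<in> borel_measurable borel"
    by (rule borel_measurable_continuous_onI[OF F_clamp_cont])
  have "(\<lambda>s. F (clampT T s) (c s) (\<theta> s)) \<in> borel_measurable (lebesgue_on {0..T})"
    using measurable_compose[OF 1 2] by simp
  then show ?thesis
    by (rule measurable_cong[THEN iffD1, rotated]) (simp add: clampT_id)
qed

lemma meas_field_F: "adm N \<theta> \<Longrightarrow> meas_field T (\<lambda>s z. F s z (\<theta> s))"
  unfolding meas_field_def adm_def using F_measurable by blast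

lemma flow_exists:
  assumes "adm N \<theta>"
  shows "\<exists>\<Phi>. is_flow \<theta> \<Phi>"
proof -
  have *: "\<exists>X. sol T (\<lambda>s z. F s z (\<theta> s)) \<tau> z X" if \<tau>: "\<tau> \<in> {0..T}" for \<tau> z
  proof (rule sol_exists[OF _ meas_field_F[OF assms] _ \<tau>])
    show "weight T (\<lambda>t. C + L * (1 + norm (\<theta> t))) N" using assms by (simp add: adm_def)
    fix s v w assume s: "s \<in> {0..T}"
    show "norm (F s v (\<theta> s) - F s w (\<theta> s)) \<le> (C + L * (1 + norm (\<theta> s))) * norm (v - w)"
      using C by (intro order_trans[OF lip[OF s]] mult_right_mono) auto
    have "norm (F s 0 (\<theta> s)) \<le> C" using growth[OF s, of 0] by simp
    also have "\<dots> \<le> C + L * (1 + norm (\<theta> s))" using L by simp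
    finally show "norm (F s 0 (\<theta> s)) \<le> C + L * (1 + norm (\<theta> s))" .
  qed (use T in auto)
  have "is_flow \<theta> (\<lambda>\<tau> t z. (SOME X. sol T (\<lambda>s z. F s z (\<theta> s)) \<tau> z X) t)"
    unfolding is_flow_def by (intro ballI allI someI_ex[OF *])
  then show ?thesis by blast
qed

text \<open>The radius that Gronwall gives for trajectories, in either time direction, that start
  within distance \<rho> of the origin; \<open>C * T\<close> integrates the constant part of the
  linear growth.\<close>

definition rad :: "real \<Rightarrow> real \<Rightarrow> real" where
  "rad N \<rho> = (\<rho> + C * T) * gron T N"

lemma flow_bound:
  assumes "adm N \<theta>" "is_flow \<theta> \<Phi>" "\<tau> \<in> {0..T}" "t \<in> {0..T}" "norm z \<le> \<rho>"
  shows "norm (\<Phi> \<tau> t z) \<le> rad N \<rho>"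
proof -
  have "norm (\<Phi> \<tau> t z) \<le> (norm z + integral {0..T} (\<lambda>_. C)) * gron T N"
  proof (rule sol_bound[where k = "\<lambda>t. C + L * (1 + norm (\<theta> t))"])
    show "sol T (\<lambda>s z. F s z (\<theta> s)) \<tau> z (\<lambda>t. \<Phi> \<tau> t z)" using assms by (simp add: is_flow_def)
    show "weight T (\<lambda>t. C + L * (1 + norm (\<theta> t))) N" using assms by (simp add: adm_def)
    fix s assume s: "s \<in> {0..T}"
    have "norm (F s (\<Phi> \<tau> s z) (\<theta> s)) \<le> C * (1 + norm (\<Phi> \<tau> s z))" by (rule growth[OF s])
    also have "\<dots> \<le> (C + L * (1 + norm (\<theta> s))) * norm (\<Phi> \<tau> s z) + C"
      using C L by (simp add: algebra_simps)
    finally show "norm (F s (\<Phi> \<tau> s z) (\<theta> s)) \<le> (C + L * (1 + norm (\<theta> s))) * norm (\<Phi> \<tau> s z) + C" .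
  qed (use assms C in auto)
  also have "\<dots> \<le> (\<rho> + C * T) * gron T N"
    using assms(5) gron_pos[of T N] T by (intro mult_right_mono) (auto simp: mult.commute)
  finally show ?thesis by (simp add: rad_def)
qed

lemma flow_c1:
  assumes \<theta>: "adm N \<theta>" and \<Phi>: "is_flow \<theta> \<Phi>"
  shows "c1_flow T (\<lambda>s z. F s z (\<theta> s)) (\<lambda>s z. blinfun_apply (DF s (\<theta> s) z)) \<Phi>"
proof
  show "meas_field T (\<lambda>s z. F s z (\<theta> s))" by (rule meas_field_F[OF \<theta>])
  show "((\<lambda>z. F s z (\<theta> s)) has_derivative blinfun_apply (DF s (\<theta> s) z)) (at z)" if "s \<in> {0..T}" for s z
    using that by (rule DF)
  show "continuous_on UNIV (\<lambda>z. blinfun_apply (DF s (\<theta> s) z) q)" if s: "s \<in> {0..T}" for s q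
    by (intro continuous_intros continuous_at_imp_continuous_on ballI has_derivative_continuous[OF D2F[OF s]])
  show "sol T (\<lambda>s z. F s z (\<theta> s)) \<tau> z (\<lambda>t. \<Phi> \<tau> t z)" if "\<tau> \<in> {0..T}" for \<tau> z
    using \<Phi> that by (simp add: is_flow_def)
  show "\<exists>\<rho>'. \<forall>\<tau>\<in>{0..T}. \<forall>t\<in>{0..T}. \<forall>z\<in>cball 0 \<rho>. norm (\<Phi> \<tau> t z) \<le> \<rho>'" for \<rho>
    using flow_bound[OF \<theta> \<Phi>] by (intro exI[of _ "rad N \<rho>"]) auto
  fix \<rho> :: real
  define c where "c = 1 + \<bar>\<rho>\<bar>"
  have w: "weight T (\<lambda>t. C + L * (1 + norm (\<theta> t))) N" using \<theta> by (simp add: adm_def)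
  have "norm (F s z (\<theta> s)) \<le> c * (C + L * (1 + norm (\<theta> s))) \<and>
    (\<forall>q. norm (DF s (\<theta> s) z q) \<le> c * (C + L * (1 + norm (\<theta> s))) * norm q)"
    if s: "s \<in> {0..T}" and z: "z \<in> cball 0 \<rho>" for s z
  proof (intro conjI allI)
    have "norm (F s z (\<theta> s)) \<le> C * (1 + norm z)" by (rule growth[OF s])
    also have "\<dots> \<le> (C + L * (1 + norm (\<theta> s))) * c" using z C L unfolding c_def by (intro mult_mono) auto
    finally show "norm (F s z (\<theta> s)) \<le> c * (C + L * (1 + norm (\<theta> s)))" by (simp add: mult.commute)
    fix q
    have "norm (DF s (\<theta> s) z q) \<le> 1 * (L * (1 + norm (\<theta> s))) * norm q" using DF_norm[OF s] by simp
    also have "\<dots> \<le> c * (C + L * (1 + norm (\<theta> s))) * norm q"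
      using C L unfolding c_def by (intro mult_right_mono mult_mono) auto
    finally show "norm (DF s (\<theta> s) z q) \<le> c * (C + L * (1 + norm (\<theta> s))) * norm q" .
  qed
  moreover have "weight T (\<lambda>t. c * (C + L * (1 + norm (\<theta> t)))) (c\<^sup>2 * N)"
    by (rule weight_scale[OF w]) (simp add: c_def)
  ultimately show "\<exists>k N. weight T k N \<and> (\<forall>s\<in>{0..T}. \<forall>z\<in>cball 0 \<rho>. norm (F s z (\<theta> s)) \<le> k s \<and>
      (\<forall>q. norm (DF s (\<theta> s) z q) \<le> k s * norm q))"
    by (intro exI[of _ "\<lambda>t. c * (C + L * (1 + norm (\<theta> t)))"] exI[of _ "c\<^sup>2 * N"]) blast
qed (rule T)

text \<open>For controls in the unit ball the second derivatives are bounded on balls of states, so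
  a constant weight serves.\<close>

lemma flow_c2:
  assumes \<theta>: "adm N \<theta>" and \<Phi>: "is_flow \<theta> \<Phi>" and le1: "\<And>s. s \<in> {0..T} \<Longrightarrow> norm (\<theta> s) \<le> 1"
  shows "c2_flow T (\<lambda>s z. F s z (\<theta> s)) (\<lambda>s. DF s (\<theta> s)) (\<lambda>s. D2F s (\<theta> s)) \<Phi>"
proof (intro c2_flow.intro flow_c1[OF \<theta> \<Phi>])
  show "(DF s (\<theta> s) has_derivative blinfun_apply (D2F s (\<theta> s) z)) (at z)" if "s \<in> {0..T}" for s z
    using that by (rule D2F)
  show "continuous_on UNIV (D2F s (\<theta> s))" if "s \<in> {0..T}" for s using that by (rule D2F_cont)
  fix \<rho> :: real
  obtain M where M: "M \<ge> 0" "\<forall>t\<in>{0..T}. \<forall>\<theta>. \<forall>z\<in>cball 0 \<rho>. norm \<theta> \<le> 1 \<longrightarrow> norm (D2F t \<theta> z) \<le> M"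
    using D2F_bound[of \<rho>] by blast
  define c where "c = M + C * (1 + \<bar>\<rho>\<bar>) + 2 * L"
  have c: "0 \<le> c" "M \<le> c" "C * (1 + \<bar>\<rho>\<bar>) \<le> c" "2 * L \<le> c" using M C L by (auto simp: c_def)
  have "norm (F s z (\<theta> s)) \<le> c \<and> norm (DF s (\<theta> s) z) \<le> c \<and> norm (D2F s (\<theta> s) z) \<le> c"
    if s: "s \<in> {0..T}" and z: "z \<in> cball 0 \<rho>" for s z
  proof (intro conjI)
    have "norm (F s z (\<theta> s)) \<le> C * (1 + norm z)" by (rule growth[OF s])
    also have "\<dots> \<le> C * (1 + \<bar>\<rho>\<bar>)" using z C by (intro mult_left_mono) auto
    finally show "norm (F s z (\<theta> s)) \<le> c" using c by simp
    have "norm (DF s (\<theta> s) z) \<le> L * (1 + norm (\<theta> s))"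
      using L by (intro norm_blinfun_bound DF_norm[OF s]) auto
    also have "\<dots> \<le> L * 2" using L le1[OF s] by (intro mult_left_mono) auto
    finally show "norm (DF s (\<theta> s) z) \<le> c" using c by simp
    show "norm (D2F s (\<theta> s) z) \<le> c" using M s z le1[OF s] c by (meson order_trans)
  qed
  moreover have "weight T (\<lambda>_. c) (T * c\<^sup>2)" using c T by (simp add: weight_def integrable_const_ivl)
  ultimately show "\<exists>k N. weight T k N \<and> (\<forall>s\<in>{0..T}. \<forall>z\<in>cball 0 \<rho>. norm (F s z (\<theta> s)) \<le> k s \<and>
      norm (DF s (\<theta> s) z) \<le> k s \<and> norm (D2F s (\<theta> s) z) \<le> k s)"
    by (intro exI[of _ "\<lambda>_. c"] exI[of _ "T * c\<^sup>2"]) blast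
qed


text \<open>In \<open>sol_stable\<close> a change of control acts as a forcing term that is
  integrated over time, so the mean distance is the natural one.\<close>

definition dist1 :: "(real \<Rightarrow> 'm) \<Rightarrow> (real \<Rightarrow> 'm) \<Rightarrow> real" where
  "dist1 \<theta>\<^sub>1 \<theta>\<^sub>2 = integral {0..T} (\<lambda>s. norm (\<theta>\<^sub>1 s - \<theta>\<^sub>2 s))"

lemma adm_integrable:
  assumes "adm N \<theta>"
  shows "\<theta> absolutely_integrable_on {0..T}"
proof (rule measurable_bounded_by_integrable_imp_absolutely_integrable)
  show "(\<lambda>s. (1 / L) * (C + L * (1 + norm (\<theta> s)))) integrable_on {0..T}"
    using assms by (intro integrable_on_mult_right set_lebesgue_integral_eq_integral(1) weight_integrable) (auto simp: adm_def)
  show "norm (\<theta> s) \<le> (1 / L) * (C + L * (1 + norm (\<theta> s)))" for s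
    using C L by (simp add: field_simps)
qed (use assms in \<open>auto simp: adm_def\<close>)

lemma dist1_integrable:
  assumes "adm N \<theta>\<^sub>1" "adm N \<theta>\<^sub>2"
  shows "(\<lambda>s. norm (\<theta>\<^sub>1 s - \<theta>\<^sub>2 s)) integrable_on {0..T}"
  using set_integral_diff(1)[OF adm_integrable[OF assms(1)] adm_integrable[OF assms(2)]]
  by (simp add: absolutely_integrable_on_def)

lemma dist1_nonneg: "0 \<le> dist1 \<theta>\<^sub>1 \<theta>\<^sub>2"
  unfolding dist1_def by (cases "(\<lambda>s. norm (\<theta>\<^sub>1 s - \<theta>\<^sub>2 s)) integrable_on {0..T}")
    (auto intro: Henstock_Kurzweil_Integration.integral_nonneg simp: not_integrable_integral)

text \<open>A second control adds the forcing
  \<open>M * norm (\<theta>\<^sub>1 s - \<theta>\<^sub>2 s)\<close>, with \<open>M\<close> taken on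
  the ball that traps the trajectories. The constant is quantified before the controls, because the
  threshold for \<lambda> will be computed from it.\<close>

lemma flow_stable:
  "\<exists>K\<ge>0. \<forall>\<theta>\<^sub>1 \<theta>\<^sub>2 \<Phi>\<^sub>1 \<Phi>\<^sub>2. adm N \<theta>\<^sub>1 \<longrightarrow> adm N \<theta>\<^sub>2 \<longrightarrow> is_flow \<theta>\<^sub>1 \<Phi>\<^sub>1 \<longrightarrow> is_flow \<theta>\<^sub>2 \<Phi>\<^sub>2 \<longrightarrow>
    (\<forall>\<tau>\<in>{0..T}. \<forall>t\<in>{0..T}. \<forall>z\<^sub>1\<in>cball 0 \<rho>. \<forall>z\<^sub>2\<in>cball 0 \<rho>.
      norm (\<Phi>\<^sub>1 \<tau> t z\<^sub>1 - \<Phi>\<^sub>2 \<tau> t z\<^sub>2) \<le> K * (norm (z\<^sub>1 - z\<^sub>2) + dist1 \<theta>\<^sub>1 \<theta>\<^sub>2))"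
proof -
  obtain M where M: "M \<ge> 0" "\<forall>t\<in>{0..T}. \<forall>\<theta>\<^sub>1 \<theta>\<^sub>2. \<forall>z\<in>cball 0 (rad N \<rho>).
    norm (F t z \<theta>\<^sub>1 - F t z \<theta>\<^sub>2) \<le> M * norm (\<theta>\<^sub>1 - \<theta>\<^sub>2)" using F_lip_control[of "rad N \<rho>"] by blast
  define K where "K = (1 + M) * gron T N"
  have K: "0 \<le> K" using M gron_pos[of T N] by (simp add: K_def)
  have "norm (\<Phi>\<^sub>1 \<tau> t z\<^sub>1 - \<Phi>\<^sub>2 \<tau> t z\<^sub>2) \<le> K * (norm (z\<^sub>1 - z\<^sub>2) + dist1 \<theta>\<^sub>1 \<theta>\<^sub>2)"
    if 1: "adm N \<theta>\<^sub>1" "is_flow \<theta>\<^sub>1 \<Phi>\<^sub>1" and 2: "adm N \<theta>\<^sub>2" "is_flow \<theta>\<^sub>2 \<Phi>\<^sub>2"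
      and t: "\<tau> \<in> {0..T}" "t \<in> {0..T}" and z: "z\<^sub>1 \<in> cball 0 \<rho>" "z\<^sub>2 \<in> cball 0 \<rho>"
    for \<theta>\<^sub>1 \<theta>\<^sub>2 \<Phi>\<^sub>1 \<Phi>\<^sub>2 \<tau> t z\<^sub>1 z\<^sub>2
  proof -
    have "norm (\<Phi>\<^sub>1 \<tau> t z\<^sub>1 - \<Phi>\<^sub>2 \<tau> t z\<^sub>2)
      \<le> (norm (z\<^sub>1 - z\<^sub>2) + integral {0..T} (\<lambda>s. M * norm (\<theta>\<^sub>1 s - \<theta>\<^sub>2 s))) * gron T N"
    proof (rule sol_stable[where k = "\<lambda>t. C + L * (1 + norm (\<theta>\<^sub>1 t))"])
      show "sol T (\<lambda>s z. F s z (\<theta>\<^sub>1 s)) \<tau> z\<^sub>1 (\<lambda>t. \<Phi>\<^sub>1 \<tau> t z\<^sub>1)" "sol T (\<lambda>s z. F s z (\<theta>\<^sub>2 s)) \<tau> z\<^sub>2 (\<lambda>t. \<Phi>\<^sub>2 \<tau> t z\<^sub>2)"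
        using 1 2 t by (auto simp: is_flow_def)
      show "weight T (\<lambda>t. C + L * (1 + norm (\<theta>\<^sub>1 t))) N" using 1 by (simp add: adm_def)
      show "(\<lambda>s. M * norm (\<theta>\<^sub>1 s - \<theta>\<^sub>2 s)) integrable_on {0..T}"
        by (intro integrable_on_mult_right dist1_integrable[OF 1(1) 2(1)])
      fix s assume s: "s \<in> {0..T}"
      let ?a = "\<Phi>\<^sub>1 \<tau> s z\<^sub>1" and ?b = "\<Phi>\<^sub>2 \<tau> s z\<^sub>2"
      have "norm (F s ?a (\<theta>\<^sub>1 s) - F s ?b (\<theta>\<^sub>2 s))
        \<le> norm (F s ?a (\<theta>\<^sub>1 s) - F s ?b (\<theta>\<^sub>1 s)) + norm (F s ?b (\<theta>\<^sub>1 s) - F s ?b (\<theta>\<^sub>2 s))"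
        using norm_triangle_ineq[of "F s ?a (\<theta>\<^sub>1 s) - F s ?b (\<theta>\<^sub>1 s)" "F s ?b (\<theta>\<^sub>1 s) - F s ?b (\<theta>\<^sub>2 s)"] by simp
      also have "\<dots> \<le> (C + L * (1 + norm (\<theta>\<^sub>1 s))) * norm (?a - ?b) + M * norm (\<theta>\<^sub>1 s - \<theta>\<^sub>2 s)"
      proof (intro add_mono)
        show "norm (F s ?a (\<theta>\<^sub>1 s) - F s ?b (\<theta>\<^sub>1 s)) \<le> (C + L * (1 + norm (\<theta>\<^sub>1 s))) * norm (?a - ?b)"
          using C by (intro order_trans[OF lip[OF s]] mult_right_mono) auto
        show "norm (F s ?b (\<theta>\<^sub>1 s) - F s ?b (\<theta>\<^sub>2 s)) \<le> M * norm (\<theta>\<^sub>1 s - \<theta>\<^sub>2 s)"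
          using M(2) s flow_bound[OF 2 t(1) s, of z\<^sub>2 \<rho>] z by auto
      qed
      finally show "norm (F s ?a (\<theta>\<^sub>1 s) - F s ?b (\<theta>\<^sub>2 s))
        \<le> (C + L * (1 + norm (\<theta>\<^sub>1 s))) * norm (?a - ?b) + M * norm (\<theta>\<^sub>1 s - \<theta>\<^sub>2 s)" .
    qed (use t M in auto)
    also have "\<dots> = (norm (z\<^sub>1 - z\<^sub>2) + M * dist1 \<theta>\<^sub>1 \<theta>\<^sub>2) * gron T N" by (simp add: dist1_def)
    also have "\<dots> \<le> ((1 + M) * (norm (z\<^sub>1 - z\<^sub>2) + dist1 \<theta>\<^sub>1 \<theta>\<^sub>2)) * gron T N"
      using M(1) gron_pos[of T N] dist1_nonneg[of \<theta>\<^sub>1 \<theta>\<^sub>2] by (intro mult_right_mono) (auto simp: algebra_simps)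
    finally show ?thesis by (simp add: K_def mult_ac)
  qed
  then show ?thesis using K by blast
qed

lemma deriv_sol:
  assumes \<theta>: "adm N \<theta>" and \<Phi>: "is_flow \<theta> \<Phi>" and \<tau>: "\<tau> \<in> {0..T}"
  obtains X where "sol T (\<lambda>s. blinfun_apply (DF s (\<theta> s) (\<Phi> \<tau> s z))) \<tau> q X"
    "\<And>t. t \<in> {0..T} \<Longrightarrow> X t = Dif (\<Phi> \<tau> t) z q"
proof -
  interpret c1_flow T "\<lambda>s z. F s z (\<theta> s)" "\<lambda>s z. blinfun_apply (DF s (\<theta> s) z)" \<Phi>
    by (rule flow_c1[OF \<theta> \<Phi>])
  show ?thesis
    by (rule that[OF Y_sol[OF \<tau>]]) (simp add: Dif_flow[OF \<tau>] D\<Phi>_apply[OF \<tau>])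
qed

lemma flow_has_Dif:
  assumes "adm N \<theta>" "is_flow \<theta> \<Phi>" "\<tau> \<in> {0..T}" "t \<in> {0..T}"
  shows "(\<Phi> \<tau> t has_derivative blinfun_apply (Dif (\<Phi> \<tau> t) z)) (at z)"
proof -
  interpret c1_flow T "\<lambda>s z. F s z (\<theta> s)" "\<lambda>s z. blinfun_apply (DF s (\<theta> s) z)" \<Phi>
    by (rule flow_c1[OF assms(1,2)])
  show ?thesis using D\<Phi>_has_derivative[OF assms(3,4)] Dif_flow[OF assms(3,4)] by simp
qed

lemma Dif_flow_bound:
  assumes \<theta>: "adm N \<theta>" and \<Phi>: "is_flow \<theta> \<Phi>" and \<tau>: "\<tau> \<in> {0..T}" and t: "t \<in> {0..T}"
  shows "norm (Dif (\<Phi> \<tau> t) z q) \<le> gron T N * norm q"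
proof -
  obtain X where X: "sol T (\<lambda>s. blinfun_apply (DF s (\<theta> s) (\<Phi> \<tau> s z))) \<tau> q X"
    "\<And>t. t \<in> {0..T} \<Longrightarrow> X t = Dif (\<Phi> \<tau> t) z q" using deriv_sol[OF \<theta> \<Phi> \<tau>] by metis
  have "norm (X t) \<le> (norm q + integral {0..T} (\<lambda>_. 0)) * gron T N"
  proof (rule sol_bound[OF X(1) _ \<tau> t, where k = "\<lambda>t. C + L * (1 + norm (\<theta> t))"])
    show "weight T (\<lambda>t. C + L * (1 + norm (\<theta> t))) N" using \<theta> by (simp add: adm_def)
    fix s assume s: "s \<in> {0..T}"
    have "norm (DF s (\<theta> s) (\<Phi> \<tau> s z) (X s)) \<le> L * (1 + norm (\<theta> s)) * norm (X s)" by (rule DF_norm[OF s])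
    also have "\<dots> \<le> (C + L * (1 + norm (\<theta> s))) * norm (X s) + 0" using C by (simp add: mult_right_mono)
    finally show "norm (DF s (\<theta> s) (\<Phi> \<tau> s z) (X s)) \<le> (C + L * (1 + norm (\<theta> s))) * norm (X s) + 0" .
  qed (auto intro: integrable_0)
  then show ?thesis using X(2)[OF t] by (simp add: mult.commute)
qed

text \<open>The two variational equations differ in the solution, in the base point and in the
  control. Gronwall absorbs the first difference; the other two are forcing terms, controlled by
  \<open>DF_lip_state\<close> together with \<open>flow_stable\<close> and by
  \<open>DF_lip_control\<close>.\<close>

lemma Dif_flow_stable:
  "\<exists>K\<ge>0. \<forall>\<theta>\<^sub>1 \<theta>\<^sub>2 \<Phi>\<^sub>1 \<Phi>\<^sub>2. adm N \<theta>\<^sub>1 \<longrightarrow> adm N \<theta>\<^sub>2 \<longrightarrow> is_flow \<theta>\<^sub>1 \<Phi>\<^sub>1 \<longrightarrow> is_flow \<theta>\<^sub>2 \<Phi>\<^sub>2 \<longrightarrow>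
    (\<forall>s\<in>{0..T}. norm (\<theta>\<^sub>1 s) \<le> 1 \<and> norm (\<theta>\<^sub>2 s) \<le> 1) \<longrightarrow>
    (\<forall>\<tau>\<in>{0..T}. \<forall>t\<in>{0..T}. \<forall>z\<^sub>1\<in>cball 0 \<rho>. \<forall>z\<^sub>2\<in>cball 0 \<rho>. \<forall>q.
      norm (Dif (\<Phi>\<^sub>1 \<tau> t) z\<^sub>1 q - Dif (\<Phi>\<^sub>2 \<tau> t) z\<^sub>2 q) \<le> K * (norm (z\<^sub>1 - z\<^sub>2) + dist1 \<theta>\<^sub>1 \<theta>\<^sub>2) * norm q)"
proof -
  obtain M where M: "M \<ge> 0" "\<And>t \<theta>\<^sub>1 \<theta>\<^sub>2 z q. t \<in> {0..T} \<Longrightarrow> z \<in> cball 0 (rad N \<rho>) \<Longrightarrow> norm \<theta>\<^sub>1 \<le> 1 \<Longrightarrow> norm \<theta>\<^sub>2 \<le> 1 \<Longrightarrow>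
    norm (DF t \<theta>\<^sub>1 z q - DF t \<theta>\<^sub>2 z q) \<le> M * norm (\<theta>\<^sub>1 - \<theta>\<^sub>2) * norm q" using DF_lip_control[of "rad N \<rho>"] by blast
  obtain M' where M': "M' \<ge> 0" "\<And>t \<theta> z w. t \<in> {0..T} \<Longrightarrow> z \<in> cball 0 (rad N \<rho>) \<Longrightarrow> w \<in> cball 0 (rad N \<rho>) \<Longrightarrow> norm \<theta> \<le> 1 \<Longrightarrow>
    norm (DF t \<theta> z - DF t \<theta> w) \<le> M' * norm (z - w)" using DF_lip_state[of "rad N \<rho>"] by blast
  obtain K1 where K1: "K1 \<ge> 0" "\<And>\<theta>\<^sub>1 \<theta>\<^sub>2 \<Phi>\<^sub>1 \<Phi>\<^sub>2 \<tau> t z\<^sub>1 z\<^sub>2. adm N \<theta>\<^sub>1 \<Longrightarrow> adm N \<theta>\<^sub>2 \<Longrightarrow> is_flow \<theta>\<^sub>1 \<Phi>\<^sub>1 \<Longrightarrow> is_flow \<theta>\<^sub>2 \<Phi>\<^sub>2 \<Longrightarrow>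
    \<tau>\<in>{0..T} \<Longrightarrow> t\<in>{0..T} \<Longrightarrow> z\<^sub>1\<in>cball 0 \<rho> \<Longrightarrow> z\<^sub>2\<in>cball 0 \<rho> \<Longrightarrow>
      norm (\<Phi>\<^sub>1 \<tau> t z\<^sub>1 - \<Phi>\<^sub>2 \<tau> t z\<^sub>2) \<le> K1 * (norm (z\<^sub>1 - z\<^sub>2) + dist1 \<theta>\<^sub>1 \<theta>\<^sub>2)"
    using flow_stable[of N \<rho>] by blast
  define G where "G = gron T N"
  have G: "0 \<le> G" using gron_pos[of T N] by (simp add: G_def)
  \<comment> \<open>One factor \<open>G\<close> bounds the solution \<open>X2\<close> inside the
    forcing, the other comes from Gronwall.\<close>
  define K where "K = (M' * K1 * T + M) * G * G"
  have K: "0 \<le> K" using M M' K1 G T by (simp add: K_def)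
  have "norm (Dif (\<Phi>\<^sub>1 \<tau> t) z\<^sub>1 q - Dif (\<Phi>\<^sub>2 \<tau> t) z\<^sub>2 q) \<le> K * (norm (z\<^sub>1 - z\<^sub>2) + dist1 \<theta>\<^sub>1 \<theta>\<^sub>2) * norm q"
    if 1: "adm N \<theta>\<^sub>1" "is_flow \<theta>\<^sub>1 \<Phi>\<^sub>1" and 2: "adm N \<theta>\<^sub>2" "is_flow \<theta>\<^sub>2 \<Phi>\<^sub>2"
      and le1: "\<forall>s\<in>{0..T}. norm (\<theta>\<^sub>1 s) \<le> 1 \<and> norm (\<theta>\<^sub>2 s) \<le> 1"
      and \<tau>: "\<tau> \<in> {0..T}" and t: "t \<in> {0..T}" and z: "z\<^sub>1 \<in> cball 0 \<rho>" "z\<^sub>2 \<in> cball 0 \<rho>"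
    for \<theta>\<^sub>1 \<theta>\<^sub>2 \<Phi>\<^sub>1 \<Phi>\<^sub>2 \<tau> t z\<^sub>1 z\<^sub>2 q
  proof -
    obtain X1 where X1: "sol T (\<lambda>s. blinfun_apply (DF s (\<theta>\<^sub>1 s) (\<Phi>\<^sub>1 \<tau> s z\<^sub>1))) \<tau> q X1"
      "\<And>t. t \<in> {0..T} \<Longrightarrow> X1 t = Dif (\<Phi>\<^sub>1 \<tau> t) z\<^sub>1 q" using deriv_sol[OF 1 \<tau>] by metis
    obtain X2 where X2: "sol T (\<lambda>s. blinfun_apply (DF s (\<theta>\<^sub>2 s) (\<Phi>\<^sub>2 \<tau> s z\<^sub>2))) \<tau> q X2"
      "\<And>t. t \<in> {0..T} \<Longrightarrow> X2 t = Dif (\<Phi>\<^sub>2 \<tau> t) z\<^sub>2 q" using deriv_sol[OF 2 \<tau>] by metis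
    define \<delta> where "\<delta> = norm (z\<^sub>1 - z\<^sub>2) + dist1 \<theta>\<^sub>1 \<theta>\<^sub>2"
    have \<delta>: "0 \<le> \<delta>" "dist1 \<theta>\<^sub>1 \<theta>\<^sub>2 \<le> \<delta>" using dist1_nonneg by (auto simp: \<delta>_def)
    define b where "b s = (M' * K1 * \<delta> + M * norm (\<theta>\<^sub>1 s - \<theta>\<^sub>2 s)) * (G * norm q)" for s
    note di = dist1_integrable[OF 1(1) 2(1)]
    have bint: "(b has_integral (M' * K1 * \<delta> * T + M * dist1 \<theta>\<^sub>1 \<theta>\<^sub>2) * (G * norm q)) {0..T}"
      unfolding b_def
    proof (intro has_integral_mult_left has_integral_add has_integral_mult_right)
      show "((\<lambda>x. M' * K1 * \<delta>) has_integral M' * K1 * \<delta> * T) {0..T}"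
        using has_integral_const_real[of "M' * K1 * \<delta>" 0 T] T by (simp add: mult.commute)
      show "((\<lambda>s. norm (\<theta>\<^sub>1 s - \<theta>\<^sub>2 s)) has_integral dist1 \<theta>\<^sub>1 \<theta>\<^sub>2) {0..T}"
        unfolding dist1_def by (rule integrable_integral[OF di])
    qed
    have "norm (X1 t - X2 t) \<le> (norm (q - q) + integral {0..T} b) * gron T N"
    proof (rule sol_stable[OF X1(1) X2(1) _ \<tau> t, where k = "\<lambda>t. C + L * (1 + norm (\<theta>\<^sub>1 t))"])
      show "weight T (\<lambda>t. C + L * (1 + norm (\<theta>\<^sub>1 t))) N" using 1 by (simp add: adm_def)
      show "b integrable_on {0..T}" using bint by blast
      fix s assume s: "s \<in> {0..T}"
      show "0 \<le> b s" using M M' K1 G \<delta> by (simp add: b_def)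
      let ?a = "\<Phi>\<^sub>1 \<tau> s z\<^sub>1" and ?b = "\<Phi>\<^sub>2 \<tau> s z\<^sub>2"
      have a: "?a \<in> cball 0 (rad N \<rho>)" and b: "?b \<in> cball 0 (rad N \<rho>)"
        using flow_bound[OF 1 \<tau> s] flow_bound[OF 2 \<tau> s] z by auto
      have X2b: "norm (X2 s) \<le> G * norm q" unfolding G_def X2(2)[OF s] by (rule Dif_flow_bound[OF 2 \<tau> s])
      have e: "DF s (\<theta>\<^sub>1 s) ?a (X1 s) - DF s (\<theta>\<^sub>2 s) ?b (X2 s) = DF s (\<theta>\<^sub>1 s) ?a (X1 s - X2 s)
        + ((DF s (\<theta>\<^sub>1 s) ?a - DF s (\<theta>\<^sub>1 s) ?b) (X2 s) + (DF s (\<theta>\<^sub>1 s) ?b (X2 s) - DF s (\<theta>\<^sub>2 s) ?b (X2 s)))"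
        by (simp add: blinfun.diff_left blinfun.diff_right)
      have "norm (DF s (\<theta>\<^sub>1 s) ?a (X1 s) - DF s (\<theta>\<^sub>2 s) ?b (X2 s)) \<le> norm (DF s (\<theta>\<^sub>1 s) ?a (X1 s - X2 s))
        + (norm ((DF s (\<theta>\<^sub>1 s) ?a - DF s (\<theta>\<^sub>1 s) ?b) (X2 s)) + norm (DF s (\<theta>\<^sub>1 s) ?b (X2 s) - DF s (\<theta>\<^sub>2 s) ?b (X2 s)))"
        unfolding e by (intro order_trans[OF norm_triangle_ineq] add_left_mono norm_triangle_ineq)
      also have "\<dots> \<le> (C + L * (1 + norm (\<theta>\<^sub>1 s))) * norm (X1 s - X2 s)
        + (M' * K1 * \<delta> * (G * norm q) + M * norm (\<theta>\<^sub>1 s - \<theta>\<^sub>2 s) * (G * norm q))"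
      proof (intro add_mono)
        show "norm (DF s (\<theta>\<^sub>1 s) ?a (X1 s - X2 s)) \<le> (C + L * (1 + norm (\<theta>\<^sub>1 s))) * norm (X1 s - X2 s)"
          using C by (intro order_trans[OF DF_norm[OF s]] mult_right_mono) auto
        have "norm (DF s (\<theta>\<^sub>1 s) ?a - DF s (\<theta>\<^sub>1 s) ?b) \<le> M' * norm (?a - ?b)"
          using le1 s by (intro M' a b) auto
        also have "\<dots> \<le> M' * (K1 * \<delta>)" unfolding \<delta>_def by (intro mult_left_mono K1 1 2 \<tau> s z M')
        finally have "norm (DF s (\<theta>\<^sub>1 s) ?a - DF s (\<theta>\<^sub>1 s) ?b) \<le> M' * K1 * \<delta>" by simp
        then show "norm ((DF s (\<theta>\<^sub>1 s) ?a - DF s (\<theta>\<^sub>1 s) ?b) (X2 s)) \<le> M' * K1 * \<delta> * (G * norm q)"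
          using M' K1 \<delta> by (intro order_trans[OF norm_blinfun] mult_mono X2b) auto
        show "norm (DF s (\<theta>\<^sub>1 s) ?b (X2 s) - DF s (\<theta>\<^sub>2 s) ?b (X2 s)) \<le> M * norm (\<theta>\<^sub>1 s - \<theta>\<^sub>2 s) * (G * norm q)"
          using M le1 s by (intro order_trans[OF M(2)[OF s b]] mult_left_mono X2b) auto
      qed
      finally show "norm (DF s (\<theta>\<^sub>1 s) ?a (X1 s) - DF s (\<theta>\<^sub>2 s) ?b (X2 s))
        \<le> (C + L * (1 + norm (\<theta>\<^sub>1 s))) * norm (X1 s - X2 s) + b s" by (simp add: b_def algebra_simps)
    qed
    also have "\<dots> = (M' * K1 * T * \<delta> + M * dist1 \<theta>\<^sub>1 \<theta>\<^sub>2) * (G * norm q) * G"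
      using integral_unique[OF bint] by (simp add: G_def mult_ac)
    also have "\<dots> \<le> (M' * K1 * T * \<delta> + M * \<delta>) * (G * norm q) * G"
      using M \<delta> G by (intro mult_right_mono add_left_mono mult_left_mono) auto
    also have "\<dots> = K * \<delta> * norm q" by (simp add: K_def algebra_simps)
    finally show ?thesis by (simp add: X1(2)[OF t] X2(2)[OF t] \<delta>_def)
  qed
  then show ?thesis using K by blast
qed

text \<open>The gradient of the backward solution \<open>g (\<Phi> t T z)\<close>, written by the
  chain rule.\<close>

definition grad :: "(real \<Rightarrow> real \<Rightarrow> 'z \<Rightarrow> 'z) \<Rightarrow> real \<Rightarrow> 'z \<Rightarrow> 'z \<Rightarrow>\<^sub>L real" where
  "grad \<Phi> t z = Dif g (\<Phi> t T z) o\<^sub>L Dif (\<Phi> t T) z"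

lemma T_in: "T \<in> {0..T}" and zero_in: "0 \<in> {0..T}"
  using T by auto

lemma Dif_g: "(g has_derivative blinfun_apply (Dif g z)) (at z)"
  using g by (auto simp: C2_def intro: C1_works)

lemma Dif_psi:
  assumes "adm N \<theta>" "is_flow \<theta> \<Phi>" "t \<in> {0..T}"
  shows "((\<lambda>z. g (\<Phi> t T z)) has_derivative blinfun_apply (grad \<Phi> t z)) (at z)"
  using has_derivative_compose[OF flow_has_Dif[OF assms T_in] Dif_g]
  by (simp add: grad_def blinfun_compose.rep_eq o_def)

lemma Dif_g_bound: "\<exists>M\<ge>0. \<forall>z\<in>cball 0 \<rho>. norm (Dif g z) \<le> M"
  using g by (intro continuous_bounded_cball) (auto simp: C2_def C1_def)

lemma Dif_g_lip: "\<exists>M\<ge>0. \<forall>z\<in>cball 0 \<rho>. \<forall>w\<in>cball 0 \<rho>. norm (Dif g z - Dif g w) \<le> M * norm (z - w)"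
proof -
  obtain M where M: "M \<ge> 0" "\<forall>z\<in>cball 0 \<rho>. norm (Dif (Dif g) z) \<le> M"
    using g continuous_bounded_cball[of "Dif (Dif g)" \<rho>] by (auto simp: C2_def C1_def)
  have "norm (Dif g z - Dif g w) \<le> M * norm (z - w)" if z: "z \<in> cball 0 \<rho>" "w \<in> cball 0 \<rho>" for z w
  proof (rule differentiable_bound[OF convex_cball _ _ z])
    fix x :: 'z assume x: "x \<in> cball 0 \<rho>"
    show "(Dif g has_derivative blinfun_apply (Dif (Dif g) x)) (at x within cball 0 \<rho>)"
      using g by (auto simp: C2_def intro: C1_works has_derivative_at_withinI)
    show "onorm (blinfun_apply (Dif (Dif g) x)) \<le> M"
      using M x by (simp add: norm_blinfun.rep_eq[symmetric])
  qed
  then show ?thesis using M(1) by blast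
qed

lemma grad_bound:
  "\<exists>K\<ge>0. \<forall>\<theta> \<Phi>. adm N \<theta> \<longrightarrow> is_flow \<theta> \<Phi> \<longrightarrow> (\<forall>t\<in>{0..T}. \<forall>z\<in>cball 0 \<rho>. norm (grad \<Phi> t z) \<le> K)"
proof -
  obtain M where M: "M \<ge> 0" "\<forall>z\<in>cball 0 (rad N \<rho>). norm (Dif g z) \<le> M" using Dif_g_bound[of "rad N \<rho>"] by blast
  have G: "0 \<le> gron T N" using gron_pos[of T N] by simp
  have "norm (grad \<Phi> t z) \<le> M * gron T N" if "adm N \<theta>" "is_flow \<theta> \<Phi>" "t \<in> {0..T}" "z \<in> cball 0 \<rho>" for \<theta> \<Phi> t z
  proof -
    have "norm (grad \<Phi> t z) \<le> norm (Dif g (\<Phi> t T z)) * norm (Dif (\<Phi> t T) z)"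
      unfolding grad_def by (rule norm_blinfun_compose)
    also have "\<dots> \<le> M * gron T N"
    proof (rule mult_mono)
      show "norm (Dif g (\<Phi> t T z)) \<le> M" using M(2) flow_bound[OF that(1-3) T_in] that(4) by auto
      show "norm (Dif (\<Phi> t T) z) \<le> gron T N"
        by (rule norm_blinfun_bound[OF G Dif_flow_bound[OF that(1-3) T_in]])
    qed (use M in auto)
    finally show ?thesis .
  qed
  moreover have "0 \<le> M * gron T N" using M G by simp
  ultimately show ?thesis by blast
qed

text \<open>A telescoping of the chain rule product: the gradient of \<open>g\<close> moves with the
  end point of the trajectory, the derivative of the flow with its linearization.\<close>

lemma grad_stable:
  "\<exists>K\<ge>0. \<forall>\<theta>\<^sub>1 \<theta>\<^sub>2 \<Phi>\<^sub>1 \<Phi>\<^sub>2. adm N \<theta>\<^sub>1 \<longrightarrow> adm N \<theta>\<^sub>2 \<longrightarrow> is_flow \<theta>\<^sub>1 \<Phi>\<^sub>1 \<longrightarrow> is_flow \<theta>\<^sub>2 \<Phi>\<^sub>2 \<longrightarrow>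
    (\<forall>s\<in>{0..T}. norm (\<theta>\<^sub>1 s) \<le> 1 \<and> norm (\<theta>\<^sub>2 s) \<le> 1) \<longrightarrow>
    (\<forall>t\<in>{0..T}. \<forall>z\<^sub>1\<in>cball 0 \<rho>. \<forall>z\<^sub>2\<in>cball 0 \<rho>.
      norm (grad \<Phi>\<^sub>1 t z\<^sub>1 - grad \<Phi>\<^sub>2 t z\<^sub>2) \<le> K * (norm (z\<^sub>1 - z\<^sub>2) + dist1 \<theta>\<^sub>1 \<theta>\<^sub>2))"
proof -
  obtain M where M: "M \<ge> 0" "\<forall>z\<in>cball 0 (rad N \<rho>). norm (Dif g z) \<le> M" using Dif_g_bound[of "rad N \<rho>"] by blast
  obtain M' where M': "M' \<ge> 0" "\<forall>z\<in>cball 0 (rad N \<rho>). \<forall>w\<in>cball 0 (rad N \<rho>). norm (Dif g z - Dif g w) \<le> M' * norm (z - w)"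
    using Dif_g_lip[of "rad N \<rho>"] by blast
  obtain K1 where K1: "K1 \<ge> 0" "\<And>\<theta>\<^sub>1 \<theta>\<^sub>2 \<Phi>\<^sub>1 \<Phi>\<^sub>2 \<tau> t z\<^sub>1 z\<^sub>2. adm N \<theta>\<^sub>1 \<Longrightarrow> adm N \<theta>\<^sub>2 \<Longrightarrow> is_flow \<theta>\<^sub>1 \<Phi>\<^sub>1 \<Longrightarrow> is_flow \<theta>\<^sub>2 \<Phi>\<^sub>2 \<Longrightarrow>
    \<tau>\<in>{0..T} \<Longrightarrow> t\<in>{0..T} \<Longrightarrow> z\<^sub>1\<in>cball 0 \<rho> \<Longrightarrow> z\<^sub>2\<in>cball 0 \<rho> \<Longrightarrow>
      norm (\<Phi>\<^sub>1 \<tau> t z\<^sub>1 - \<Phi>\<^sub>2 \<tau> t z\<^sub>2) \<le> K1 * (norm (z\<^sub>1 - z\<^sub>2) + dist1 \<theta>\<^sub>1 \<theta>\<^sub>2)"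
    using flow_stable[of N \<rho>] by blast
  obtain K2 where K2: "K2 \<ge> 0" "\<And>\<theta>\<^sub>1 \<theta>\<^sub>2 \<Phi>\<^sub>1 \<Phi>\<^sub>2 \<tau> t z\<^sub>1 z\<^sub>2 q. adm N \<theta>\<^sub>1 \<Longrightarrow> adm N \<theta>\<^sub>2 \<Longrightarrow> is_flow \<theta>\<^sub>1 \<Phi>\<^sub>1 \<Longrightarrow> is_flow \<theta>\<^sub>2 \<Phi>\<^sub>2 \<Longrightarrow>
    \<forall>s\<in>{0..T}. norm (\<theta>\<^sub>1 s) \<le> 1 \<and> norm (\<theta>\<^sub>2 s) \<le> 1 \<Longrightarrow>
    \<tau>\<in>{0..T} \<Longrightarrow> t\<in>{0..T} \<Longrightarrow> z\<^sub>1\<in>cball 0 \<rho> \<Longrightarrow> z\<^sub>2\<in>cball 0 \<rho> \<Longrightarrow>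
      norm (Dif (\<Phi>\<^sub>1 \<tau> t) z\<^sub>1 q - Dif (\<Phi>\<^sub>2 \<tau> t) z\<^sub>2 q) \<le> K2 * (norm (z\<^sub>1 - z\<^sub>2) + dist1 \<theta>\<^sub>1 \<theta>\<^sub>2) * norm q"
    using Dif_flow_stable[of N \<rho>] by blast
  define G where "G = gron T N"
  have G: "0 \<le> G" using gron_pos[of T N] by (simp add: G_def)
  define K where "K = M' * K1 * G + M * K2"
  have K: "0 \<le> K" using M M' K1 K2 G by (simp add: K_def)
  have "norm (grad \<Phi>\<^sub>1 t z\<^sub>1 - grad \<Phi>\<^sub>2 t z\<^sub>2) \<le> K * (norm (z\<^sub>1 - z\<^sub>2) + dist1 \<theta>\<^sub>1 \<theta>\<^sub>2)"
    if 1: "adm N \<theta>\<^sub>1" "is_flow \<theta>\<^sub>1 \<Phi>\<^sub>1" and 2: "adm N \<theta>\<^sub>2" "is_flow \<theta>\<^sub>2 \<Phi>\<^sub>2"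
      and le1: "\<forall>s\<in>{0..T}. norm (\<theta>\<^sub>1 s) \<le> 1 \<and> norm (\<theta>\<^sub>2 s) \<le> 1"
      and t: "t \<in> {0..T}" and z: "z\<^sub>1 \<in> cball 0 \<rho>" "z\<^sub>2 \<in> cball 0 \<rho>"
    for \<theta>\<^sub>1 \<theta>\<^sub>2 \<Phi>\<^sub>1 \<Phi>\<^sub>2 t z\<^sub>1 z\<^sub>2
  proof -
    define \<delta> where "\<delta> = norm (z\<^sub>1 - z\<^sub>2) + dist1 \<theta>\<^sub>1 \<theta>\<^sub>2"
    have \<delta>: "0 \<le> \<delta>" using dist1_nonneg by (auto simp: \<delta>_def)
    let ?a = "\<Phi>\<^sub>1 t T z\<^sub>1" and ?b = "\<Phi>\<^sub>2 t T z\<^sub>2"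
    have a: "?a \<in> cball 0 (rad N \<rho>)" and b: "?b \<in> cball 0 (rad N \<rho>)"
      using flow_bound[OF 1 t T_in] flow_bound[OF 2 t T_in] z by auto
    have "norm ((Dif g ?a - Dif g ?b) o\<^sub>L Dif (\<Phi>\<^sub>1 t T) z\<^sub>1) \<le> M' * (K1 * \<delta>) * G"
    proof (intro order_trans[OF norm_blinfun_compose] mult_mono)
      have "norm (Dif g ?a - Dif g ?b) \<le> M' * norm (?a - ?b)" using M' a b by blast
      also have "\<dots> \<le> M' * (K1 * \<delta>)" unfolding \<delta>_def by (intro mult_left_mono K1 1 2 t T_in z M')
      finally show "norm (Dif g ?a - Dif g ?b) \<le> M' * (K1 * \<delta>)" .
      show "norm (Dif (\<Phi>\<^sub>1 t T) z\<^sub>1) \<le> G"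
        using G unfolding G_def by (rule norm_blinfun_bound[OF _ Dif_flow_bound[OF 1 t T_in]])
    qed (use M' K1 \<delta> in auto)
    moreover have "norm (Dif g ?b o\<^sub>L (Dif (\<Phi>\<^sub>1 t T) z\<^sub>1 - Dif (\<Phi>\<^sub>2 t T) z\<^sub>2)) \<le> M * (K2 * \<delta>)"
    proof (intro order_trans[OF norm_blinfun_compose] mult_mono)
      show "norm (Dif g ?b) \<le> M" using M b by blast
      show "norm (Dif (\<Phi>\<^sub>1 t T) z\<^sub>1 - Dif (\<Phi>\<^sub>2 t T) z\<^sub>2) \<le> K2 * \<delta>"
        unfolding \<delta>_def
        by (rule norm_blinfun_bound) (use K2(1) \<delta> K2(2)[OF 1(1) 2(1) 1(2) 2(2) le1 t T_in z] in \<open>auto simp: blinfun.diff_left \<delta>_def\<close>)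
    qed (use M in auto)
    moreover have "grad \<Phi>\<^sub>1 t z\<^sub>1 - grad \<Phi>\<^sub>2 t z\<^sub>2
      = ((Dif g ?a - Dif g ?b) o\<^sub>L Dif (\<Phi>\<^sub>1 t T) z\<^sub>1) + (Dif g ?b o\<^sub>L (Dif (\<Phi>\<^sub>1 t T) z\<^sub>1 - Dif (\<Phi>\<^sub>2 t T) z\<^sub>2))"
      by (rule blinfun_eqI) (simp add: grad_def blinfun.diff_left blinfun.add_left blinfun.diff_right)
    ultimately have "norm (grad \<Phi>\<^sub>1 t z\<^sub>1 - grad \<Phi>\<^sub>2 t z\<^sub>2) \<le> M' * (K1 * \<delta>) * G + M * (K2 * \<delta>)"
      by (simp only:) (rule norm_triangle_mono)
    then show ?thesis unfolding \<delta>_def[symmetric] K_def by (simp add: algebra_simps)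
  qed
  then show ?thesis using K by blast
qed

end

section \<open>Measures transported by the flow\<close>

text \<open>Concentration is stated almost everywhere rather than through \<open>msupport\<close>,
  since this form passes directly to push-forwards and to bounds for integrals.\<close>

definition on_ball :: "real \<Rightarrow> 'z::euclidean_space measure \<Rightarrow> bool" where
  "on_ball \<rho> \<nu> \<longleftrightarrow> prob_space \<nu> \<and> sets \<nu> = sets borel \<and> (AE z in \<nu>. z \<in> cball 0 \<rho>)"

lemma on_ball_AE:
  assumes "on_ball \<rho> \<nu>" "\<And>z. z \<in> cball 0 \<rho> \<Longrightarrow> P z"
  shows "AE z in \<nu>. P z"
proof -
  have "AE z in \<nu>. z \<in> cball 0 \<rho>" using assms(1) by (simp add: on_ball_def)
  then show ?thesis by (rule AE_mp) (intro AE_I2 impI assms(2))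
qed

lemma on_ball_integrable:
  fixes f :: "'z::euclidean_space \<Rightarrow> 'b::euclidean_space"
  assumes \<nu>: "on_ball \<rho> \<nu>" and f: "continuous_on UNIV f"
  shows "integrable \<nu> f"
proof -
  interpret prob_space \<nu> using \<nu> by (simp add: on_ball_def)
  obtain B where B: "\<forall>z\<in>cball 0 \<rho>. norm (f z) \<le> B" using continuous_bounded_cball[OF f] by blast
  have "f \<in> borel_measurable borel" using f by (rule borel_measurable_continuous_onI)
  moreover have "sets \<nu> = sets borel" using \<nu> by (simp add: on_ball_def)
  ultimately have m: "f \<in> borel_measurable \<nu>" using measurable_cong_sets[of \<nu> borel borel borel] by blast
  have "AE z in \<nu>. norm (f z) \<le> B" by (rule on_ball_AE[OF \<nu>]) (use B in blast)
  then show ?thesis by (rule integrable_const_bound[OF _ m])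
qed

lemma on_ball_integral_bound:
  fixes f :: "'z::euclidean_space \<Rightarrow> 'b::euclidean_space"
  assumes \<nu>: "on_ball \<rho> \<nu>" and B: "\<And>z. z \<in> cball 0 \<rho> \<Longrightarrow> norm (f z) \<le> B" and B0: "0 \<le> B"
  shows "norm (LINT z|\<nu>. f z) \<le> B"
proof (cases "integrable \<nu> f")
  case True
  interpret prob_space \<nu> using \<nu> by (simp add: on_ball_def)
  have "norm (LINT z|\<nu>. f z) \<le> (LINT z|\<nu>. norm (f z))" by (rule integral_norm_bound)
  also have "\<dots> \<le> (LINT z|\<nu>. B)"
    by (rule integral_mono_AE[OF integrable_norm[OF True] _ on_ball_AE[OF \<nu> B]]) simp_all
  finally show ?thesis by (simp add: prob_space)
qed (simp add: not_integrable_integral_eq B0)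

context control_system
begin

text \<open>The integrand of the control equation, expressed by the control and its flow
  alone.\<close>

definition Gf :: "(real \<Rightarrow> 'm) \<Rightarrow> (real \<Rightarrow> real \<Rightarrow> 'z \<Rightarrow> 'z) \<Rightarrow> real \<Rightarrow> 'z \<Rightarrow> 'm" where
  "Gf \<theta> \<Phi> t z = gp (grad \<Phi> t z) (A t z (\<theta> t))"

lemma flow_cont_start:
  assumes "adm N \<theta>" "is_flow \<theta> \<Phi>" "t \<in> {0..T}"
  shows "continuous_on ({0..T} \<times> UNIV) (\<lambda>(\<tau>, z). \<Phi> \<tau> t z)"
    and "continuous_on ({0..T} \<times> UNIV) (\<lambda>(\<tau>, z). Dif (\<Phi> \<tau> t) z)"
proof -
  interpret c1_flow T "\<lambda>s z. F s z (\<theta> s)" "\<lambda>s z. blinfun_apply (DF s (\<theta> s) z)" \<Phi>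
    by (rule flow_c1[OF assms(1,2)])
  show "continuous_on ({0..T} \<times> UNIV) (\<lambda>(\<tau>, z). \<Phi> \<tau> t z)" by (rule flow_continuous[OF assms(3)])
  show "continuous_on ({0..T} \<times> UNIV) (\<lambda>(\<tau>, z). Dif (\<Phi> \<tau> t) z)"
    by (rule continuous_on_eq[OF D\<Phi>_continuous[OF assms(3)]]) (use assms(3) in \<open>auto simp: Dif_flow\<close>)
qed

lemma flow_cont_end:
  assumes "is_flow \<theta> \<Phi>" "\<tau> \<in> {0..T}"
  shows "continuous_on {0..T} (\<lambda>t. \<Phi> \<tau> t z)"
  using assms by (auto simp: is_flow_def sol_def)

lemma flow_cont_state:
  assumes "adm N \<theta>" "is_flow \<theta> \<Phi>" "\<tau> \<in> {0..T}" "t \<in> {0..T}"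
  shows "continuous_on UNIV (\<Phi> \<tau> t)"
  using flow_has_Dif[OF assms] by (meson has_derivative_continuous continuous_at_imp_continuous_on)

lemma grad_cont:
  assumes "adm N \<theta>" "is_flow \<theta> \<Phi>"
  shows "continuous_on ({0..T} \<times> UNIV) (\<lambda>x. grad \<Phi> (fst x) (snd x))"
  unfolding grad_def
proof (intro continuous_intros)
  show "continuous_on ({0..T} \<times> UNIV) (\<lambda>x. Dif (\<Phi> (fst x) T) (snd x))"
    using flow_cont_start(2)[OF assms T_in] by (simp add: case_prod_beta)
  have "continuous_on UNIV (Dif g)" using g by (simp add: C2_def C1_def)
  then show "continuous_on ({0..T} \<times> UNIV) (\<lambda>x. Dif g (\<Phi> (fst x) T (snd x)))"
    by (rule continuous_on_compose2)
      (use flow_cont_start(1)[OF assms T_in] in \<open>auto simp: case_prod_beta\<close>)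
qed

lemma grad_cont_state:
  assumes "adm N \<theta>" "is_flow \<theta> \<Phi>" "t \<in> {0..T}"
  shows "continuous_on UNIV (grad \<Phi> t)"
proof -
  have "continuous_on UNIV (\<lambda>z. grad \<Phi> (fst (t, z)) (snd (t, z)))"
    by (rule continuous_on_compose2[OF grad_cont[OF assms(1,2)]]) (use assms in \<open>auto intro!: continuous_intros\<close>)
  then show ?thesis by simp
qed

lemma Gf_cont_state:
  assumes "adm N \<theta>" "is_flow \<theta> \<Phi>" "t \<in> {0..T}"
  shows "continuous_on UNIV (Gf \<theta> \<Phi> t)"
  unfolding Gf_def
proof (intro continuous_on_gp grad_cont_state[OF assms])
  have "continuous_on UNIV (\<lambda>z. (\<lambda>(t, z, \<theta>). A t z \<theta>) (t, z, \<theta> t))"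
    by (rule continuous_on_compose2[OF A_cont]) (use assms in \<open>auto intro!: continuous_intros\<close>)
  then show "continuous_on UNIV (\<lambda>z. A t z (\<theta> t))" by simp
qed

lemma Gf_cont_curve:
  assumes "adm N \<theta>" "is_flow \<theta> \<Phi>" and c: "continuous_on {0..T} \<theta>" "continuous_on {0..T} X"
  shows "continuous_on {0..T} (\<lambda>t. Gf \<theta> \<Phi> t (X t))"
  unfolding Gf_def
proof (intro continuous_on_gp)
  have "continuous_on {0..T} (\<lambda>t. grad \<Phi> (fst (t, X t)) (snd (t, X t)))"
    by (rule continuous_on_compose2[OF grad_cont[OF assms(1,2)]]) (use c in \<open>auto intro!: continuous_intros\<close>)
  then show "continuous_on {0..T} (\<lambda>t. grad \<Phi> t (X t))" by simp
  have "continuous_on {0..T} (\<lambda>t. (\<lambda>(t, z, \<theta>). A t z \<theta>) (t, X t, \<theta> t))"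
    by (rule continuous_on_compose2[OF A_cont]) (use c in \<open>auto intro!: continuous_intros\<close>)
  then show "continuous_on {0..T} (\<lambda>t. A t (X t) (\<theta> t))" by simp
qed

lemma Gf_bound:
  "\<exists>K\<ge>0. \<forall>\<theta> \<Phi>. adm N \<theta> \<longrightarrow> is_flow \<theta> \<Phi> \<longrightarrow> (\<forall>t\<in>{0..T}. \<forall>z\<in>cball 0 \<rho>. norm (Gf \<theta> \<Phi> t z) \<le> K)"
proof -
  obtain K where K: "K \<ge> 0" "\<And>\<theta> \<Phi> t z. adm N \<theta> \<Longrightarrow> is_flow \<theta> \<Phi> \<Longrightarrow> t\<in>{0..T} \<Longrightarrow> z\<in>cball 0 \<rho> \<Longrightarrow> norm (grad \<Phi> t z) \<le> K"
    using grad_bound[of N \<rho>] by blast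
  obtain M where M: "M \<ge> 0" "\<And>t \<theta> z. t\<in>{0..T} \<Longrightarrow> z\<in>cball 0 \<rho> \<Longrightarrow> norm (A t z \<theta>) \<le> M" using A_bound[of \<rho>] by blast
  have "norm (Gf \<theta> \<Phi> t z) \<le> K * M" if "adm N \<theta>" "is_flow \<theta> \<Phi>" "t\<in>{0..T}" "z\<in>cball 0 \<rho>" for \<theta> \<Phi> t z
    unfolding Gf_def by (intro order_trans[OF norm_gp] mult_mono K that M) (use K that in auto)
  moreover have "0 \<le> K * M" using K M by simp
  ultimately show ?thesis by blast
qed

lemma norm_gp_diff:
  "norm (gp p B - gp p' B') \<le> norm (p - p') * norm B + norm p' * norm (B - B')"
proof -
  have "gp p B - gp p' B' = gp (p - p') B + gp p' (B - B')" by (simp add: gp_diff_left gp_diff_right)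
  then have "norm (gp p B - gp p' B') \<le> norm (gp (p - p') B) + norm (gp p' (B - B'))"
    by (simp only: norm_triangle_ineq)
  also have "\<dots> \<le> norm (p - p') * norm B + norm p' * norm (B - B')" by (intro add_mono norm_gp)
  finally show ?thesis .
qed

text \<open>By Kantorovich-Rubinstein duality, this bounds the Wasserstein distance of order one by \<open>d\<close>.\<close>

definition close :: "real \<Rightarrow> real \<Rightarrow> 'z measure \<Rightarrow> 'z measure \<Rightarrow> bool" where
  "close \<rho> d \<nu>\<^sub>1 \<nu>\<^sub>2 \<longleftrightarrow> 0 \<le> d \<and> (\<forall>(h :: 'z \<Rightarrow> real) K. continuous_on UNIV h \<and> 0 \<le> K \<and>
     (\<forall>z\<in>cball 0 \<rho>. \<forall>w\<in>cball 0 \<rho>. \<bar>h z - h w\<bar> \<le> K * norm (z - w)) \<longrightarrow>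
     \<bar>(LINT z|\<nu>\<^sub>1. h z) - (LINT z|\<nu>\<^sub>2. h z)\<bar> \<le> K * d)"

text \<open>The change is split into a change of measure at a fixed integrand, bounded through the
  Lipschitz constant of the integrand and \<open>close\<close>, and a change of integrand at a fixed
  measure, bounded pointwise on the ball.\<close>

lemma Gf_integral_stable:
  "\<exists>K\<ge>0. \<forall>\<theta>\<^sub>1 \<theta>\<^sub>2 \<Phi>\<^sub>1 \<Phi>\<^sub>2. adm N \<theta>\<^sub>1 \<longrightarrow> adm N \<theta>\<^sub>2 \<longrightarrow> is_flow \<theta>\<^sub>1 \<Phi>\<^sub>1 \<longrightarrow> is_flow \<theta>\<^sub>2 \<Phi>\<^sub>2 \<longrightarrow>
    (\<forall>s\<in>{0..T}. norm (\<theta>\<^sub>1 s) \<le> 1 \<and> norm (\<theta>\<^sub>2 s) \<le> 1) \<longrightarrow>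
    (\<forall>t\<in>{0..T}. \<forall>\<nu>\<^sub>1 \<nu>\<^sub>2 d. on_ball \<rho> \<nu>\<^sub>1 \<longrightarrow> on_ball \<rho> \<nu>\<^sub>2 \<longrightarrow> close \<rho> d \<nu>\<^sub>1 \<nu>\<^sub>2 \<longrightarrow>
      norm ((LINT z|\<nu>\<^sub>1. Gf \<theta>\<^sub>1 \<Phi>\<^sub>1 t z) - (LINT z|\<nu>\<^sub>2. Gf \<theta>\<^sub>2 \<Phi>\<^sub>2 t z))
        \<le> K * (dist1 \<theta>\<^sub>1 \<theta>\<^sub>2 + norm (\<theta>\<^sub>1 t - \<theta>\<^sub>2 t) + d))"
proof -
  obtain Kg where Kg: "Kg \<ge> 0" "\<And>\<theta> \<Phi> t z. adm N \<theta> \<Longrightarrow> is_flow \<theta> \<Phi> \<Longrightarrow> t\<in>{0..T} \<Longrightarrow> z\<in>cball 0 \<rho> \<Longrightarrow> norm (grad \<Phi> t z) \<le> Kg"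
    using grad_bound[of N \<rho>] by blast
  obtain Ks where Ks: "Ks \<ge> 0" "\<And>\<theta>\<^sub>1 \<theta>\<^sub>2 \<Phi>\<^sub>1 \<Phi>\<^sub>2 t z\<^sub>1 z\<^sub>2. adm N \<theta>\<^sub>1 \<Longrightarrow> adm N \<theta>\<^sub>2 \<Longrightarrow> is_flow \<theta>\<^sub>1 \<Phi>\<^sub>1 \<Longrightarrow> is_flow \<theta>\<^sub>2 \<Phi>\<^sub>2 \<Longrightarrow>
      \<forall>s\<in>{0..T}. norm (\<theta>\<^sub>1 s) \<le> 1 \<and> norm (\<theta>\<^sub>2 s) \<le> 1 \<Longrightarrow> t\<in>{0..T} \<Longrightarrow> z\<^sub>1\<in>cball 0 \<rho> \<Longrightarrow> z\<^sub>2\<in>cball 0 \<rho> \<Longrightarrow>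
      norm (grad \<Phi>\<^sub>1 t z\<^sub>1 - grad \<Phi>\<^sub>2 t z\<^sub>2) \<le> Ks * (norm (z\<^sub>1 - z\<^sub>2) + dist1 \<theta>\<^sub>1 \<theta>\<^sub>2)"
    using grad_stable[of N \<rho>] by blast
  obtain Ma where Ma: "Ma \<ge> 0" "\<And>t \<theta> z. t\<in>{0..T} \<Longrightarrow> z\<in>cball 0 \<rho> \<Longrightarrow> norm (A t z \<theta>) \<le> Ma" using A_bound[of \<rho>] by blast
  obtain Mz where Mz: "Mz \<ge> 0" "\<And>t \<theta> z w. t\<in>{0..T} \<Longrightarrow> z\<in>cball 0 \<rho> \<Longrightarrow> w\<in>cball 0 \<rho> \<Longrightarrow> norm \<theta> \<le> 1 \<Longrightarrow>
      norm (A t z \<theta> - A t w \<theta>) \<le> Mz * norm (z - w)" using A_lip_state[of \<rho>] by blast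
  obtain Mc where Mc: "Mc \<ge> 0" "\<And>t \<theta>\<^sub>1 \<theta>\<^sub>2 z. t\<in>{0..T} \<Longrightarrow> z\<in>cball 0 \<rho> \<Longrightarrow>
      norm (A t z \<theta>\<^sub>1 - A t z \<theta>\<^sub>2) \<le> Mc * norm (\<theta>\<^sub>1 - \<theta>\<^sub>2)" using A_lip_control[of \<rho>] by blast
  define Lg where "Lg = Ks * Ma + Kg * Mz"
  define K where "K = Lg + Ks * Ma + Kg * Mc"
  have Lg: "0 \<le> Lg" using Ks Ma Kg Mz by (simp add: Lg_def)
  have K: "0 \<le> K" "Lg \<le> K" "Ks * Ma \<le> K" "Kg * Mc \<le> K" using Lg Ks Ma Kg Mc by (auto simp: K_def)
  have "norm ((LINT z|\<nu>\<^sub>1. Gf \<theta>\<^sub>1 \<Phi>\<^sub>1 t z) - (LINT z|\<nu>\<^sub>2. Gf \<theta>\<^sub>2 \<Phi>\<^sub>2 t z))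
        \<le> K * (dist1 \<theta>\<^sub>1 \<theta>\<^sub>2 + norm (\<theta>\<^sub>1 t - \<theta>\<^sub>2 t) + d)"
    if 1: "adm N \<theta>\<^sub>1" "is_flow \<theta>\<^sub>1 \<Phi>\<^sub>1" and 2: "adm N \<theta>\<^sub>2" "is_flow \<theta>\<^sub>2 \<Phi>\<^sub>2"
      and le1: "\<forall>s\<in>{0..T}. norm (\<theta>\<^sub>1 s) \<le> 1 \<and> norm (\<theta>\<^sub>2 s) \<le> 1"
      and t: "t \<in> {0..T}" and \<nu>: "on_ball \<rho> \<nu>\<^sub>1" "on_ball \<rho> \<nu>\<^sub>2" and d: "close \<rho> d \<nu>\<^sub>1 \<nu>\<^sub>2"
    for \<theta>\<^sub>1 \<theta>\<^sub>2 \<Phi>\<^sub>1 \<Phi>\<^sub>2 t \<nu>\<^sub>1 \<nu>\<^sub>2 d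
  proof -
    let ?G1 = "Gf \<theta>\<^sub>1 \<Phi>\<^sub>1 t" and ?G2 = "Gf \<theta>\<^sub>2 \<Phi>\<^sub>2 t"
    have d0: "0 \<le> d" using d by (simp add: close_def)
    have c1: "continuous_on UNIV ?G1" and c2: "continuous_on UNIV ?G2"
      by (rule Gf_cont_state[OF 1 t], rule Gf_cont_state[OF 2 t])
    note i = on_ball_integrable[OF \<nu>(1) c1] on_ball_integrable[OF \<nu>(2) c1] on_ball_integrable[OF \<nu>(2) c2]
    have lipG: "norm (?G1 z - ?G1 w) \<le> Lg * norm (z - w)" if z: "z \<in> cball 0 \<rho>" "w \<in> cball 0 \<rho>" for z w
    proof -
      have "norm (?G1 z - ?G1 w) \<le> norm (grad \<Phi>\<^sub>1 t z - grad \<Phi>\<^sub>1 t w) * norm (A t z (\<theta>\<^sub>1 t))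
        + norm (grad \<Phi>\<^sub>1 t w) * norm (A t z (\<theta>\<^sub>1 t) - A t w (\<theta>\<^sub>1 t))" unfolding Gf_def by (rule norm_gp_diff)
      \<comment> \<open>The stability estimate with twice the same control is a Lipschitz bound in
        space, since the distance of a control to itself vanishes.\<close>
      also have "\<dots> \<le> (Ks * (norm (z - w) + dist1 \<theta>\<^sub>1 \<theta>\<^sub>1)) * Ma + Kg * (Mz * norm (z - w))"
        using le1 t Ks(1) Kg(1) by (intro add_mono mult_mono Ks(2) Kg(2)[OF 1] Ma Mz 1 z) (auto simp: dist1_def)
      also have "\<dots> = Lg * norm (z - w)" by (simp add: dist1_def Lg_def algebra_simps)
      finally show ?thesis .
    qed
    \<comment> \<open>\<open>close\<close> speaks about scalar functions only. Tested with the
      component of the integrand along \<open>v\<close> itself, it bounds the square of the norm of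
      \<open>v\<close>.\<close>
    define v where "v = (LINT z|\<nu>\<^sub>1. ?G1 z) - (LINT z|\<nu>\<^sub>2. ?G1 z)"
    have "norm v * norm v = (LINT z|\<nu>\<^sub>1. ?G1 z \<bullet> v) - (LINT z|\<nu>\<^sub>2. ?G1 z \<bullet> v)"
    proof -
      have "norm v * norm v = v \<bullet> v" by (simp flip: power2_norm_eq_inner power2_eq_square)
      also have "\<dots> = (LINT z|\<nu>\<^sub>1. ?G1 z) \<bullet> v - (LINT z|\<nu>\<^sub>2. ?G1 z) \<bullet> v"
        by (subst (1) v_def) (rule inner_diff_left)
      also have "\<dots> = (LINT z|\<nu>\<^sub>1. ?G1 z \<bullet> v) - (LINT z|\<nu>\<^sub>2. ?G1 z \<bullet> v)" using i by simp
      finally show ?thesis .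
    qed
    also have "\<dots> \<le> \<bar>(LINT z|\<nu>\<^sub>1. ?G1 z \<bullet> v) - (LINT z|\<nu>\<^sub>2. ?G1 z \<bullet> v)\<bar>" by simp
    also have "\<dots> \<le> (Lg * norm v) * d"
    proof -
      have "\<bar>?G1 z \<bullet> v - ?G1 w \<bullet> v\<bar> \<le> (Lg * norm v) * norm (z - w)" if z: "z \<in> cball 0 \<rho>" "w \<in> cball 0 \<rho>" for z w
      proof -
        have "\<bar>?G1 z \<bullet> v - ?G1 w \<bullet> v\<bar> \<le> norm (?G1 z - ?G1 w) * norm v"
          unfolding inner_diff_left[symmetric] by (rule Cauchy_Schwarz_ineq2)
        also have "\<dots> \<le> (Lg * norm (z - w)) * norm v" by (intro mult_right_mono lipG z) auto
        finally show ?thesis by (simp add: mult_ac)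
      qed
      moreover have "continuous_on UNIV (\<lambda>z. ?G1 z \<bullet> v)" by (intro continuous_intros c1)
      moreover have "0 \<le> Lg * norm v" using Lg by simp
      ultimately show ?thesis using d unfolding close_def by blast
    qed
    finally have "norm v * norm v \<le> (Lg * d) * norm v" by (simp add: mult_ac)
    then have v: "norm v \<le> Lg * d"
      using Lg d0 by (cases "norm v = 0") (auto simp: mult_nonneg_nonneg)
    have "norm (LINT z|\<nu>\<^sub>2. ?G1 z - ?G2 z) \<le> Ks * Ma * dist1 \<theta>\<^sub>1 \<theta>\<^sub>2 + Kg * Mc * norm (\<theta>\<^sub>1 t - \<theta>\<^sub>2 t)"
    proof (rule on_ball_integral_bound[OF \<nu>(2)])
      fix z :: 'z assume z: "z \<in> cball 0 \<rho>"
      have "norm (?G1 z - ?G2 z) \<le> norm (grad \<Phi>\<^sub>1 t z - grad \<Phi>\<^sub>2 t z) * norm (A t z (\<theta>\<^sub>1 t))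
        + norm (grad \<Phi>\<^sub>2 t z) * norm (A t z (\<theta>\<^sub>1 t) - A t z (\<theta>\<^sub>2 t))" unfolding Gf_def by (rule norm_gp_diff)
      also have "\<dots> \<le> (Ks * (norm (z - z) + dist1 \<theta>\<^sub>1 \<theta>\<^sub>2)) * Ma + Kg * (Mc * norm (\<theta>\<^sub>1 t - \<theta>\<^sub>2 t))"
        using le1 t Ks(1) Kg(1) dist1_nonneg by (intro add_mono mult_mono Ks(2) Kg(2)[OF 2] Ma Mc 1 2 z) auto
      finally show "norm (?G1 z - ?G2 z) \<le> Ks * Ma * dist1 \<theta>\<^sub>1 \<theta>\<^sub>2 + Kg * Mc * norm (\<theta>\<^sub>1 t - \<theta>\<^sub>2 t)" by (simp add: mult_ac)
    qed (use Ks Ma Kg Mc dist1_nonneg in auto)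
    then have "norm ((LINT z|\<nu>\<^sub>2. ?G1 z) - (LINT z|\<nu>\<^sub>2. ?G2 z)) \<le> Ks * Ma * dist1 \<theta>\<^sub>1 \<theta>\<^sub>2 + Kg * Mc * norm (\<theta>\<^sub>1 t - \<theta>\<^sub>2 t)"
      using i by simp
    also have "\<dots> \<le> K * dist1 \<theta>\<^sub>1 \<theta>\<^sub>2 + K * norm (\<theta>\<^sub>1 t - \<theta>\<^sub>2 t)"
      using dist1_nonneg by (intro add_mono mult_right_mono K) auto
    finally have w: "norm ((LINT z|\<nu>\<^sub>2. ?G1 z) - (LINT z|\<nu>\<^sub>2. ?G2 z)) \<le> K * dist1 \<theta>\<^sub>1 \<theta>\<^sub>2 + K * norm (\<theta>\<^sub>1 t - \<theta>\<^sub>2 t)" .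
    have "norm v \<le> K * d" using v mult_right_mono[OF K(2) d0] by simp
    have "norm ((LINT z|\<nu>\<^sub>1. ?G1 z) - (LINT z|\<nu>\<^sub>2. ?G2 z)) = norm (v + ((LINT z|\<nu>\<^sub>2. ?G1 z) - (LINT z|\<nu>\<^sub>2. ?G2 z)))"
      by (simp add: v_def)
    also have "\<dots> \<le> K * d + (K * dist1 \<theta>\<^sub>1 \<theta>\<^sub>2 + K * norm (\<theta>\<^sub>1 t - \<theta>\<^sub>2 t))"
      by (intro norm_triangle_mono w) fact
    finally show ?thesis by (simp add: algebra_simps)
  qed
  then show ?thesis using K(1) by blast
qed

lemma adm_continuous:
  assumes "continuous_on {0..T} \<theta>" "\<And>t. t \<in> {0..T} \<Longrightarrow> norm (\<theta> t) \<le> 1" and N: "T * (C + 2 * L)\<^sup>2 \<le> N"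
  shows "adm N \<theta>"
  unfolding adm_def weight_def
proof (intro conjI ballI)
  show \<theta>m: "\<theta> \<in> borel_measurable (lebesgue_on {0..T})"
    by (intro continuous_imp_measurable_on_sets_lebesgue assms) auto
  show "(\<lambda>t. C + L * (1 + norm (\<theta> t))) \<in> borel_measurable (lebesgue_on {0..T})"
    by (intro continuous_imp_measurable_on_sets_lebesgue continuous_intros assms) auto
  show i: "(\<lambda>s. (C + L * (1 + norm (\<theta> s)))\<^sup>2) integrable_on {0..T}"
    by (intro integrable_continuous_real continuous_intros assms)
  have "integral {0..T} (\<lambda>s. (C + L * (1 + norm (\<theta> s)))\<^sup>2) \<le> integral {0..T} (\<lambda>s. (C + 2 * L)\<^sup>2)"
  proof (intro integral_le i)
    fix s assume s: "s \<in> {0..T}"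
    have "L * (1 + norm (\<theta> s)) \<le> L * 2" using L assms(2)[OF s] by (intro mult_left_mono) auto
    then show "(C + L * (1 + norm (\<theta> s)))\<^sup>2 \<le> (C + 2 * L)\<^sup>2" using C L by (intro power_mono) auto
  qed (simp add: integrable_const_ivl)
  also have "\<dots> \<le> N" using N T by simp
  finally show "integral {0..T} (\<lambda>s. (C + L * (1 + norm (\<theta> s)))\<^sup>2) \<le> N" .
qed (use C L in simp)

lemma pushforward_on_ball:
  fixes f :: "'z \<Rightarrow> 'b::euclidean_space"
  assumes "on_ball \<rho> \<mu>" "adm N \<theta>" "is_flow \<theta> \<Phi>" "\<tau> \<in> {0..T}" "t \<in> {0..T}"
  shows "on_ball (rad N \<rho>) (distr \<mu> borel (\<Phi> \<tau> t))"
    and "f \<in> borel_measurable borel \<Longrightarrow> (LINT z|distr \<mu> borel (\<Phi> \<tau> t). f z) = (LINT z|\<mu>. f (\<Phi> \<tau> t z))"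
proof -
  interpret prob_space \<mu> using assms by (simp add: on_ball_def)
  have s: "sets \<mu> = sets borel" using assms by (simp add: on_ball_def)
  have "\<Phi> \<tau> t \<in> borel_measurable borel" by (rule borel_measurable_continuous_onI[OF flow_cont_state[OF assms(2-5)]])
  then have m: "\<Phi> \<tau> t \<in> measurable \<mu> borel" unfolding measurable_cong_sets[OF s refl] .
  have "AE z in \<mu>. \<Phi> \<tau> t z \<in> cball 0 (rad N \<rho>)"
    by (rule on_ball_AE[OF assms(1)]) (use flow_bound[OF assms(2-5)] in simp)
  then have "AE z in distr \<mu> borel (\<Phi> \<tau> t). z \<in> cball 0 (rad N \<rho>)"
    by (subst AE_distr_iff[OF m]) auto
  then show "on_ball (rad N \<rho>) (distr \<mu> borel (\<Phi> \<tau> t))"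
    unfolding on_ball_def using prob_space_distr[OF m] by simp
  show "(LINT z|distr \<mu> borel (\<Phi> \<tau> t). f z) = (LINT z|\<mu>. f (\<Phi> \<tau> t z))" if "f \<in> borel_measurable borel"
    by (rule integral_distr[OF m that])
qed

definition push :: "(real \<Rightarrow> real \<Rightarrow> 'z \<Rightarrow> 'z) \<Rightarrow> 'z measure \<Rightarrow> real \<Rightarrow> 'z measure" where
  "push \<Phi> \<mu> t = distr \<mu> borel (\<Phi> 0 t)"

text \<open>Both measures are images of the same initial measure, so they are coupled trajectory by
  trajectory and their distance is at most that of the flows.\<close>

lemma push_close:
  "\<exists>K\<ge>0. \<forall>\<theta>\<^sub>1 \<theta>\<^sub>2 \<Phi>\<^sub>1 \<Phi>\<^sub>2. adm N \<theta>\<^sub>1 \<longrightarrow> adm N \<theta>\<^sub>2 \<longrightarrow> is_flow \<theta>\<^sub>1 \<Phi>\<^sub>1 \<longrightarrow> is_flow \<theta>\<^sub>2 \<Phi>\<^sub>2 \<longrightarrow>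
    (\<forall>t\<in>{0..T}. \<forall>\<mu>. on_ball \<rho> \<mu> \<longrightarrow> close (rad N \<rho>) (K * dist1 \<theta>\<^sub>1 \<theta>\<^sub>2) (push \<Phi>\<^sub>1 \<mu> t) (push \<Phi>\<^sub>2 \<mu> t))"
proof -
  obtain K where K: "K \<ge> 0" "\<And>\<theta>\<^sub>1 \<theta>\<^sub>2 \<Phi>\<^sub>1 \<Phi>\<^sub>2 \<tau> t z\<^sub>1 z\<^sub>2. adm N \<theta>\<^sub>1 \<Longrightarrow> adm N \<theta>\<^sub>2 \<Longrightarrow> is_flow \<theta>\<^sub>1 \<Phi>\<^sub>1 \<Longrightarrow> is_flow \<theta>\<^sub>2 \<Phi>\<^sub>2 \<Longrightarrow>
    \<tau>\<in>{0..T} \<Longrightarrow> t\<in>{0..T} \<Longrightarrow> z\<^sub>1\<in>cball 0 \<rho> \<Longrightarrow> z\<^sub>2\<in>cball 0 \<rho> \<Longrightarrow>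
      norm (\<Phi>\<^sub>1 \<tau> t z\<^sub>1 - \<Phi>\<^sub>2 \<tau> t z\<^sub>2) \<le> K * (norm (z\<^sub>1 - z\<^sub>2) + dist1 \<theta>\<^sub>1 \<theta>\<^sub>2)"
    using flow_stable[of N \<rho>] by blast
  have "close (rad N \<rho>) (K * dist1 \<theta>\<^sub>1 \<theta>\<^sub>2) (push \<Phi>\<^sub>1 \<mu> t) (push \<Phi>\<^sub>2 \<mu> t)"
    if 1: "adm N \<theta>\<^sub>1" "is_flow \<theta>\<^sub>1 \<Phi>\<^sub>1" and 2: "adm N \<theta>\<^sub>2" "is_flow \<theta>\<^sub>2 \<Phi>\<^sub>2" and t: "t \<in> {0..T}" and \<mu>: "on_ball \<rho> \<mu>"
    for \<theta>\<^sub>1 \<theta>\<^sub>2 \<Phi>\<^sub>1 \<Phi>\<^sub>2 t \<mu>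
    unfolding close_def
  proof (intro conjI allI impI)
    show "0 \<le> K * dist1 \<theta>\<^sub>1 \<theta>\<^sub>2" using K dist1_nonneg by simp
    fix h :: "'z \<Rightarrow> real" and B
    assume "continuous_on UNIV h \<and> 0 \<le> B \<and>
      (\<forall>z\<in>cball 0 (rad N \<rho>). \<forall>w\<in>cball 0 (rad N \<rho>). \<bar>h z - h w\<bar> \<le> B * norm (z - w))"
    then have h: "continuous_on UNIV h" and B: "0 \<le> B"
      and lip: "\<forall>z\<in>cball 0 (rad N \<rho>). \<forall>w\<in>cball 0 (rad N \<rho>). \<bar>h z - h w\<bar> \<le> B * norm (z - w)"
      by auto
    have hm: "h \<in> borel_measurable borel" using h by (rule borel_measurable_continuous_onI)
    have i: "integrable \<mu> (\<lambda>z. h (\<Phi> 0 t z))" if "adm N \<theta>" "is_flow \<theta> \<Phi>" for \<theta> \<Phi>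
      by (intro on_ball_integrable[OF \<mu>] continuous_on_compose2[OF h flow_cont_state[OF that zero_in t]]) auto
    have "norm (LINT z|\<mu>. h (\<Phi>\<^sub>1 0 t z) - h (\<Phi>\<^sub>2 0 t z)) \<le> B * (K * dist1 \<theta>\<^sub>1 \<theta>\<^sub>2)"
    proof (rule on_ball_integral_bound[OF \<mu>])
      fix z :: 'z assume z: "z \<in> cball 0 \<rho>"
      have "norm (h (\<Phi>\<^sub>1 0 t z) - h (\<Phi>\<^sub>2 0 t z)) \<le> B * norm (\<Phi>\<^sub>1 0 t z - \<Phi>\<^sub>2 0 t z)"
        using lip flow_bound[OF 1 zero_in t] flow_bound[OF 2 zero_in t] z by auto
      also have "\<dots> \<le> B * (K * (norm (z - z) + dist1 \<theta>\<^sub>1 \<theta>\<^sub>2))"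
        by (intro mult_left_mono K 1 2 zero_in t z B)
      finally show "norm (h (\<Phi>\<^sub>1 0 t z) - h (\<Phi>\<^sub>2 0 t z)) \<le> B * (K * dist1 \<theta>\<^sub>1 \<theta>\<^sub>2)" by simp
    qed (use B K dist1_nonneg in simp)
    then show "\<bar>(LINT z|push \<Phi>\<^sub>1 \<mu> t. h z) - (LINT z|push \<Phi>\<^sub>2 \<mu> t. h z)\<bar> \<le> B * (K * dist1 \<theta>\<^sub>1 \<theta>\<^sub>2)"
      unfolding push_def pushforward_on_ball(2)[OF \<mu> 1 zero_in t hm] pushforward_on_ball(2)[OF \<mu> 2 zero_in t hm]
      by (simp add: Bochner_Integration.integral_diff[OF i[OF 1] i[OF 2]])
  qed
  then show ?thesis using K(1) by blast
qed

lemma push_on_ball: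
  assumes "on_ball \<rho> \<mu>" "adm N \<theta>" "is_flow \<theta> \<Phi>" "t \<in> {0..T}"
  shows "on_ball (rad N \<rho>) (push \<Phi> \<mu> t)"
  unfolding push_def by (rule pushforward_on_ball(1)[OF assms(1-3) zero_in assms(4)])

lemma push_integral:
  fixes f :: "'z \<Rightarrow> 'b::euclidean_space"
  assumes "on_ball \<rho> \<mu>" "adm N \<theta>" "is_flow \<theta> \<Phi>" "t \<in> {0..T}" "continuous_on UNIV f"
  shows "(LINT z|push \<Phi> \<mu> t. f z) = (LINT z|\<mu>. f (\<Phi> 0 t z))"
  unfolding push_def
  by (rule pushforward_on_ball(2)[OF assms(1-3) zero_in assms(4) borel_measurable_continuous_onI[OF assms(5)]])

text \<open>Dominated convergence along sequences of times, with the constant \<open>B\<close> as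
  majorant.\<close>

lemma continuous_on_parametric_integral:
  fixes f :: "real \<Rightarrow> 'z \<Rightarrow> 'b::euclidean_space"
  assumes \<mu>: "on_ball \<rho> \<mu>" and c: "\<And>t. t \<in> {0..T} \<Longrightarrow> continuous_on UNIV (f t)"
    and ct: "\<And>z. continuous_on {0..T} (\<lambda>t. f t z)"
    and B: "\<And>t z. t \<in> {0..T} \<Longrightarrow> z \<in> cball 0 \<rho> \<Longrightarrow> norm (f t z) \<le> B"
  shows "continuous_on {0..T} (\<lambda>t. LINT z|\<mu>. f t z)"
  unfolding continuous_on_sequentially
proof (intro allI ballI impI, elim conjE)
  interpret prob_space \<mu> using \<mu> by (simp add: on_ball_def)
  fix x t assume t: "t \<in> {0..T}" and x: "\<forall>n. x n \<in> {0..T}" "x \<longlonglongrightarrow> t"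
  have "(\<lambda>n. LINT z|\<mu>. f (x n) z) \<longlonglongrightarrow> (LINT z|\<mu>. f t z)"
  proof (rule integral_dominated_convergence[where w = "\<lambda>_. B"])
    show "f t \<in> borel_measurable \<mu>" using on_ball_integrable[OF \<mu> c[OF t]] by simp
    show "f (x n) \<in> borel_measurable \<mu>" for n using on_ball_integrable[OF \<mu> c[of "x n"]] x by simp
    show "AE z in \<mu>. (\<lambda>n. f (x n) z) \<longlonglongrightarrow> f t z"
      using continuous_on_tendsto_compose[OF ct x(2) t] x(1) by simp
    show "AE z in \<mu>. norm (f (x n) z) \<le> B" for n
      by (rule on_ball_AE[OF \<mu>]) (use B x in blast)
  qed simp
  then show "((\<lambda>t. LINT z|\<mu>. f t z) \<circ> x) \<longlonglongrightarrow> (LINT z|\<mu>. f t z)" by (simp add: o_def)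
qed

lemma Gf_push_continuous:
  assumes \<mu>: "on_ball \<rho> \<mu>" and \<theta>: "adm N \<theta>" and \<Phi>: "is_flow \<theta> \<Phi>" and c: "continuous_on {0..T} \<theta>"
  shows "continuous_on {0..T} (\<lambda>t. LINT z|push \<Phi> \<mu> t. Gf \<theta> \<Phi> t z)"
proof -
  obtain K where K: "\<And>t z. t\<in>{0..T} \<Longrightarrow> z\<in>cball 0 (rad N \<rho>) \<Longrightarrow> norm (Gf \<theta> \<Phi> t z) \<le> K"
    using Gf_bound[of N "rad N \<rho>"] \<theta> \<Phi> by blast
  have "continuous_on {0..T} (\<lambda>t. LINT z|\<mu>. Gf \<theta> \<Phi> t (\<Phi> 0 t z))"
  proof (rule continuous_on_parametric_integral[OF \<mu>])
    show "continuous_on UNIV (\<lambda>z. Gf \<theta> \<Phi> t (\<Phi> 0 t z))" if t: "t \<in> {0..T}" for t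
      by (rule continuous_on_compose2[OF Gf_cont_state[OF \<theta> \<Phi> t] flow_cont_state[OF \<theta> \<Phi> zero_in t]]) auto
    show "continuous_on {0..T} (\<lambda>t. Gf \<theta> \<Phi> t (\<Phi> 0 t z))" for z
      by (rule Gf_cont_curve[OF \<theta> \<Phi> c flow_cont_end[OF \<Phi> zero_in]])
    show "norm (Gf \<theta> \<Phi> t (\<Phi> 0 t z)) \<le> K" if "t \<in> {0..T}" "z \<in> cball 0 \<rho>" for t z
      using K[OF that(1)] flow_bound[OF \<theta> \<Phi> zero_in that(1)] that(2) by auto
  qed
  then show ?thesis
    by (rule continuous_on_eq) (simp add: push_integral[OF \<mu> \<theta> \<Phi> _ Gf_cont_state[OF \<theta> \<Phi>]])
qed

end

section \<open>Existence and regularity of the control\<close>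

context control_system
begin

text \<open>The right-hand side of the control equation maps the continuous controls of size at most
  \<open>M\<^sub>0\<close> into themselves and halves their distance. The threshold is chosen before
  the initial measure, so it serves for every measure on the ball.\<close>

lemma control_exists:
  assumes N: "T * (C + 2 * L)\<^sup>2 \<le> N" and M0: "0 < M\<^sub>0" "M\<^sub>0 \<le> 1"
  shows "\<exists>lam\<^sub>0>0. \<forall>lam>lam\<^sub>0. \<forall>\<mu>. on_ball \<rho> \<mu> \<longrightarrow>
    (\<exists>\<theta> \<Phi>. continuous_on {0..T} \<theta> \<and> (\<forall>t. norm (\<theta> t) \<le> M\<^sub>0) \<and> adm N \<theta> \<and> is_flow \<theta> \<Phi> \<and>
      (\<forall>t\<in>{0..T}. \<theta> t = - (1 / (2 * lam)) *\<^sub>R (LINT z|push \<Phi> \<mu> t. Gf \<theta> \<Phi> t z)))"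
proof -
  obtain Kb where Kb: "Kb \<ge> 0" "\<And>\<theta> \<Phi> t z. adm N \<theta> \<Longrightarrow> is_flow \<theta> \<Phi> \<Longrightarrow> t\<in>{0..T} \<Longrightarrow> z\<in>cball 0 (rad N \<rho>) \<Longrightarrow> norm (Gf \<theta> \<Phi> t z) \<le> Kb"
    using Gf_bound[of N "rad N \<rho>"] by blast
  obtain Ks where Ks: "Ks \<ge> 0" "\<And>\<theta>\<^sub>1 \<theta>\<^sub>2 \<Phi>\<^sub>1 \<Phi>\<^sub>2 t \<nu>\<^sub>1 \<nu>\<^sub>2 d. adm N \<theta>\<^sub>1 \<Longrightarrow> adm N \<theta>\<^sub>2 \<Longrightarrow> is_flow \<theta>\<^sub>1 \<Phi>\<^sub>1 \<Longrightarrow> is_flow \<theta>\<^sub>2 \<Phi>\<^sub>2 \<Longrightarrow>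
    \<forall>s\<in>{0..T}. norm (\<theta>\<^sub>1 s) \<le> 1 \<and> norm (\<theta>\<^sub>2 s) \<le> 1 \<Longrightarrow> t\<in>{0..T} \<Longrightarrow>
    on_ball (rad N \<rho>) \<nu>\<^sub>1 \<Longrightarrow> on_ball (rad N \<rho>) \<nu>\<^sub>2 \<Longrightarrow> close (rad N \<rho>) d \<nu>\<^sub>1 \<nu>\<^sub>2 \<Longrightarrow>
      norm ((LINT z|\<nu>\<^sub>1. Gf \<theta>\<^sub>1 \<Phi>\<^sub>1 t z) - (LINT z|\<nu>\<^sub>2. Gf \<theta>\<^sub>2 \<Phi>\<^sub>2 t z))
        \<le> Ks * (dist1 \<theta>\<^sub>1 \<theta>\<^sub>2 + norm (\<theta>\<^sub>1 t - \<theta>\<^sub>2 t) + d)"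
    using Gf_integral_stable[of N "rad N \<rho>"] by blast
  obtain Kp where Kp: "Kp \<ge> 0" "\<And>\<theta>\<^sub>1 \<theta>\<^sub>2 \<Phi>\<^sub>1 \<Phi>\<^sub>2 t \<mu>. adm N \<theta>\<^sub>1 \<Longrightarrow> adm N \<theta>\<^sub>2 \<Longrightarrow> is_flow \<theta>\<^sub>1 \<Phi>\<^sub>1 \<Longrightarrow> is_flow \<theta>\<^sub>2 \<Phi>\<^sub>2 \<Longrightarrow>
    t\<in>{0..T} \<Longrightarrow> on_ball \<rho> \<mu> \<Longrightarrow> close (rad N \<rho>) (Kp * dist1 \<theta>\<^sub>1 \<theta>\<^sub>2) (push \<Phi>\<^sub>1 \<mu> t) (push \<Phi>\<^sub>2 \<mu> t)"
    using push_close[of N \<rho>] by blast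
  \<comment> \<open>The three summands come from the distance of the flows, the pointwise distance
    of the controls and the distance of the transported measures, each measured against the supremum
    distance.\<close>
  define c where "c = Ks * (T + 1 + Kp * T)"
  have c0: "0 \<le> c" using Ks Kp T by (simp add: c_def)
  \<comment> \<open>The term \<open>Kb / M\<^sub>0\<close> keeps the image in the ball of controls,
    and \<open>c\<close> makes the contraction factor at most 1/2.\<close>
  define lam0 where "lam0 = 1 + Kb / M\<^sub>0 + c"
  have lam0: "0 < lam0" "Kb / M\<^sub>0 \<le> lam0" "c \<le> lam0" using divide_nonneg_pos[OF Kb(1) M0(1)] c0 by (simp_all add: lam0_def)
  show ?thesis
  proof (intro exI[of _ lam0] conjI allI impI lam0(1))
    fix lam and \<mu> :: "'z measure" assume lam: "lam0 < lam" and \<mu>: "on_ball \<rho> \<mu>"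
    have lam_pos: "0 < lam" using lam lam0 by simp
    \<comment> \<open>Selecting one flow for each control makes the right-hand side a function of
      the control.\<close>
    define flw where "flw \<theta> = (SOME \<Phi>. is_flow \<theta> \<Phi>)" for \<theta>
    have flw: "is_flow \<theta> (flw \<theta>)" if "adm N \<theta>" for \<theta>
      unfolding flw_def by (rule someI_ex[OF flow_exists[OF that]])
    define S where "S \<theta> t = - (1 / (2 * lam)) *\<^sub>R (LINT z|push (flw \<theta>) \<mu> t. Gf \<theta> (flw \<theta>) t z)" for \<theta> t
    \<comment> \<open>Written with \<open>PiC\<close> because closedness of such sets in the space
      of bounded continuous functions is known, and with it completeness.\<close>
    define B where "B = PiC UNIV (\<lambda>_. cball 0 M\<^sub>0) \<inter> (UNIV :: (real \<Rightarrow>\<^sub>C 'm) set)"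
    have B: "Y \<in> B \<longleftrightarrow> (\<forall>t. norm (apply_bcontfun Y t) \<le> M\<^sub>0)" for Y
      by (auto simp: B_def mem_PiC_iff Pi_iff)
    have admB: "adm N (apply_bcontfun Y)" if "Y \<in> B" for Y
      using that M0 by (intro adm_continuous[OF _ _ N]) (auto simp: B intro: order_trans)
    have Sc: "continuous_on {0..T} (S Y)" if "Y \<in> B" for Y :: "real \<Rightarrow>\<^sub>C 'm"
      unfolding S_def using admB[OF that]
      by (intro continuous_intros Gf_push_continuous[OF \<mu> _ flw]) auto
    have Sb: "norm (S Y t) \<le> M\<^sub>0" if Y: "Y \<in> B" and t: "t \<in> {0..T}" for Y :: "real \<Rightarrow>\<^sub>C 'm" and t
    proof -
      note a = admB[OF Y] flw[OF admB[OF Y]]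
      have "norm (LINT z|push (flw Y) \<mu> t. Gf Y (flw Y) t z) \<le> Kb"
        by (rule on_ball_integral_bound[OF push_on_ball[OF \<mu> a t]]) (use Kb a t in auto)
      then have "norm (S Y t) \<le> (1 / (2 * lam)) * Kb" using lam_pos by (simp add: S_def divide_right_mono)
      also have "\<dots> \<le> M\<^sub>0"
      proof -
        have "Kb \<le> lam * M\<^sub>0" using lam0(2) lam M0 by (simp add: divide_le_eq) (smt (verit) mult_right_mono)
        also have "\<dots> \<le> 2 * lam * M\<^sub>0" using lam_pos M0 by simp
        finally show ?thesis using lam_pos by (simp add: field_simps)
      qed
      finally show ?thesis .
    qed
    \<comment> \<open>Images are defined on the time interval only and are extended by constants, so
      the fixed point solves the control equation on the interval.\<close>
    define Q where "Q Y = Bcontfun (\<lambda>t. S (apply_bcontfun Y) (clampT T t))" for Y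
    have Q: "apply_bcontfun (Q Y) t = S Y (clampT T t)" if "Y \<in> B" for Y t
      unfolding Q_def using T by (simp add: Bcontfun_inverse clamp_bcontfun[OF Sc[OF that]])
    have cl: "clampT T t \<in> {0..T}" for t using clampT_in[of T t] T by simp
    have closedB: "closed B" unfolding B_def by (intro closed_Int closed_PiC) auto
    note completeB = closedB[folded complete_eq_closed]
    have "(\<lambda>_. 0) \<in> (bcontfun :: (real \<Rightarrow> 'm) set)" by (simp add: const_bcontfun)
    then have "Bcontfun (\<lambda>_. 0) \<in> B" using M0 by (simp add: B Bcontfun_inverse)
    then have neB: "B \<noteq> {}" by blast
    have QB: "Q ` B \<subseteq> B" using Sb cl by (auto simp: B Q) 
    have "\<exists>!Y\<in>B. Q Y = Y"
    proof (rule Banach_fix[OF completeB neB _ _ QB])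
      show "(0::real) \<le> 1 / 2" "(1 / 2 :: real) < 1" by auto
      fix Y1 Y2 :: "real \<Rightarrow>\<^sub>C 'm" assume Y: "Y1 \<in> B" "Y2 \<in> B"
      note a1 = admB[OF Y(1)] flw[OF admB[OF Y(1)]] and a2 = admB[OF Y(2)] flw[OF admB[OF Y(2)]]
      define D where "D = dist Y1 Y2"
      have D0: "0 \<le> D" by (simp add: D_def)
      have pt: "norm (apply_bcontfun Y1 s - apply_bcontfun Y2 s) \<le> D" for s
        unfolding D_def dist_norm[symmetric] by (rule dist_bounded)
      have d1: "dist1 Y1 Y2 \<le> T * D"
      proof -
        have "dist1 Y1 Y2 \<le> integral {0..T} (\<lambda>_. D)"
          unfolding dist1_def by (intro integral_le dist1_integrable[OF a1(1) a2(1)] pt) (auto simp: integrable_const_ivl)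
        then show ?thesis using T by simp
      qed
      show "dist (Q Y1) (Q Y2) \<le> 1 / 2 * dist Y1 Y2"
      proof (rule dist_bound)
        fix t0 :: real
        define t where "t = clampT T t0"
        have t: "t \<in> {0..T}" unfolding t_def by (rule cl)
        let ?I1 = "LINT z|push (flw Y1) \<mu> t. Gf Y1 (flw Y1) t z" and ?I2 = "LINT z|push (flw Y2) \<mu> t. Gf Y2 (flw Y2) t z"
        have "norm (?I1 - ?I2) \<le> Ks * (dist1 Y1 Y2 + norm (apply_bcontfun Y1 t - apply_bcontfun Y2 t) + Kp * dist1 Y1 Y2)"
        proof (rule Ks(2)[OF a1(1) a2(1) a1(2) a2(2) _ t])
          show "\<forall>s\<in>{0..T}. norm (apply_bcontfun Y1 s) \<le> 1 \<and> norm (apply_bcontfun Y2 s) \<le> 1"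
            using Y M0 by (auto simp: B intro: order_trans)
        qed (rule push_on_ball[OF \<mu> a1 t] push_on_ball[OF \<mu> a2 t] Kp(2)[OF a1(1) a2(1) a1(2) a2(2) t \<mu>])+
        also have "\<dots> \<le> Ks * (T * D + D + Kp * (T * D))"
          using Ks Kp by (intro mult_left_mono add_mono d1 pt) auto
        also have "\<dots> = c * D" by (simp add: c_def algebra_simps)
        also have "\<dots> \<le> lam * D" using lam0 lam D0 by (intro mult_right_mono) auto
        finally have le: "norm (?I1 - ?I2) \<le> lam * D" .
        have "dist (apply_bcontfun (Q Y1) t0) (apply_bcontfun (Q Y2) t0) = norm (S Y1 t - S Y2 t)"
          by (simp add: Q Y dist_norm t_def)
        also have "\<dots> = norm ((- (1 / (2 * lam))) *\<^sub>R (?I1 - ?I2))"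
          unfolding S_def by (simp only: scaleR_diff_right)
        also have "\<dots> = (1 / (2 * lam)) * norm (?I1 - ?I2)" using lam_pos by simp
        also have "\<dots> \<le> (1 / (2 * lam)) * (lam * D)" using lam_pos by (intro mult_left_mono le) auto
        also have "\<dots> = 1 / 2 * dist Y1 Y2" using lam_pos by (simp add: D_def)
        finally show "dist (apply_bcontfun (Q Y1) t0) (apply_bcontfun (Q Y2) t0) \<le> 1 / 2 * dist Y1 Y2" .
      qed
    qed
    then obtain Y where Y: "Y \<in> B" "Q Y = Y" by blast
    have "apply_bcontfun Y t = S Y t" if "t \<in> {0..T}" for t
      using Q[OF Y(1), of t] Y(2) clampT_id[OF that] by simp
    then show "\<exists>\<theta> \<Phi>. continuous_on {0..T} \<theta> \<and> (\<forall>t. norm (\<theta> t) \<le> M\<^sub>0) \<and> adm N \<theta> \<and> is_flow \<theta> \<Phi> \<and>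
      (\<forall>t\<in>{0..T}. \<theta> t = - (1 / (2 * lam)) *\<^sub>R (LINT z|push \<Phi> \<mu> t. Gf \<theta> \<Phi> t z))"
      using Y(1) admB[OF Y(1)] flw[OF admB[OF Y(1)]]
      by (intro exI[of _ "apply_bcontfun Y"] exI[of _ "flw Y"]) (auto simp: B S_def)
  qed
qed

lemma integral_seg_const: "integral (seg s t) (\<lambda>_. c :: real) = c * \<bar>t - s\<bar>"
  by (cases "s \<le> t") (simp_all add: seg_def)

text \<open>The speed is bounded by the growth condition on the trapping ball, whatever the
  regularity of the control.\<close>

lemma flow_time_lip:
  assumes "adm N \<theta>" "is_flow \<theta> \<Phi>" and ts: "t \<in> {0..T}" "s \<in> {0..T}" and z: "z \<in> cball 0 \<rho>"
  shows "norm (\<Phi> 0 t z - \<Phi> 0 s z) \<le> C * (1 + rad N \<rho>) * \<bar>t - s\<bar>"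
proof -
  have "sol T (\<lambda>s z. F s z (\<theta> s)) 0 z (\<lambda>t. \<Phi> 0 t z)"
    using assms(2) zero_in unfolding is_flow_def by blast
  note sol = sol_shift[OF this zero_in ts(2)]
  have "\<Phi> 0 t z = \<Phi> 0 s z + J s t (\<lambda>r. F r (\<Phi> 0 r z) (\<theta> r))" using sol ts unfolding sol_def by blast
  then have "norm (\<Phi> 0 t z - \<Phi> 0 s z) = norm (J s t (\<lambda>r. F r (\<Phi> 0 r z) (\<theta> r)))" by simp
  also have "\<dots> \<le> integral (seg s t) (\<lambda>_. C * (1 + rad N \<rho>))"
  proof (rule J_norm_bound[OF sol_integrable[OF sol] _ ts(2,1)])
    fix r assume "r \<in> seg s t"
    then have r: "r \<in> {0..T}" using seg_subset[OF ts(2,1)] by auto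
    have "norm (F r (\<Phi> 0 r z) (\<theta> r)) \<le> C * (1 + norm (\<Phi> 0 r z))" by (rule growth[OF r])
    also have "\<dots> \<le> C * (1 + rad N \<rho>)"
      using C flow_bound[OF assms(1,2) zero_in r] z by (intro mult_left_mono add_left_mono) auto
    finally show "norm (F r (\<Phi> 0 r z) (\<theta> r)) \<le> C * (1 + rad N \<rho>)" .
  qed (simp add: integrable_const_ivl)
  also have "\<dots> = C * (1 + rad N \<rho>) * \<bar>t - s\<bar>"
    unfolding integral_seg_const by (simp add: abs_minus_commute)
  finally show ?thesis .
qed

lemma flow_trans':
  assumes "adm N \<theta>" "is_flow \<theta> \<Phi>" "\<tau> \<in> {0..T}" "\<sigma> \<in> {0..T}" "t \<in> {0..T}"
  shows "\<Phi> \<sigma> t (\<Phi> \<tau> \<sigma> z) = \<Phi> \<tau> t z"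
proof -
  interpret c1_flow T "\<lambda>s z. F s z (\<theta> s)" "\<lambda>s z. blinfun_apply (DF s (\<theta> s) z)" \<Phi>
    by (rule flow_c1[OF assms(1,2)])
  show ?thesis by (rule flow_trans[OF assms(3-5)])
qed

text \<open>Along a trajectory, \<open>D\<Phi>\<^bsub>t,T\<^esub>\<close> only depends on \<open>t\<close> through the starting time of a fixed
  linear equation; this avoids second derivatives of the flow.\<close>

lemma Dif_along_trajectory_lip:
  assumes \<theta>: "adm N \<theta>" and \<Phi>: "is_flow \<theta> \<Phi>" and ts: "t \<in> {0..T}" "s \<in> {0..T}"
    and le1: "\<And>s. s \<in> {0..T} \<Longrightarrow> norm (\<theta> s) \<le> 1"
  shows "norm (Dif (\<Phi> t T) (\<Phi> 0 t z) q - Dif (\<Phi> s T) (\<Phi> 0 s z) q) \<le> (2 * L * gron T N * gron T N) * \<bar>t - s\<bar> * norm q"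
proof -
  have tr: "\<Phi> r u (\<Phi> 0 r z) = \<Phi> 0 u z" if "r \<in> {0..T}" "u \<in> {0..T}" for r u
    by (rule flow_trans'[OF \<theta> \<Phi> zero_in that])
  have w: "weight T (\<lambda>t. C + L * (1 + norm (\<theta> t))) N" using \<theta> by (simp add: adm_def)
  have G: "0 \<le> gron T N" using gron_pos[of T N] by simp
  let ?H = "\<lambda>r. blinfun_apply (DF r (\<theta> r) (\<Phi> 0 r z))"
  have ex: "\<exists>X. sol T ?H u q X \<and> (\<forall>r\<in>{0..T}. X r = Dif (\<Phi> u r) (\<Phi> 0 u z) q)" if u: "u \<in> {0..T}" for u
  proof -
    obtain X where X: "sol T (\<lambda>r. blinfun_apply (DF r (\<theta> r) (\<Phi> u r (\<Phi> 0 u z)))) u q X"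
      "\<And>r. r \<in> {0..T} \<Longrightarrow> X r = Dif (\<Phi> u r) (\<Phi> 0 u z) q" by (rule deriv_sol[OF \<theta> \<Phi> u, of "\<Phi> 0 u z" q]) (rule that)
    have "sol T ?H u q X" by (rule sol_cong[OF X(1) u]) (simp add: tr[OF u])
    then show ?thesis using X(2) by blast
  qed
  obtain X1 where X1: "sol T ?H t q X1" "\<And>r. r \<in> {0..T} \<Longrightarrow> X1 r = Dif (\<Phi> t r) (\<Phi> 0 t z) q" using ex[OF ts(1)] by blast
  obtain X2 where X2: "sol T ?H s q X2" "\<And>r. r \<in> {0..T} \<Longrightarrow> X2 r = Dif (\<Phi> s r) (\<Phi> 0 s z) q" using ex[OF ts(2)] by blast
  \<comment> \<open>Started from \<open>q\<close> at time \<open>t\<close>, the first solution has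
    moved by at most a multiple of \<open>\<bar>t - s\<bar>\<close> when time \<open>s\<close> is
    reached, where the second one starts from \<open>q\<close>. The equation is the same for
    both.\<close>
  have "X1 s = q + J t s (\<lambda>r. ?H r (X1 r))" using X1(1) ts unfolding sol_def by blast
  then have "norm (X1 s - q) = norm (J t s (\<lambda>r. ?H r (X1 r)))" by simp
  also have "\<dots> \<le> integral (seg t s) (\<lambda>_. 2 * L * (gron T N * norm q))"
  proof (rule J_norm_bound[OF sol_integrable[OF X1(1)] _ ts])
    fix r assume "r \<in> seg t s"
    then have r: "r \<in> {0..T}" using seg_subset[OF ts] by auto
    have "norm (?H r (X1 r)) \<le> L * (1 + norm (\<theta> r)) * norm (X1 r)" by (rule DF_norm[OF r])
    also have "\<dots> \<le> 2 * L * (gron T N * norm q)"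
    proof (rule mult_mono)
      show "L * (1 + norm (\<theta> r)) \<le> 2 * L" using L le1[OF r] by (simp add: algebra_simps)
      show "norm (X1 r) \<le> gron T N * norm q" unfolding X1(2)[OF r] by (rule Dif_flow_bound[OF \<theta> \<Phi> ts(1) r])
    qed (use L in auto)
    finally show "norm (?H r (X1 r)) \<le> 2 * L * (gron T N * norm q)" .
  qed (simp add: integrable_const_ivl)
  also have "\<dots> = 2 * L * (gron T N * norm q) * \<bar>t - s\<bar>"
    unfolding integral_seg_const by (simp add: abs_minus_commute)
  finally have 1: "norm (X1 s - q) \<le> 2 * L * (gron T N * norm q) * \<bar>t - s\<bar>" .
  have "norm (X1 T - X2 T) \<le> (norm (X1 s - q) + integral {0..T} (\<lambda>_. 0)) * gron T N"
  proof (rule sol_stable[OF sol_shift[OF X1(1) ts] X2(1) w ts(2) T_in])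
    fix r assume r: "r \<in> {0..T}"
    have "norm (?H r (X1 r) - ?H r (X2 r)) = norm (?H r (X1 r - X2 r))" by (simp add: blinfun.diff_right)
    also have "\<dots> \<le> L * (1 + norm (\<theta> r)) * norm (X1 r - X2 r)" by (rule DF_norm[OF r])
    also have "\<dots> \<le> (C + L * (1 + norm (\<theta> r))) * norm (X1 r - X2 r) + 0" using C by (simp add: mult_right_mono)
    finally show "norm (?H r (X1 r) - ?H r (X2 r)) \<le> (C + L * (1 + norm (\<theta> r))) * norm (X1 r - X2 r) + 0" .
  qed (auto intro: integrable_0)
  also have "\<dots> \<le> (2 * L * (gron T N * norm q) * \<bar>t - s\<bar>) * gron T N"
    using 1 G by (intro mult_right_mono) auto
  finally show ?thesis unfolding X1(2)[OF T_in] X2(2)[OF T_in] by (simp add: mult_ac)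
qed

text \<open>At two times the right-hand sides of the control equation differ by a multiple of
  \<open>\<bar>t - s\<bar>\<close> plus a multiple of the change of the control itself, and for
  large \<lambda> the latter is absorbed. As the prefactor decays with \<lambda>, any prescribed
  Lipschitz constant can be reached.\<close>

lemma control_lipschitz:
  assumes A_time: "\<And>\<rho>. \<exists>M\<ge>0. \<forall>s\<in>{0..T}. \<forall>t\<in>{0..T}. \<forall>\<theta>. \<forall>z\<in>cball 0 \<rho>. norm \<theta> \<le> 1 \<longrightarrow>
      norm (A t z \<theta> - A s z \<theta>) \<le> M * \<bar>t - s\<bar>" and Lp: "0 < Lp"
  shows "\<exists>lam\<^sub>0>0. \<forall>lam>lam\<^sub>0. \<forall>\<mu> \<theta> \<Phi>. on_ball \<rho> \<mu> \<longrightarrow> adm N \<theta> \<longrightarrow> is_flow \<theta> \<Phi> \<longrightarrow>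
    (\<forall>t\<in>{0..T}. norm (\<theta> t) \<le> 1) \<longrightarrow>
    (\<forall>t\<in>{0..T}. \<theta> t = - (1 / (2 * lam)) *\<^sub>R (LINT z|push \<Phi> \<mu> t. Gf \<theta> \<Phi> t z)) \<longrightarrow>
    Lp-lipschitz_on {0..T} \<theta>"
proof -
  let ?\<rho> = "rad N \<rho>"
  obtain Kg where Kg: "Kg \<ge> 0" "\<And>\<theta> \<Phi> t z. adm N \<theta> \<Longrightarrow> is_flow \<theta> \<Phi> \<Longrightarrow> t\<in>{0..T} \<Longrightarrow> z\<in>cball 0 ?\<rho> \<Longrightarrow> norm (grad \<Phi> t z) \<le> Kg"
    using grad_bound[of N ?\<rho>] by blast
  obtain Mg where Mg: "Mg \<ge> 0" "\<forall>z\<in>cball 0 (rad N \<rho>). norm (Dif g z) \<le> Mg" using Dif_g_bound[of "rad N \<rho>"] by blast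
  obtain Ma where Ma: "Ma \<ge> 0" "\<And>t \<theta> z. t\<in>{0..T} \<Longrightarrow> z\<in>cball 0 ?\<rho> \<Longrightarrow> norm (A t z \<theta>) \<le> Ma" using A_bound[of "rad N \<rho>"] by blast
  obtain Mz where Mz: "Mz \<ge> 0" "\<And>t \<theta> z w. t\<in>{0..T} \<Longrightarrow> z\<in>cball 0 ?\<rho> \<Longrightarrow> w\<in>cball 0 ?\<rho> \<Longrightarrow> norm \<theta> \<le> 1 \<Longrightarrow>
      norm (A t z \<theta> - A t w \<theta>) \<le> Mz * norm (z - w)" using A_lip_state[of ?\<rho>] by blast
  obtain Mc where Mc: "Mc \<ge> 0" "\<And>t \<theta>\<^sub>1 \<theta>\<^sub>2 z. t\<in>{0..T} \<Longrightarrow> z\<in>cball 0 ?\<rho> \<Longrightarrow>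
      norm (A t z \<theta>\<^sub>1 - A t z \<theta>\<^sub>2) \<le> Mc * norm (\<theta>\<^sub>1 - \<theta>\<^sub>2)" using A_lip_control[of ?\<rho>] by blast
  obtain Mt where Mt: "Mt \<ge> 0" "\<And>s t \<theta> z. s\<in>{0..T} \<Longrightarrow> t\<in>{0..T} \<Longrightarrow> z\<in>cball 0 ?\<rho> \<Longrightarrow> norm \<theta> \<le> 1 \<Longrightarrow>
      norm (A t z \<theta> - A s z \<theta>) \<le> Mt * \<bar>t - s\<bar>" using A_time[of ?\<rho>] by blast
  define K1 where "K1 = 2 * L * gron T N * gron T N"
  have K1: "0 \<le> K1" using L gron_pos[of T N] by (simp add: K1_def)
  \<comment> \<open>The absolute value guards against a negative radius, since nothing is assumed
    about the sign of \<rho>.\<close>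
  define K2 where "K2 = \<bar>C * (1 + ?\<rho>)\<bar>"
  define K where "K = Mg * K1 * Ma + Kg * (Mt + Mz * K2) + Kg * Mc"
  have K: "0 \<le> K" "Mg * K1 * Ma + Kg * (Mt + Mz * K2) \<le> K" "Kg * Mc \<le> K"
    using Mg K1 Ma Kg Mt Mz Mc by (auto simp: K_def K2_def)
  \<comment> \<open>The summand \<open>K\<close> absorbs the increment of the control, and
    \<open>K / Lp\<close> brings the resulting constant \<open>K / lam\<close> below
    \<open>Lp\<close>.\<close>
  define lam0 where "lam0 = 1 + K + K / Lp"
  have lam0: "0 < lam0" "K \<le> lam0" "K / Lp \<le> lam0" using divide_nonneg_pos[OF K(1) Lp] K(1) by (simp_all add: lam0_def)
  show ?thesis
  proof (intro exI[of _ lam0] conjI allI impI lam0(1))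
    fix lam \<theta> \<Phi> and \<mu> :: "'z measure" assume lam: "lam0 < lam" and \<mu>: "on_ball \<rho> \<mu>" and \<theta>: "adm N \<theta>" and \<Phi>: "is_flow \<theta> \<Phi>"
      and le1: "\<forall>t\<in>{0..T}. norm (\<theta> t) \<le> 1"
      and eq: "\<forall>t\<in>{0..T}. \<theta> t = - (1 / (2 * lam)) *\<^sub>R (LINT z|push \<Phi> \<mu> t. Gf \<theta> \<Phi> t z)"
    have lam_pos: "0 < lam" using lam lam0 by simp
    show "Lp-lipschitz_on {0..T} \<theta>"
    proof (rule lipschitz_onI)
      fix t s assume ts: "t \<in> {0..T}" "s \<in> {0..T}"
      let ?d = "\<bar>t - s\<bar>" and ?e = "norm (\<theta> t - \<theta> s)"
      let ?f = "\<lambda>t z. Gf \<theta> \<Phi> t (\<Phi> 0 t z)"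
      have i: "integrable \<mu> (?f t)" if "t \<in> {0..T}" for t
        by (intro on_ball_integrable[OF \<mu>] continuous_on_compose2[OF Gf_cont_state[OF \<theta> \<Phi> that] flow_cont_state[OF \<theta> \<Phi> zero_in that]]) auto
      have I: "(LINT z|push \<Phi> \<mu> t. Gf \<theta> \<Phi> t z) = (LINT z|\<mu>. ?f t z)" if "t \<in> {0..T}" for t
        by (rule push_integral[OF \<mu> \<theta> \<Phi> that Gf_cont_state[OF \<theta> \<Phi> that]])
      have "norm (LINT z|\<mu>. ?f t z - ?f s z) \<le> K * ?d + K * ?e"
      proof (rule on_ball_integral_bound[OF \<mu>])
        fix z :: 'z assume z: "z \<in> cball 0 \<rho>"
        let ?a = "\<Phi> 0 t z" and ?b = "\<Phi> 0 s z"
        have ab: "?a \<in> cball 0 ?\<rho>" "?b \<in> cball 0 ?\<rho>" "\<Phi> 0 T z \<in> cball 0 ?\<rho>"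
          using flow_bound[OF \<theta> \<Phi> zero_in] ts T_in z by auto
        have "norm (grad \<Phi> t ?a - grad \<Phi> s ?b) \<le> Mg * (K1 * ?d)"
        proof -
          \<comment> \<open>Both points lie on one trajectory and have the same end point at time
            \<open>T\<close>, so the gradient of \<open>g\<close> is a common factor.\<close>
          have e: "grad \<Phi> t ?a - grad \<Phi> s ?b = Dif g (\<Phi> 0 T z) o\<^sub>L (Dif (\<Phi> t T) ?a - Dif (\<Phi> s T) ?b)"
            by (rule blinfun_eqI) (simp add: grad_def flow_trans'[OF \<theta> \<Phi> zero_in ts(1) T_in]
                flow_trans'[OF \<theta> \<Phi> zero_in ts(2) T_in] blinfun.diff_left blinfun.diff_right)
          have "norm (Dif (\<Phi> t T) ?a - Dif (\<Phi> s T) ?b) \<le> K1 * ?d"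
          proof (rule norm_blinfun_bound)
            show "norm ((Dif (\<Phi> t T) ?a - Dif (\<Phi> s T) ?b) q) \<le> K1 * ?d * norm q" for q
              using Dif_along_trajectory_lip[OF \<theta> \<Phi> ts, of z q] le1 by (simp add: K1_def blinfun.diff_left)
          qed (use K1 in simp)
          then show ?thesis unfolding e
            using Mg ab(3) K1 by (intro order_trans[OF norm_blinfun_compose] mult_mono) auto
        qed
        moreover have "norm (A t ?a (\<theta> t) - A s ?b (\<theta> s)) \<le> Mt * ?d + Mz * (K2 * ?d) + Mc * ?e"
        proof -
          have "A t ?a (\<theta> t) - A s ?b (\<theta> s) = (A t ?a (\<theta> t) - A s ?a (\<theta> t)) + (A s ?a (\<theta> t) - A s ?b (\<theta> t))
            + (A s ?b (\<theta> t) - A s ?b (\<theta> s))" by simp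
          also have "norm \<dots> \<le> Mt * ?d + Mz * (K2 * ?d) + Mc * ?e"
          proof (intro norm_triangle_mono)
            show "norm (A t ?a (\<theta> t) - A s ?a (\<theta> t)) \<le> Mt * ?d" using le1 ts by (intro Mt ab) auto
            show "norm (A s ?b (\<theta> t) - A s ?b (\<theta> s)) \<le> Mc * ?e" by (intro Mc ts ab)
            have "norm (A s ?a (\<theta> t) - A s ?b (\<theta> t)) \<le> Mz * norm (?a - ?b)" using le1 ts by (intro Mz ab) auto
            also have "\<dots> \<le> Mz * (K2 * ?d)"
              unfolding K2_def
              by (intro mult_left_mono order_trans[OF flow_time_lip[OF \<theta> \<Phi> ts z]] mult_right_mono Mz(1) abs_ge_self) simp
            finally show "norm (A s ?a (\<theta> t) - A s ?b (\<theta> t)) \<le> Mz * (K2 * ?d)" .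
          qed
          finally show ?thesis .
        qed
        ultimately have "norm (?f t z - ?f s z) \<le> Mg * (K1 * ?d) * Ma + Kg * (Mt * ?d + Mz * (K2 * ?d) + Mc * ?e)"
          unfolding Gf_def using Mg K1 Kg(1) ts
          by (intro order_trans[OF norm_gp_diff] add_mono mult_mono Ma Kg(2)[OF \<theta> \<Phi>] ab) auto
        also have "\<dots> = (Mg * K1 * Ma + Kg * (Mt + Mz * K2)) * ?d + (Kg * Mc) * ?e" by (simp add: algebra_simps)
        also have "\<dots> \<le> K * ?d + K * ?e" by (intro add_mono mult_right_mono K) auto
        finally show "norm (?f t z - ?f s z) \<le> K * ?d + K * ?e" .
      qed (use K in simp)
      then have le: "norm ((LINT z|\<mu>. ?f t z) - (LINT z|\<mu>. ?f s z)) \<le> K * ?d + K * ?e"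
        by (simp add: Bochner_Integration.integral_diff[OF i[OF ts(1)] i[OF ts(2)]])
      have "\<theta> t - \<theta> s = (- (1 / (2 * lam))) *\<^sub>R ((LINT z|\<mu>. ?f t z) - (LINT z|\<mu>. ?f s z))"
        using eq ts I by (simp add: scaleR_diff_right)
      then have "?e = (1 / (2 * lam)) * norm ((LINT z|\<mu>. ?f t z) - (LINT z|\<mu>. ?f s z))" using lam_pos by simp
      also have "\<dots> \<le> (1 / (2 * lam)) * (K * ?d + K * ?e)" using lam_pos by (intro mult_left_mono le) auto
      finally have "2 * lam * ?e \<le> K * ?d + K * ?e" using lam_pos by (simp add: field_simps)
      moreover have "K * ?e \<le> lam * ?e" using lam0 lam by (intro mult_right_mono) auto
      ultimately have "lam * ?e \<le> K * ?d" by simp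
      moreover have "K \<le> Lp * lam" using lam0(3) lam Lp by (simp add: divide_le_eq) (smt (verit) mult_right_mono mult.commute)
      then have "K * ?d \<le> Lp * lam * ?d" by (intro mult_right_mono) auto
      ultimately have "lam * ?e \<le> lam * (Lp * ?d)" by (simp add: mult_ac)
      then show "dist (\<theta> t) (\<theta> s) \<le> Lp * dist t s" using lam_pos by (simp add: dist_norm)
    qed (use Lp in simp)
  qed
qed

end

section \<open>Smooth cut-offs and Lipschitz approximation\<close>

lemma C1I:
  fixes f :: "'a::euclidean_space \<Rightarrow> 'b::real_normed_vector"
  assumes d: "\<And>z. (f has_derivative f' z) (at z)"
    and c: "\<And>q. q \<in> Basis \<Longrightarrow> continuous_on UNIV (\<lambda>z. f' z q)"
  shows "C1 f"
  unfolding C1_def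
proof (intro conjI allI)
  show "f differentiable at z" for z using d[of z] by (rule differentiableI)
  show "continuous_on UNIV (Dif f)"
    by (rule continuous_on_blinfun_componentwise) (simp add: Dif_apply[OF d] c)
qed

text \<open>The squared positive part, a \<open>C1\<close> function that vanishes on a half line.
  The cut-offs built from it are \<open>C1\<close>, the regularity that test functions must
  have.\<close>

definition qpos :: "real \<Rightarrow> real" where
  "qpos r = (max 0 r)\<^sup>2"

lemma qpos_simps [simp]: "r \<le> 0 \<Longrightarrow> qpos r = 0" "0 \<le> r \<Longrightarrow> qpos r = r\<^sup>2" "0 \<le> qpos r"
  by (auto simp: qpos_def max_def)

lemma qpos_eq_0: "qpos r = 0 \<longleftrightarrow> r \<le> 0"
  by (auto simp: qpos_def max_def)

lemma qpos_has_derivative: "(qpos has_real_derivative 2 * max 0 r) (at r)"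
proof -
  consider "r < 0" | "r = 0" | "r > 0" by linarith
  then show ?thesis
  proof cases
    case 1
    have "((\<lambda>r. 0) has_real_derivative 0) (at r)" by simp
    then have "(qpos has_real_derivative 0) (at r)"
      by (rule has_field_derivative_transform_within_open[where S = "{..<0}"]) (use 1 in auto)
    then show ?thesis using 1 by simp
  next
    case 2
    have "((\<lambda>y. max 0 y) \<longlongrightarrow> max 0 (0::real)) (at 0)" by (intro tendsto_intros)
    moreover have "\<forall>\<^sub>F y in at (0::real). max 0 y = (qpos y - qpos 0) / (y - 0)"
      by (auto simp: eventually_at_filter qpos_def max_def power2_eq_square)
    ultimately have "((\<lambda>y. (qpos y - qpos 0) / (y - 0)) \<longlongrightarrow> 0) (at 0)"
      by (simp add: tendsto_cong)
    then show ?thesis using 2 by (simp add: has_field_derivative_iff)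
  next
    case 3
    have "((\<lambda>r. r\<^sup>2) has_real_derivative 2 * r) (at r)" by (auto intro!: derivative_eq_intros)
    then have "(qpos has_real_derivative 2 * r) (at r)"
      by (rule has_field_derivative_transform_within_open[where S = "{0<..}"]) (use 3 in auto)
    then show ?thesis using 3 by simp
  qed
qed

lemma qpos_continuous: "continuous_on S qpos"
  unfolding qpos_def by (intro continuous_intros)

text \<open>A \<open>C1\<close> transition from 0 on the negative half line to 1 beyond 1.
  Differences of shifted and scaled copies cut off in time, and their derivatives concentrate at a
  time.\<close>

definition step :: "real \<Rightarrow> real" where
  "step r = qpos r / (qpos r + qpos (1 - r))"

definition step' :: "real \<Rightarrow> real" where
  "step' r = (2 * max 0 r * qpos (1 - r) + qpos r * (2 * max 0 (1 - r))) / (qpos r + qpos (1 - r))\<^sup>2"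

lemma step_den: "0 < qpos r + qpos (1 - r)"
proof -
  have "qpos r \<noteq> 0 \<or> qpos (1 - r) \<noteq> 0" unfolding qpos_eq_0 by linarith
  then show ?thesis using qpos_simps(3)[of r] qpos_simps(3)[of "1 - r"] by linarith
qed

lemma step_has_derivative: "(step has_real_derivative step' r) (at r)"
proof -
  have 1: "((\<lambda>r. qpos (1 - r)) has_real_derivative 2 * max 0 (1 - r) * - 1) (at r)"
    by (rule DERIV_chain2[OF qpos_has_derivative]) (auto intro!: derivative_eq_intros)
  have "(step has_real_derivative (2 * max 0 r * (qpos r + qpos (1 - r)) - qpos r * (2 * max 0 r + 2 * max 0 (1 - r) * - 1))
      / ((qpos r + qpos (1 - r)) * (qpos r + qpos (1 - r)))) (at r)"
    unfolding step_def[abs_def]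
    by (rule DERIV_divide[OF qpos_has_derivative DERIV_add[OF qpos_has_derivative 1]]) (use step_den[of r] in simp)
  then show ?thesis by (simp add: step'_def power2_eq_square algebra_simps)
qed

lemma step'_continuous: "continuous_on S step'"
  unfolding step'_def
  by (intro continuous_intros continuous_on_compose2[OF qpos_continuous[of UNIV]]) (use step_den in \<open>auto simp: less_imp_neq[symmetric]\<close>)

lemma step_simps:
  "r \<le> 0 \<Longrightarrow> step r = 0" "1 \<le> r \<Longrightarrow> step r = 1" "0 \<le> step r" "step r \<le> 1"
  "r \<le> 0 \<Longrightarrow> step' r = 0" "1 \<le> r \<Longrightarrow> step' r = 0" "0 \<le> step' r"
  using step_den[of r] by (auto simp: step_def step'_def divide_simps)

text \<open>Built from \<open>z \<bullet> z\<close> rather than from the norm, so that it is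
  differentiable at the origin too. It equals 1 where \<open>norm z \<le> \<rho>\<close> and 0 once
  \<open>z \<bullet> z \<ge> \<rho>\<^sup>2 + 1\<close>.\<close>

definition cutoff :: "real \<Rightarrow> 'a::real_inner \<Rightarrow> real" where
  "cutoff \<rho> z = qpos (1 - qpos (z \<bullet> z - \<rho>\<^sup>2))"

definition cutoff' :: "real \<Rightarrow> 'a::real_inner \<Rightarrow> 'a \<Rightarrow> real" where
  "cutoff' \<rho> z h = - (2 * max 0 (1 - qpos (z \<bullet> z - \<rho>\<^sup>2)) * (2 * max 0 (z \<bullet> z - \<rho>\<^sup>2))) * (2 * (z \<bullet> h))"

lemma cutoff_has_derivative: "(cutoff \<rho> has_derivative cutoff' \<rho> z) (at z)"
proof -
  have 1: "((\<lambda>z. z \<bullet> z - \<rho>\<^sup>2) has_derivative (\<lambda>h. 2 * (z \<bullet> h))) (at z)"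
    by (auto intro!: derivative_eq_intros simp: inner_commute)
  have 2: "((\<lambda>r. qpos (1 - qpos r)) has_real_derivative - (2 * max 0 (1 - qpos r) * (2 * max 0 r))) (at r)" for r
    using DERIV_chain2[OF qpos_has_derivative DERIV_diff[OF DERIV_const[of 1] qpos_has_derivative], of r] by simp
  show ?thesis
    using has_derivative_compose[OF 1 2[unfolded has_field_derivative_def]]
    unfolding cutoff_def[abs_def] cutoff'_def[abs_def] by simp
qed

lemma cutoff'_continuous: "continuous_on S (\<lambda>z. cutoff' \<rho> z h)"
  unfolding cutoff'_def
  by (intro continuous_intros continuous_on_compose2[OF qpos_continuous[of UNIV]]) auto

lemma cutoff_continuous: "continuous_on S (cutoff \<rho>)"
  unfolding cutoff_def
  by (intro continuous_intros continuous_on_compose2[OF qpos_continuous[of UNIV]]) auto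

lemma cutoff_on_ball:
  assumes "norm z \<le> \<rho>"
  shows "cutoff \<rho> z = 1" "cutoff' \<rho> z h = 0"
proof -
  have "z \<bullet> z \<le> \<rho>\<^sup>2" using assms by (simp add: power_mono flip: power2_norm_eq_inner)
  then show "cutoff \<rho> z = 1" "cutoff' \<rho> z h = 0" by (auto simp: cutoff_def cutoff'_def)
qed

text \<open>The squared norm is at most \<open>\<rho>\<^sup>2 + 1\<close>, and a norm above 1 is at
  most its square; the crude radius spares a square root.\<close>

lemma cutoff_support:
  assumes "cutoff \<rho> z \<noteq> 0"
  shows "norm z \<le> \<rho>\<^sup>2 + 1"
proof -
  let ?r = "z \<bullet> z - \<rho>\<^sup>2"
  have "qpos ?r < 1" using assms by (auto simp: cutoff_def qpos_eq_0 not_le)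
  then have "?r \<le> 1" by (cases "?r \<le> 0") (auto simp: power_less_one_iff abs_square_less_1 abs_less_iff)
  then have n: "(norm z)\<^sup>2 \<le> \<rho>\<^sup>2 + 1" by (simp add: power2_norm_eq_inner)
  show ?thesis
  proof (cases "norm z \<le> 1")
    case False
    then have "norm z \<le> (norm z)\<^sup>2" by (simp add: self_le_power)
    then show ?thesis using n by simp
  qed (use zero_le_power2[of \<rho>] in linarith)
qed

text \<open>The soft minimum of the smoothed cones \<open>h i + K sqrt (\<bar>z - i\<bar>\<^sup>2 + \<delta>\<^sup>2)\<close> over a finite net is \<open>C\<^sup>1\<close>
  and, being a soft minimum, inherits their Lipschitz constant.\<close>

lemma softmin_approx:
  fixes h :: "'a::euclidean_space \<Rightarrow> real"
  assumes K: "0 \<le> K" and lip: "\<And>z w. z \<in> cball 0 \<rho> \<Longrightarrow> w \<in> cball 0 \<rho> \<Longrightarrow> \<bar>h z - h w\<bar> \<le> K * norm (z - w)"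
    and e: "0 < \<epsilon>" and \<rho>: "0 \<le> \<rho>"
  shows "\<exists>f. C1 f \<and> (\<forall>z w. \<bar>f z - f w\<bar> \<le> K * norm (z - w)) \<and> (\<forall>z\<in>cball 0 \<rho>. \<bar>f z - h z\<bar> \<le> \<epsilon>)"
proof -
  \<comment> \<open>Near a net point the smoothed cone costs at most \<open>2 * K * \<delta>\<close>
    and the variation of \<open>h\<close> at most \<open>K * \<delta>\<close>. The added 1 covers
    \<open>K = 0\<close>.\<close>
  define \<delta> where "\<delta> = \<epsilon> / (3 * K + 1)"
  have \<delta>: "0 < \<delta>" "3 * K * \<delta> \<le> \<epsilon>"
  proof -
    show "0 < \<delta>" using e K by (simp add: \<delta>_def)
    have "3 * K * \<delta> \<le> (3 * K + 1) * \<delta>" using \<open>0 < \<delta>\<close> by (simp add: algebra_simps)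
    also have "\<dots> = \<epsilon>" using K by (simp add: \<delta>_def)
    finally show "3 * K * \<delta> \<le> \<epsilon>" .
  qed
  obtain Z :: "'a set" where Z: "finite Z" "Z \<subseteq> cball 0 \<rho>" "cball 0 \<rho> \<subseteq> (\<Union>i\<in>Z. ball i \<delta>)"
  proof (rule compactE_image[OF compact_cball[of "0::'a" \<rho>], of "cball 0 \<rho>" "\<lambda>i. ball i \<delta>"])
    show "cball 0 \<rho> \<subseteq> (\<Union>i\<in>cball (0::'a) \<rho>. ball i \<delta>)" using \<delta>(1) by (meson UN_I centre_in_ball subsetI)
  qed auto
  have Zne: "Z \<noteq> {}" using Z(3) \<rho> by force
  define n where "n = real (card Z)"
  have n: "1 \<le> n" using Zne Z(1) by (simp add: n_def Suc_le_eq card_gt_0_iff)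
  \<comment> \<open>A soft minimum of \<open>n\<close> functions lies below their minimum by at most
    \<open>ln n / \<beta>\<close>, and \<open>ln n \<le> n\<close>.\<close>
  define \<beta> where "\<beta> = n / \<epsilon>"
  have \<beta>: "0 < \<beta>" "ln n / \<beta> \<le> \<epsilon>"
  proof -
    show "0 < \<beta>" using n e by (simp add: \<beta>_def)
    have "ln n \<le> n" using n ln_le_minus_one[of n] by simp
    then show "ln n / \<beta> \<le> \<epsilon>" using n e by (simp add: \<beta>_def field_simps)
  qed
  \<comment> \<open>The norm of the pair is the smoothed distance; it is differentiable because the
    second entry keeps the pair away from zero.\<close>
  define a where "a i z = h i + K * norm (z - i, \<delta>)" for i z
  define S where "S z = (\<Sum>i\<in>Z. exp (- \<beta> * a i z))" for z
  define f where "f z = - (1 / \<beta>) * ln (S z)" for z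
  have S0: "0 < S z" for z unfolding S_def using Z(1) Zne by (intro sum_pos) auto
  define S' where "S' z q = (\<Sum>i\<in>Z. exp (- \<beta> * a i z) * (- \<beta> * (K * ((q, 0) \<bullet> sgn (z - i, \<delta>)))))" for z q
  have np: "(z - i, \<delta>) \<noteq> 0" for z i :: 'a using \<delta>(1) by (simp add: zero_prod_def)
  have a': "(a i has_derivative (\<lambda>q. K * ((q, 0) \<bullet> sgn (z - i, \<delta>)))) (at z)" for i z
  proof -
    have "((\<lambda>z. (z - i, \<delta>)) has_derivative (\<lambda>q. (q, 0))) (at z)" by (auto intro!: derivative_eq_intros)
    from has_derivative_compose[OF this has_derivative_norm[OF np]]
    have "((\<lambda>z. norm (z - i, \<delta>)) has_derivative (\<lambda>q. (q, 0) \<bullet> sgn (z - i, \<delta>))) (at z)" .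
    then show ?thesis unfolding a_def by (auto intro!: derivative_eq_intros)
  qed
  have S': "(S has_derivative S' z) (at z)" for z
    unfolding S_def[abs_def] S'_def[abs_def]
    by (intro has_derivative_sum) (auto intro!: derivative_eq_intros a')
  have f': "(f has_derivative (\<lambda>q. - (1 / \<beta>) * (S' z q * (1 / S z)))) (at z)" for z
    unfolding f_def[abs_def]
    by (intro has_derivative_mult_right) (use S0[of z] in \<open>auto intro!: derivative_eq_intros S' simp: field_simps\<close>)
  have ac: "continuous_on UNIV (a i)" for i
    unfolding a_def by (intro continuous_intros)
  have Sc: "continuous_on UNIV S" unfolding S_def
    by (intro continuous_on_sum continuous_on_exp continuous_on_mult ac continuous_on_const)
  have "C1 f"
  proof (rule C1I[OF f'])
    fix q :: 'a
    have "continuous_on UNIV (\<lambda>z. S' z q)" unfolding S'_def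
      by (intro continuous_intros ac) (simp add: np)
    then show "continuous_on UNIV (\<lambda>z. - (1 / \<beta>) * (S' z q * (1 / S z)))"
      using S0 by (intro continuous_intros Sc) (auto simp: less_imp_neq[symmetric])
  qed
  moreover have one_sided: "f z \<le> f w + K * norm (z - w)" for z w
  proof -
    \<comment> \<open>Each cone rises by at most \<open>K * norm (z - w)\<close>, so each
      exponential shrinks by at most the corresponding factor. The factor is common to all summands
      and survives the logarithm as the Lipschitz constant.\<close>
    have "exp (- \<beta> * (K * norm (z - w))) * S w \<le> S z"
      unfolding S_def sum_distrib_left
    proof (rule sum_mono)
      fix i assume "i \<in> Z"
      have "norm (z - i, \<delta>) \<le> norm (w - i, \<delta>) + norm (z - w, 0::real)"
        using norm_triangle_ineq[of "(w - i, \<delta>)" "(z - w, 0::real)"] by simp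
      then have "a i z \<le> a i w + K * norm (z - w)"
        unfolding a_def using K mult_left_mono[of "norm (z - i, \<delta>)" "norm (w - i, \<delta>) + norm (z - w)" K]
        by (simp add: norm_Pair algebra_simps)
      then have "- \<beta> * (K * norm (z - w)) + - \<beta> * a i w \<le> - \<beta> * a i z"
        using \<beta>(1) mult_left_mono[of "a i z" "a i w + K * norm (z - w)" \<beta>] by (simp add: algebra_simps)
      then show "exp (- \<beta> * (K * norm (z - w))) * exp (- \<beta> * a i w) \<le> exp (- \<beta> * a i z)"
        by (simp flip: exp_add)
    qed
    then have "ln (exp (- \<beta> * (K * norm (z - w))) * S w) \<le> ln (S z)" using S0 by (simp add: ln_mono)
    then have "- \<beta> * (K * norm (z - w)) + ln (S w) \<le> ln (S z)" using S0[of w] by (simp add: ln_mult)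
    then have "(1 / \<beta>) * (- \<beta> * (K * norm (z - w)) + ln (S w)) \<le> (1 / \<beta>) * ln (S z)"
      using \<beta>(1) by (intro mult_left_mono) auto
    moreover have "(1 / \<beta>) * (- \<beta> * (K * norm (z - w)) + ln (S w)) = - (K * norm (z - w)) + (1 / \<beta>) * ln (S w)"
      using \<beta>(1) by (simp add: field_simps)
    ultimately show ?thesis by (simp add: f_def)
  qed
  moreover have "\<bar>f z - f w\<bar> \<le> K * norm (z - w)" for z w
    using one_sided[of z w] one_sided[of w z] by (simp add: abs_le_iff norm_minus_commute[of w z])
  moreover have "\<bar>f z - h z\<bar> \<le> \<epsilon>" if z: "z \<in> cball 0 \<rho>" for z
  proof -
    obtain i where i: "i \<in> Z" "dist i z < \<delta>" using Z(3) z by auto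
    have iB: "i \<in> cball 0 \<rho>" using i Z(2) by auto
    have "norm (z - i, \<delta>) \<le> norm (z - i) + norm \<delta>" by (rule norm_Pair_le)
    also have "\<dots> \<le> 2 * \<delta>" using i(2) \<delta>(1) by (simp add: dist_norm norm_minus_commute)
    finally have "a i z \<le> h i + K * (2 * \<delta>)" unfolding a_def using K by (simp add: mult_left_mono)
    moreover have "h i \<le> h z + K * \<delta>"
    proof -
      have "\<bar>h i - h z\<bar> \<le> K * norm (i - z)" by (rule lip[OF iB z])
      also have "\<dots> \<le> K * \<delta>" using i(2) K by (intro mult_left_mono) (auto simp: dist_norm)
      finally show ?thesis by simp
    qed
    ultimately have ai: "a i z \<le> h z + \<epsilon>" using \<delta>(2) by simp
    have "exp (- \<beta> * a i z) \<le> S z" unfolding S_def using i(1) Z(1) by (intro member_le_sum) auto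
    then have "- \<beta> * a i z \<le> ln (S z)" using S0[of z] by (simp add: ln_ge_iff)
    then have up: "f z \<le> a i z" using \<beta>(1) by (simp add: f_def field_simps)
    have "S z \<le> (\<Sum>i\<in>Z. exp (- \<beta> * h z))"
      unfolding S_def
    proof (rule sum_mono)
      fix j assume j: "j \<in> Z"
      then have "\<bar>h z - h j\<bar> \<le> K * norm (z - j)" using Z(2) z by (intro lip) auto
      also have "\<dots> \<le> K * norm (z - j, \<delta>)" using K norm_fst_le[of "z - j" \<delta>] by (intro mult_left_mono) auto
      finally have "h z \<le> a j z" by (simp add: a_def)
      then show "exp (- \<beta> * a j z) \<le> exp (- \<beta> * h z)" using \<beta>(1) by simp
    qed
    then have "S z \<le> n * exp (- \<beta> * h z)" by (simp add: n_def)
    then have "ln (S z) \<le> ln (n * exp (- \<beta> * h z))" using S0[of z] n by (simp add: ln_mono)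
    also have "\<dots> = ln n - \<beta> * h z" using n by (simp add: ln_mult)
    finally have "(1 / \<beta>) * ln (S z) \<le> (1 / \<beta>) * (ln n - \<beta> * h z)" using \<beta>(1) by (intro mult_left_mono) auto
    also have "\<dots> = ln n / \<beta> - h z" using \<beta>(1) by (simp add: field_simps)
    finally have low: "h z - ln n / \<beta> \<le> f z" by (simp add: f_def)
    show ?thesis using up ai low \<beta>(2) by simp
  qed
  ultimately show ?thesis by blast
qed

section \<open>Supports of measures\<close>

lemma closed_msupport: "closed (msupport M)"
proof -
  have "\<exists>U. open U \<and> z \<in> U \<and> U \<subseteq> - msupport M" if "z \<in> - msupport M" for z
  proof -
    obtain U where U: "open U" "z \<in> U" "\<not> emeasure M U > 0"
      using \<open>z \<in> - msupport M\<close> unfolding msupport_def by blast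
    then have "U \<subseteq> - msupport M" unfolding msupport_def by blast
    with U show ?thesis by blast
  qed
  then have "open (- msupport M)" unfolding open_subopen[of "- msupport M"] by blast
  then show ?thesis by (simp add: closed_def)
qed

text \<open>By second countability, the complement of the support is covered by countably many basic
  open sets of measure zero.\<close>

lemma AE_msupport:
  fixes M :: "'a::second_countable_topology measure"
  assumes "sets M = sets borel"
  shows "AE z in M. z \<in> msupport M"
proof -
  obtain B :: "'a set set" where B: "countable B" "topological_basis B" using ex_countable_basis by blast
  define B0 where "B0 = {b \<in> B. emeasure M b = 0}"
  have "countable B0" using B(1) by (simp add: B0_def)
  moreover have "b \<in> null_sets M" if "b \<in> B0" for b
    using that topological_basis_open[OF B(2)] assms by (auto simp: B0_def null_sets_def)
  ultimately have "(\<Union>b\<in>B0. b) \<in> null_sets M" by (intro null_sets_UN') auto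
  moreover have "{z \<in> space M. z \<notin> msupport M} \<subseteq> (\<Union>b\<in>B0. b)"
  proof
    fix z assume "z \<in> {z \<in> space M. z \<notin> msupport M}"
    then obtain U where U: "open U" "z \<in> U" "\<not> emeasure M U > 0" unfolding msupport_def by blast
    then have U0: "emeasure M U = 0" by simp
    obtain b where b: "b \<in> B" "z \<in> b" "b \<subseteq> U" using topological_basisE[OF B(2) U(1,2)] .
    have "U \<in> sets M" using U(1) assms by simp
    then have "emeasure M b \<le> emeasure M U" using b(3) by (intro emeasure_mono)
    then show "z \<in> (\<Union>b\<in>B0. b)" using b U0 by (auto simp: B0_def)
  qed
  ultimately show ?thesis by (rule AE_I')
qed

lemma on_ball_msupport:
  fixes M :: "'a::euclidean_space measure"
  assumes "prob_space M" "sets M = sets borel" "msupport M \<subseteq> cball 0 \<rho>"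
  shows "on_ball \<rho> M"
  unfolding on_ball_def
proof (intro conjI assms)
  show "AE z in M. z \<in> cball 0 \<rho>"
    by (rule AE_mp[OF AE_msupport[OF assms(2)]]) (use assms(3) in \<open>intro AE_I2 impI, blast\<close>)
qed

lemma msupport_on_ball:
  fixes M :: "'a::euclidean_space measure"
  assumes "on_ball \<rho> M"
  shows "msupport M \<subseteq> cball 0 \<rho>"
proof
  fix z assume z: "z \<in> msupport M"
  show "z \<in> cball 0 \<rho>"
  proof (rule ccontr)
    assume "z \<notin> cball 0 \<rho>"
    then have "emeasure M (- cball 0 \<rho>) > 0"
      using z unfolding msupport_def by (auto simp: open_Compl)
    moreover have "emeasure M (- cball 0 \<rho>) = 0"
    proof -
      have "AE z in M. z \<notin> - cball 0 \<rho>" by (rule on_ball_AE[OF assms]) simp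
      moreover have "- cball 0 \<rho> \<in> sets M" using assms by (simp add: on_ball_def borel_open open_Compl)
      ultimately have "- cball 0 \<rho> \<in> null_sets M" using AE_iff_null_sets[of "- cball 0 \<rho>" M] by blast
      then show ?thesis by (rule null_setsD1)
    qed
    ultimately show False by simp
  qed
qed

lemma on_ball_Pc: "on_ball \<rho> M \<Longrightarrow> M \<in> Pc"
  unfolding Pc_def compact_eq_bounded_closed
  by (intro CollectI conjI closed_msupport bounded_subset[OF bounded_cball msupport_on_ball[of \<rho> M]])
    (simp_all add: on_ball_def)

section \<open>Weak solutions of the continuity equation\<close>

lemma fsupport_zero: "z \<notin> fsupport f \<Longrightarrow> f z = 0"
  unfolding fsupport_def using closure_subset[of "{z. f z \<noteq> 0}"] by auto

lemma has_real_derivative_iff_mult_left: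
  "(f has_real_derivative c) F \<longleftrightarrow> (f has_derivative (\<lambda>x. x * c)) F"
proof -
  have "times c = (\<lambda>x. x * c)" by (rule ext) (rule mult.commute)
  from arg_cong[OF this, of "\<lambda>D. (f has_derivative D) F"] show ?thesis
    unfolding has_field_derivative_def .
qed

context control_system
begin

text \<open>The mean value inequality bounds the difference quotients by \<open>B\<close>, so
  dominated convergence applies; at the end points of the interval the derivatives are
  one-sided.\<close>

lemma leibniz_on_ball:
  fixes f :: "real \<Rightarrow> 'z \<Rightarrow> real"
  assumes \<mu>: "on_ball \<rho> \<mu>"
    and d: "\<And>t z. t \<in> {0..T} \<Longrightarrow> ((\<lambda>t. f t z) has_real_derivative f' t z) (at t within {0..T})"
    and c: "\<And>t. t \<in> {0..T} \<Longrightarrow> continuous_on UNIV (f t)" "\<And>t. t \<in> {0..T} \<Longrightarrow> continuous_on UNIV (f' t)"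
    and B: "\<And>t z. t \<in> {0..T} \<Longrightarrow> z \<in> cball 0 \<rho> \<Longrightarrow> norm (f' t z) \<le> B"
    and t: "t \<in> {0..T}"
  shows "((\<lambda>t. LINT z|\<mu>. f t z) has_real_derivative (LINT z|\<mu>. f' t z)) (at t within {0..T})"
  unfolding has_field_derivative_iff tendsto_at_iff_sequentially
proof (intro allI impI)
  interpret prob_space \<mu> using \<mu> by (simp add: on_ball_def)
  fix x :: "nat \<Rightarrow> real" assume xt: "\<forall>i. x i \<in> {0..T} - {t}" and x: "x \<longlonglongrightarrow> t"
  have xn: "x n \<in> {0..T}" "x n \<noteq> t" for n using xt by auto
  have i: "integrable \<mu> (f s)" if "s \<in> {0..T}" for s by (rule on_ball_integrable[OF \<mu> c(1)[OF that]])
  have cq: "continuous_on UNIV (\<lambda>z. (f (x n) z - f t z) / (x n - t))" for n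
    by (rule continuous_on_divide[OF continuous_on_diff[OF c(1)[OF xn(1)] c(1)[OF t]] continuous_on_const])
      (intro ballI, simp add: xn(2))
  have "(\<lambda>n. LINT z|\<mu>. (f (x n) z - f t z) / (x n - t)) \<longlonglongrightarrow> (LINT z|\<mu>. f' t z)"
  proof (rule integral_dominated_convergence[where w = "\<lambda>_. B"])
    show "f' t \<in> borel_measurable \<mu>" by (rule borel_measurable_integrable[OF on_ball_integrable[OF \<mu> c(2)[OF t]]])
    show "(\<lambda>z. (f (x n) z - f t z) / (x n - t)) \<in> borel_measurable \<mu>" for n
      by (rule borel_measurable_integrable[OF on_ball_integrable[OF \<mu> cq]])
    have "(\<lambda>n. (f (x n) z - f t z) / (x n - t)) \<longlonglongrightarrow> f' t z" for z
    proof -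
      have "((\<lambda>y. (f y z - f t z) / (y - t)) \<longlongrightarrow> f' t z) (at t within {0..T})"
        using d[OF t, of z] by (simp only: has_field_derivative_iff)
      moreover have "filterlim x (at t within {0..T}) sequentially"
        unfolding filterlim_at using xt x by simp
      ultimately show ?thesis by (rule filterlim_compose)
    qed
    then show "AE z in \<mu>. (\<lambda>n. (f (x n) z - f t z) / (x n - t)) \<longlonglongrightarrow> f' t z"
      by (intro AE_I2)
    show "AE z in \<mu>. norm ((f (x n) z - f t z) / (x n - t)) \<le> B" for n
    proof (rule on_ball_AE[OF \<mu>])
      fix z :: 'z assume z: "z \<in> cball 0 \<rho>"
      have "norm (f (x n) z - f t z) \<le> B * norm (x n - t)"
      proof (rule field_differentiable_bound[of "{0..T}" "\<lambda>t. f t z" "\<lambda>t. f' t z"])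
        show "((\<lambda>t. f t z) has_real_derivative f' s z) (at s within {0..T})" if "s \<in> {0..T}" for s
          by (rule d[OF that])
        show "norm (f' s z) \<le> B" if "s \<in> {0..T}" for s by (rule B[OF that z])
      qed (use xn(1) t in simp_all)
      then show "norm ((f (x n) z - f t z) / (x n - t)) \<le> B"
        using xn(2)[of n] by (simp add: divide_le_eq)
    qed
  qed simp
  moreover have "(LINT z|\<mu>. (f (x n) z - f t z) / (x n - t)) = ((LINT z|\<mu>. f (x n) z) - (LINT z|\<mu>. f t z)) / (x n - t)" for n
    using Bochner_Integration.integral_diff[OF i[OF xn(1)[of n]] i[OF t]] by simp
  ultimately show "((\<lambda>y. ((LINT z|\<mu>. f y z) - (LINT z|\<mu>. f t z)) / (y - t)) \<circ> x) \<longlonglongrightarrow> (LINT z|\<mu>. f' t z)"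
    by (simp only: o_def)
qed

text \<open>The continuity equation for an abstract control system; for the lifted field it is the
  given one by \<open>continuity_equation_iff\<close>.\<close>

definition weak_solution :: "'z measure \<Rightarrow> (real \<Rightarrow> 'm) \<Rightarrow> (real \<Rightarrow> 'z measure) \<Rightarrow> bool" where
  "weak_solution \<mu>\<^sub>0 \<theta> \<mu> \<longleftrightarrow> continuous_curve_Pc T \<mu> \<and> \<mu> 0 = \<mu>\<^sub>0 \<and>
    (\<forall>\<phi> :: real \<times> 'z \<Rightarrow> real. C1c \<phi> \<and> fsupport \<phi> \<subseteq> {0<..<T} \<times> UNIV \<longrightarrow>
      (let I = (\<lambda>t. LINT z|\<mu> t. Dif \<phi> (t, z) (1, F t z (\<theta> t)))
       in integrable (lebesgue_on {0..T}) I \<and> (LINT t|lebesgue_on {0..T}. I t) = 0))"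

lemma F_curve_cont:
  assumes "continuous_on S f" "continuous_on S X" "continuous_on S \<theta>" "f ` S \<subseteq> {0..T}"
  shows "continuous_on S (\<lambda>t. F (f t) (X t) (\<theta> t))"
proof -
  have "continuous_on S (\<lambda>t. (\<lambda>(t, z, \<theta>). F t z \<theta>) (f t, X t, \<theta> t))"
    by (rule continuous_on_compose2[OF F_cont]) (use assms in \<open>auto intro!: continuous_intros\<close>)
  then show ?thesis by simp
qed

lemma flow_init':
  assumes "is_flow \<theta> \<Phi>" "\<tau> \<in> {0..T}"
  shows "\<Phi> \<tau> \<tau> z = z"
proof -
  have "sol T (\<lambda>s z. F s z (\<theta> s)) \<tau> z (\<lambda>t. \<Phi> \<tau> t z)" using assms unfolding is_flow_def by blast
  then show ?thesis using assms(2) by (rule sol_init)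
qed

lemma flow_end_derivative:
  assumes "adm N \<theta>" "is_flow \<theta> \<Phi>" "continuous_on {0..T} \<theta>" "\<tau> \<in> {0..T}" "t \<in> {0..T}"
  shows "((\<lambda>t. \<Phi> \<tau> t z) has_vector_derivative F t (\<Phi> \<tau> t z) (\<theta> t)) (at t within {0..T})"
proof -
  interpret c1_flow T "\<lambda>s z. F s z (\<theta> s)" "\<lambda>s z. blinfun_apply (DF s (\<theta> s) z)" \<Phi>
    by (rule flow_c1[OF assms(1,2)])
  show ?thesis
    by (rule flow_time_derivative[OF F_curve_cont[OF continuous_on_id flow_cont[OF assms(4)] assms(3)] assms(4,5)]) simp
qed

lemma flow_begin_derivative:
  assumes "adm N \<theta>" "is_flow \<theta> \<Phi>" "continuous_on {0..T} \<theta>" "\<tau> \<in> {0..T}" "t \<in> {0..T}"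
  shows "((\<lambda>\<sigma>. \<Phi> \<sigma> t z) has_vector_derivative - Dif (\<Phi> \<tau> t) z (F \<tau> z (\<theta> \<tau>))) (at \<tau> within {0..T})"
proof -
  interpret c1_flow T "\<lambda>s z. F s z (\<theta> s)" "\<lambda>s z. blinfun_apply (DF s (\<theta> s) z)" \<Phi>
    by (rule flow_c1[OF assms(1,2)])
  show ?thesis
    using flow_start_derivative[OF F_curve_cont[OF continuous_on_id flow_cont[OF assms(4)] assms(3)] assms(4,5)]
    by (simp add: Dif_flow[OF assms(4,5)])
qed

text \<open>Along trajectories, which are \<open>C1\<close> because the control is continuous, the
  tested expression is the time derivative of \<phi>. Its integral over time is a difference of end
  values, and these vanish since \<phi> is supported in the open time interval.\<close>

lemma push_weak_solution:
  assumes \<theta>: "adm N \<theta>" and \<Phi>: "is_flow \<theta> \<Phi>" and c: "continuous_on {0..T} \<theta>" and \<mu>: "on_ball \<rho> \<mu>"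
  shows "weak_solution \<mu> \<theta> (push \<Phi> \<mu>)"
  unfolding weak_solution_def continuous_curve_Pc_def
proof (intro conjI ballI allI impI)
  fix t assume "t \<in> {0..T}"
  then show "push \<Phi> \<mu> t \<in> Pc" by (rule on_ball_Pc[OF push_on_ball[OF \<mu> \<theta> \<Phi>]])
next
  fix f :: "'z \<Rightarrow> real" assume f: "continuous_on UNIV f \<and> bounded (range f)"
  then obtain B where B: "\<And>z. norm (f z) \<le> B" unfolding bounded_iff by blast
  have "continuous_on {0..T} (\<lambda>t. LINT z|\<mu>. f (\<Phi> 0 t z))"
  proof (rule continuous_on_parametric_integral[OF \<mu>])
    show "continuous_on UNIV (\<lambda>z. f (\<Phi> 0 t z))" if t: "t \<in> {0..T}" for t
      by (rule continuous_on_compose2[OF conjunct1[OF f] flow_cont_state[OF \<theta> \<Phi> zero_in t]]) auto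
    show "continuous_on {0..T} (\<lambda>t. f (\<Phi> 0 t z))" for z
      by (rule continuous_on_compose2[OF conjunct1[OF f] flow_cont_end[OF \<Phi> zero_in]]) auto
  qed (rule B)
  then show "continuous_on {0..T} (\<lambda>t. LINT z|push \<Phi> \<mu> t. f z)"
    by (rule continuous_on_eq) (simp add: push_integral[OF \<mu> \<theta> \<Phi> _ conjunct1[OF f]])
next
  have "\<Phi> 0 0 = (\<lambda>z. z)" by (rule ext) (rule flow_init'[OF \<Phi> zero_in])
  then show "push \<Phi> \<mu> 0 = \<mu>" using \<mu> by (simp add: push_def on_ball_def distr_id2)
next
  fix \<phi> :: "real \<times> 'z \<Rightarrow> real" assume \<phi>: "C1c \<phi> \<and> fsupport \<phi> \<subseteq> {0<..<T} \<times> UNIV"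
  then have d\<phi>: "(\<phi> has_derivative blinfun_apply (Dif \<phi> p)) (at p)" and c\<phi>: "continuous_on UNIV (Dif \<phi>)" for p
    by (auto simp: C1c_def intro: C1_works) (simp add: C1_def)
  define j where "j t z = Dif \<phi> (t, \<Phi> 0 t z) (1, F t (\<Phi> 0 t z) (\<theta> t))" for t z
  have Dc: "continuous_on S (\<lambda>x. Dif \<phi> (a x) (b x))"
    if "continuous_on S a" "continuous_on S b" for S :: "'c::topological_space set" and a b
    by (intro continuous_intros continuous_on_compose2[OF c\<phi>] that) auto
  have jt: "continuous_on {0..T} (\<lambda>t. j t z)" for z
    unfolding j_def using flow_cont_end[OF \<Phi> zero_in]
    by (intro Dc continuous_intros F_curve_cont c) auto
  have jz: "continuous_on UNIV (j t)" if "t \<in> {0..T}" for t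
    unfolding j_def using flow_cont_state[OF \<theta> \<Phi> zero_in that] that
    by (intro Dc continuous_intros F_curve_cont) auto
  obtain M where M: "0 \<le> M" "\<forall>p\<in>cball 0 (T + rad N \<rho>). norm (Dif \<phi> p) \<le> M"
    using continuous_bounded_cball[OF c\<phi>] by blast
  have jB: "norm (j t z) \<le> M * (1 + C * (1 + rad N \<rho>))" if t: "t \<in> {0..T}" and z: "z \<in> cball 0 \<rho>" for t z
  proof -
    have b: "norm (\<Phi> 0 t z) \<le> rad N \<rho>" using flow_bound[OF \<theta> \<Phi> zero_in t] z by simp
    have "norm (t, \<Phi> 0 t z) \<le> T + rad N \<rho>" using norm_Pair_le[of t "\<Phi> 0 t z"] b t by simp
    then have 1: "norm (Dif \<phi> (t, \<Phi> 0 t z)) \<le> M" using M by simp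
    have "norm (F t (\<Phi> 0 t z) (\<theta> t)) \<le> C * (1 + norm (\<Phi> 0 t z))" by (rule growth[OF t])
    also have "\<dots> \<le> C * (1 + rad N \<rho>)" using b C by simp
    finally have 2: "norm (1::real, F t (\<Phi> 0 t z) (\<theta> t)) \<le> 1 + C * (1 + rad N \<rho>)"
      using norm_Pair_le[of "1::real" "F t (\<Phi> 0 t z) (\<theta> t)"] by simp
    show ?thesis unfolding j_def
      by (intro order_trans[OF norm_blinfun] mult_mono 1 2 M) simp
  qed
  have fz: "((\<lambda>t. \<phi> (t, \<Phi> 0 t z)) has_real_derivative j t z) (at t within {0..T})" if t: "t \<in> {0..T}" for t z
  proof -
    have "((\<lambda>t. (t, \<Phi> 0 t z)) has_derivative (\<lambda>x. (x, x *\<^sub>R F t (\<Phi> 0 t z) (\<theta> t)))) (at t within {0..T})"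
      using flow_end_derivative[OF \<theta> \<Phi> c zero_in t, of z]
      unfolding has_vector_derivative_def by (intro has_derivative_Pair has_derivative_ident)
    from has_derivative_compose[OF this d\<phi>]
    have "((\<lambda>t. \<phi> (t, \<Phi> 0 t z)) has_derivative (\<lambda>x. Dif \<phi> (t, \<Phi> 0 t z) (x *\<^sub>R (1, F t (\<Phi> 0 t z) (\<theta> t))))) (at t within {0..T})"
      by simp
    then show ?thesis unfolding has_real_derivative_iff_mult_left j_def blinfun.scaleR_right by simp
  qed
  have fc: "continuous_on UNIV (\<lambda>z. \<phi> (t, \<Phi> 0 t z))" if "t \<in> {0..T}" for t
  proof -
    have "continuous_on UNIV \<phi>" using d\<phi> by (meson has_derivative_continuous continuous_at_imp_continuous_on)
    then show ?thesis
      by (rule continuous_on_compose2) (use flow_cont_state[OF \<theta> \<Phi> zero_in that] in \<open>auto intro!: continuous_intros\<close>)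
  qed
  define I where "I t = (LINT z|\<mu>. j t z)" for t
  have Ic: "continuous_on {0..T} I"
    unfolding I_def by (rule continuous_on_parametric_integral[OF \<mu> jz jt jB])
  have "(I has_integral (LINT z|\<mu>. \<phi> (T, \<Phi> 0 T z)) - (LINT z|\<mu>. \<phi> (0, \<Phi> 0 0 z))) {0..T}"
  proof (rule fundamental_theorem_of_calculus)
    show "((\<lambda>t. LINT z|\<mu>. \<phi> (t, \<Phi> 0 t z)) has_vector_derivative I t) (at t within {0..T})" if "t \<in> {0..T}" for t
      using leibniz_on_ball[OF \<mu> fz fc jz jB that]
      unfolding I_def by (simp add: has_real_derivative_iff_has_vector_derivative)
  qed (use T in simp)
  moreover have "\<phi> (T, z) = 0" "\<phi> (0, z) = 0" for z
    by (rule fsupport_zero, use \<phi> in auto)+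
  ultimately have I0: "integral {0..T} I = 0" by (simp add: integral_unique)
  have I: "(LINT z|push \<Phi> \<mu> t. Dif \<phi> (t, z) (1, F t z (\<theta> t))) = I t" if t: "t \<in> {0..T}" for t
    unfolding I_def j_def
  proof (rule push_integral[OF \<mu> \<theta> \<Phi> t])
    show "continuous_on UNIV (\<lambda>z. Dif \<phi> (t, z) (1, F t z (\<theta> t)))"
      using t by (intro Dc continuous_intros F_curve_cont) auto
  qed
  have Ii: "integrable (lebesgue_on {0..T}) I"
    using Ic by (intro continuous_imp_integrable_real) auto
  show "let I = (\<lambda>t. LINT z|push \<Phi> \<mu> t. Dif \<phi> (t, z) (1, F t z (\<theta> t)))
       in integrable (lebesgue_on {0..T}) I \<and> (LINT t|lebesgue_on {0..T}. I t) = 0"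
    unfolding Let_def
  proof (intro conjI)
    show "integrable (lebesgue_on {0..T}) (\<lambda>t. LINT z|push \<Phi> \<mu> t. Dif \<phi> (t, z) (1, F t z (\<theta> t)))"
      by (rule Bochner_Integration.integrable_cong[THEN iffD2, OF refl _ Ii]) (simp add: I)
    have "(LINT t|lebesgue_on {0..T}. LINT z|push \<Phi> \<mu> t. Dif \<phi> (t, z) (1, F t z (\<theta> t))) = (LINT t|lebesgue_on {0..T}. I t)"
      by (rule Bochner_Integration.integral_cong) (simp_all add: I)
    also have "\<dots> = 0" using lebesgue_integral_eq_integral[OF Ii] I0 by simp
    finally show "(LINT t|lebesgue_on {0..T}. LINT z|push \<Phi> \<mu> t. Dif \<phi> (t, z) (1, F t z (\<theta> t))) = 0" .
  qed
qed

text \<open>The analogue of \<open>grad\<close> for an arbitrary function and final time: the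
  gradient of the test function transported back from time \<open>t\<close> to time
  \<open>s\<close>.\<close>

definition pull_grad :: "('z \<Rightarrow> real) \<Rightarrow> (real \<Rightarrow> real \<Rightarrow> 'z \<Rightarrow> 'z) \<Rightarrow> real \<Rightarrow> real \<Rightarrow> 'z \<Rightarrow> 'z \<Rightarrow>\<^sub>L real" where
  "pull_grad h \<Phi> t s z = Dif h (\<Phi> s t z) o\<^sub>L Dif (\<Phi> s t) z"

lemma pull_has_derivative:
  assumes "adm N \<theta>" "is_flow \<theta> \<Phi>" "s \<in> {0..T}" "t \<in> {0..T}" "C1 h"
  shows "((\<lambda>z. h (\<Phi> s t z)) has_derivative blinfun_apply (pull_grad h \<Phi> t s z)) (at z)"
  using has_derivative_compose[OF flow_has_Dif[OF assms(1-4)] C1_works[OF assms(5)]]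
  by (simp add: pull_grad_def blinfun_compose.rep_eq o_def)

text \<open>The transport equation for functions constant along the flow, obtained from the
  derivative of the flow in its starting time.\<close>

lemma pull_time_derivative:
  assumes "adm N \<theta>" "is_flow \<theta> \<Phi>" "continuous_on {0..T} \<theta>" "s \<in> {0..T}" "t \<in> {0..T}" "C1 h"
  shows "((\<lambda>s. h (\<Phi> s t z)) has_real_derivative - (pull_grad h \<Phi> t s z (F s z (\<theta> s)))) (at s within {0..T})"
proof -
  let ?v = "- Dif (\<Phi> s t) z (F s z (\<theta> s))"
  have "((\<lambda>s. \<Phi> s t z) has_derivative (\<lambda>x. x *\<^sub>R ?v)) (at s within {0..T})"
    using flow_begin_derivative[OF assms(1-5)] unfolding has_vector_derivative_def .
  from has_derivative_compose[OF this C1_works[OF assms(6)]]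
  show ?thesis
    unfolding has_real_derivative_iff_mult_left pull_grad_def blinfun.scaleR_right
    by (simp add: blinfun.minus_right)
qed

lemma pull_cont:
  assumes "adm N \<theta>" "is_flow \<theta> \<Phi>" "t \<in> {0..T}" "C1 h"
  shows "continuous_on ({0..T} \<times> UNIV) (\<lambda>p. h (\<Phi> (fst p) t (snd p)))"
    and "continuous_on ({0..T} \<times> UNIV) (\<lambda>p. pull_grad h \<Phi> t (fst p) (snd p))"
proof -
  have 1: "continuous_on ({0..T} \<times> UNIV) (\<lambda>p. \<Phi> (fst p) t (snd p))"
    and 2: "continuous_on ({0..T} \<times> UNIV) (\<lambda>p. Dif (\<Phi> (fst p) t) (snd p))"
    using flow_cont_start[OF assms(1-3)] by (simp_all add: case_prod_beta)
  have h: "continuous_on UNIV h" "continuous_on UNIV (Dif h)"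
    using assms(4) C1_works[OF assms(4)] by (meson has_derivative_continuous continuous_at_imp_continuous_on, simp add: C1_def)
  show "continuous_on ({0..T} \<times> UNIV) (\<lambda>p. h (\<Phi> (fst p) t (snd p)))"
    by (rule continuous_on_compose2[OF h(1) 1]) auto
  show "continuous_on ({0..T} \<times> UNIV) (\<lambda>p. pull_grad h \<Phi> t (fst p) (snd p))"
    unfolding pull_grad_def by (intro continuous_intros 2 continuous_on_compose2[OF h(2) 1]) auto
qed

text \<open>Both partial derivatives exist and the one in space is jointly continuous, which gives
  differentiability in the pair. The time is interior so that the derivative is two-sided.\<close>

lemma pull_joint_derivative:
  assumes "adm N \<theta>" "is_flow \<theta> \<Phi>" "continuous_on {0..T} \<theta>" "s \<in> {0<..<T}" "t \<in> {0..T}" "C1 h"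
  shows "((\<lambda>p. h (\<Phi> (fst p) t (snd p))) has_derivative
    (\<lambda>q. fst q * - (pull_grad h \<Phi> t s z (F s z (\<theta> s))) + pull_grad h \<Phi> t s z (snd q))) (at (s, z))"
proof -
  have s: "s \<in> {0..T}" using assms(4) by auto
  have mem: "(s, z) \<in> {0<..<T} \<times> UNIV" using assms(4) by simp
  have op: "open ({0<..<T} \<times> (UNIV :: 'z set))" by (intro open_Times) auto
  have "((\<lambda>(s, z). h (\<Phi> s t z)) has_derivative
      (\<lambda>(ds, dz). (\<lambda>x. x * - (pull_grad h \<Phi> t s z (F s z (\<theta> s)))) ds + pull_grad h \<Phi> t s z dz))
      (at (s, z) within {0<..<T} \<times> UNIV)"
  proof (rule has_derivative_partialsI)
    show "((\<lambda>s. h (\<Phi> s t z)) has_derivative (\<lambda>x. x * - (pull_grad h \<Phi> t s z (F s z (\<theta> s))))) (at s within {0<..<T})"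
      by (rule has_derivative_subset[OF pull_time_derivative[OF assms(1-3) s assms(5,6), of z, unfolded has_real_derivative_iff_mult_left]]) auto
    show "((\<lambda>z. h (\<Phi> s t z)) has_derivative blinfun_apply (pull_grad h \<Phi> t s z)) (at z within UNIV)"
      if "s \<in> {0<..<T}" for s z
      using pull_has_derivative[OF assms(1,2) _ assms(5,6), of s z] that by simp
    have "continuous_on ({0<..<T} \<times> UNIV) (\<lambda>p. pull_grad h \<Phi> t (fst p) (snd p))"
      by (rule continuous_on_subset[OF pull_cont(2)[OF assms(1,2,5,6)]]) auto
    then show "continuous (at (s, z) within {0<..<T} \<times> UNIV) (\<lambda>(s, z). pull_grad h \<Phi> t s z)"
      using assms(4) unfolding continuous_on_eq_continuous_within case_prod_beta by blast
  qed auto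
  then show ?thesis unfolding case_prod_beta' at_within_open[OF mem op] .
qed

end

text \<open>The scaled derivative of \<open>step\<close> is nonnegative, has integral 1 and lives on
  \<open>{c..c + \<epsilon>}\<close>, so it averages \<open>m\<close> over that interval.\<close>

lemma bump_integral:
  fixes m :: "real \<Rightarrow> real"
  assumes m: "continuous_on {0..T} m" and c: "0 \<le> c" "c + \<epsilon> \<le> T" and e: "0 < \<epsilon>"
    and close: "\<And>s. s \<in> {c..c + \<epsilon>} \<Longrightarrow> \<bar>m s - M\<bar> \<le> d" and d: "0 \<le> d"
  shows "\<bar>integral {0..T} (\<lambda>s. step' ((s - c) / \<epsilon>) / \<epsilon> * m s) - M\<bar> \<le> d"
proof -
  let ?k = "\<lambda>s. step' ((s - c) / \<epsilon>) / \<epsilon>"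
  have kc: "continuous_on {0..T} ?k"
    using e by (intro continuous_intros continuous_on_compose2[OF step'_continuous[of UNIV]]) auto
  have "(?k has_integral step ((T - c) / \<epsilon>) - step ((0 - c) / \<epsilon>)) {0..T}"
  proof (rule fundamental_theorem_of_calculus)
    fix s
    have "((\<lambda>s. (s - c) / \<epsilon>) has_real_derivative 1 / \<epsilon>) (at s)" using e by (auto intro!: derivative_eq_intros)
    from DERIV_chain2[OF step_has_derivative this]
    show "((\<lambda>s. step ((s - c) / \<epsilon>)) has_vector_derivative ?k s) (at s within {0..T})"
      by (simp add: has_real_derivative_iff_has_vector_derivative[symmetric] has_field_derivative_at_within)
  qed (use c e in simp)
  moreover have "step ((T - c) / \<epsilon>) = 1" "step ((0 - c) / \<epsilon>) = 0"
    using c e by (auto intro!: step_simps simp: le_divide_eq divide_le_0_iff)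
  ultimately have k1: "(?k has_integral 1) {0..T}" by simp
  have 1: "((\<lambda>s. ?k s * m s) has_integral integral {0..T} (\<lambda>s. ?k s * m s)) {0..T}"
    by (intro integrable_integral integrable_continuous_real continuous_on_mult kc m)
  have 2: "((\<lambda>s. ?k s * m s - ?k s * M) has_integral integral {0..T} (\<lambda>s. ?k s * m s) - 1 * M) {0..T}"
    by (rule has_integral_diff[OF 1 has_integral_mult_left[OF k1]])
  have 3: "((\<lambda>s. ?k s * d) has_integral 1 * d) {0..T}" by (rule has_integral_mult_left[OF k1])
  have 4: "norm (?k s * m s - ?k s * M) \<le> ?k s * d" for s
  proof (cases "s \<in> {c..c + \<epsilon>}")
    case True
    have "norm (?k s * m s - ?k s * M) = ?k s * \<bar>m s - M\<bar>"
    proof -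
      have "norm (k * a - k * b) = k * \<bar>a - b\<bar>" if "0 \<le> k" for k a b :: real
        using that by (simp add: abs_mult flip: right_diff_distrib)
      moreover have "0 \<le> ?k s" using step_simps(7)[of "(s - c) / \<epsilon>"] e by simp
      ultimately show ?thesis by blast
    qed
    also have "\<dots> \<le> ?k s * d" using step_simps(7)[of "(s - c) / \<epsilon>"] e by (intro mult_left_mono close True) auto
    finally show ?thesis .
  next
    case False
    then have "(s - c) / \<epsilon> \<le> 0 \<or> 1 \<le> (s - c) / \<epsilon>" using e by (auto simp: divide_le_0_iff le_divide_eq)
    then have k0: "?k s = 0" using step_simps(5,6) by auto
    show ?thesis unfolding k0 by simp
  qed
  have "norm (integral {0..T} (\<lambda>s. ?k s * m s - ?k s * M)) \<le> integral {0..T} (\<lambda>s. ?k s * d)"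
    by (rule integral_norm_bound_integral[OF has_integral_integrable[OF 2] has_integral_integrable[OF 3] 4])
  then have "norm (integral {0..T} (\<lambda>s. ?k s * m s) - 1 * M) \<le> 1 * d"
    unfolding integral_unique[OF 2] integral_unique[OF 3] .
  then show ?thesis by simp
qed

lemma on_ball_mono:
  assumes "on_ball r \<nu>" "r \<le> \<rho>"
  shows "on_ball \<rho> \<nu>"
  unfolding on_ball_def
proof (intro conjI)
  show "AE z in \<nu>. z \<in> cball 0 \<rho>" by (rule on_ball_AE[OF assms(1)]) (use assms(2) in simp)
qed (use assms in \<open>simp_all add: on_ball_def\<close>)

context control_system
begin

text \<open>A transported function, cut off in space for compact support and in time to stay inside
  the open interval. The clamp only gives meaning to times where \<eta> will vanish.\<close>

definition test_fun :: "(real \<Rightarrow> real) \<Rightarrow> real \<Rightarrow> ('z \<Rightarrow> real) \<Rightarrow> (real \<Rightarrow> real \<Rightarrow> 'z \<Rightarrow> 'z) \<Rightarrow> real \<Rightarrow> real \<times> 'z \<Rightarrow> real" where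
  "test_fun \<eta> \<rho> h \<Phi> t p = \<eta> (fst p) * (cutoff \<rho> (snd p) * h (\<Phi> (clampT T (fst p)) t (snd p)))"

definition test_fun' :: "(real \<Rightarrow> real) \<Rightarrow> (real \<Rightarrow> real) \<Rightarrow> (real \<Rightarrow> 'm) \<Rightarrow> real \<Rightarrow> ('z \<Rightarrow> real) \<Rightarrow> (real \<Rightarrow> real \<Rightarrow> 'z \<Rightarrow> 'z) \<Rightarrow> real
    \<Rightarrow> real \<times> 'z \<Rightarrow> real \<times> 'z \<Rightarrow> real" where
  "test_fun' \<eta> \<eta>' \<theta> \<rho> h \<Phi> t p q =
     (let s = clampT T (fst p); z = snd p; u = h (\<Phi> s t z); Du = pull_grad h \<Phi> t s z
      in \<eta> (fst p) * (cutoff \<rho> z * (fst q * - (Du (F s z (\<theta> s))) + Du (snd q)) + cutoff' \<rho> z (snd q) * u)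
         + fst q * \<eta>' (fst p) * (cutoff \<rho> z * u))"

lemma test_fun_C1c:
  assumes \<theta>: "adm N \<theta>" and \<Phi>: "is_flow \<theta> \<Phi>" and c: "continuous_on {0..T} \<theta>" and t: "t \<in> {0..T}" and h: "C1 h"
    and \<eta>: "\<And>s. (\<eta> has_real_derivative \<eta>' s) (at s)" and \<eta>': "continuous_on UNIV \<eta>'"
    and ab: "0 < a" "b < T" and supp: "\<And>s. s \<notin> {a..b} \<Longrightarrow> \<eta> s = 0"
  shows "(test_fun \<eta> \<rho> h \<Phi> t has_derivative test_fun' \<eta> \<eta>' \<theta> \<rho> h \<Phi> t p) (at p)"
    and "C1c (test_fun \<eta> \<rho> h \<Phi> t)" and "fsupport (test_fun \<eta> \<rho> h \<Phi> t) \<subseteq> {0<..<T} \<times> UNIV"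
proof -
  have d: "(test_fun \<eta> \<rho> h \<Phi> t has_derivative test_fun' \<eta> \<eta>' \<theta> \<rho> h \<Phi> t p) (at p)" for p
  proof -
    obtain s z where p: "p = (s, z)" by (cases p)
    show ?thesis
    proof (cases "s \<in> {0<..<T}")
      case True
      then have cs: "clampT T s = s" by (simp add: clampT_def)
      have 1: "((\<lambda>p. \<eta> (fst p)) has_derivative (\<lambda>q. fst q * \<eta>' s)) (at (s, z))"
        using has_derivative_compose[OF bounded_linear_imp_has_derivative[OF bounded_linear_fst, of "at (s, z)"],
            of \<eta> "\<lambda>x. x * \<eta>' s"] \<eta>[unfolded has_real_derivative_iff_mult_left, of s] by simp
      have 2: "((\<lambda>p. cutoff \<rho> (snd p)) has_derivative (\<lambda>q. cutoff' \<rho> z (snd q))) (at (s, z))"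
        using has_derivative_compose[OF bounded_linear_imp_has_derivative[OF bounded_linear_snd, of "at (s, z)"],
            of "cutoff \<rho>" "cutoff' \<rho> z"] cutoff_has_derivative[of \<rho> z] by simp
      note 3 = pull_joint_derivative[OF \<theta> \<Phi> c True t h, of z]
      have "((\<lambda>p. \<eta> (fst p) * (cutoff \<rho> (snd p) * h (\<Phi> (fst p) t (snd p)))) has_derivative
          test_fun' \<eta> \<eta>' \<theta> \<rho> h \<Phi> t p) (at (s, z))"
        using has_derivative_mult[OF 1 has_derivative_mult[OF 2 3]]
        by (simp add: test_fun'_def[abs_def] Let_def p cs)
      moreover have "open ({0<..<T} \<times> (UNIV :: 'z set))" by (intro open_Times) auto
      ultimately show ?thesis unfolding p
        by (rule has_derivative_transform_within_open)
          (use True in \<open>auto simp: test_fun_def clampT_def\<close>)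
    next
      case False
      \<comment> \<open>The end points of the interval, where only one-sided derivatives of the
        transported function are available, lie in the open set on which \<eta> is zero.\<close>
      then have s: "s \<in> - {a..b}" using ab by auto
      have "((\<lambda>_. 0) has_real_derivative 0) (at s)" by simp
      then have "(\<eta> has_real_derivative 0) (at s)"
        by (rule has_field_derivative_transform_within_open[where S = "- {a..b}"]) (use s supp in auto)
      then have "\<eta>' s = 0" using \<eta> by (rule DERIV_unique[symmetric])
      then have z: "test_fun' \<eta> \<eta>' \<theta> \<rho> h \<Phi> t p = (\<lambda>_. 0)" using supp s by (simp add: test_fun'_def[abs_def] Let_def p)
      have "((\<lambda>_. 0) has_derivative (\<lambda>_. 0)) (at (s, z))" by simp
      moreover have "open ((- {a..b}) \<times> (UNIV :: 'z set))" by (intro open_Times) auto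
      ultimately show ?thesis unfolding z unfolding p
        by (rule has_derivative_transform_within_open) (use s supp in \<open>auto simp: test_fun_def\<close>)
    qed
  qed
  show "(test_fun \<eta> \<rho> h \<Phi> t has_derivative test_fun' \<eta> \<eta>' \<theta> \<rho> h \<Phi> t p) (at p)" by (rule d)
  have S: "fsupport (test_fun \<eta> \<rho> h \<Phi> t) \<subseteq> {a..b} \<times> cball 0 (\<rho>\<^sup>2 + 1)"
    unfolding fsupport_def
  proof (rule closure_minimal)
    show "{p. test_fun \<eta> \<rho> h \<Phi> t p \<noteq> 0} \<subseteq> {a..b} \<times> cball 0 (\<rho>\<^sup>2 + 1)"
      using supp cutoff_support[of \<rho>] by (force simp: test_fun_def)
    show "closed ({a..b} \<times> cball 0 (\<rho>\<^sup>2 + 1 :: real) :: (real \<times> 'z) set)" by (intro closed_Times) auto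
  qed
  then show "fsupport (test_fun \<eta> \<rho> h \<Phi> t) \<subseteq> {0<..<T} \<times> UNIV" using ab by force
  have cl: "continuous_on UNIV (\<lambda>p :: real \<times> 'z. clampT T (fst p))"
    by (rule continuous_on_compose2[OF continuous_clampT[of UNIV]]) (auto intro!: continuous_intros)
  have clin: "clampT T r \<in> {0..T}" for r using clampT_in[of T r] T by simp
  have cp: "continuous_on UNIV (\<lambda>p :: real \<times> 'z. (clampT T (fst p), snd p))"
    by (intro continuous_intros cl)
  have cpr: "range (\<lambda>p :: real \<times> 'z. (clampT T (fst p), snd p)) \<subseteq> {0..T} \<times> UNIV" using clin by blast
  have 1: "continuous_on UNIV (\<lambda>p. h (\<Phi> (clampT T (fst p)) t (snd p)))"
    using continuous_on_compose2[OF pull_cont(1)[OF \<theta> \<Phi> t h] cp cpr] by simp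
  have 2: "continuous_on UNIV (\<lambda>p. pull_grad h \<Phi> t (clampT T (fst p)) (snd p))"
    using continuous_on_compose2[OF pull_cont(2)[OF \<theta> \<Phi> t h] cp cpr] by simp
  have 3: "continuous_on UNIV (\<lambda>p. F (clampT T (fst p)) (snd p) (\<theta> (clampT T (fst p))))"
    by (rule F_curve_cont[OF cl]) (use clin in \<open>auto intro!: continuous_intros continuous_on_compose2[OF c cl]\<close>)
  have 4: "continuous_on UNIV \<eta>" using \<eta> by (meson DERIV_isCont continuous_at_imp_continuous_on)
  have 5: "continuous_on UNIV (\<lambda>p :: real \<times> 'z. \<eta> (fst p))" "continuous_on UNIV (\<lambda>p :: real \<times> 'z. \<eta>' (fst p))"
    by (rule continuous_on_compose2[OF 4], auto intro!: continuous_intros)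
      (rule continuous_on_compose2[OF \<eta>'], auto intro!: continuous_intros)
  have 6: "continuous_on UNIV (\<lambda>p :: real \<times> 'z. cutoff \<rho> (snd p))"
    by (rule continuous_on_compose2[OF cutoff_continuous[of UNIV]]) (auto intro!: continuous_intros)
  have 7: "continuous_on UNIV (\<lambda>p :: real \<times> 'z. cutoff' \<rho> (snd p) v)" for v
    by (rule continuous_on_compose2[OF cutoff'_continuous[of UNIV]]) (auto intro!: continuous_intros)
  have "C1 (test_fun \<eta> \<rho> h \<Phi> t)"
  proof (rule C1I[OF d])
    fix q :: "real \<times> 'z"
    show "continuous_on UNIV (\<lambda>p. test_fun' \<eta> \<eta>' \<theta> \<rho> h \<Phi> t p q)"
      unfolding test_fun'_def Let_def by (intro continuous_intros 1 2 3 5 6 7)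
  qed
  moreover have "compact (fsupport (test_fun \<eta> \<rho> h \<Phi> t))"
  proof -
    have "bounded ({a..b} \<times> cball 0 (\<rho>\<^sup>2 + 1 :: real) :: (real \<times> 'z) set)" by (intro bounded_Times) auto
    then have "bounded (fsupport (test_fun \<eta> \<rho> h \<Phi> t))" using S by (rule bounded_subset)
    then show ?thesis by (simp add: compact_eq_bounded_closed fsupport_def)
  qed
  ultimately show "C1c (test_fun \<eta> \<rho> h \<Phi> t)" by (simp add: C1c_def)
qed

text \<open>Let \<open>m s\<close> be the integral over \<open>\<mu> s\<close> of \<open>h\<close>
  transported back along the flow of \<theta>. By the transport equation its weak derivative
  contains only the difference of the two fields. Its value at \<open>t\<close> is the integral of
  \<open>h\<close> itself, its value at 0 the integral over the push-forward of the initial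
  measure.\<close>

lemma weak_solution_stable_C1:
  assumes \<theta>: "adm N \<theta>" and \<Phi>: "is_flow \<theta> \<Phi>" and c: "continuous_on {0..T} \<theta>"
    and \<theta>': "adm N \<theta>'" and \<mu>: "weak_solution \<mu>\<^sub>0 \<theta>' \<mu>" and ball: "\<And>s. s \<in> {0..T} \<Longrightarrow> on_ball \<rho> (\<mu> s)"
    and h: "C1 h" and K: "0 \<le> K" "\<And>z w. \<bar>h z - h w\<bar> \<le> K * norm (z - w)"
    and M: "0 \<le> M" "\<And>s z \<theta>\<^sub>1 \<theta>\<^sub>2. s \<in> {0..T} \<Longrightarrow> z \<in> cball 0 \<rho> \<Longrightarrow> norm (F s z \<theta>\<^sub>1 - F s z \<theta>\<^sub>2) \<le> M * norm (\<theta>\<^sub>1 - \<theta>\<^sub>2)"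
    and t: "t \<in> {0<..<T}"
  shows "\<bar>(LINT z|\<mu> t. h z) - (LINT z|\<mu>\<^sub>0. h (\<Phi> 0 t z))\<bar> \<le> K * (gron T N * M * dist1 \<theta> \<theta>')"
proof -
  have tT: "t \<in> {0..T}" using t by auto
  define B where "B = K * gron T N"
  have G: "0 \<le> gron T N" using gron_pos[of T N] by simp
  have B0: "0 \<le> B" using K G by (simp add: B_def)
  have Dh: "norm (Dif h z) \<le> K" for z
    by (rule norm_blinfun_bound[OF K(1)]) (rule has_derivative_norm_le[OF C1_works[OF h] zero_less_one], use K in simp)
  have pg: "norm (pull_grad h \<Phi> t s z) \<le> B" if s: "s \<in> {0..T}" for s z
    unfolding pull_grad_def B_def
    by (intro order_trans[OF norm_blinfun_compose] mult_mono Dh K norm_blinfun_bound[OF G Dif_flow_bound[OF \<theta> \<Phi> s tT]]) simp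
  define u where "u s z = h (\<Phi> s t z)" for s z
  have uz: "continuous_on UNIV (u s)" if s: "s \<in> {0..T}" for s
    unfolding u_def using pull_has_derivative[OF \<theta> \<Phi> s tT h]
    by (meson has_derivative_continuous continuous_at_imp_continuous_on)
  define m where "m s = (LINT z|\<mu> s. u s z)" for s
  \<comment> \<open>What survives when the transport equation for \<theta> is inserted into the weak
    equation for \<open>\<theta>'\<close>.\<close>
  define v where "v s z = pull_grad h \<Phi> t s z (F s z (\<theta>' s) - F s z (\<theta> s))" for s z
  have Fz: "continuous_on UNIV (\<lambda>z. F s z r)" if "s \<in> {0..T}" for s r
    using that by (intro F_curve_cont continuous_intros) auto
  have pz: "continuous_on UNIV (pull_grad h \<Phi> t s)" if s: "s \<in> {0..T}" for s
  proof -
    have "continuous_on UNIV (\<lambda>z. pull_grad h \<Phi> t (fst (s, z)) (snd (s, z)))"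
      by (rule continuous_on_compose2[OF pull_cont(2)[OF \<theta> \<Phi> tT h]]) (use s in \<open>auto intro!: continuous_intros\<close>)
    then show ?thesis by simp
  qed
  have vz: "continuous_on UNIV (v s)" if s: "s \<in> {0..T}" for s
    unfolding v_def by (intro continuous_intros pz Fz s)
  define w where "w s = (LINT z|\<mu> s. v s z)" for s
  have wb: "norm (w s) \<le> B * M * norm (\<theta> s - \<theta>' s)" if s: "s \<in> {0..T}" for s
    unfolding w_def
  proof (rule on_ball_integral_bound[OF ball[OF s]])
    fix z :: 'z assume z: "z \<in> cball 0 \<rho>"
    have "norm (v s z) \<le> norm (pull_grad h \<Phi> t s z) * norm (F s z (\<theta>' s) - F s z (\<theta> s))"
      unfolding v_def by (rule norm_blinfun)
    also have "\<dots> \<le> B * (M * norm (\<theta>' s - \<theta> s))" by (intro mult_mono pg M s z B0) simp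
    finally show "norm (v s z) \<le> B * M * norm (\<theta> s - \<theta>' s)" by (simp add: norm_minus_commute)
  qed (use B0 M in simp)
  have ut: "\<bar>u s z - u r z\<bar> \<le> B * (C * (1 + \<rho>)) * \<bar>s - r\<bar>"
    if s: "s \<in> {0..T}" "r \<in> {0..T}" and z: "z \<in> cball 0 \<rho>" for s r z
  proof -
    have "norm (u s z - u r z) \<le> B * (C * (1 + \<rho>)) * norm (s - r)"
    proof (rule field_differentiable_bound[of "{0..T}" "\<lambda>s. u s z" "\<lambda>s. - (pull_grad h \<Phi> t s z (F s z (\<theta> s)))"])
      fix s assume s: "s \<in> {0..T}"
      show "((\<lambda>s. u s z) has_real_derivative - (pull_grad h \<Phi> t s z (F s z (\<theta> s)))) (at s within {0..T})"
        unfolding u_def by (rule pull_time_derivative[OF \<theta> \<Phi> c s tT h])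
      have "norm (F s z (\<theta> s)) \<le> C * (1 + \<rho>)"
        using z C by (intro order_trans[OF growth[OF s]] mult_left_mono) auto
      then have "norm (pull_grad h \<Phi> t s z (F s z (\<theta> s))) \<le> B * (C * (1 + \<rho>))"
        by (rule order_trans[OF norm_blinfun mult_mono[OF pg[OF s] _ B0 norm_ge_zero]])
      then show "norm (- (pull_grad h \<Phi> t s z (F s z (\<theta> s)))) \<le> B * (C * (1 + \<rho>))" by simp
    qed (use s in simp_all)
    then show ?thesis by simp
  qed
  have curve: "continuous_on {0..T} (\<lambda>s. LINT z|\<mu> s. f z)" if "continuous_on UNIV f" "bounded (range f)" for f :: "'z \<Rightarrow> real"
    using \<mu> that unfolding weak_solution_def continuous_curve_Pc_def by blast
  \<comment> \<open>A probability measure cannot be carried by an empty ball.\<close>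
  have \<rho>0: "0 \<le> \<rho>"
  proof (rule ccontr)
    assume "\<not> 0 \<le> \<rho>"
    then have "AE z in \<mu> 0. False" using ball[OF zero_in] by (auto simp: on_ball_def)
    then show False using ball[OF zero_in] prob_space.AE_False[of "\<mu> 0"] by (simp add: on_ball_def)
  qed
  \<comment> \<open>Measure and integrand both depend on time. The integrand is uniformly Lipschitz
    in time on the ball; narrow continuity only concerns bounded functions, so it is used for the
    cut-off integrand, which has the same integrals.\<close>
  have mc: "continuous_on {0..T} m"
    unfolding continuous_on_def
  proof
    fix r assume r: "r \<in> {0..T}"
    define f where "f z = cutoff \<rho> z * u r z" for z
    have fc: "continuous_on UNIV f" unfolding f_def by (intro continuous_intros cutoff_continuous uz r)
    have "bounded (range f)"
    proof -
      obtain D where D: "0 \<le> D" "\<forall>z\<in>cball 0 (\<rho>\<^sup>2 + 1). norm (f z) \<le> D" using continuous_bounded_cball[OF fc] by blast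
      have "norm (f z) \<le> D" for z
      proof (cases "cutoff \<rho> z = 0")
        case False
        then show ?thesis using D(2) cutoff_support[OF False] by simp
      qed (simp add: f_def D)
      then show ?thesis unfolding bounded_iff by blast
    qed
    from curve[OF fc this] have lim: "((\<lambda>s. LINT z|\<mu> s. f z) \<longlongrightarrow> (LINT z|\<mu> r. f z)) (at r within {0..T})"
      using r by (simp add: continuous_on_def)
    have eq: "(LINT z|\<mu> s. f z) = (LINT z|\<mu> s. u r z)" if s: "s \<in> {0..T}" for s
    proof (rule integral_cong_AE)
      show "f \<in> borel_measurable (\<mu> s)" "u r \<in> borel_measurable (\<mu> s)"
        using on_ball_integrable[OF ball[OF s] fc] on_ball_integrable[OF ball[OF s] uz[OF r]] by auto
      show "AE z in \<mu> s. f z = u r z"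
        by (rule on_ball_AE[OF ball[OF s]]) (simp add: f_def cutoff_on_ball)
    qed
    have bd: "norm (m s - (LINT z|\<mu> s. f z)) \<le> B * (C * (1 + \<rho>)) * \<bar>s - r\<bar>" if s: "s \<in> {0..T}" for s
    proof -
      have "m s - (LINT z|\<mu> s. f z) = (LINT z|\<mu> s. u s z - u r z)"
        unfolding m_def eq[OF s]
        using on_ball_integrable[OF ball[OF s] uz[OF s]] on_ball_integrable[OF ball[OF s] uz[OF r]] by simp
      also have "norm \<dots> \<le> B * (C * (1 + \<rho>)) * \<bar>s - r\<bar>"
        by (rule on_ball_integral_bound[OF ball[OF s]]) (use ut[OF s r] B0 C \<rho>0 in auto)
      finally show ?thesis .
    qed
    have "((\<lambda>s. m s - (LINT z|\<mu> s. f z)) \<longlongrightarrow> 0) (at r within {0..T})"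
    proof (rule Lim_null_comparison)
      show "\<forall>\<^sub>F s in at r within {0..T}. norm (m s - (LINT z|\<mu> s. f z)) \<le> B * (C * (1 + \<rho>)) * \<bar>s - r\<bar>"
        using bd by (simp add: eventually_at_filter)
      have "((\<lambda>s. B * (C * (1 + \<rho>)) * \<bar>s - r\<bar>) \<longlongrightarrow> B * (C * (1 + \<rho>)) * \<bar>r - r\<bar>) (at r within {0..T})"
        by (intro tendsto_intros)
      then show "((\<lambda>s. B * (C * (1 + \<rho>)) * \<bar>s - r\<bar>) \<longlongrightarrow> 0) (at r within {0..T})" by simp
    qed
    from tendsto_add[OF this lim] have "(m \<longlongrightarrow> (LINT z|\<mu> r. f z)) (at r within {0..T})" by simp
    then show "(m \<longlongrightarrow> m r) (at r within {0..T})" unfolding m_def[of r] eq[OF r, symmetric] .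
  qed
  \<comment> \<open>In the sense of distributions the derivative of \<open>m\<close> is
    \<open>w\<close>, and the mean of \<open>w\<close> is controlled by \<open>wb\<close>.\<close>
  have weak: "\<bar>integral {0..T} (\<lambda>s. \<eta>' s * m s)\<bar> \<le> B * M * dist1 \<theta> \<theta>'"
    if \<eta>: "\<And>s. (\<eta> has_real_derivative \<eta>' s) (at s)" and \<eta>': "continuous_on UNIV \<eta>'"
      and ab: "0 < a" "b < T" and supp: "\<And>s. s \<notin> {a..b} \<Longrightarrow> \<eta> s = 0" and le1: "\<And>s. \<bar>\<eta> s\<bar> \<le> 1" for \<eta> \<eta>' a b
  proof -
    let ?\<phi> = "test_fun \<eta> \<rho> h \<Phi> t"
    note tf = test_fun_C1c[OF \<theta> \<Phi> c tT h \<eta> \<eta>' ab supp, where \<rho> = \<rho>]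
    define I where "I s = (LINT z|\<mu> s. Dif ?\<phi> (s, z) (1, F s z (\<theta>' s)))" for s
    have I: "integrable (lebesgue_on {0..T}) I" "(LINT s|lebesgue_on {0..T}. I s) = 0"
      using \<mu> tf(2,3) unfolding weak_solution_def Let_def I_def by blast+
    have Ii: "I integrable_on {0..T}" and I0: "integral {0..T} I = 0"
      using integrable_on_lebesgue_on[OF I(1)] lebesgue_integral_eq_integral[OF I(1)] I(2) by auto
    \<comment> \<open>On the ball that carries the measure the spatial cut-off is 1 with zero
      derivative, so only the derivative of \<eta> and the difference of the fields remain.\<close>
    have Is: "I s = \<eta>' s * m s + \<eta> s * w s" if s: "s \<in> {0..T}" for s
    proof -
      have int: "integrable (\<mu> s) (u s)" "integrable (\<mu> s) (v s)"
        by (intro on_ball_integrable[OF ball[OF s]] uz vz s)+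
      have "I s = (LINT z|\<mu> s. \<eta>' s * u s z + \<eta> s * v s z)"
        unfolding I_def
      proof (rule integral_cong_AE)
        show "(\<lambda>z. \<eta>' s * u s z + \<eta> s * v s z) \<in> borel_measurable (\<mu> s)" using int by auto
        have "C1 ?\<phi>" using tf(2) by (simp add: C1c_def)
        then have D: "continuous_on UNIV (Dif ?\<phi>)" by (simp add: C1_def)
        have "continuous_on UNIV (\<lambda>z. Dif ?\<phi> (s, z) (1, F s z (\<theta>' s)))"
          by (intro continuous_intros continuous_on_compose2[OF D] Fz s) auto
        then show "(\<lambda>z. Dif ?\<phi> (s, z) (1, F s z (\<theta>' s))) \<in> borel_measurable (\<mu> s)"
          by (rule borel_measurable_integrable[OF on_ball_integrable[OF ball[OF s]]])
        show "AE z in \<mu> s. Dif ?\<phi> (s, z) (1, F s z (\<theta>' s)) = \<eta>' s * u s z + \<eta> s * v s z"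
        proof (rule on_ball_AE[OF ball[OF s]])
          fix z :: 'z assume "z \<in> cball 0 \<rho>"
          then have z: "norm z \<le> \<rho>" by simp
          show "Dif ?\<phi> (s, z) (1, F s z (\<theta>' s)) = \<eta>' s * u s z + \<eta> s * v s z"
          proof -
            have e: "blinfun_apply (Dif ?\<phi> (s, z)) = test_fun' \<eta> \<eta>' \<theta> \<rho> h \<Phi> t (s, z)"
              by (rule Dif_apply[OF tf(1)])
            show ?thesis unfolding e
            by (simp add: test_fun'_def Let_def clampT_id[OF s] cutoff_on_ball[OF z] u_def v_def blinfun.diff_right algebra_simps)
          qed
        qed
      qed
      also have "\<dots> = \<eta>' s * m s + \<eta> s * w s" using int by (simp add: m_def w_def)
      finally show ?thesis .
    qed
    have mi: "(\<lambda>s. \<eta>' s * m s) integrable_on {0..T}"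
      by (intro integrable_continuous_real continuous_on_mult mc continuous_on_subset[OF \<eta>']) auto
    have "norm (integral {0..T} (\<lambda>s. I s - \<eta>' s * m s)) \<le> integral {0..T} (\<lambda>s. B * M * norm (\<theta> s - \<theta>' s))"
    proof (rule integral_norm_bound_integral)
      show "(\<lambda>s. I s - \<eta>' s * m s) integrable_on {0..T}" by (rule integrable_diff[OF Ii mi])
      show "(\<lambda>s. B * M * norm (\<theta> s - \<theta>' s)) integrable_on {0..T}"
        by (rule integrable_on_mult_right[OF dist1_integrable[OF \<theta> \<theta>']])
      fix s assume s: "s \<in> {0..T}"
      have "norm (I s - \<eta>' s * m s) = \<bar>\<eta> s\<bar> * norm (w s)" by (simp add: Is[OF s] abs_mult)
      also have "\<dots> \<le> 1 * (B * M * norm (\<theta> s - \<theta>' s))" by (intro mult_mono le1 wb[OF s]) auto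
      finally show "norm (I s - \<eta>' s * m s) \<le> B * M * norm (\<theta> s - \<theta>' s)" by simp
    qed
    moreover have "integral {0..T} (\<lambda>s. I s - \<eta>' s * m s) = - integral {0..T} (\<lambda>s. \<eta>' s * m s)"
      using Henstock_Kurzweil_Integration.integral_diff[OF Ii mi] I0 by simp
    ultimately show ?thesis by (simp add: dist1_def)
  qed
  have main: "\<bar>m t - m 0\<bar> \<le> B * M * dist1 \<theta> \<theta>'"
  proof (rule field_le_epsilon)
    fix e :: real assume e: "0 < e"
    have near: "\<exists>\<delta>>0. \<forall>s\<in>{0..T}. \<bar>s - r\<bar> < \<delta> \<longrightarrow> \<bar>m s - m r\<bar> \<le> e / 2" if r: "r \<in> {0..T}" for r
    proof -
      obtain \<delta> where "\<delta> > 0" "\<forall>s\<in>{0..T}. dist s r < \<delta> \<longrightarrow> dist (m s) (m r) < e / 2"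
        using mc[unfolded continuous_on_iff, rule_format, OF r, of "e / 2"] e by auto
      then show ?thesis by (intro exI[of _ \<delta>]) (auto simp: dist_real_def less_imp_le)
    qed
    obtain d0 where d0: "d0 > 0" "\<And>s. s \<in> {0..T} \<Longrightarrow> \<bar>s - 0\<bar> < d0 \<Longrightarrow> \<bar>m s - m 0\<bar> \<le> e / 2" using near[OF zero_in] by blast
    obtain d1 where d1: "d1 > 0" "\<And>s. s \<in> {0..T} \<Longrightarrow> \<bar>s - t\<bar> < d1 \<Longrightarrow> \<bar>m s - m t\<bar> \<le> e / 2" using near[OF tT] by blast
    \<comment> \<open>Room for the ramps \<open>{\<epsilon>..2 * \<epsilon>}\<close> and
      \<open>{t..t + \<epsilon>}\<close> strictly inside the time interval, and short enough for
      \<open>m\<close> to vary by at most \<open>e / 2\<close> from its values at 0 and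
      \<open>t\<close> there.\<close>
    define \<epsilon> where "\<epsilon> = min (min (t / 2) ((T - t) / 2)) (min (d0 / 3) (d1 / 2))"
    have \<epsilon>: "0 < \<epsilon>" "2 * \<epsilon> \<le> t" "t + 2 * \<epsilon> \<le> T" "2 * \<epsilon> < d0" "\<epsilon> < d1"
    proof -
      have "\<epsilon> \<le> t / 2" "\<epsilon> \<le> (T - t) / 2" "\<epsilon> \<le> d0 / 3" "\<epsilon> \<le> d1 / 2" unfolding \<epsilon>_def by linarith+
      then show "2 * \<epsilon> \<le> t" "t + 2 * \<epsilon> \<le> T" "2 * \<epsilon> < d0" "\<epsilon> < d1" using d0(1) d1(1) by auto
      show "0 < \<epsilon>" using t d0 d1 by (auto simp: \<epsilon>_def)
    qed
    \<comment> \<open>A smooth stand-in for the indicator of the times between 0 and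
      \<open>t\<close>; its derivative recovers \<open>m 0 - m t\<close> in the limit.\<close>
    define \<eta> where "\<eta> s = step ((s - \<epsilon>) / \<epsilon>) - step ((s - t) / \<epsilon>)" for s
    define \<eta>' where "\<eta>' s = step' ((s - \<epsilon>) / \<epsilon>) / \<epsilon> - step' ((s - t) / \<epsilon>) / \<epsilon>" for s
    have sd: "((\<lambda>s. step ((s - c) / \<epsilon>)) has_real_derivative step' ((s - c) / \<epsilon>) / \<epsilon>) (at s)" for s c
    proof -
      have "((\<lambda>s. (s - c) / \<epsilon>) has_real_derivative 1 / \<epsilon>) (at s)" using \<epsilon> by (auto intro!: derivative_eq_intros)
      from DERIV_chain2[OF step_has_derivative this] show ?thesis by simp
    qed
    have kc: "continuous_on S (\<lambda>s. step' ((s - c) / \<epsilon>) / \<epsilon>)" for c S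
      using \<epsilon> by (intro continuous_intros continuous_on_compose2[OF step'_continuous[of UNIV]]) auto
    have "\<bar>integral {0..T} (\<lambda>s. \<eta>' s * m s)\<bar> \<le> B * M * dist1 \<theta> \<theta>'"
    proof (rule weak[where \<eta> = \<eta> and a = \<epsilon> and b = "t + \<epsilon>"])
      show "(\<eta> has_real_derivative \<eta>' s) (at s)" for s
        unfolding \<eta>_def[abs_def] \<eta>'_def by (intro DERIV_diff sd)
      show "continuous_on UNIV \<eta>'" unfolding \<eta>'_def[abs_def] by (intro continuous_on_diff kc)
      show "\<eta> s = 0" if "s \<notin> {\<epsilon>..t + \<epsilon>}" for s
      proof (cases "s < \<epsilon>")
        case True
        then have "(s - \<epsilon>) / \<epsilon> \<le> 0" "(s - t) / \<epsilon> \<le> 0" using \<epsilon> by (auto simp: divide_le_0_iff)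
        then show ?thesis by (simp add: \<eta>_def step_simps)
      next
        case False
        then have "1 \<le> (s - \<epsilon>) / \<epsilon>" "1 \<le> (s - t) / \<epsilon>" using that \<epsilon> by (auto simp: le_divide_eq)
        then show ?thesis by (simp add: \<eta>_def step_simps)
      qed
      show "\<bar>\<eta> s\<bar> \<le> 1" for s
        using step_simps(3,4)[of "(s - \<epsilon>) / \<epsilon>"] step_simps(3,4)[of "(s - t) / \<epsilon>"] unfolding \<eta>_def by linarith
    qed (use \<epsilon> in auto)
    moreover have "integral {0..T} (\<lambda>s. \<eta>' s * m s)
      = integral {0..T} (\<lambda>s. step' ((s - \<epsilon>) / \<epsilon>) / \<epsilon> * m s) - integral {0..T} (\<lambda>s. step' ((s - t) / \<epsilon>) / \<epsilon> * m s)"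
      unfolding \<eta>'_def left_diff_distrib
      by (intro Henstock_Kurzweil_Integration.integral_diff integrable_continuous_real continuous_on_mult kc mc)
    moreover have "\<bar>integral {0..T} (\<lambda>s. step' ((s - \<epsilon>) / \<epsilon>) / \<epsilon> * m s) - m 0\<bar> \<le> e / 2"
    proof (rule bump_integral[OF mc])
      show "\<bar>m s - m 0\<bar> \<le> e / 2" if "s \<in> {\<epsilon>..\<epsilon> + \<epsilon>}" for s
        by (rule d0(2)) (use that \<epsilon> tT in auto)
    qed (use \<epsilon> e tT in auto)
    moreover have "\<bar>integral {0..T} (\<lambda>s. step' ((s - t) / \<epsilon>) / \<epsilon> * m s) - m t\<bar> \<le> e / 2"
    proof (rule bump_integral[OF mc])
      show "\<bar>m s - m t\<bar> \<le> e / 2" if "s \<in> {t..t + \<epsilon>}" for s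
        by (rule d1(2)) (use that \<epsilon> tT in auto)
    qed (use \<epsilon> e tT in auto)
    ultimately show "\<bar>m t - m 0\<bar> \<le> B * M * dist1 \<theta> \<theta>' + e" by linarith
  qed
  have "m t = (LINT z|\<mu> t. h z)" by (simp add: m_def u_def flow_init'[OF \<Phi> tT])
  moreover have "m 0 = (LINT z|\<mu>\<^sub>0. h (\<Phi> 0 t z))" using \<mu> by (simp add: m_def u_def weak_solution_def)
  ultimately show ?thesis using main by (simp add: B_def mult_ac)
qed

text \<open>The estimate for \<open>C1\<close> functions carries over to Lipschitz functions by
  approximation on the ball that carries both measures.\<close>

lemma weak_solution_close:
  assumes \<theta>: "adm N \<theta>" and \<Phi>: "is_flow \<theta> \<Phi>" and c: "continuous_on {0..T} \<theta>"
    and \<theta>': "adm N \<theta>'" and \<mu>: "weak_solution \<mu>\<^sub>0 \<theta>' \<mu>" and ball: "\<And>s. s \<in> {0..T} \<Longrightarrow> on_ball \<rho> (\<mu> s)"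
    and \<mu>0: "on_ball R \<mu>\<^sub>0" and \<rho>: "rad N R \<le> \<rho>" "0 \<le> \<rho>"
    and M: "0 \<le> M" "\<And>s z \<theta>\<^sub>1 \<theta>\<^sub>2. s \<in> {0..T} \<Longrightarrow> z \<in> cball 0 \<rho> \<Longrightarrow> norm (F s z \<theta>\<^sub>1 - F s z \<theta>\<^sub>2) \<le> M * norm (\<theta>\<^sub>1 - \<theta>\<^sub>2)"
    and t: "t \<in> {0<..<T}"
  shows "close \<rho> (gron T N * M * dist1 \<theta> \<theta>') (push \<Phi> \<mu>\<^sub>0 t) (\<mu> t)"
  unfolding close_def
proof (intro conjI allI impI)
  have tT: "t \<in> {0..T}" using t by auto
  show "0 \<le> gron T N * M * dist1 \<theta> \<theta>'" using gron_pos[of T N] M dist1_nonneg by simp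
  have pb: "on_ball \<rho> (push \<Phi> \<mu>\<^sub>0 t)"
    by (rule on_ball_mono[OF push_on_ball[OF \<mu>0 \<theta> \<Phi> tT] \<rho>(1)])
  fix h :: "'z \<Rightarrow> real" and K
  assume "continuous_on UNIV h \<and> 0 \<le> K \<and> (\<forall>z\<in>cball 0 \<rho>. \<forall>w\<in>cball 0 \<rho>. \<bar>h z - h w\<bar> \<le> K * norm (z - w))"
  then have h: "continuous_on UNIV h" and K: "0 \<le> K"
    and lip: "\<And>z w. z \<in> cball 0 \<rho> \<Longrightarrow> w \<in> cball 0 \<rho> \<Longrightarrow> \<bar>h z - h w\<bar> \<le> K * norm (z - w)" by auto
  show "\<bar>(LINT z|push \<Phi> \<mu>\<^sub>0 t. h z) - (LINT z|\<mu> t. h z)\<bar> \<le> K * (gron T N * M * dist1 \<theta> \<theta>')"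
  proof (rule field_le_epsilon)
    fix e :: real assume e: "0 < e"
    \<comment> \<open>The approximation keeps the Lipschitz constant \<open>K\<close>, now on the
      whole space; otherwise the bound would change in the limit.\<close>
    obtain f where f: "C1 f" "\<And>z w. \<bar>f z - f w\<bar> \<le> K * norm (z - w)" "\<And>z. z \<in> cball 0 \<rho> \<Longrightarrow> \<bar>f z - h z\<bar> \<le> e / 2"
      using softmin_approx[OF K lip _ \<rho>(2), of "e / 2"] e by auto
    have fc: "continuous_on UNIV f" using C1_works[OF f(1)] by (meson has_derivative_continuous continuous_at_imp_continuous_on)
    have ap: "\<bar>(LINT z|\<nu>. f z) - (LINT z|\<nu>. h z)\<bar> \<le> e / 2" if \<nu>: "on_ball \<rho> \<nu>" for \<nu>
    proof -
      have "norm (LINT z|\<nu>. f z - h z) \<le> e / 2"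
        by (rule on_ball_integral_bound[OF \<nu>]) (use f(3) e in auto)
      then show ?thesis using on_ball_integrable[OF \<nu> fc] on_ball_integrable[OF \<nu> h] by simp
    qed
    have "\<bar>(LINT z|\<mu> t. f z) - (LINT z|push \<Phi> \<mu>\<^sub>0 t. f z)\<bar> \<le> K * (gron T N * M * dist1 \<theta> \<theta>')"
      unfolding push_integral[OF \<mu>0 \<theta> \<Phi> tT fc]
      by (rule weak_solution_stable_C1[OF \<theta> \<Phi> c \<theta>' \<mu> ball f(1) K f(2) M t])
    then show "\<bar>(LINT z|push \<Phi> \<mu>\<^sub>0 t. h z) - (LINT z|\<mu> t. h z)\<bar> \<le> K * (gron T N * M * dist1 \<theta> \<theta>') + e"
      using ap[OF pb] ap[OF ball[OF tT]] by linarith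
  qed
qed

end

section \<open>Uniqueness of the control\<close>

lemma AE_negligible:
  "(AE t in lebesgue_on {0..T::real}. P t) \<longleftrightarrow> (\<exists>S. negligible S \<and> (\<forall>t\<in>{0..T} - S. P t))"
proof -
  have "(AE t in lebesgue_on {0..T}. P t) \<longleftrightarrow> (AE t in lebesgue. t \<in> {0..T} \<longrightarrow> P t)"
    by (rule AE_restrict_space_iff) simp
  also have "\<dots> \<longleftrightarrow> (\<exists>S. S \<in> null_sets lebesgue \<and> {t. \<not> (t \<in> {0..T} \<longrightarrow> P t)} \<subseteq> S)"
    by (simp add: eventually_ae_filter) blast
  also have "\<dots> \<longleftrightarrow> (\<exists>S. negligible S \<and> (\<forall>t\<in>{0..T} - S. P t))"
    unfolding negligible_iff_null_sets by blast
  finally show ?thesis .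
qed

text \<open>Integrals ignore negligible sets of times, so modifying a control on such a set leaves
  its flow unchanged.\<close>

lemma sol_spike:
  assumes sol: "sol T H \<tau> z X" and S: "negligible S" and \<tau>: "\<tau> \<in> {0..T}"
    and eq: "\<And>s. s \<in> {0..T} - S \<Longrightarrow> H2 s (X s) = H s (X s)"
  shows "sol T H2 \<tau> z X"
  unfolding sol_def
proof (intro conjI ballI)
  show "continuous_on {0..T} X" using sol by (rule sol_continuous)
  show "(\<lambda>s. H2 s (X s)) integrable_on {0..T}"
    by (rule integrable_spike[OF sol_integrable[OF sol] S]) (rule eq)
  have i: "integral {0..r} (\<lambda>s. H2 s (X s)) = integral {0..r} (\<lambda>s. H s (X s))" if "r \<in> {0..T}" for r
    by (rule integral_spike[OF S]) (use that in \<open>auto intro!: eq[symmetric]\<close>)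
  fix t assume t: "t \<in> {0..T}"
  have "X t = z + J \<tau> t (\<lambda>s. H s (X s))" using sol t unfolding sol_def by blast
  also have "J \<tau> t (\<lambda>s. H s (X s)) = J \<tau> t (\<lambda>s. H2 s (X s))" unfolding J_def i[OF t] i[OF \<tau>] ..
  finally show "X t = z + J \<tau> t (\<lambda>s. H2 s (X s))" .
qed

text \<open>Uniform second-order bounds turn joint continuity of \<open>G\<close> into joint continuity of its derivative,
  since difference quotients then converge locally uniformly.\<close>

lemma derivative_jointly_continuous:
  fixes G :: "'t::metric_space \<Rightarrow> 'a::euclidean_space \<Rightarrow> 'b::euclidean_space"
  assumes G: "continuous_on (S \<times> UNIV) (\<lambda>(t, z). G t z)"
    and d: "\<And>t z. t \<in> S \<Longrightarrow> (G t has_derivative blinfun_apply (G' t z)) (at z)"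
    and lip: "\<And>\<rho>. \<exists>M\<ge>0. \<forall>t\<in>S. \<forall>z\<in>cball 0 \<rho>. \<forall>w\<in>cball 0 \<rho>. norm (G' t z - G' t w) \<le> M * norm (z - w)"
  shows "continuous_on (S \<times> UNIV) (\<lambda>p. G' (fst p) (snd p))"
proof (rule continuous_on_blinfun_componentwise)
  fix q :: 'a
  show "continuous_on (S \<times> UNIV) (\<lambda>p. G' (fst p) (snd p) q)"
    unfolding continuous_on_sequentially
  proof (intro allI ballI impI, elim conjE)
    fix x and p :: "'t \<times> 'a" assume p: "p \<in> S \<times> UNIV" and x: "\<forall>n. x n \<in> S \<times> (UNIV :: 'a set)" "x \<longlonglongrightarrow> p"
    have S: "fst p \<in> S" "\<And>n. fst (x n) \<in> S" using p x(1) by (auto simp: mem_Times_iff)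
    obtain r where r: "\<And>n. norm (snd (x n)) \<le> r" "norm (snd p) \<le> r"
      using LIMSEQ_common_bound[OF tendsto_snd[OF x(2)]] by blast
    obtain M where M: "M \<ge> 0" "\<And>t z w. t \<in> S \<Longrightarrow> z \<in> cball 0 (r + norm q) \<Longrightarrow> w \<in> cball 0 (r + norm q) \<Longrightarrow>
        norm (G' t z - G' t w) \<le> M * norm (z - w)" using lip[of "r + norm q"] by blast
    \<comment> \<open>Mean value inequality for \<open>G t\<close> minus its linearization at
      \<open>z\<close>: the Lipschitz bound on the derivative gives an error proportional to
      \<open>h\<close>, uniformly in \<open>t\<close> and in the bounded points
      \<open>z\<close>.\<close>
    have quot: "norm ((1 / h) *\<^sub>R (G t (z + h *\<^sub>R q) - G t z) - G' t z q) \<le> M * (norm q)\<^sup>2 * h"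
      if t: "t \<in> S" and z: "norm z \<le> r" and h: "0 < h" "h \<le> 1" for t z h
    proof -
      have ball: "y \<in> cball 0 (r + norm q)" if "y \<in> closed_segment z (z + h *\<^sub>R q)" for y
      proof -
        have "norm (y - z) \<le> norm (h *\<^sub>R q)" using segment_bound(1)[OF that] by simp
        also have "\<dots> \<le> norm q" using h by (simp add: mult_left_le_one_le)
        finally show ?thesis using z norm_triangle_sub[of y z] by simp
      qed
      have "norm ((G t (z + h *\<^sub>R q) - G' t z (z + h *\<^sub>R q)) - (G t z - G' t z z)) \<le> (M * (h * norm q)) * norm (z + h *\<^sub>R q - z)"
      proof (rule differentiable_bound[of "closed_segment z (z + h *\<^sub>R q)"])
        fix y assume y: "y \<in> closed_segment z (z + h *\<^sub>R q)"
        show "((\<lambda>y. G t y - G' t z y) has_derivative (\<lambda>v. G' t y v - G' t z v)) (at y within closed_segment z (z + h *\<^sub>R q))"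
          by (rule has_derivative_at_withinI[OF has_derivative_diff[OF d[OF t] bounded_linear_imp_has_derivative[OF blinfun.bounded_linear_right]]])
        have "norm (G' t y - G' t z) \<le> M * norm (y - z)" by (intro M t ball y) simp
        also have "\<dots> \<le> M * (h * norm q)"
          using segment_bound(1)[OF y] h M by (intro mult_left_mono) auto
        finally have "norm (G' t y - G' t z) \<le> M * (h * norm q)" .
        moreover have "blinfun_apply (G' t y - G' t z) = (\<lambda>v. G' t y v - G' t z v)" by (rule ext) (rule blinfun.diff_left)
        ultimately show "onorm (\<lambda>v. G' t y v - G' t z v) \<le> M * (h * norm q)" by (simp only: norm_blinfun.rep_eq)
      qed auto
      then have "norm (G t (z + h *\<^sub>R q) - G t z - h *\<^sub>R G' t z q) \<le> M * (norm q)\<^sup>2 * h * h"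
        using h by (simp add: blinfun.add_right blinfun.scaleR_right algebra_simps power2_eq_square)
      moreover have "(1 / h) *\<^sub>R (G t (z + h *\<^sub>R q) - G t z) - G' t z q = (1 / h) *\<^sub>R (G t (z + h *\<^sub>R q) - G t z - h *\<^sub>R G' t z q)"
        using h by (simp add: scaleR_diff_right)
      ultimately show ?thesis using h by (simp add: divide_le_eq)
    qed
    have "(\<lambda>n. G' (fst (x n)) (snd (x n)) q) \<longlonglongrightarrow> G' (fst p) (snd p) q"
    proof (rule LIMSEQ_I)
      fix e :: real assume e: "0 < e"
      \<comment> \<open>A fixed step whose quotient errors are at most \<open>e / 3\<close> at every
        point concerned; the remaining third is the continuity of the quotient itself.\<close>
      define h where "h = min 1 (e / (3 * (M * (norm q)\<^sup>2 + 1)))"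
      have den: "0 < M * (norm q)\<^sup>2 + 1" using M(1) by (intro add_nonneg_pos) auto
      have h: "0 < h" "h \<le> 1" using e den by (auto simp: h_def)
      have hM: "M * (norm q)\<^sup>2 * h \<le> e / 3"
      proof -
        have "h \<le> e / (3 * (M * (norm q)\<^sup>2 + 1))" by (simp add: h_def)
        then have "h * (M * (norm q)\<^sup>2 + 1) \<le> e / 3" using den by (simp add: pos_le_divide_eq algebra_simps)
        then show ?thesis using h(1) unfolding distrib_left by (simp add: mult.commute)
      qed
      define Q where "Q t z = (1 / h) *\<^sub>R (G t (z + h *\<^sub>R q) - G t z)" for t z
      have Gs: "(\<lambda>n. G (fst (x n)) (a n)) \<longlonglongrightarrow> G (fst p) b" if "a \<longlonglongrightarrow> b" for a b
        using continuous_on_tendsto_compose[OF G tendsto_Pair[OF tendsto_fst[OF x(2)] that]] S by simp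
      have "(\<lambda>n. Q (fst (x n)) (snd (x n))) \<longlonglongrightarrow> Q (fst p) (snd p)"
        unfolding Q_def by (intro tendsto_intros Gs x(2))
      from LIMSEQ_D[OF this, of "e / 3"] e obtain n0 where
        n0: "\<And>n. n \<ge> n0 \<Longrightarrow> norm (Q (fst (x n)) (snd (x n)) - Q (fst p) (snd p)) < e / 3" by auto
      show "\<exists>n0. \<forall>n\<ge>n0. norm (G' (fst (x n)) (snd (x n)) q - G' (fst p) (snd p) q) < e"
      proof (intro exI allI impI)
        fix n assume n: "n \<ge> n0"
        let ?a = "G' (fst (x n)) (snd (x n)) q" and ?b = "G' (fst p) (snd p) q"
        let ?A = "Q (fst (x n)) (snd (x n))" and ?B = "Q (fst p) (snd p)"
        have "norm (?A - ?a) \<le> e / 3" "norm (?B - ?b) \<le> e / 3"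
          using quot[OF S(2) r(1) h] quot[OF S(1) r(2) h] hM unfolding Q_def by (meson order_trans)+
        moreover have "norm (?a - ?b) \<le> norm (?A - ?B) + norm (?A - ?a) + norm (?B - ?b)"
        proof -
          have e: "?a - ?b = (?A - ?B) - (?A - ?a) + (?B - ?b)" by simp
          show ?thesis
            by (subst e) (rule order_trans[OF norm_triangle_ineq add_right_mono[OF norm_triangle_ineq4]])
        qed
        ultimately show "norm (?a - ?b) < e" using n0[OF n] by linarith
      qed
    qed
    then show "((\<lambda>p. G' (fst p) (snd p) q) \<circ> x) \<longlonglongrightarrow> G' (fst p) (snd p) q" by (simp add: o_def)
  qed
qed

context control_system
begin

text \<open>Truncation only lowers the weight, so the same \<open>N\<close> still bounds it.\<close>

lemma adm_truncate:
  assumes "adm N \<theta>"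
  shows "adm N (\<lambda>t. if norm (\<theta> t) \<le> 1 then \<theta> t else 0)"
proof -
  let ?\<theta> = "\<lambda>t. if norm (\<theta> t) \<le> 1 then \<theta> t else 0"
  have m: "\<theta> \<in> borel_measurable (lebesgue_on {0..T})" using assms by (simp add: adm_def)
  then have m': "?\<theta> \<in> borel_measurable (lebesgue_on {0..T})" by measurable
  have w: "(\<lambda>t. (C + L * (1 + norm (\<theta> t)))\<^sup>2) integrable_on {0..T}"
    "integral {0..T} (\<lambda>t. (C + L * (1 + norm (\<theta> t)))\<^sup>2) \<le> N" using assms by (auto simp: adm_def weight_def)
  have km: "(\<lambda>t. C + L * (1 + norm (?\<theta> t))) \<in> borel_measurable (lebesgue_on {0..T})" using m' by measurable
  have le: "(C + L * (1 + norm (?\<theta> t)))\<^sup>2 \<le> (C + L * (1 + norm (\<theta> t)))\<^sup>2" for t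
    using C L by (intro power_mono add_mono mult_left_mono) auto
  have i: "(\<lambda>t. (C + L * (1 + norm (?\<theta> t)))\<^sup>2) integrable_on {0..T}"
  proof (rule set_lebesgue_integral_eq_integral(1), rule measurable_bounded_by_integrable_imp_absolutely_integrable[OF _ _ w(1)])
    show "(\<lambda>t. (C + L * (1 + norm (?\<theta> t)))\<^sup>2) \<in> borel_measurable (lebesgue_on {0..T})" using km by measurable
    show "norm ((C + L * (1 + norm (?\<theta> t)))\<^sup>2) \<le> (C + L * (1 + norm (\<theta> t)))\<^sup>2" for t using le[of t] by simp
  qed simp
  have "integral {0..T} (\<lambda>t. (C + L * (1 + norm (?\<theta> t)))\<^sup>2) \<le> N"
    by (rule order_trans[OF integral_le[OF i w(1) le] w(2)])
  then show ?thesis unfolding adm_def weight_def using m' km i C L by auto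
qed

text \<open>Off a negligible set the control equations bound the pointwise difference by
  \<open>(c / lam) * d\<close>, where \<open>d\<close> is the mean distance. Integrating gives
  \<open>d \<le> (T * c / lam) * d\<close>, which forces \<open>d = 0\<close>.\<close>

lemma control_unique:
  assumes \<rho>: "rad N R \<le> \<rho>" "0 \<le> \<rho>"
  shows "\<exists>lam\<^sub>0>0. \<forall>lam>lam\<^sub>0. \<forall>\<mu>\<^sub>0 \<theta> \<Phi> \<theta>' \<Phi>' \<mu>'. on_ball R \<mu>\<^sub>0 \<longrightarrow> continuous_on {0..T} \<theta> \<longrightarrow>
    (\<forall>t\<in>{0..T}. norm (\<theta> t) \<le> 1) \<longrightarrow> adm N \<theta> \<longrightarrow> is_flow \<theta> \<Phi> \<longrightarrow>
    (\<forall>t\<in>{0..T}. \<theta> t = - (1 / (2 * lam)) *\<^sub>R (LINT z|push \<Phi> \<mu>\<^sub>0 t. Gf \<theta> \<Phi> t z)) \<longrightarrow>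
    adm N \<theta>' \<longrightarrow> is_flow \<theta>' \<Phi>' \<longrightarrow> weak_solution \<mu>\<^sub>0 \<theta>' \<mu>' \<longrightarrow> (\<forall>t\<in>{0..T}. on_ball \<rho> (\<mu>' t)) \<longrightarrow>
    (AE t in lebesgue_on {0..T}. \<theta>' t = - (1 / (2 * lam)) *\<^sub>R (LINT z|\<mu>' t. Gf \<theta>' \<Phi>' t z)) \<longrightarrow>
    (AE t in lebesgue_on {0..T}. \<theta>' t = \<theta> t)"
proof -
  obtain Kb where Kb: "Kb \<ge> 0" "\<And>\<theta> \<Phi> t z. adm N \<theta> \<Longrightarrow> is_flow \<theta> \<Phi> \<Longrightarrow> t\<in>{0..T} \<Longrightarrow> z\<in>cball 0 \<rho> \<Longrightarrow> norm (Gf \<theta> \<Phi> t z) \<le> Kb"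
    using Gf_bound[of N \<rho>] by blast
  obtain Ks where Ks: "Ks \<ge> 0" "\<And>\<theta>\<^sub>1 \<theta>\<^sub>2 \<Phi>\<^sub>1 \<Phi>\<^sub>2 t \<nu>\<^sub>1 \<nu>\<^sub>2 d. adm N \<theta>\<^sub>1 \<Longrightarrow> adm N \<theta>\<^sub>2 \<Longrightarrow> is_flow \<theta>\<^sub>1 \<Phi>\<^sub>1 \<Longrightarrow> is_flow \<theta>\<^sub>2 \<Phi>\<^sub>2 \<Longrightarrow>
    \<forall>s\<in>{0..T}. norm (\<theta>\<^sub>1 s) \<le> 1 \<and> norm (\<theta>\<^sub>2 s) \<le> 1 \<Longrightarrow> t\<in>{0..T} \<Longrightarrow>
    on_ball \<rho> \<nu>\<^sub>1 \<Longrightarrow> on_ball \<rho> \<nu>\<^sub>2 \<Longrightarrow> close \<rho> d \<nu>\<^sub>1 \<nu>\<^sub>2 \<Longrightarrow>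
      norm ((LINT z|\<nu>\<^sub>1. Gf \<theta>\<^sub>1 \<Phi>\<^sub>1 t z) - (LINT z|\<nu>\<^sub>2. Gf \<theta>\<^sub>2 \<Phi>\<^sub>2 t z))
        \<le> Ks * (dist1 \<theta>\<^sub>1 \<theta>\<^sub>2 + norm (\<theta>\<^sub>1 t - \<theta>\<^sub>2 t) + d)"
    using Gf_integral_stable[of N \<rho>] by blast
  obtain M where M: "0 \<le> M" "\<And>s z \<theta>\<^sub>1 \<theta>\<^sub>2. s \<in> {0..T} \<Longrightarrow> z \<in> cball 0 \<rho> \<Longrightarrow> norm (F s z \<theta>\<^sub>1 - F s z \<theta>\<^sub>2) \<le> M * norm (\<theta>\<^sub>1 - \<theta>\<^sub>2)"
    using F_lip_control[of \<rho>] by blast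
  define Kp where "Kp = gron T N * M"
  have Kp: "0 \<le> Kp" using gron_pos[of T N] M by (simp add: Kp_def)
  define c where "c = Ks * (1 + Kp)"
  have c0: "0 \<le> c" using Ks Kp by (simp add: c_def)
  \<comment> \<open>\<open>Kb\<close> brings the competing control into the unit ball,
    \<open>Ks\<close> absorbs the pointwise difference of the controls, and \<open>T * c\<close>
    makes the mean distance contract.\<close>
  define lam0 where "lam0 = 1 + Kb + Ks + T * c"
  have lam0: "0 < lam0" "Kb \<le> lam0" "Ks \<le> lam0" "T * c \<le> lam0"
    using Kb(1) Ks(1) mult_nonneg_nonneg[of T c] T c0 by (auto simp: lam0_def intro!: add_pos_nonneg)
  show ?thesis
  proof (intro exI[of _ lam0] conjI allI impI lam0(1))
    fix lam and \<mu>\<^sub>0 :: "'z measure" and \<theta> \<Phi> \<theta>' \<Phi>' and \<mu>' :: "real \<Rightarrow> 'z measure"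
    assume lam: "lam0 < lam" and \<mu>0: "on_ball R \<mu>\<^sub>0" and c\<theta>: "continuous_on {0..T} \<theta>"
      and le1: "\<forall>t\<in>{0..T}. norm (\<theta> t) \<le> 1" and \<theta>: "adm N \<theta>" and \<Phi>: "is_flow \<theta> \<Phi>"
      and eq: "\<forall>t\<in>{0..T}. \<theta> t = - (1 / (2 * lam)) *\<^sub>R (LINT z|push \<Phi> \<mu>\<^sub>0 t. Gf \<theta> \<Phi> t z)"
      and \<theta>': "adm N \<theta>'" and \<Phi>': "is_flow \<theta>' \<Phi>'" and \<mu>': "weak_solution \<mu>\<^sub>0 \<theta>' \<mu>'"
      and ball: "\<forall>t\<in>{0..T}. on_ball \<rho> (\<mu>' t)"
      and AE: "AE t in lebesgue_on {0..T}. \<theta>' t = - (1 / (2 * lam)) *\<^sub>R (LINT z|\<mu>' t. Gf \<theta>' \<Phi>' t z)"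
    have lam_pos: "0 < lam" using lam lam0 by simp
    obtain S where S: "negligible S"
      "\<And>t. t \<in> {0..T} - S \<Longrightarrow> \<theta>' t = - (1 / (2 * lam)) *\<^sub>R (LINT z|\<mu>' t. Gf \<theta>' \<Phi>' t z)"
      using AE unfolding AE_negligible by blast
    \<comment> \<open>The control equation bounds \<open>\<theta>'\<close> by 1 only almost
      everywhere, whereas the stability estimates ask for this bound at every time. Truncation
      repairs the exceptional times without changing the flow.\<close>
    define \<theta>2 where "\<theta>2 t = (if norm (\<theta>' t) \<le> 1 then \<theta>' t else 0)" for t
    have \<theta>2: "adm N \<theta>2" unfolding \<theta>2_def[abs_def] by (rule adm_truncate[OF \<theta>'])
    have \<theta>2eq: "\<theta>2 t = \<theta>' t" if t: "t \<in> {0..T} - S" for t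
    proof -
      have "norm (LINT z|\<mu>' t. Gf \<theta>' \<Phi>' t z) \<le> Kb"
        by (rule on_ball_integral_bound[of \<rho>]) (use ball t Kb(1) Kb(2)[OF \<theta>' \<Phi>'] in auto)
      moreover have "norm (\<theta>' t) = (1 / (2 * lam)) * norm (LINT z|\<mu>' t. Gf \<theta>' \<Phi>' t z)"
        using lam_pos by (subst S(2)[OF t]) simp
      ultimately have "norm (\<theta>' t) \<le> (1 / (2 * lam)) * Kb" using lam_pos by (simp add: divide_right_mono)
      also have "\<dots> \<le> 1" using lam lam0 lam_pos by simp
      finally show ?thesis by (simp add: \<theta>2_def)
    qed
    have \<Phi>2: "is_flow \<theta>2 \<Phi>'"
      unfolding is_flow_def
    proof (intro ballI allI)
      fix \<tau> z assume \<tau>: "\<tau> \<in> {0..T}"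
      have "sol T (\<lambda>s z. F s z (\<theta>' s)) \<tau> z (\<lambda>t. \<Phi>' \<tau> t z)" using \<Phi>' \<tau> unfolding is_flow_def by blast
      then show "sol T (\<lambda>s z. F s z (\<theta>2 s)) \<tau> z (\<lambda>t. \<Phi>' \<tau> t z)"
        by (rule sol_spike[OF _ S(1) \<tau>]) (simp add: \<theta>2eq)
    qed
    define d where "d = dist1 \<theta> \<theta>2"
    have d0: "0 \<le> d" unfolding d_def by (rule dist1_nonneg)
    have d': "dist1 \<theta> \<theta>' = d"
      unfolding d_def dist1_def by (rule integral_spike[OF S(1)]) (simp add: \<theta>2eq)
    have le1': "\<forall>s\<in>{0..T}. norm (\<theta> s) \<le> 1 \<and> norm (\<theta>2 s) \<le> 1" using le1 by (simp add: \<theta>2_def)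
    \<comment> \<open>The end points are excluded because \<open>weak_solution_close\<close> speaks
      about interior times; they are negligible.\<close>
    have pt: "norm (\<theta> t - \<theta>2 t) \<le> (c / lam) * d" if t: "t \<in> {0..T} - (S \<union> {0, T})" for t
    proof -
      have tS: "t \<in> {0..T} - S" and t': "t \<in> {0<..<T}" and tT: "t \<in> {0..T}" using t by auto
      let ?I1 = "LINT z|push \<Phi> \<mu>\<^sub>0 t. Gf \<theta> \<Phi> t z" and ?I2 = "LINT z|\<mu>' t. Gf \<theta>2 \<Phi>' t z"
      have G2: "Gf \<theta>2 \<Phi>' t = Gf \<theta>' \<Phi>' t" by (rule ext) (simp add: Gf_def \<theta>2eq[OF tS])
      have cl: "close \<rho> (Kp * d) (push \<Phi> \<mu>\<^sub>0 t) (\<mu>' t)"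
        using weak_solution_close[OF \<theta> \<Phi> c\<theta> \<theta>' \<mu>' _ \<mu>0 \<rho> M t'] ball by (simp add: Kp_def d')
      have pb: "on_ball \<rho> (push \<Phi> \<mu>\<^sub>0 t)" by (rule on_ball_mono[OF push_on_ball[OF \<mu>0 \<theta> \<Phi> tT] \<rho>(1)])
      have "norm (?I1 - ?I2) \<le> Ks * (dist1 \<theta> \<theta>2 + norm (\<theta> t - \<theta>2 t) + Kp * d)"
        by (rule Ks(2)[OF \<theta> \<theta>2 \<Phi> \<Phi>2 le1' tT pb _ cl]) (use ball tT in blast)
      then have le: "norm (?I1 - ?I2) \<le> c * d + Ks * norm (\<theta> t - \<theta>2 t)" by (simp add: c_def d_def algebra_simps)
      have "\<theta> t - \<theta>2 t = (- (1 / (2 * lam))) *\<^sub>R (?I1 - ?I2)"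
        unfolding \<theta>2eq[OF tS] G2 scaleR_diff_right S(2)[OF tS, symmetric] using eq tT by metis
      then have "norm (\<theta> t - \<theta>2 t) = (1 / (2 * lam)) * norm (?I1 - ?I2)" using lam_pos by simp
      also have "\<dots> \<le> (1 / (2 * lam)) * (c * d + Ks * norm (\<theta> t - \<theta>2 t))" using lam_pos by (intro mult_left_mono le) auto
      finally have "2 * lam * norm (\<theta> t - \<theta>2 t) \<le> c * d + Ks * norm (\<theta> t - \<theta>2 t)" using lam_pos by (simp add: field_simps)
      moreover have "Ks * norm (\<theta> t - \<theta>2 t) \<le> lam * norm (\<theta> t - \<theta>2 t)" using lam0 lam by (intro mult_right_mono) auto
      ultimately have "lam * norm (\<theta> t - \<theta>2 t) \<le> c * d" by simp
      then show ?thesis using lam_pos by (simp add: field_simps)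
    qed
    have S': "negligible (S \<union> {0, T})" using S(1) by (intro negligible_Un) auto
    have "d = integral {0..T} (\<lambda>t. if t \<in> S \<union> {0, T} then 0 else norm (\<theta> t - \<theta>2 t))"
      unfolding d_def dist1_def by (rule integral_spike[OF S']) simp
    also have "\<dots> \<le> integral {0..T} (\<lambda>_. (c / lam) * d)"
    proof (rule integral_le)
      show "(\<lambda>t. if t \<in> S \<union> {0, T} then 0 else norm (\<theta> t - \<theta>2 t)) integrable_on {0..T}"
        by (rule integrable_spike[OF dist1_integrable[OF \<theta> \<theta>2] S']) simp
      show "(if t \<in> S \<union> {0, T} then 0 else norm (\<theta> t - \<theta>2 t)) \<le> (c / lam) * d" if "t \<in> {0..T}" for t
        using pt[of t] that c0 lam_pos d0 by (auto simp: divide_nonneg_pos)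
    qed (simp add: integrable_const_ivl)
    also have "\<dots> = (T * c / lam) * d" using T by simp
    finally have dd: "d \<le> (T * c / lam) * d" .
    have "T * c / lam < 1" using lam lam0 lam_pos by (simp add: divide_less_eq)
    then have "d = 0" using dd d0 mult_strict_right_mono[of "T * c / lam" 1 d] by (cases "d = 0") auto
    then have "\<theta>' t = \<theta> t" if "t \<in> {0..T} - (S \<union> {0, T})" for t
      using pt[OF that] \<theta>2eq[of t] that by auto
    then show "AE t in lebesgue_on {0..T}. \<theta>' t = \<theta> t" unfolding AE_negligible using S' by blast
  qed
qed

text \<open>Two chain rules give the spatial derivatives \<open>E1\<close> and \<open>E2\<close>.
  The time derivative is read off the transport equation; it contains the first derivative of the
  solution and the field, both \<open>C1\<close> in space, hence it is itself
  \<open>C1\<close>.\<close>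

lemma psi_regular:
  assumes \<theta>: "adm N \<theta>" and \<Phi>: "is_flow \<theta> \<Phi>" and c: "continuous_on {0..T} \<theta>"
    and le1: "\<And>s. s \<in> {0..T} \<Longrightarrow> norm (\<theta> s) \<le> 1" and g_supp: "compact (fsupport g)"
  shows "C1_in_time_C2c T (\<lambda>t z. g (\<Phi> t T z))"
proof -
  interpret c2_flow T "\<lambda>s z. F s z (\<theta> s)" "\<lambda>s. DF s (\<theta> s)" "\<lambda>s. D2F s (\<theta> s)" \<Phi>
    by (rule flow_c2[OF \<theta> \<Phi> le1])
  define \<psi> where "\<psi> t z = g (\<Phi> t T z)" for t z
  have g1: "C1 g" "C1 (Dif g)" using g by (auto simp: C2_def)
  have cg: "continuous_on UNIV g" "continuous_on UNIV (Dif g)" "continuous_on UNIV (Dif (Dif g))"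
    using C1_works[OF g1(1)] g1 by (meson has_derivative_continuous continuous_at_imp_continuous_on, simp_all add: C1_def)
  have DF_eq: "Dif (\<Phi> t T) = D\<Phi> t T" if "t \<in> {0..T}" for t by (rule ext) (rule Dif_flow[OF that T_in])
  have c\<Phi>: "continuous_on ({0..T} \<times> UNIV) (\<lambda>p. \<Phi> (fst p) T (snd p))"
    using flow_cont_start(1)[OF \<theta> \<Phi> T_in] by (simp add: case_prod_beta)
  have cD: "continuous_on ({0..T} \<times> UNIV) (\<lambda>p. D\<Phi> (fst p) T (snd p))"
    using D\<Phi>_continuous[OF T_in] by (simp add: case_prod_beta)
  have cD2: "continuous_on ({0..T} \<times> UNIV) (\<lambda>p. D2\<Phi> (fst p) T (snd p))"
    using D2\<Phi>_continuous[OF T_in] by (simp add: case_prod_beta)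
  have cF: "continuous_on ({0..T} \<times> UNIV) (\<lambda>p. F (fst p) (snd p) (\<theta> (fst p)))"
    by (rule F_curve_cont) (auto intro!: continuous_intros continuous_on_compose2[OF c])
  \<comment> \<open>Continuity in time of the state derivative comes from continuity of the field
    and its uniform second order bounds, as the control stays in the unit ball.\<close>
  have cDF: "continuous_on ({0..T} \<times> UNIV) (\<lambda>p. DF (fst p) (\<theta> (fst p)) (snd p))"
  proof (rule derivative_jointly_continuous[where G = "\<lambda>t z. F t z (\<theta> t)"])
    show "continuous_on ({0..T} \<times> UNIV) (\<lambda>(t, z). F t z (\<theta> t))" using cF by (simp add: case_prod_beta)
    show "((\<lambda>z. F t z (\<theta> t)) has_derivative blinfun_apply (DF t (\<theta> t) z)) (at z)" if "t \<in> {0..T}" for t z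
      by (rule DF[OF that])
    fix \<rho>
    obtain M where "M\<ge>0" "\<forall>t\<in>{0..T}. \<forall>\<theta>. \<forall>z\<in>cball 0 \<rho>. \<forall>w\<in>cball 0 \<rho>. norm \<theta> \<le> 1 \<longrightarrow>
      norm (DF t \<theta> z - DF t \<theta> w) \<le> M * norm (z - w)" using DF_lip_state[of \<rho>] by blast
    then show "\<exists>M\<ge>0. \<forall>t\<in>{0..T}. \<forall>z\<in>cball 0 \<rho>. \<forall>w\<in>cball 0 \<rho>. norm (DF t (\<theta> t) z - DF t (\<theta> t) w) \<le> M * norm (z - w)"
      using le1 by (intro exI[of _ M]) simp
  qed
  define E1 where "E1 p = Dif g (\<Phi> (fst p) T (snd p)) o\<^sub>L D\<Phi> (fst p) T (snd p)" for p
  define E2 where "E2 p q = (Dif g (\<Phi> (fst p) T (snd p)) o\<^sub>L D2\<Phi> (fst p) T (snd p) q)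
      + (Dif (Dif g) (\<Phi> (fst p) T (snd p)) (D\<Phi> (fst p) T (snd p) q) o\<^sub>L D\<Phi> (fst p) T (snd p))" for p q
  have cgP: "continuous_on ({0..T} \<times> UNIV) (\<lambda>p. Dif g (\<Phi> (fst p) T (snd p)))"
    "continuous_on ({0..T} \<times> UNIV) (\<lambda>p. Dif (Dif g) (\<Phi> (fst p) T (snd p)))"
    "continuous_on ({0..T} \<times> UNIV) (\<lambda>p. g (\<Phi> (fst p) T (snd p)))"
    by (rule continuous_on_compose2[OF cg(2) c\<Phi>], simp, rule continuous_on_compose2[OF cg(3) c\<Phi>], simp,
        rule continuous_on_compose2[OF cg(1) c\<Phi>], simp)
  have cE1: "continuous_on ({0..T} \<times> UNIV) E1" unfolding E1_def[abs_def] by (intro continuous_intros cgP cD)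
  have cE2: "continuous_on ({0..T} \<times> UNIV) (\<lambda>p. E2 p q)" for q
    unfolding E2_def by (intro continuous_intros cgP cD cD2)
  have cont_slice: "continuous_on UNIV (\<lambda>z. f (t, z))" if "continuous_on ({0..T} \<times> UNIV) f" "t \<in> {0..T}"
    for f :: "real \<times> 'z \<Rightarrow> 'x::topological_space" and t
    by (rule continuous_on_compose2[OF that(1)]) (use that(2) in \<open>auto intro!: continuous_intros\<close>)
  have d1: "(\<psi> t has_derivative blinfun_apply (E1 (t, z))) (at z)" if t: "t \<in> {0..T}" for t z
    using Dif_psi[OF \<theta> \<Phi> t, of z] by (simp add: \<psi>_def[abs_def] E1_def grad_def DF_eq[OF t])
  have Dif1: "Dif (\<psi> t) = (\<lambda>z. E1 (t, z))" if "t \<in> {0..T}" for t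
    by (rule ext) (rule Dif_eqI[OF d1[OF that]])
  have d2: "((\<lambda>z. E1 (t, z)) has_derivative E2 (t, z)) (at z)" if t: "t \<in> {0..T}" for t z
  proof -
    have "((\<lambda>z. Dif g (\<Phi> t T z)) has_derivative (\<lambda>q. Dif (Dif g) (\<Phi> t T z) (D\<Phi> t T z q))) (at z)"
      by (rule has_derivative_compose[OF D\<Phi>_has_derivative[OF t T_in] C1_works[OF g1(2)]])
    from bounded_bilinear.FDERIV[OF bounded_bilinear_blinfun_compose this D2\<Phi>_has_derivative[OF t T_in]]
    show ?thesis by (simp add: E1_def E2_def[abs_def])
  qed
  have d2': "(Dif (\<psi> t) has_derivative E2 (t, z)) (at z)" if "t \<in> {0..T}" for t z
    unfolding Dif1[OF that] by (rule d2[OF that])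
  have C2: "C2 (\<psi> t)" if t: "t \<in> {0..T}" for t
    unfolding C2_def
  proof
    show "C1 (\<psi> t)"
      by (rule C1I[OF d1[OF t]]) (rule blinfun.continuous_on[OF cont_slice[OF cE1 t] continuous_on_const])
    show "C1 (Dif (\<psi> t))"
      by (rule C1I[OF d2'[OF t]]) (rule cont_slice[OF cE2 t])
  qed
  obtain r where r: "fsupport g \<subseteq> cball 0 r"
  proof -
    obtain r where "\<forall>z\<in>fsupport g. norm z \<le> r" using compact_imp_bounded[OF g_supp] unfolding bounded_iff by blast
    then show ?thesis by (intro that[of r]) auto
  qed
  have supp: "fsupport (\<psi> t) \<subseteq> cball 0 (rad N r)" if t: "t \<in> {0..T}" for t
    unfolding fsupport_def
  proof (rule closure_minimal)
    show "{z. \<psi> t z \<noteq> 0} \<subseteq> cball 0 (rad N r)"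
    proof
      fix z assume "z \<in> {z. \<psi> t z \<noteq> 0}"
      then have "\<Phi> t T z \<in> fsupport g" using fsupport_zero[of "\<Phi> t T z" g] by (auto simp: \<psi>_def)
      then have "norm (\<Phi> t T z) \<le> r" using r by auto
      \<comment> \<open>A point of the support is recovered by flowing its image, which lies in the
        support of \<open>g\<close>, back from time \<open>T\<close> to time
        \<open>t\<close>.\<close>
      from flow_bound[OF \<theta> \<Phi> T_in t this] show "z \<in> cball 0 (rad N r)"
        by (simp add: flow_trans'[OF \<theta> \<Phi> t T_in t] flow_init'[OF \<Phi> t])
    qed
  qed simp
  define \<psi>' where "\<psi>' t z = - (E1 (t, z) (F t z (\<theta> t)))" for t z
  define E3 where "E3 p q = - (E1 p (DF (fst p) (\<theta> (fst p)) (snd p) q) + E2 p q (F (fst p) (snd p) (\<theta> (fst p))))" for p q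
  have d3: "(\<psi>' t has_derivative E3 (t, z)) (at z)" if t: "t \<in> {0..T}" for t z
  proof -
    have "((\<lambda>z. E1 (t, z) (F t z (\<theta> t))) has_derivative (\<lambda>q. E1 (t, z) (DF t (\<theta> t) z q) + E2 (t, z) q (F t z (\<theta> t)))) (at z)"
      by (rule blinfun.FDERIV[OF d2[OF t] DF[OF t]])
    from has_derivative_minus[OF this] show ?thesis by (simp add: \<psi>'_def[abs_def] E3_def[abs_def])
  qed
  have cE3: "continuous_on ({0..T} \<times> UNIV) (\<lambda>p. E3 p q)" for q
    unfolding E3_def by (intro continuous_intros cE1 cE2 cDF cF)
  have time: "((\<lambda>s. \<psi> s z) has_real_derivative \<psi>' t z) (at t within {0..T})" if t: "t \<in> {0..T}" for t z
    using pull_time_derivative[OF \<theta> \<Phi> c t T_in g1(1), of z]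
    by (simp add: \<psi>_def \<psi>'_def E1_def pull_grad_def DF_eq[OF t])
  have slices: "continuous_on ({0..T} \<times> UNIV) (\<lambda>(t, z). f t z)" if "continuous_on ({0..T} \<times> UNIV) f'"
    "\<And>t z. t \<in> {0..T} \<Longrightarrow> f t z = f' (t, z)" for f :: "real \<Rightarrow> 'z \<Rightarrow> 'x::topological_space" and f'
    by (rule continuous_on_eq[OF that(1)]) (use that(2) in auto)
  have "C1_in_time_C2c T \<psi>"
    unfolding C1_in_time_C2c_def
  proof (intro conjI ballI exI[of _ "cball 0 (rad N r)"] exI[of _ \<psi>'] allI)
    show "C2c (\<psi> t)" if t: "t \<in> {0..T}" for t
      using C2[OF t] bounded_subset[OF bounded_cball supp[OF t]]
      by (simp add: C2c_def compact_eq_bounded_closed fsupport_def)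
    show "continuous_on ({0..T} \<times> UNIV) (\<lambda>(t, z). \<psi> t z)"
      by (rule slices[OF cgP(3)]) (simp add: \<psi>_def)
    show "continuous_on ({0..T} \<times> UNIV) (\<lambda>(t, z). Dif (\<psi> t) z)"
      by (rule slices[OF cE1]) (simp add: Dif1)
    show "continuous_on ({0..T} \<times> UNIV) (\<lambda>(t, z). Dif (Dif (\<psi> t)) z)"
    proof (rule continuous_on_blinfun_componentwise)
      fix q :: 'z
      show "continuous_on ({0..T} \<times> UNIV) (\<lambda>p. blinfun_apply (case p of (t, z) \<Rightarrow> Dif (Dif (\<psi> t)) z) q)"
        by (rule continuous_on_eq[OF cE2[of q]]) (clarsimp simp: Dif_apply[OF d2'])
    qed
    show "C1 (\<psi>' t)" if t: "t \<in> {0..T}" for t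
      by (rule C1I[OF d3[OF t]]) (rule cont_slice[OF cE3 t])
    show "continuous_on ({0..T} \<times> UNIV) (\<lambda>(t, z). \<psi>' t z)"
      by (rule slices[OF continuous_on_minus[OF blinfun.continuous_on[OF cE1 cF]]]) (simp add: \<psi>'_def)
    show "continuous_on ({0..T} \<times> UNIV) (\<lambda>(t, z). Dif (\<psi>' t) z)"
    proof (rule continuous_on_blinfun_componentwise)
      fix q :: 'z
      show "continuous_on ({0..T} \<times> UNIV) (\<lambda>p. blinfun_apply (case p of (t, z) \<Rightarrow> Dif (\<psi>' t) z) q)"
        by (rule continuous_on_eq[OF cE3[of q]]) (clarsimp simp: Dif_apply[OF d3])
    qed
    show "fsupport (\<psi> t) \<subseteq> cball 0 (rad N r)" if "t \<in> {0..T}" for t by (rule supp[OF that])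
    show "((\<lambda>s. \<psi> s z) has_real_derivative \<psi>' t z) (at t within {0..T})" if "t \<in> {0..T}" for t z by (rule time[OF that])
  qed (rule compact_cball)
  then show ?thesis by (simp add: \<psi>_def[abs_def])
qed

end

section \<open>Lifting the vector field to pairs\<close>

definition emb :: "'a::real_normed_vector \<Rightarrow>\<^sub>L ('a \<times> 'b::real_normed_vector)" where
  "emb = Blinfun (\<lambda>x. (x, 0))"

definition pro :: "('a::real_normed_vector \<times> 'b::real_normed_vector) \<Rightarrow>\<^sub>L 'a" where
  "pro = Blinfun fst"

text \<open>Conjugation by \<open>emb\<close> and \<open>pro\<close> as a bounded linear map, so
  that it can be composed with the second derivative of the unlifted field.\<close>

definition lft :: "('a::real_normed_vector \<Rightarrow>\<^sub>L 'a) \<Rightarrow>\<^sub>L (('a \<times> 'b::real_normed_vector) \<Rightarrow>\<^sub>L ('a \<times> 'b))" where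
  "lft = Blinfun (\<lambda>B. emb o\<^sub>L B o\<^sub>L pro)"

lemma emb_apply [simp]: "blinfun_apply emb x = (x, 0)"
  unfolding emb_def
  by (subst bounded_linear_Blinfun_apply) (intro bounded_linear_Pair bounded_linear_ident bounded_linear_zero, rule refl)

lemma pro_apply [simp]: "blinfun_apply pro z = fst z"
  unfolding pro_def by (subst bounded_linear_Blinfun_apply) (rule bounded_linear_fst, rule refl)

lemma lft_apply: "blinfun_apply lft B = emb o\<^sub>L B o\<^sub>L pro"
proof -
  have "bounded_linear (\<lambda>B. emb o\<^sub>L B o\<^sub>L pro)"
    using bounded_linear_compose[OF bounded_bilinear.bounded_linear_left[OF bounded_bilinear_blinfun_compose]
        bounded_bilinear.bounded_linear_right[OF bounded_bilinear_blinfun_compose]] .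
  then show ?thesis unfolding lft_def by (subst bounded_linear_Blinfun_apply) auto
qed

lemma norm_emb_compose: "norm (emb o\<^sub>L B) \<le> norm B"
  by (rule norm_blinfun_bound) (simp_all add: norm_Pair norm_blinfun)

lemma norm_emb_diff: "norm ((emb o\<^sub>L B) - (emb o\<^sub>L B')) \<le> norm (B - B')"
  using norm_emb_compose[of "B - B'"]
  by (simp add: bounded_bilinear.diff_right[OF bounded_bilinear_blinfun_compose])

lemma norm_fst_le_norm: "norm (fst z) \<le> norm z"
  using norm_fst_le[of "fst z" "snd z"] by simp

lemma norm_compose_pro:
  fixes B :: "'a::real_normed_vector \<Rightarrow>\<^sub>L 'c::real_normed_vector"
  shows "norm (B o\<^sub>L (pro :: ('a \<times> 'b::real_normed_vector) \<Rightarrow>\<^sub>L 'a)) \<le> norm B"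
proof (rule norm_blinfun_bound)
  fix z :: "'a \<times> 'b"
  have "norm (B (fst z)) \<le> norm B * norm (fst z)" by (rule norm_blinfun)
  also have "\<dots> \<le> norm B * norm z" by (intro mult_left_mono norm_fst_le_norm) auto
  finally show "norm (blinfun_apply (B o\<^sub>L pro) z) \<le> norm B * norm z" by simp
qed simp

lemma norm_lft_compose:
  fixes B :: "'a::real_normed_vector \<Rightarrow>\<^sub>L ('a \<Rightarrow>\<^sub>L 'a)"
  shows "norm ((lft :: _ \<Rightarrow>\<^sub>L (('a \<times> 'b::real_normed_vector) \<Rightarrow>\<^sub>L ('a \<times> 'b))) o\<^sub>L B o\<^sub>L (pro :: ('a \<times> 'b) \<Rightarrow>\<^sub>L 'a)) \<le> norm B"
proof (rule order_trans[OF norm_compose_pro], rule norm_blinfun_bound)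
  let ?l = "lft :: _ \<Rightarrow>\<^sub>L (('a \<times> 'b) \<Rightarrow>\<^sub>L ('a \<times> 'b))"
  fix v
  have "norm (?l (B v)) \<le> norm (B v)"
    unfolding lft_apply by (rule order_trans[OF norm_compose_pro norm_emb_compose])
  then show "norm (blinfun_apply (?l o\<^sub>L B) v) \<le> norm B * norm v"
    using norm_blinfun[of B v] by simp
qed simp

text \<open>A violation at one time would persist on an interval of positive length. This turns the
  almost everywhere bounds of \<open>A1\<close> into bounds at every time.\<close>

lemma AE_le_continuous:
  fixes f :: "real \<Rightarrow> real"
  assumes ae: "AE t in lebesgue_on {0..T}. f t \<le> c" and f: "continuous_on {0..T} f" and T: "0 < T"
    and t: "t \<in> {0..T}"
  shows "f t \<le> c"
proof (rule ccontr)
  assume "\<not> f t \<le> c"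
  then have "0 < f t - c" by simp
  then obtain d where d: "d > 0" "\<And>s. s \<in> {0..T} \<Longrightarrow> dist s t < d \<Longrightarrow> dist (f s) (f t) < f t - c"
    using f t unfolding continuous_on_iff by blast
  obtain S where S: "negligible S" "\<forall>t\<in>{0..T} - S. f t \<le> c" using ae unfolding AE_negligible by blast
  define a b where "a = max 0 (t - d / 2)" and "b = min T (t + d / 2)"
  have ab: "a < b" using t T d(1) by (auto simp: a_def b_def)
  have "cbox a b \<subseteq> S"
  proof
    fix s assume "s \<in> cbox a b"
    then have s: "s \<in> {0..T}" "dist s t < d" using d(1) by (auto simp: a_def b_def dist_real_def)
    then have "f s > c" using d(2)[OF s] by (simp add: dist_real_def)
    then show "s \<in> S" using S(2) s(1) by force
  qed
  then have "negligible (cbox a b)" using S(1) negligible_subset by blast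
  moreover have "box a b \<noteq> {}" using ab by (simp add: box_real)
  ultimately show False using negligible_interval(1)[of a b] by blast
qed

lemma A1_constants:
  fixes F :: "real \<Rightarrow> real^'d \<Rightarrow> real^'m \<Rightarrow> real^'d"
  assumes "A1 T F" "0 < T"
  obtains C L where "0 < C" "0 < L" "\<And>t x \<theta>. t \<in> {0..T} \<Longrightarrow> norm (F t x \<theta>) \<le> C * (1 + norm x)"
    "\<And>t x y \<theta>. t \<in> {0..T} \<Longrightarrow> norm (F t x \<theta> - F t y \<theta>) \<le> L * (1 + norm \<theta>) * norm (x - y)"
proof -
  have c: "continuous_on {0..T} (\<lambda>t. F t x \<theta>)" for x \<theta>
  proof -
    have "continuous_on ({0..T} \<times> UNIV) (\<lambda>(t, x). F t x \<theta>)" using assms(1) by (simp add: A1_def)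
    then have "continuous_on {0..T} (\<lambda>t. (\<lambda>(t, x). F t x \<theta>) (t, x))"
      by (rule continuous_on_compose2) (auto intro!: continuous_intros)
    then show ?thesis by simp
  qed
  obtain C where C: "0 < C" "\<forall>\<theta>. AE t in lebesgue_on {0..T}. \<forall>x. norm (F t x \<theta>) \<le> C * (1 + norm x)"
    using assms(1) unfolding A1_def by blast
  obtain L where L: "0 < L" "\<forall>\<theta>. AE t in lebesgue_on {0..T}. \<forall>x\<^sub>1 x\<^sub>2.
        norm (F t x\<^sub>1 \<theta> - F t x\<^sub>2 \<theta>) \<le> L * (1 + norm \<theta>) * norm (x\<^sub>1 - x\<^sub>2)"
    using assms(1) unfolding A1_def by blast
  show ?thesis
  proof (rule that[OF C(1) L(1)])
    fix t x y \<theta> assume t: "t \<in> {0..T}"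
    show "norm (F t x \<theta>) \<le> C * (1 + norm x)"
    proof (rule AE_le_continuous[OF _ _ assms(2) t, of "\<lambda>t. norm (F t x \<theta>)"])
      show "AE t in lebesgue_on {0..T}. norm (F t x \<theta>) \<le> C * (1 + norm x)"
        by (rule eventually_mono[OF C(2)[rule_format, of \<theta>]]) (rule spec)
    qed (intro continuous_intros c)
    show "norm (F t x \<theta> - F t y \<theta>) \<le> L * (1 + norm \<theta>) * norm (x - y)"
    proof (rule AE_le_continuous[OF _ _ assms(2) t, of "\<lambda>t. norm (F t x \<theta> - F t y \<theta>)"])
      show "AE t in lebesgue_on {0..T}. norm (F t x \<theta> - F t y \<theta>) \<le> L * (1 + norm \<theta>) * norm (x - y)"
        by (rule eventually_mono[OF L(2)[rule_format, of \<theta>]]) blast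
    qed (intro continuous_intros c)
  qed
qed

lemma A2_lipschitz:
  fixes F :: "real \<Rightarrow> real^'d \<Rightarrow> real^'m \<Rightarrow> real^'d"
  assumes "A2 T F"
  obtains M where "M \<ge> 0" "\<And>t x \<theta> \<theta>'. t \<in> {0..T} \<Longrightarrow> norm x \<le> \<rho> \<Longrightarrow>
    norm (F t x \<theta> - F t x \<theta>') \<le> M * norm (\<theta> - \<theta>')"
proof -
  have "\<forall>R>0. \<exists>C. \<forall>\<theta>\<^sub>1 \<theta>\<^sub>2. \<forall>s\<in>{0..T}. \<forall>t\<in>{0..T}. \<forall>x\<in>cball 0 R.
        norm (F t x \<theta>\<^sub>1 - F s x \<theta>\<^sub>2) \<le> C * (\<bar>t - s\<bar> + norm (\<theta>\<^sub>1 - \<theta>\<^sub>2))"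
    using assms unfolding A2_def by blast
  then obtain M where M: "\<forall>\<theta>\<^sub>1 \<theta>\<^sub>2. \<forall>s\<in>{0..T}. \<forall>t\<in>{0..T}. \<forall>x\<in>cball 0 (\<bar>\<rho>\<bar> + 1).
        norm (F t x \<theta>\<^sub>1 - F s x \<theta>\<^sub>2) \<le> M * (\<bar>t - s\<bar> + norm (\<theta>\<^sub>1 - \<theta>\<^sub>2))" by (meson abs_ge_zero add_nonneg_pos zero_less_one)
  show ?thesis
  proof (rule that[of "\<bar>M\<bar>"])
    fix t and x :: "real^'d" and \<theta> \<theta>' :: "real^'m" assume *: "t \<in> {0..T}" "norm x \<le> \<rho>"
    then have x: "x \<in> cball 0 (\<bar>\<rho>\<bar> + 1)" by simp
    have "norm (F t x \<theta> - F t x \<theta>') \<le> M * (\<bar>t - t\<bar> + norm (\<theta> - \<theta>'))"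
      using M *(1) x by blast
    also have "\<dots> = M * norm (\<theta> - \<theta>')" by simp
    also have "\<dots> \<le> \<bar>M\<bar> * norm (\<theta> - \<theta>')" by (intro mult_right_mono) auto
    finally show "norm (F t x \<theta> - F t x \<theta>') \<le> \<bar>M\<bar> * norm (\<theta> - \<theta>')" .
  qed simp
qed

text \<open>Continuity in time and state at a fixed control combines with the Lipschitz bound in the
  control, which is uniform near the state.\<close>

lemma A1_jointly_continuous:
  fixes F :: "real \<Rightarrow> real^'d \<Rightarrow> real^'m \<Rightarrow> real^'d"
  assumes "A1 T F" "A2 T F"
  shows "continuous_on ({0..T} \<times> UNIV \<times> UNIV) (\<lambda>(t, x, \<theta>). F t x \<theta>)"
  unfolding continuous_on_def
proof
  fix p :: "real \<times> (real^'d) \<times> (real^'m)" assume p: "p \<in> {0..T} \<times> UNIV \<times> UNIV"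
  obtain t0 x0 \<theta>0 where p_def: "p = (t0, x0, \<theta>0)" by (cases p) auto
  let ?S = "{0..T} \<times> UNIV \<times> UNIV :: (real \<times> (real^'d) \<times> (real^'m)) set"
  obtain M where M: "M \<ge> 0" "\<And>t x \<theta> \<theta>'. t \<in> {0..T} \<Longrightarrow> norm x \<le> norm x0 + 1 \<Longrightarrow>
    norm (F t x \<theta> - F t x \<theta>') \<le> M * norm (\<theta> - \<theta>')" using A2_lipschitz[OF assms(2)] by blast
  have "continuous_on ({0..T} \<times> UNIV) (\<lambda>(t, x). F t x \<theta>0)" using assms(1) by (simp add: A1_def)
  then have "continuous_on ?S (\<lambda>q. (\<lambda>(t, x). F t x \<theta>0) (fst q, fst (snd q)))"
    by (rule continuous_on_compose2) (auto intro!: continuous_intros)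
  then have 1: "((\<lambda>q. F (fst q) (fst (snd q)) \<theta>0) \<longlongrightarrow> F t0 x0 \<theta>0) (at p within ?S)"
    using p by (auto simp: continuous_on_def p_def)
  have 2: "((\<lambda>q. F (fst q) (fst (snd q)) (snd (snd q)) - F (fst q) (fst (snd q)) \<theta>0) \<longlongrightarrow> 0) (at p within ?S)"
  proof (rule Lim_null_comparison)
    have "((\<lambda>q. fst (snd q)) \<longlongrightarrow> fst (snd p)) (at p within ?S)"
      by (intro tendsto_fst tendsto_snd tendsto_ident_at)
    then have "((\<lambda>q. norm (fst (snd q))) \<longlongrightarrow> norm x0) (at p within ?S)"
      using tendsto_norm by (fastforce simp: p_def)
    then have "eventually (\<lambda>q. norm (fst (snd q)) < norm x0 + 1) (at p within ?S)"
      by (rule order_tendstoD) simp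
    moreover have "eventually (\<lambda>q. q \<in> ?S) (at p within ?S)" by (simp add: eventually_at_filter)
    ultimately show "eventually (\<lambda>q. norm (F (fst q) (fst (snd q)) (snd (snd q)) - F (fst q) (fst (snd q)) \<theta>0)
        \<le> M * norm (snd (snd q) - snd (snd p))) (at p within ?S)"
      by eventually_elim (auto simp: p_def intro!: M(2))
    show "((\<lambda>q. M * norm (snd (snd q) - snd (snd p))) \<longlongrightarrow> 0) (at p within ?S)"
      by (rule tendsto_eq_rhs[where x = "M * norm (snd (snd p) - snd (snd p))"])
        (intro tendsto_mult_left tendsto_norm tendsto_diff tendsto_snd tendsto_ident_at tendsto_const, simp)
  qed
  show "((\<lambda>(t, x, \<theta>). F t x \<theta>) \<longlongrightarrow> (case p of (t, x, \<theta>) \<Rightarrow> F t x \<theta>)) (at p within ?S)"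
    using tendsto_add[OF 1 2] by (simp add: p_def case_prod_unfold)
qed

lemma continuous_on_balls:
  fixes f :: "real \<times> 'a::real_normed_vector \<times> 'b::real_normed_vector \<Rightarrow> 'c::topological_space"
  assumes "\<And>R. R > 0 \<Longrightarrow> continuous_on (S \<times> cball 0 R \<times> UNIV) f"
  shows "continuous_on (S \<times> UNIV \<times> UNIV) f"
  unfolding continuous_on_def
proof
  fix p assume p: "p \<in> S \<times> (UNIV :: 'a set) \<times> (UNIV :: 'b set)"
  define R where "R = norm (fst (snd p)) + 1"
  have R: "R > 0" by (simp add: R_def add_nonneg_pos)
  have "(f \<longlongrightarrow> f p) (at p within S \<times> cball 0 R \<times> UNIV)"
    using assms[OF R] p unfolding continuous_on_def by (auto simp: R_def)
  moreover have "at p within S \<times> cball 0 R \<times> UNIV = at p within S \<times> UNIV \<times> UNIV"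
    by (rule at_within_nhd[where S = "UNIV \<times> ball 0 R \<times> UNIV"])
      (auto simp: R_def mem_Times_iff intro!: open_Times)
  ultimately show "(f \<longlongrightarrow> f p) (at p within S \<times> UNIV \<times> UNIV)" by simp
qed

text \<open>The second component of the lifted field is zero, so composition with \<open>emb\<close>
  and \<open>pro\<close> does not increase norms and all bounds are inherited. Lipschitz continuity
  of the control gradient in the control follows from the bound on the second control
  derivative.\<close>

lemma control_system_lift:
  fixes F :: "real \<Rightarrow> real^'d \<Rightarrow> real^'m \<Rightarrow> real^'d" and g :: "(real^'d) \<times> (real^'d) \<Rightarrow> real"
  assumes T: "0 < T" and A1: "A1 T F" and A2: "A2 T F" and g: "C2 g"
  obtains C L where "control_system T (\<lambda>t z \<theta>. (F t (fst z) \<theta>, 0))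
      (\<lambda>t \<theta> z. emb o\<^sub>L Dif (\<lambda>x. F t x \<theta>) (fst z) o\<^sub>L pro)
      (\<lambda>t \<theta> z. lft o\<^sub>L Dif (Dif (\<lambda>x. F t x \<theta>)) (fst z) o\<^sub>L pro)
      (\<lambda>t z \<theta>. emb o\<^sub>L Dif (F t (fst z)) \<theta>) C L g"
proof -
  let ?e = "emb :: (real^'d) \<Rightarrow>\<^sub>L ((real^'d) \<times> (real^'d))"
  let ?p = "pro :: ((real^'d) \<times> (real^'d)) \<Rightarrow>\<^sub>L (real^'d)"
  let ?l = "lft :: ((real^'d) \<Rightarrow>\<^sub>L (real^'d)) \<Rightarrow>\<^sub>L (((real^'d) \<times> (real^'d)) \<Rightarrow>\<^sub>L ((real^'d) \<times> (real^'d)))"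
  obtain C L where CL: "0 < C" "0 < L" "\<And>t x \<theta>. t \<in> {0..T} \<Longrightarrow> norm (F t x \<theta>) \<le> C * (1 + norm x)"
    "\<And>t x y \<theta>. t \<in> {0..T} \<Longrightarrow> norm (F t x \<theta> - F t y \<theta>) \<le> L * (1 + norm \<theta>) * norm (x - y)"
    using A1_constants[OF A1 T] by blast
  have C2: "C1 (\<lambda>x. F t x \<theta>)" "C1 (Dif (\<lambda>x. F t x \<theta>))" if "t \<in> {0..T}" for t \<theta>
  proof -
    have "\<forall>t\<in>{0..T}. \<forall>\<theta>. C2 (\<lambda>x. F t x \<theta>)" using A2 unfolding A2_def by (rule conjunct1)
    then have "C2 (\<lambda>x. F t x \<theta>)" using that by blast
    then show "C1 (\<lambda>x. F t x \<theta>)" "C1 (Dif (\<lambda>x. F t x \<theta>))" unfolding C2_def by auto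
  qed
  have d\<theta>: "(F t x has_derivative Dif (F t x) \<theta>) (at \<theta>)" "(Dif (F t x) has_derivative Dif (Dif (F t x)) \<theta>) (at \<theta>)"
    if "t \<in> {0..T}" for t x \<theta>
  proof -
    have "\<forall>t\<in>{0..T}. \<forall>x \<theta>. F t x differentiable (at \<theta>) \<and> Dif (F t x) differentiable (at \<theta>)"
      using A1 unfolding A1_def by (elim conjE)
    then have "F t x differentiable (at \<theta>)" "Dif (F t x) differentiable (at \<theta>)" using that by blast+
    then show "(F t x has_derivative Dif (F t x) \<theta>) (at \<theta>)" "(Dif (F t x) has_derivative Dif (Dif (F t x)) \<theta>) (at \<theta>)"
      by (auto intro: Dif_works)
  qed
  \<comment> \<open>The assumptions concern positive radii while the locale quantifies over all of
    them; \<open>\<bar>\<rho>\<bar> + 1\<close> is positive in any case.\<close>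
  have fst_le: "z \<in> cball 0 \<rho> \<Longrightarrow> fst z \<in> cball 0 (\<bar>\<rho>\<bar> + 1)" for z :: "(real^'d) \<times> (real^'d)" and \<rho>
    using norm_fst_le_norm[of z] by simp
  have pos: "\<bar>\<rho>\<bar> + 1 > 0" for \<rho> :: real by (simp add: add_nonneg_pos)
  have b1: "\<exists>M>0. \<forall>t\<in>{0..T}. \<forall>x\<in>cball 0 R. \<forall>\<theta>. norm (Dif (F t x) \<theta>) + norm (Dif (Dif (F t x)) \<theta>) \<le> M" if "R > 0" for R
    using A1 that unfolding A1_def by blast
  have b2: "\<exists>K. mono K \<and> (\<forall>t\<in>{0..T}. \<forall>x\<in>cball 0 R. \<forall>\<theta>.
        norm (row_divergence (\<lambda>x. Dif (F t x) \<theta>) x) + norm (Dif (\<lambda>x. F t x \<theta>) x)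
          + norm (Dif (Dif (\<lambda>x. F t x \<theta>)) x) \<le> K (norm \<theta>))" if "R > 0" for R
    using A2 that unfolding A2_def by blast
  have b3: "\<exists>K. mono K \<and> (\<forall>\<theta>. \<forall>t\<in>{0..T}. \<forall>x\<in>cball 0 R. \<forall>y\<in>cball 0 R.
        norm (Dif (F t x) \<theta> - Dif (F t y) \<theta>) \<le> K (norm \<theta>) * norm (x - y))" if "R > 0" for R
    using A2 that unfolding A2_def by blast
  show ?thesis
  proof (rule that[of C L], unfold_locales)
    show "0 < T" "0 < C" "0 < L" "C2 g" by fact+
    show "continuous_on ({0..T} \<times> UNIV \<times> UNIV) (\<lambda>(t, z :: (real^'d) \<times> (real^'d), \<theta>). (F t (fst z) \<theta>, 0 :: real^'d))"
    proof -
      have "continuous_on ({0..T} \<times> UNIV \<times> UNIV) (\<lambda>q :: real \<times> ((real^'d) \<times> (real^'d)) \<times> (real^'m).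
          (\<lambda>(t, x, \<theta>). F t x \<theta>) (fst q, fst (fst (snd q)), snd (snd q)))"
        by (rule continuous_on_compose2[OF A1_jointly_continuous[OF A1 A2]]) (auto intro!: continuous_intros)
      from continuous_on_Pair[OF this continuous_on_const[of _ "0 :: real^'d"]]
      show ?thesis by (simp add: case_prod_beta)
    qed
    show "continuous_on ({0..T} \<times> UNIV \<times> UNIV) (\<lambda>(t, z :: (real^'d) \<times> (real^'d), \<theta>). ?e o\<^sub>L Dif (F t (fst z)) \<theta>)"
    proof -
      have "continuous_on ({0..T} \<times> UNIV \<times> UNIV) (\<lambda>(t, x, \<theta>). Dif (F t x) \<theta>)"
        by (rule continuous_on_balls) (use A1 in \<open>unfold A1_def, blast\<close>)
      then have "continuous_on ({0..T} \<times> UNIV \<times> UNIV) (\<lambda>q :: real \<times> ((real^'d) \<times> (real^'d)) \<times> (real^'m).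
          (\<lambda>(t, x, \<theta>). Dif (F t x) \<theta>) (fst q, fst (fst (snd q)), snd (snd q)))"
        by (rule continuous_on_compose2) (auto intro!: continuous_intros)
      from bounded_bilinear.continuous_on[OF bounded_bilinear_blinfun_compose continuous_on_const[of _ ?e] this]
      show ?thesis by (simp add: case_prod_beta)
    qed
  next
    fix t :: real and z w :: "(real^'d) \<times> (real^'d)" and \<theta> :: "real^'m" assume t: "t \<in> {0..T}"
    have "norm (F t (fst z) \<theta>) \<le> C * (1 + norm (fst z))" by (rule CL(3)[OF t])
    also have "\<dots> \<le> C * (1 + norm z)" using CL(1) by (intro mult_left_mono add_left_mono norm_fst_le_norm) auto
    finally show "norm (F t (fst z) \<theta>, 0 :: real^'d) \<le> C * (1 + norm z)" by (simp add: norm_Pair)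
    have "norm (F t (fst z) \<theta> - F t (fst w) \<theta>) \<le> L * (1 + norm \<theta>) * norm (fst (z - w))"
      using CL(4)[OF t] by simp
    also have "\<dots> \<le> L * (1 + norm \<theta>) * norm (z - w)"
      using CL(2) by (intro mult_left_mono norm_fst_le_norm) auto
    finally show "norm ((F t (fst z) \<theta>, 0 :: real^'d) - (F t (fst w) \<theta>, 0)) \<le> L * (1 + norm \<theta>) * norm (z - w)"
      by (simp add: norm_Pair)
    have "((\<lambda>z. F t (fst z) \<theta>) has_derivative (\<lambda>q. Dif (\<lambda>x. F t x \<theta>) (fst z) (fst q))) (at z)"
      by (rule has_derivative_compose[OF has_derivative_fst[OF has_derivative_ident] C1_works[OF C2(1)[OF t]]])
    from has_derivative_Pair[OF this has_derivative_const[of "0 :: real^'d"]]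
    show "((\<lambda>z. (F t (fst z) \<theta>, 0 :: real^'d)) has_derivative blinfun_apply (?e o\<^sub>L Dif (\<lambda>x. F t x \<theta>) (fst z) o\<^sub>L ?p)) (at z)"
      by (rule has_derivative_eq_rhs) (simp add: fun_eq_iff)
    have "((\<lambda>z. Dif (\<lambda>x. F t x \<theta>) (fst z)) has_derivative (\<lambda>q. Dif (Dif (\<lambda>x. F t x \<theta>)) (fst z) (fst q))) (at z)"
      by (rule has_derivative_compose[OF has_derivative_fst[OF has_derivative_ident] C1_works[OF C2(2)[OF t]]])
    from bounded_linear.has_derivative[OF blinfun.bounded_linear_right[of ?l] this]
    have "((\<lambda>z. ?l (Dif (\<lambda>x. F t x \<theta>) (fst z))) has_derivative
      blinfun_apply (?l o\<^sub>L Dif (Dif (\<lambda>x. F t x \<theta>)) (fst z) o\<^sub>L ?p)) (at z)"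
      by (rule has_derivative_eq_rhs) (simp add: fun_eq_iff)
    then show "((\<lambda>z. ?e o\<^sub>L Dif (\<lambda>x. F t x \<theta>) (fst z) o\<^sub>L ?p) has_derivative
      blinfun_apply (?l o\<^sub>L Dif (Dif (\<lambda>x. F t x \<theta>)) (fst z) o\<^sub>L ?p)) (at z)"
      by (simp only: lft_apply)
    show "continuous_on UNIV (\<lambda>z :: (real^'d) \<times> (real^'d). ?l o\<^sub>L Dif (Dif (\<lambda>x. F t x \<theta>)) (fst z) o\<^sub>L ?p)"
    proof -
      have "continuous_on UNIV (Dif (Dif (\<lambda>x. F t x \<theta>)))" using C2(2)[OF t] unfolding C1_def by blast
      then have "continuous_on UNIV (\<lambda>z :: (real^'d) \<times> (real^'d). Dif (Dif (\<lambda>x. F t x \<theta>)) (fst z))"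
        by (rule continuous_on_compose2) (auto intro: continuous_on_fst continuous_on_id)
      then show ?thesis
        by (intro bounded_bilinear.continuous_on[OF bounded_bilinear_blinfun_compose
            bounded_bilinear.continuous_on[OF bounded_bilinear_blinfun_compose continuous_on_const] continuous_on_const])
    qed
    from has_derivative_Pair[OF d\<theta>(1)[OF t] has_derivative_const[of "0 :: real^'d"]]
    show "((\<lambda>\<theta>. (F t (fst z) \<theta>, 0 :: real^'d)) has_derivative blinfun_apply (?e o\<^sub>L Dif (F t (fst z)) \<theta>)) (at \<theta>)"
      by (rule has_derivative_eq_rhs) (simp add: fun_eq_iff)
  next
    fix \<rho> :: real
    obtain K where K: "mono K" "\<forall>t\<in>{0..T}. \<forall>x\<in>cball 0 (\<bar>\<rho>\<bar> + 1). \<forall>\<theta>.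
        norm (row_divergence (\<lambda>x. Dif (F t x) \<theta>) x) + norm (Dif (\<lambda>x. F t x \<theta>) x)
          + norm (Dif (Dif (\<lambda>x. F t x \<theta>)) x) \<le> K (norm \<theta>)" using b2[OF pos] by blast
    \<comment> \<open>On the unit ball of controls, monotonicity freezes the bound at
      \<open>K 1\<close>; the maximum with 0 supplies the sign required by the locale.\<close>
    have "norm (?l o\<^sub>L Dif (Dif (\<lambda>x. F t x \<theta>)) (fst z) o\<^sub>L ?p) \<le> max (K 1) 0"
      if "t \<in> {0..T}" "z \<in> cball 0 \<rho>" "norm \<theta> \<le> 1" for t \<theta> and z :: "(real^'d) \<times> (real^'d)"
    proof -
      have "norm (row_divergence (\<lambda>x. Dif (F t x) \<theta>) (fst z)) + norm (Dif (\<lambda>x. F t x \<theta>) (fst z))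
          + norm (Dif (Dif (\<lambda>x. F t x \<theta>)) (fst z)) \<le> K (norm \<theta>)"
        using K(2) that(1) fst_le[OF that(2)] by blast
      then have "norm (Dif (Dif (\<lambda>x. F t x \<theta>)) (fst z)) \<le> K (norm \<theta>)"
        using norm_ge_zero[of "row_divergence (\<lambda>x. Dif (F t x) \<theta>) (fst z)"] norm_ge_zero[of "Dif (\<lambda>x. F t x \<theta>) (fst z)"]
        by linarith
      also have "\<dots> \<le> K 1" by (rule monoD[OF K(1) that(3)])
      finally show ?thesis by (intro order_trans[OF norm_lft_compose]) simp
    qed
    then show "\<exists>M\<ge>0. \<forall>t\<in>{0..T}. \<forall>\<theta>. \<forall>z\<in>cball 0 \<rho> :: ((real^'d) \<times> (real^'d)) set. norm \<theta> \<le> 1 \<longrightarrow>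
        norm (?l o\<^sub>L Dif (Dif (\<lambda>x. F t x \<theta>)) (fst z) o\<^sub>L ?p) \<le> M"
      by (intro exI[of _ "max (K 1) 0"]) simp
    obtain M where M: "M > 0" "\<forall>t\<in>{0..T}. \<forall>x\<in>cball 0 (\<bar>\<rho>\<bar> + 1). \<forall>\<theta>.
        norm (Dif (F t x) \<theta>) + norm (Dif (Dif (F t x)) \<theta>) \<le> M" using b1[OF pos] by blast
    have M': "norm (Dif (F t x) \<theta>) \<le> M" "norm (Dif (Dif (F t x)) \<theta>) \<le> M"
      if "t \<in> {0..T}" "x \<in> cball 0 (\<bar>\<rho>\<bar> + 1)" for t x \<theta>
    proof -
      have "norm (Dif (F t x) \<theta>) + norm (Dif (Dif (F t x)) \<theta>) \<le> M" using M(2) that by blast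
      then show "norm (Dif (F t x) \<theta>) \<le> M" "norm (Dif (Dif (F t x)) \<theta>) \<le> M"
        using norm_ge_zero[of "Dif (F t x) \<theta>"] norm_ge_zero[of "Dif (Dif (F t x)) \<theta>"] by linarith+
    qed
    have "norm (?e o\<^sub>L Dif (F t (fst z)) \<theta>) \<le> M" if "t \<in> {0..T}" "z \<in> cball 0 \<rho>" for t \<theta> and z :: "(real^'d) \<times> (real^'d)"
      by (rule order_trans[OF norm_emb_compose M'(1)[OF that(1) fst_le[OF that(2)]]])
    then show "\<exists>M\<ge>0. \<forall>t\<in>{0..T}. \<forall>\<theta>. \<forall>z\<in>cball 0 \<rho> :: ((real^'d) \<times> (real^'d)) set. norm (?e o\<^sub>L Dif (F t (fst z)) \<theta>) \<le> M"
      using M(1) by (intro exI[of _ M]) simp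
    have "norm ((?e o\<^sub>L Dif (F t (fst z)) \<theta>\<^sub>1) - (?e o\<^sub>L Dif (F t (fst z)) \<theta>\<^sub>2)) \<le> M * norm (\<theta>\<^sub>1 - \<theta>\<^sub>2)"
      if "t \<in> {0..T}" "z \<in> cball 0 \<rho>" for t \<theta>\<^sub>1 \<theta>\<^sub>2 and z :: "(real^'d) \<times> (real^'d)"
    proof (rule order_trans[OF norm_emb_diff])
      show "norm (Dif (F t (fst z)) \<theta>\<^sub>1 - Dif (F t (fst z)) \<theta>\<^sub>2) \<le> M * norm (\<theta>\<^sub>1 - \<theta>\<^sub>2)"
      proof (rule differentiable_bound[OF convex_UNIV])
        fix \<theta>
        show "(Dif (F t (fst z)) has_derivative blinfun_apply (Dif (Dif (F t (fst z))) \<theta>)) (at \<theta>)"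
          by (rule d\<theta>(2)[OF that(1)])
        show "onorm (blinfun_apply (Dif (Dif (F t (fst z))) \<theta>)) \<le> M"
          using M'(2)[OF that(1) fst_le[OF that(2)]] by (simp add: norm_blinfun.rep_eq[symmetric])
      qed auto
    qed
    then show "\<exists>M\<ge>0. \<forall>t\<in>{0..T}. \<forall>\<theta>\<^sub>1 \<theta>\<^sub>2. \<forall>z\<in>cball 0 \<rho> :: ((real^'d) \<times> (real^'d)) set.
        norm ((?e o\<^sub>L Dif (F t (fst z)) \<theta>\<^sub>1) - (?e o\<^sub>L Dif (F t (fst z)) \<theta>\<^sub>2)) \<le> M * norm (\<theta>\<^sub>1 - \<theta>\<^sub>2)"
      using M(1) by (intro exI[of _ M]) simp
    obtain K where K: "mono K" "\<forall>\<theta>. \<forall>t\<in>{0..T}. \<forall>x\<in>cball 0 (\<bar>\<rho>\<bar> + 1). \<forall>y\<in>cball 0 (\<bar>\<rho>\<bar> + 1).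
        norm (Dif (F t x) \<theta> - Dif (F t y) \<theta>) \<le> K (norm \<theta>) * norm (x - y)" using b3[OF pos] by blast
    have "norm ((?e o\<^sub>L Dif (F t (fst z)) \<theta>) - (?e o\<^sub>L Dif (F t (fst w)) \<theta>)) \<le> max (K 1) 0 * norm (z - w)"
      if "t \<in> {0..T}" "z \<in> cball 0 \<rho>" "w \<in> cball 0 \<rho>" "norm \<theta> \<le> 1" for t \<theta> and z w :: "(real^'d) \<times> (real^'d)"
    proof (rule order_trans[OF norm_emb_diff])
      have "norm (Dif (F t (fst z)) \<theta> - Dif (F t (fst w)) \<theta>) \<le> K (norm \<theta>) * norm (fst z - fst w)"
        using K(2) that(1) fst_le[OF that(2)] fst_le[OF that(3)] by blast
      also have "\<dots> \<le> max (K 1) 0 * norm (fst z - fst w)"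
        using monoD[OF K(1) that(4)] by (intro mult_right_mono) auto
      also have "\<dots> \<le> max (K 1) 0 * norm (z - w)"
        using norm_fst_le_norm[of "z - w"] by (intro mult_left_mono) auto
      finally show "norm (Dif (F t (fst z)) \<theta> - Dif (F t (fst w)) \<theta>) \<le> max (K 1) 0 * norm (z - w)" .
    qed
    then show "\<exists>M\<ge>0. \<forall>t\<in>{0..T}. \<forall>\<theta>. \<forall>z\<in>cball 0 \<rho> :: ((real^'d) \<times> (real^'d)) set. \<forall>w\<in>cball 0 \<rho> :: ((real^'d) \<times> (real^'d)) set. norm \<theta> \<le> 1 \<longrightarrow>
        norm ((?e o\<^sub>L Dif (F t (fst z)) \<theta>) - (?e o\<^sub>L Dif (F t (fst w)) \<theta>)) \<le> M * norm (z - w)"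
      by (intro exI[of _ "max (K 1) 0"]) simp
  qed
qed

section \<open>The control problem\<close>

text \<open>The bridge between the oriented Lebesgue integral in \<open>flow\<close> and the gauge
  integral in \<open>sol\<close>; absolute integrability makes the two agree.\<close>

lemma interval_integral_eq_J:
  fixes f :: "real \<Rightarrow> 'b::euclidean_space"
  assumes f: "f absolutely_integrable_on {0..T}" and \<tau>: "\<tau> \<in> {0..T}" and t: "t \<in> {0..T}"
  shows "interval_lebesgue_integrable lebesgue (ereal \<tau>) (ereal t) f"
    and "(LINT s=ereal \<tau>..ereal t|lebesgue. f s) = J \<tau> t f"
proof -
  have i: "set_integrable lebesgue {a<..<b} f" if "a \<in> {0..T}" "b \<in> {0..T}" for a b
    by (rule set_integrable_subset[OF f]) (use that in auto)
  have J: "(LINT s:{a<..<b}|lebesgue. f s) = J a b f" if "a \<in> {0..T}" "b \<in> {0..T}" "a \<le> b" for a b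
  proof -
    have "(LINT s:{a<..<b}|lebesgue. f s) = integral {a..b} f"
      using set_lebesgue_integral_eq_integral(2)[OF i[OF that(1,2)]] by (simp add: integral_open_interval_real)
    also have "\<dots> = J a b f"
      by (rule J_le[symmetric])
        (use that integrable_sub(1)[OF set_lebesgue_integral_eq_integral(1)[OF f], of 0 b] in auto)
    finally show ?thesis .
  qed
  show "interval_lebesgue_integrable lebesgue (ereal \<tau>) (ereal t) f"
    using i[OF \<tau> t] i[OF t \<tau>] by (simp add: interval_lebesgue_integrable_def)
  show "(LINT s=ereal \<tau>..ereal t|lebesgue. f s) = J \<tau> t f"
    using J[OF \<tau> t] J[OF t \<tau>] J_swap[of t \<tau> f] by (simp add: interval_lebesgue_integral_def)
qed

lemma grad_prod_eq_gp: "grad_prod p A = gp p A"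
  unfolding vec_eq_iff
proof
  fix j
  have "gp p A $ j = gp p A \<bullet> axis j 1" by (simp add: inner_axis)
  also have "\<dots> = p (A (axis j 1))" by (rule gp_inner)
  also have "\<dots> = p (\<Sum>k\<in>UNIV. (A (axis j 1) $ k) *\<^sub>R axis k 1)"
    using basis_expansion[of "blinfun_apply A (axis j 1)"] by (simp add: scalar_mult_eq_scaleR)
  also have "\<dots> = (\<Sum>k\<in>UNIV. p (axis k 1) * (A (axis j 1) $ k))"
    by (simp add: blinfun.sum_right blinfun.scaleR_right mult.commute)
  finally show "grad_prod p A $ j = gp p A $ j" by (simp add: grad_prod_def)
qed

lemma gp_compose: "gp (p o\<^sub>L B) A = gp p (B o\<^sub>L A)"
  by (simp add: gp_def)

lemma continuous_bounded_in_Gamma_C: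
  fixes \<theta> :: "real \<Rightarrow> real^'m"
  assumes T: "0 < T" and M: "0 < M" and c: "continuous_on {0..T} \<theta>" and le: "\<And>t. norm (\<theta> t) \<le> M"
  shows "\<theta> \<in> Gamma_C T M"
proof -
  have i: "integrable (lebesgue_on {0..T}) (\<lambda>t. (norm (\<theta> t))\<^sup>2)"
    by (intro continuous_imp_integrable_real continuous_intros c)
  have "(LINT t|lebesgue_on {0..T}. (norm (\<theta> t))\<^sup>2) = integral {0..T} (\<lambda>t. (norm (\<theta> t))\<^sup>2)"
    by (rule lebesgue_integral_eq_integral[OF i]) simp
  also have "\<dots> \<le> integral {0..T} (\<lambda>t. M\<^sup>2)"
    by (intro integral_le integrable_continuous_real continuous_intros c power_mono le) auto
  also have "\<dots> = M\<^sup>2 * T" using T by simp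
  finally have "L2_norm T \<theta> \<le> sqrt (M\<^sup>2 * T)" unfolding L2_norm_def by (rule real_sqrt_le_mono)
  also have "\<dots> = M * sqrt T" using M by (simp add: real_sqrt_mult)
  finally show ?thesis
    using i continuous_imp_measurable_on_sets_lebesgue[OF c] by (simp add: Gamma_C_def L2_def)
qed

lemma Gamma_C_mono: "\<theta> \<in> Gamma_C T M \<Longrightarrow> M \<le> M' \<Longrightarrow> 0 \<le> T \<Longrightarrow> \<theta> \<in> Gamma_C T M'"
  unfolding Gamma_C_def using mult_right_mono[of M M' "sqrt T"] by auto

lemma (in control_system) is_flow_unique:
  assumes \<theta>: "adm N \<theta>" and 1: "is_flow \<theta> \<Phi>\<^sub>1" and 2: "is_flow \<theta> \<Phi>\<^sub>2" and \<tau>: "\<tau> \<in> {0..T}" and t: "t \<in> {0..T}"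
  shows "\<Phi>\<^sub>1 \<tau> t z = \<Phi>\<^sub>2 \<tau> t z"
proof (rule sol_unique[OF _ _ _ \<tau> t, where ?X1.0 = "\<lambda>t. \<Phi>\<^sub>1 \<tau> t z" and ?X2.0 = "\<lambda>t. \<Phi>\<^sub>2 \<tau> t z"])
  show "sol T (\<lambda>s z. F s z (\<theta> s)) \<tau> z (\<lambda>t. \<Phi>\<^sub>1 \<tau> t z)" "sol T (\<lambda>s z. F s z (\<theta> s)) \<tau> z (\<lambda>t. \<Phi>\<^sub>2 \<tau> t z)"
    using 1 2 \<tau> unfolding is_flow_def by blast+
  show "weight T (\<lambda>t. C + L * (1 + norm (\<theta> t))) N" using \<theta> by (simp add: adm_def)
  fix s assume s: "s \<in> {0..T}"
  show "norm (F s (\<Phi>\<^sub>1 \<tau> s z) (\<theta> s) - F s (\<Phi>\<^sub>2 \<tau> s z) (\<theta> s))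
      \<le> (C + L * (1 + norm (\<theta> s))) * norm (\<Phi>\<^sub>1 \<tau> s z - \<Phi>\<^sub>2 \<tau> s z)"
    using C by (intro order_trans[OF lip[OF s]] mult_right_mono) auto
qed

locale lifted_system = control_system T "\<lambda>t z \<theta>. (F t (fst z) \<theta>, 0 :: real^'d)" DF D2F
    "\<lambda>t z \<theta>. emb o\<^sub>L Dif (F t (fst z)) \<theta>" C L g
  for T :: real and F :: "real \<Rightarrow> real^'d \<Rightarrow> real^'m \<Rightarrow> real^'d" and DF D2F and C L :: real
    and g :: "(real^'d) \<times> (real^'d) \<Rightarrow> real"
begin

lemma continuity_equation_iff: "continuity_equation T F \<mu>\<^sub>0 \<theta> \<mu> \<longleftrightarrow> weak_solution \<mu>\<^sub>0 \<theta> \<mu>"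
  unfolding continuity_equation_def weak_solution_def by (simp only: case_prod_unfold prod.collapse)

lemma curve_absolutely_integrable:
  assumes \<theta>: "adm N \<theta>" and X: "continuous_on {0..T} X"
  shows "(\<lambda>s. F s (X s) (\<theta> s)) absolutely_integrable_on {0..T}"
proof (rule measurable_bounded_by_integrable_imp_absolutely_integrable)
  have "(\<lambda>s. (F s (fst (X s, 0 :: real^'d)) (\<theta> s), 0 :: real^'d)) \<in> borel_measurable (lebesgue_on {0..T})"
    by (rule F_measurable) (use \<theta> X in \<open>auto simp: adm_def intro!: continuous_intros\<close>)
  then have "(\<lambda>s. fst (F s (X s) (\<theta> s), 0 :: real^'d)) \<in> borel_measurable (lebesgue_on {0..T})"
    by (intro borel_measurable_continuous_on[where f = fst]) (auto intro: continuous_intros)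
  then show "(\<lambda>s. F s (X s) (\<theta> s)) \<in> borel_measurable (lebesgue_on {0..T})" by simp
  show "(\<lambda>s. C * (1 + norm (X s))) integrable_on {0..T}"
    by (intro integrable_continuous_real continuous_intros X)
  show "norm (F s (X s) (\<theta> s)) \<le> C * (1 + norm (X s))" if "s \<in> {0..T}" for s
    using growth[OF that, of "(X s, 0)" "\<theta> s"] by (simp add: norm_Pair)
qed simp

lemma flow_lift:
  assumes \<theta>: "adm N \<theta>" and \<Phi>: "flow T F \<theta> \<Phi>"
  shows "is_flow \<theta> (\<lambda>\<tau> t z. (\<Phi> \<tau> t (fst z), snd z))"
  unfolding is_flow_def sol_def
proof (intro ballI allI conjI)
  fix \<tau> and z :: "(real^'d) \<times> (real^'d)" assume \<tau>: "\<tau> \<in> {0..T}"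
  let ?X = "\<lambda>t. \<Phi> \<tau> t (fst z)"
  have X: "continuous_on {0..T} ?X"
    "\<And>t. t \<in> {0..T} \<Longrightarrow> ?X t = fst z + (LINT s=ereal \<tau>..ereal t|lebesgue. F s (?X s) (\<theta> s))"
    using \<Phi> \<tau> unfolding flow_def by blast+
  note ai = curve_absolutely_integrable[OF \<theta> X(1)]
  have i: "(\<lambda>s. F s (?X s) (\<theta> s)) integrable_on {0..T}" by (rule set_lebesgue_integral_eq_integral(1)[OF ai])
  have l: "bounded_linear (\<lambda>x :: real^'d. (x, 0 :: real^'d))"
    by (intro bounded_linear_Pair bounded_linear_ident bounded_linear_zero)
  show "continuous_on {0..T} (\<lambda>t. (?X t, snd z))" by (intro continuous_intros X(1))
  show "(\<lambda>s. (F s (fst (?X s, snd z)) (\<theta> s), 0 :: real^'d)) integrable_on {0..T}"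
    using integrable_linear[OF i l] by (simp add: o_def)
  fix t assume t: "t \<in> {0..T}"
  have "J \<tau> t (\<lambda>s. (F s (?X s) (\<theta> s), 0 :: real^'d)) = (J \<tau> t (\<lambda>s. F s (?X s) (\<theta> s)), 0)"
    by (rule J_linear[OF i \<tau> t l])
  moreover have "?X t = fst z + J \<tau> t (\<lambda>s. F s (?X s) (\<theta> s))"
    using X(2)[OF t] interval_integral_eq_J(2)[OF ai \<tau> t] by (rule trans[OF _ arg_cong])
  ultimately show "(?X t, snd z) = z + J \<tau> t (\<lambda>s. (F s (fst (?X s, snd z)) (\<theta> s), 0))"
    by (cases z) (simp only: fst_conv snd_conv add_Pair add_0_right)
qed

lemma flow_project:
  assumes \<theta>: "adm N \<theta>" and \<Phi>: "is_flow \<theta> \<Phi>"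
  shows "flow T F \<theta> (\<lambda>\<tau> t x. fst (\<Phi> \<tau> t (x, 0)))"
  unfolding flow_def
proof (intro ballI allI conjI)
  fix \<tau> and x :: "real^'d" assume \<tau>: "\<tau> \<in> {0..T}"
  let ?X = "\<lambda>t. fst (\<Phi> \<tau> t (x, 0))"
  have s: "continuous_on {0..T} (\<lambda>t. \<Phi> \<tau> t (x, 0))"
    "(\<lambda>s. (F s (?X s) (\<theta> s), 0 :: real^'d)) integrable_on {0..T}"
    "\<And>t. t \<in> {0..T} \<Longrightarrow> \<Phi> \<tau> t (x, 0) = (x, 0) + J \<tau> t (\<lambda>s. (F s (?X s) (\<theta> s), 0))"
    using \<Phi> \<tau> unfolding is_flow_def sol_def by blast+
  show X: "continuous_on {0..T} ?X" by (intro continuous_intros s(1))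
  note ai = curve_absolutely_integrable[OF \<theta> X]
  fix t assume t: "t \<in> {0..T}"
  show "interval_lebesgue_integrable lebesgue (ereal \<tau>) (ereal t) (\<lambda>s. F s (?X s) (\<theta> s))"
    by (rule interval_integral_eq_J(1)[OF ai \<tau> t])
  have "?X t = x + fst (J \<tau> t (\<lambda>s. (F s (?X s) (\<theta> s), 0 :: real^'d)))"
    by (subst s(3)[OF t]) (simp only: fst_add fst_conv)
  also have "fst (J \<tau> t (\<lambda>s. (F s (?X s) (\<theta> s), 0 :: real^'d))) = J \<tau> t (\<lambda>s. fst (F s (?X s) (\<theta> s), 0 :: real^'d))"
    by (rule J_linear[OF s(2) \<tau> t bounded_linear_fst, symmetric])
  also have "\<dots> = (LINT s=ereal \<tau>..ereal t|lebesgue. F s (?X s) (\<theta> s))"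
    by (simp only: fst_conv interval_integral_eq_J(2)[OF ai \<tau> t])
  finally show "?X t = x + (LINT s=ereal \<tau>..ereal t|lebesgue. F s (?X s) (\<theta> s))" .
qed

text \<open>Projecting the flow to the state and lifting it back with a frozen label gives a flow of
  the same field, and uniqueness identifies it with the original one.\<close>

lemma flow_lift_project:
  assumes \<theta>: "adm N \<theta>" and \<Phi>: "is_flow \<theta> \<Phi>" and "\<tau> \<in> {0..T}" "t \<in> {0..T}"
  shows "\<Phi> \<tau> t (x, y) = (fst (\<Phi> \<tau> t (x, 0)), y)"
  using is_flow_unique[OF \<theta> \<Phi> flow_lift[OF \<theta> flow_project[OF \<theta> \<Phi>]] assms(3,4), of "(x, y)"] by simp

lemma characteristic_form_project:
  assumes \<theta>: "adm N \<theta>" and \<Phi>: "is_flow \<theta> \<Phi>"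
  shows "characteristic_form T F g \<theta> (\<lambda>t z. g (\<Phi> t T z))"
  unfolding characteristic_form_def
proof (intro exI conjI ballI allI)
  show "flow T F \<theta> (\<lambda>\<tau> t x. fst (\<Phi> \<tau> t (x, 0)))" by (rule flow_project[OF \<theta> \<Phi>])
  show "g (\<Phi> t T (x, y)) = g (fst (\<Phi> t T (x, 0)), y)" if "t \<in> {0..T}" for t x y
    by (rule arg_cong[OF flow_lift_project[OF \<theta> \<Phi> that T_in]])
qed

lemma Dx_psi:
  assumes \<theta>: "adm N \<theta>" and \<Phi>: "is_flow \<theta> \<Phi>" and t: "t \<in> {0..T}"
    and h: "\<And>x y. h (x, y) = g (\<Phi> t T (x, y))"
  shows "Dx h x y = grad \<Phi> t (x, y) o\<^sub>L emb"
proof -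
  have "((\<lambda>x'. (x', y)) has_derivative (\<lambda>v. (v, 0))) (at x)"
    by (intro has_derivative_Pair has_derivative_ident has_derivative_const)
  from has_derivative_compose[OF this Dif_psi[OF \<theta> \<Phi> t]]
  have "((\<lambda>x'. g (\<Phi> t T (x', y))) has_derivative blinfun_apply (grad \<Phi> t (x, y) o\<^sub>L emb)) (at x)"
    by (rule has_derivative_eq_rhs) (simp add: fun_eq_iff)
  then show ?thesis unfolding Dx_def h by (rule Dif_eqI)
qed

text \<open>A measure carried by a ball integrates every continuous function, so the integrability
  clause holds automatically and the chain rule identifies the integrand with
  \<open>Gf\<close>.\<close>

lemma control_equation_iff:
  assumes \<theta>: "adm N \<theta>" and \<Phi>: "is_flow \<theta> \<Phi>" and t: "t \<in> {0..T}" and \<mu>: "on_ball \<rho> (\<mu> t)"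
    and \<psi>: "\<And>x y. \<psi> t (x, y) = g (\<Phi> t T (x, y))"
  shows "control_equation_at F lam \<mu> \<theta> \<psi> t \<longleftrightarrow> \<theta> t = - (1 / (2 * lam)) *\<^sub>R (LINT z|\<mu> t. Gf \<theta> \<Phi> t z)"
proof -
  have "(\<lambda>(x, y). grad_prod (Dx (\<psi> t) x y) (Dif (F t x) (\<theta> t))) = Gf \<theta> \<Phi> t"
    by (simp add: fun_eq_iff Dx_psi[OF \<theta> \<Phi> t, of "\<psi> t", OF \<psi>] grad_prod_eq_gp gp_compose Gf_def)
  then show ?thesis
    using on_ball_integrable[OF \<mu> Gf_cont_state[OF \<theta> \<Phi> t]] by (simp add: control_equation_at_def)
qed

lemma backward_equation_psi:
  assumes \<theta>: "adm N \<theta>" and \<Phi>: "is_flow \<theta> \<Phi>" and c: "continuous_on {0..T} \<theta>"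
  shows "backward_equation T F g \<theta> (\<lambda>t z. g (\<Phi> t T z))"
  unfolding backward_equation_def
proof (intro conjI ballI allI exI)
  show "(\<lambda>z. g (\<Phi> T T z)) = g" by (simp add: flow_init'[OF \<Phi> T_in])
  fix t x y assume t: "t \<in> {0..T}"
  have "C1 g" using g by (simp add: C2_def)
  from pull_time_derivative[OF \<theta> \<Phi> c t T_in this, of "(x, y)"]
  show "((\<lambda>s. g (\<Phi> s T (x, y))) has_real_derivative - (grad \<Phi> t (x, y) (F t x (\<theta> t), 0))) (at t within {0..T})"
    by (simp add: pull_grad_def grad_def)
  show "- (grad \<Phi> t (x, y) (F t x (\<theta> t), 0)) + blinfun_apply (Dx (\<lambda>z. g (\<Phi> t T z)) x y) (F t x (\<theta> t)) = 0"
    by (subst Dx_psi[OF \<theta> \<Phi> t, of "\<lambda>z. g (\<Phi> t T z)"]) simp_all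
qed

text \<open>The square of a sum is at most twice the sum of the squares, so a bound for the square
  integral of the control bounds that of its weight.\<close>

lemma Gamma_C_adm:
  assumes \<theta>: "\<theta> \<in> Gamma_C T M" and N: "2 * (C + L)\<^sup>2 * T + 2 * L\<^sup>2 * (M\<^sup>2 * T) \<le> N" and M: "0 < M"
  shows "adm N \<theta>"
proof -
  have m: "\<theta> \<in> borel_measurable (lebesgue_on {0..T})" and i: "integrable (lebesgue_on {0..T}) (\<lambda>t. (norm (\<theta> t))\<^sup>2)"
    and n: "L2_norm T \<theta> \<le> M * sqrt T"
    using \<theta> by (auto simp: Gamma_C_def L2_def)
  have i': "(\<lambda>t. (norm (\<theta> t))\<^sup>2) integrable_on {0..T}" by (rule integrable_on_lebesgue_on[OF i]) simp
  have "L2_norm T \<theta> \<le> sqrt (M\<^sup>2 * T)" using n M by (simp add: real_sqrt_mult)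
  then have "(LINT t|lebesgue_on {0..T}. (norm (\<theta> t))\<^sup>2) \<le> M\<^sup>2 * T" unfolding L2_norm_def by simp
  then have le: "integral {0..T} (\<lambda>t. (norm (\<theta> t))\<^sup>2) \<le> M\<^sup>2 * T"
    using lebesgue_integral_eq_integral[OF i] by simp
  let ?k = "\<lambda>t. C + L * (1 + norm (\<theta> t))"
  let ?b = "\<lambda>t. 2 * (C + L)\<^sup>2 + 2 * L\<^sup>2 * (norm (\<theta> t))\<^sup>2"
  have km: "?k \<in> borel_measurable (lebesgue_on {0..T})" using m by measurable
  have kb: "(?k t)\<^sup>2 \<le> ?b t" for t
    using zero_le_power2[of "C + L - L * norm (\<theta> t)"] by (simp add: power2_eq_square algebra_simps)
  have bi: "?b integrable_on {0..T}" by (intro integrable_add integrable_on_mult_right i') auto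
  have ki: "(\<lambda>t. (?k t)\<^sup>2) integrable_on {0..T}"
    by (rule set_lebesgue_integral_eq_integral(1)[OF measurable_bounded_by_integrable_imp_absolutely_integrable[OF borel_measurable_power[OF km] _ bi]]) (use kb in auto)
  have "integral {0..T} (\<lambda>t. (?k t)\<^sup>2) \<le> integral {0..T} ?b" by (intro integral_le ki bi kb)
  also have "\<dots> = integral {0..T} (\<lambda>t. 2 * (C + L)\<^sup>2) + integral {0..T} (\<lambda>t. 2 * L\<^sup>2 * (norm (\<theta> t))\<^sup>2)"
    by (intro Henstock_Kurzweil_Integration.integral_add integrable_on_mult_right i') auto
  also have "\<dots> = 2 * (C + L)\<^sup>2 * T + 2 * L\<^sup>2 * integral {0..T} (\<lambda>t. (norm (\<theta> t))\<^sup>2)" using T by simp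
  also have "\<dots> \<le> 2 * (C + L)\<^sup>2 * T + 2 * L\<^sup>2 * (M\<^sup>2 * T)" by (intro add_left_mono mult_left_mono le) simp
  also note N
  finally show ?thesis using km ki m C L by (simp add: adm_def weight_def)
qed

end

theorem theorem4p1:
  fixes T R R\<^sub>T C\<^sub>\<Gamma> Lip :: real
    and F :: "real \<Rightarrow> real^'d \<Rightarrow> real^'m \<Rightarrow> real^'d"
    and l \<psi>\<^sub>T :: "(real^'d) \<times> (real^'d) \<Rightarrow> real"
  assumes "T > 0" and "R > 0"
    and "A1 T F" and "A2 T F"
    and "C2 l"
    and "support_radius T R F R\<^sub>T"
    and "C2c \<psi>\<^sub>T" and "fsupport \<psi>\<^sub>T = cball 0 R\<^sub>T"
    and "\<forall>z\<in>cball 0 R\<^sub>T. \<psi>\<^sub>T z = l z"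
    and "C\<^sub>\<Gamma> > 0" and "Lip > 0"
  shows "\<exists>lam\<^sub>0>0. \<forall>lam>lam\<^sub>0. \<forall>\<mu>\<^sub>0\<in>Pc. msupport \<mu>\<^sub>0 \<subseteq> cball 0 R \<longrightarrow>
    (\<exists>\<mu> \<theta> \<psi>.
       continuous_curve_Pc T \<mu> \<and>
       continuous_on {0..T} \<theta> \<and>
       (gradient_time_lipschitz T F \<longrightarrow> Lip-lipschitz_on {0..T} \<theta>) \<and>
       C1_in_time_C2c T \<psi> \<and>
       continuity_equation T F \<mu>\<^sub>0 \<theta> \<mu> \<and>
       backward_equation T F \<psi>\<^sub>T \<theta> \<psi> \<and>
       (\<forall>t\<in>{0..T}. control_equation_at F lam \<mu> \<theta> \<psi> t) \<and>
       characteristic_form T F \<psi>\<^sub>T \<theta> \<psi> \<and>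
       \<theta> \<in> Gamma_C T C\<^sub>\<Gamma> \<and>
       (\<forall>\<mu>' \<theta>' \<psi>'.
          \<theta>' \<in> Gamma_C T C\<^sub>\<Gamma> \<and>
          continuity_equation T F \<mu>\<^sub>0 \<theta>' \<mu>' \<and>
          characteristic_form T F \<psi>\<^sub>T \<theta>' \<psi>' \<and>
          (AE t in lebesgue_on {0..T}. control_equation_at F lam \<mu>' \<theta>' \<psi>' t) \<longrightarrow>
          (AE t in lebesgue_on {0..T}. \<theta>' t = \<theta> t)))"
proof -
  have g: "C2 \<psi>\<^sub>T" and g_supp: "compact (fsupport \<psi>\<^sub>T)" using \<open>C2c \<psi>\<^sub>T\<close> by (auto simp: C2c_def)
  obtain C L where cs: "control_system T (\<lambda>t z \<theta>. (F t (fst z) \<theta>, 0))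
      (\<lambda>t \<theta> z. emb o\<^sub>L Dif (\<lambda>x. F t x \<theta>) (fst z) o\<^sub>L pro)
      (\<lambda>t \<theta> z. lft o\<^sub>L Dif (Dif (\<lambda>x. F t x \<theta>)) (fst z) o\<^sub>L pro)
      (\<lambda>t z \<theta>. emb o\<^sub>L Dif (F t (fst z)) \<theta>) C L \<psi>\<^sub>T"
    using control_system_lift[OF \<open>T > 0\<close> \<open>A1 T F\<close> \<open>A2 T F\<close> g] by blast
  interpret lifted_system T F "\<lambda>t \<theta> z. emb o\<^sub>L Dif (\<lambda>x. F t x \<theta>) (fst z) o\<^sub>L pro"
      "\<lambda>t \<theta> z. lft o\<^sub>L Dif (Dif (\<lambda>x. F t x \<theta>)) (fst z) o\<^sub>L pro" C L \<psi>\<^sub>T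
    unfolding lifted_system_def by (rule cs)
  \<comment> \<open>A size of at most 1 gives access to the bounds on the unit ball, and at most
    \<open>C\<^sub>\<Gamma>\<close> puts the control into \<open>Gamma_C\<close>.\<close>
  define M where "M = min 1 C\<^sub>\<Gamma>"
  have M: "0 < M" "M \<le> 1" "M \<le> C\<^sub>\<Gamma>" using \<open>C\<^sub>\<Gamma> > 0\<close> by (auto simp: M_def)
  \<comment> \<open>The first entry serves the small continuous controls of the fixed point
    argument, the second all competitors in \<open>Gamma_C\<close>.\<close>
  define N where "N = max (T * (C + 2 * L)\<^sup>2) (2 * (C + L)\<^sup>2 * T + 2 * L\<^sup>2 * (C\<^sub>\<Gamma>\<^sup>2 * T))"
  have N: "T * (C + 2 * L)\<^sup>2 \<le> N" "2 * (C + L)\<^sup>2 * T + 2 * L\<^sup>2 * (C\<^sub>\<Gamma>\<^sup>2 * T) \<le> N" by (auto simp: N_def)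
  have R\<^sub>T: "0 < R\<^sub>T" using \<open>support_radius T R F R\<^sub>T\<close> by (simp add: support_radius_def)
  \<comment> \<open>One ball for the push-forwards of the initial measure, which reach
    \<open>rad N R\<close>, and for the measures of a competitor, which
    \<open>support_radius\<close> confines to \<open>R\<^sub>T\<close>.\<close>
  define \<rho> where "\<rho> = max (rad N R) R\<^sub>T"
  have \<rho>: "rad N R \<le> \<rho>" "0 \<le> \<rho>" "R\<^sub>T \<le> \<rho>" using R\<^sub>T by (auto simp: \<rho>_def)
  obtain lam\<^sub>1 where lam\<^sub>1: "lam\<^sub>1 > 0" "\<And>lam \<mu>. lam > lam\<^sub>1 \<Longrightarrow> on_ball R \<mu> \<Longrightarrow>
    (\<exists>\<theta> \<Phi>. continuous_on {0..T} \<theta> \<and> (\<forall>t. norm (\<theta> t) \<le> M) \<and> adm N \<theta> \<and> is_flow \<theta> \<Phi> \<and>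
      (\<forall>t\<in>{0..T}. \<theta> t = - (1 / (2 * lam)) *\<^sub>R (LINT z|push \<Phi> \<mu> t. Gf \<theta> \<Phi> t z)))"
    using control_exists[OF N(1) M(1,2), of R] by blast
  obtain lam\<^sub>2 where lam\<^sub>2: "lam\<^sub>2 > 0" "\<And>lam \<mu>\<^sub>0 \<theta> \<Phi> \<theta>' \<Phi>' \<mu>'. lam > lam\<^sub>2 \<Longrightarrow> on_ball R \<mu>\<^sub>0 \<Longrightarrow> continuous_on {0..T} \<theta> \<Longrightarrow>
    (\<forall>t\<in>{0..T}. norm (\<theta> t) \<le> 1) \<Longrightarrow> adm N \<theta> \<Longrightarrow> is_flow \<theta> \<Phi> \<Longrightarrow>
    (\<forall>t\<in>{0..T}. \<theta> t = - (1 / (2 * lam)) *\<^sub>R (LINT z|push \<Phi> \<mu>\<^sub>0 t. Gf \<theta> \<Phi> t z)) \<Longrightarrow>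
    adm N \<theta>' \<Longrightarrow> is_flow \<theta>' \<Phi>' \<Longrightarrow> weak_solution \<mu>\<^sub>0 \<theta>' \<mu>' \<Longrightarrow> (\<forall>t\<in>{0..T}. on_ball \<rho> (\<mu>' t)) \<Longrightarrow>
    (AE t in lebesgue_on {0..T}. \<theta>' t = - (1 / (2 * lam)) *\<^sub>R (LINT z|\<mu>' t. Gf \<theta>' \<Phi>' t z)) \<Longrightarrow>
    (AE t in lebesgue_on {0..T}. \<theta>' t = \<theta> t)"
    using control_unique[OF \<rho>(1,2)] by blast
  \<comment> \<open>The threshold stands outside the implication, so that a single value of
    \<lambda> is fixed whether or not the control gradient is Lipschitz in time.\<close>
  have "\<exists>lam\<^sub>0>0. gradient_time_lipschitz T F \<longrightarrow> (\<forall>lam>lam\<^sub>0. \<forall>\<mu> \<theta> \<Phi>. on_ball R \<mu> \<longrightarrow> adm N \<theta> \<longrightarrow> is_flow \<theta> \<Phi> \<longrightarrow>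
    (\<forall>t\<in>{0..T}. norm (\<theta> t) \<le> 1) \<longrightarrow>
    (\<forall>t\<in>{0..T}. \<theta> t = - (1 / (2 * lam)) *\<^sub>R (LINT z|push \<Phi> \<mu> t. Gf \<theta> \<Phi> t z)) \<longrightarrow>
    Lip-lipschitz_on {0..T} \<theta>)"
  proof (cases "gradient_time_lipschitz T F")
    case True
    have "\<exists>M\<ge>0. \<forall>s\<in>{0..T}. \<forall>t\<in>{0..T}. \<forall>\<theta>. \<forall>z :: (real^'d) \<times> (real^'d) \<in>cball 0 r. norm \<theta> \<le> 1 \<longrightarrow>
      norm ((emb o\<^sub>L Dif (F t (fst z)) \<theta> :: _ \<Rightarrow>\<^sub>L ((real^'d) \<times> (real^'d))) - (emb o\<^sub>L Dif (F s (fst z)) \<theta>)) \<le> M * \<bar>t - s\<bar>" for r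
    proof -
      have "\<bar>r\<bar> + 1 > 0" by (simp add: add_nonneg_pos)
      then obtain K where K: "mono K" "\<forall>\<theta>. \<forall>s\<in>{0..T}. \<forall>t\<in>{0..T}. \<forall>x\<in>cball 0 (\<bar>r\<bar> + 1).
        norm (Dif (F t x) \<theta> - Dif (F s x) \<theta>) \<le> K (norm \<theta>) * \<bar>t - s\<bar>"
        using True unfolding gradient_time_lipschitz_def by blast
      have "norm ((emb o\<^sub>L Dif (F t (fst z)) \<theta> :: _ \<Rightarrow>\<^sub>L ((real^'d) \<times> (real^'d))) - (emb o\<^sub>L Dif (F s (fst z)) \<theta>)) \<le> max (K 1) 0 * \<bar>t - s\<bar>"
        if "s \<in> {0..T}" "t \<in> {0..T}" "z \<in> cball 0 r" "norm \<theta> \<le> 1" for s t \<theta> and z :: "(real^'d) \<times> (real^'d)"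
      proof (rule order_trans[OF norm_emb_diff])
        have "fst z \<in> cball 0 (\<bar>r\<bar> + 1)" using that(3) norm_fst_le_norm[of z] by simp
        then have "norm (Dif (F t (fst z)) \<theta> - Dif (F s (fst z)) \<theta>) \<le> K (norm \<theta>) * \<bar>t - s\<bar>"
          using K(2) that(1,2) by blast
        also have "\<dots> \<le> max (K 1) 0 * \<bar>t - s\<bar>"
          using monoD[OF K(1) that(4)] by (intro mult_right_mono) auto
        finally show "norm (Dif (F t (fst z)) \<theta> - Dif (F s (fst z)) \<theta>) \<le> max (K 1) 0 * \<bar>t - s\<bar>" .
      qed
      then show ?thesis by (intro exI[of _ "max (K 1) 0"]) simp
    qed
    from control_lipschitz[OF this \<open>Lip > 0\<close>, of R N] show ?thesis by blast
  next
    case False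
    then show ?thesis by (intro exI[of _ 1]) simp
  qed
  then obtain lam\<^sub>3 where lam\<^sub>3: "lam\<^sub>3 > 0" "\<And>lam \<mu> \<theta> \<Phi>. gradient_time_lipschitz T F \<Longrightarrow> lam > lam\<^sub>3 \<Longrightarrow> on_ball R \<mu> \<Longrightarrow>
    adm N \<theta> \<Longrightarrow> is_flow \<theta> \<Phi> \<Longrightarrow> (\<forall>t\<in>{0..T}. norm (\<theta> t) \<le> 1) \<Longrightarrow>
    (\<forall>t\<in>{0..T}. \<theta> t = - (1 / (2 * lam)) *\<^sub>R (LINT z|push \<Phi> \<mu> t. Gf \<theta> \<Phi> t z)) \<Longrightarrow>
    Lip-lipschitz_on {0..T} \<theta>" by blast
  show ?thesis
  proof (intro exI[of _ "max lam\<^sub>1 (max lam\<^sub>2 lam\<^sub>3)"] conjI allI ballI impI)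
    show "0 < max lam\<^sub>1 (max lam\<^sub>2 lam\<^sub>3)" using lam\<^sub>1(1) by simp
    fix lam and \<mu>\<^sub>0 :: "((real^'d) \<times> (real^'d)) measure"
    assume lam: "max lam\<^sub>1 (max lam\<^sub>2 lam\<^sub>3) < lam" and \<mu>\<^sub>0: "\<mu>\<^sub>0 \<in> Pc" "msupport \<mu>\<^sub>0 \<subseteq> cball 0 R"
    have b0: "on_ball R \<mu>\<^sub>0" by (rule on_ball_msupport) (use \<mu>\<^sub>0 in \<open>auto simp: Pc_def\<close>)
    have l1: "lam > lam\<^sub>1" and l2: "lam > lam\<^sub>2" and l3: "lam > lam\<^sub>3" using lam by auto
    obtain \<theta> \<Phi> where c: "continuous_on {0..T} \<theta>" and le: "\<forall>t. norm (\<theta> t) \<le> M" and \<theta>: "adm N \<theta>"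
      and \<Phi>: "is_flow \<theta> \<Phi>" and eq: "\<forall>t\<in>{0..T}. \<theta> t = - (1 / (2 * lam)) *\<^sub>R (LINT z|push \<Phi> \<mu>\<^sub>0 t. Gf \<theta> \<Phi> t z)"
      using lam\<^sub>1(2)[OF l1 b0] by blast
    have le1: "norm (\<theta> t) \<le> 1" for t using le[rule_format, of t] M(2) by simp
    have ws: "weak_solution \<mu>\<^sub>0 \<theta> (push \<Phi> \<mu>\<^sub>0)" by (rule push_weak_solution[OF \<theta> \<Phi> c b0])
    show "\<exists>\<mu> \<theta> \<psi>.
       continuous_curve_Pc T \<mu> \<and>
       continuous_on {0..T} \<theta> \<and>
       (gradient_time_lipschitz T F \<longrightarrow> Lip-lipschitz_on {0..T} \<theta>) \<and>
       C1_in_time_C2c T \<psi> \<and>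
       continuity_equation T F \<mu>\<^sub>0 \<theta> \<mu> \<and>
       backward_equation T F \<psi>\<^sub>T \<theta> \<psi> \<and>
       (\<forall>t\<in>{0..T}. control_equation_at F lam \<mu> \<theta> \<psi> t) \<and>
       characteristic_form T F \<psi>\<^sub>T \<theta> \<psi> \<and>
       \<theta> \<in> Gamma_C T C\<^sub>\<Gamma> \<and>
       (\<forall>\<mu>' \<theta>' \<psi>'.
          \<theta>' \<in> Gamma_C T C\<^sub>\<Gamma> \<and>
          continuity_equation T F \<mu>\<^sub>0 \<theta>' \<mu>' \<and>
          characteristic_form T F \<psi>\<^sub>T \<theta>' \<psi>' \<and>
          (AE t in lebesgue_on {0..T}. control_equation_at F lam \<mu>' \<theta>' \<psi>' t) \<longrightarrow>
          (AE t in lebesgue_on {0..T}. \<theta>' t = \<theta> t))"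
    proof (intro exI[of _ "push \<Phi> \<mu>\<^sub>0"] exI[of _ \<theta>] exI[of _ "\<lambda>t z. \<psi>\<^sub>T (\<Phi> t T z)"] conjI allI impI ballI)
      show "continuous_curve_Pc T (push \<Phi> \<mu>\<^sub>0)" using ws unfolding weak_solution_def by blast
      show "continuous_on {0..T} \<theta>" by (rule c)
      show "Lip-lipschitz_on {0..T} \<theta>" if "gradient_time_lipschitz T F"
        by (rule lam\<^sub>3(2)[OF that l3 b0 \<theta> \<Phi> _ eq]) (use le1 in blast)
      show "C1_in_time_C2c T (\<lambda>t z. \<psi>\<^sub>T (\<Phi> t T z))" by (rule psi_regular[OF \<theta> \<Phi> c le1 g_supp])
      show "continuity_equation T F \<mu>\<^sub>0 \<theta> (push \<Phi> \<mu>\<^sub>0)" unfolding continuity_equation_iff by (rule ws)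
      show "backward_equation T F \<psi>\<^sub>T \<theta> (\<lambda>t z. \<psi>\<^sub>T (\<Phi> t T z))" by (rule backward_equation_psi[OF \<theta> \<Phi> c])
      show "characteristic_form T F \<psi>\<^sub>T \<theta> (\<lambda>t z. \<psi>\<^sub>T (\<Phi> t T z))" by (rule characteristic_form_project[OF \<theta> \<Phi>])
      show "\<theta> \<in> Gamma_C T C\<^sub>\<Gamma>"
        by (rule Gamma_C_mono[OF continuous_bounded_in_Gamma_C[OF T M(1) c] M(3)]) (use le T in auto)
    next
      fix t assume t: "t \<in> {0..T}"
      show "control_equation_at F lam (push \<Phi> \<mu>\<^sub>0) \<theta> (\<lambda>t z. \<psi>\<^sub>T (\<Phi> t T z)) t"
        using eq t by (subst control_equation_iff[where \<mu> = "push \<Phi> \<mu>\<^sub>0" and \<psi> = "\<lambda>t z. \<psi>\<^sub>T (\<Phi> t T z)", OF \<theta> \<Phi> t push_on_ball[OF b0 \<theta> \<Phi> t]]) blast+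
    next
      fix \<mu>' \<theta>' \<psi>'
      assume *: "\<theta>' \<in> Gamma_C T C\<^sub>\<Gamma> \<and>
          continuity_equation T F \<mu>\<^sub>0 \<theta>' \<mu>' \<and>
          characteristic_form T F \<psi>\<^sub>T \<theta>' \<psi>' \<and>
          (AE t in lebesgue_on {0..T}. control_equation_at F lam \<mu>' \<theta>' \<psi>' t)"
      then have ce: "continuity_equation T F \<mu>\<^sub>0 \<theta>' \<mu>'" and G: "\<theta>' \<in> Gamma_C T C\<^sub>\<Gamma>" by blast+
      have \<theta>': "adm N \<theta>'" by (rule Gamma_C_adm[OF G N(2) \<open>C\<^sub>\<Gamma> > 0\<close>])
      obtain \<Phi>' where \<Phi>': "flow T F \<theta>' \<Phi>'" and \<psi>': "\<And>t x y. t \<in> {0..T} \<Longrightarrow> \<psi>' t (x, y) = \<psi>\<^sub>T (\<Phi>' t T x, y)"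
        using * unfolding characteristic_form_def by blast
      define \<Psi> where "\<Psi> = (\<lambda>\<tau> t z. (\<Phi>' \<tau> t (fst z), snd z :: real^'d))"
      have \<Psi>: "is_flow \<theta>' \<Psi>" unfolding \<Psi>_def by (rule flow_lift[OF \<theta>' \<Phi>'])
      have \<psi>\<Psi>: "\<psi>' t (x, y) = \<psi>\<^sub>T (\<Psi> t T (x, y))" if "t \<in> {0..T}" for t x y
        using \<psi>'[OF that] by (simp add: \<Psi>_def)
      have ball: "on_ball R\<^sub>T (\<mu>' t)" if t: "t \<in> {0..T}" for t
      proof (rule on_ball_msupport)
        have "\<mu>' t \<in> Pc" using ce t unfolding continuity_equation_def continuous_curve_Pc_def by blast
        then show "prob_space (\<mu>' t)" "sets (\<mu>' t) = sets borel" by (auto simp: Pc_def)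
        have "\<theta>' \<in> L2 T" using G by (simp add: Gamma_C_def)
        then show "msupport (\<mu>' t) \<subseteq> cball 0 R\<^sub>T"
          using \<open>support_radius T R F R\<^sub>T\<close> \<mu>\<^sub>0 ce t unfolding support_radius_def by blast
      qed
      have "AE t in lebesgue_on {0..T}. control_equation_at F lam \<mu>' \<theta>' \<psi>' t" using * by blast
      then have ae: "AE t in lebesgue_on {0..T}. \<theta>' t = - (1 / (2 * lam)) *\<^sub>R (LINT z|\<mu>' t. Gf \<theta>' \<Psi> t z)"
        unfolding AE_negligible using control_equation_iff[where \<mu> = \<mu>' and \<psi> = \<psi>', OF \<theta>' \<Psi> _ ball \<psi>\<Psi>] by blast
      show "AE t in lebesgue_on {0..T}. \<theta>' t = \<theta> t"
      proof (rule lam\<^sub>2(2)[OF l2 b0 c _ \<theta> \<Phi> eq \<theta>' \<Psi> _ _ ae])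
        show "\<forall>t\<in>{0..T}. norm (\<theta> t) \<le> 1" using le1 by blast
        show "weak_solution \<mu>\<^sub>0 \<theta>' \<mu>'" using ce by (simp only: continuity_equation_iff)
        show "\<forall>t\<in>{0..T}. on_ball \<rho> (\<mu>' t)" using on_ball_mono[OF ball \<rho>(3)] by blast
      qed
    qed
  qed
qed

end
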